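(* Let $u^0\in\mathbb S$ and let $\tau_{\min}>0$ be a sufficiently small lower bound for the step sizes. Then there exists an upper bound $\tau_{\max}>\tau_{\min}$ such that for any step sizes $\tau_n\in[\tau_{\min},\tau_{\max}]$ the iterates $\{u^n\}_{n\in\mathbb N}$ of the energy-adaptive Riemannian gradient method satisfy: (i) $E(u^n)-E(u^{n+1})\ge C_\tau\|u^{n+1}-u^n\|_{H^1}^2$ for all $n\ge0$, with a constant $C_\tau>0$ depending on $\tau_{\min},\tau_{\max}$, which fulfills $C_\tau\ge\frac12$ for $\tau_n$ small enough; (ii) the limit $\boldsymbol E:=\lim_{n\to\infty}E(u^n)$ exists; (iii) there is a subsequence $\{u^{n_j}\}_{j}$ and $u\in\mathbb S$ with $\lim_{j\to\infty}\|u^{n_j}-u\|_{H^1}=0$; moreover $u$ is an eigenfunction of the Gross--Pitaevskii eigenvalue problem, i.e. $E'(u)=\lambda\,\mathcal Iu$ with $\lambda:=(u,\mathcal A_{|u|}^{-1}\mathcal Iu)_{L^2}^{-1}=\lim_{j\to\infty}\gamma^{n_j}$; (iv) if any of the limits $u$ in (iii) is a locally quasi-unique ground state, then the whole sequence of densities converges: $\lim_{n\to\infty}\||u^n|^2-|u|^2\|_{L^2}=0$ and $\lim_{n\to\infty}\||u^n|-|u|\|_{H^1}=0$.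
   Context: Let $\mathcal D\subset\mathbb R^d$, $d\in\{2,3\}$, be a bounded convex domain, $V\in L^\infty(\mathcal D;\mathbb R_{\ge0})$, $\beta\ge0$, $\Omega\in\mathbb R$, and assume there is $K>0$ with $V(x)-\frac{1+K}{4}\Omega^2(x_1^2+x_2^2)\ge0$ a.e. The spaces $L^2(\mathcal D;\mathbb C)$, $H^1_0(\mathcal D;\mathbb C)$ are real Hilbert spaces with $(v,w)_{L^2}=\mathrm{Re}\int v\bar w$, $(v,w)_{H^1}=\mathrm{Re}\int(v\bar w+\nabla v\cdot\overline{\nabla w})$; $\langle\cdot,\cdot\rangle$ is the $H^{-1}$--$H^1_0$ pairing (real dual) and $\mathcal I v:=(v,\cdot)_{L^2}$. With $\mathcal L_3=-\mathrm{i}(x_1\partial_{x_2}-x_2\partial_{x_1})$, $E(v)=\frac12\int|\nabla v|^2+V|v|^2-\Omega\bar v\mathcal L_3v+\frac\beta2|v|^4\,dx$, $E'$ its Fréchet derivative, and $\mathbb S=\{v\in H^1_0:\|v\|_{L^2}=1\}$. A ground state is a minimizer of $E$ on $\mathbb S$. For $z\in H^1_0$, $\langle\mathcal A_{|z|}v,w\rangle=(\nabla v,\nabla w)_{L^2}+(Vv,w)_{L^2}-\Omega(\mathcal L_3v,w)_{L^2}+\beta(|z|^2v,w)_{L^2}$ (a coercive, $L^2$-symmetric form), and for $f\in L^2$, $\mathcal A_{|z|}^{-1}\mathcal I f$ denotes the unique $q\in H^1_0$ with $\langle\mathcal A_{|z|}q,w\rangle=(f,w)_{L^2}$ for all $w\in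 H^1_0$. Energy-adaptive Riemannian gradient method: given $u^0\in\mathbb S$ and $\tau_n>0$, set $\gamma^n=(u^n,\mathcal A_{|u^n|}^{-1}\mathcal Iu^n)_{L^2}^{-1}$, $\hat u^{n+1}=(1-\tau_n)u^n+\tau_n\gamma^n\mathcal A_{|u^n|}^{-1}\mathcal Iu^n$ and $u^{n+1}=\hat u^{n+1}/\|\hat u^{n+1}\|_{L^2}$. For $u\in\mathbb S$, $T_u=\{v\in H^1_0:(u,v)_{L^2}=0\}$; $\langle E''(u)v,w\rangle=\langle\mathcal A_{|u|}v,w\rangle+2\beta(\mathrm{Re}(u\bar v)u,w)_{L^2}$. A ground state $u$ is locally quasi-unique if for every smooth curve $\gamma:(-1,1)\to\mathbb S$ with $\gamma(0)=u$, $\gamma'(0)\in(T_u\cap T_{\mathrm{i}u})\setminus\{0\}$, one has $\frac{d^2}{dt^2}E(\gamma(t))|_{t=0}>0$. *)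

theory Defs
  imports "HOL-Analysis.Analysis"
begin

text \<open>Functions on the domain D (a subset of a 2- or 3-dimensional Euclidean space 'a)
  are represented by complex-valued functions; all notions below are invariant under
  modification on Lebesgue null sets. Coordinates x1, x2 are x \<bullet> e1, x \<bullet> e2
  for two distinct basis vectors e1, e2.\<close>

definition smooth_fun :: "('a::euclidean_space \<Rightarrow> complex) \<Rightarrow> bool" where
  "smooth_fun \<phi> \<longleftrightarrow> (\<exists>F. \<phi> \<in> F \<and>
     (\<forall>g\<in>F. (\<forall>x. g differentiable (at x)) \<and>
              (\<forall>b\<in>Basis. (\<lambda>x. frechet_derivative g (at x) b) \<in> F)))"

definition test_fun :: "'a::euclidean_space set \<Rightarrow> ('a \<Rightarrow> complex) \<Rightarrow> bool" where
  "test_fun D \<phi> \<longleftrightarrow> smooth_fun \<phi> \<and> compact (closure {x. \<phi> x \<noteq> 0})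
      \<and> closure {x. \<phi> x \<noteq> 0} \<subseteq> D"

definition L2 :: "'a::euclidean_space set \<Rightarrow> ('a \<Rightarrow> complex) \<Rightarrow> bool" where
  "L2 D f \<longleftrightarrow> set_borel_measurable lebesgue D f
      \<and> set_integrable lebesgue D (\<lambda>x. (cmod (f x))^2)"

definition l2inner :: "'a::euclidean_space set \<Rightarrow> ('a \<Rightarrow> complex) \<Rightarrow> ('a \<Rightarrow> complex) \<Rightarrow> real" where
  "l2inner D v w = Re (set_lebesgue_integral lebesgue D (\<lambda>x. v x * cnj (w x)))"

definition l2norm :: "'a::euclidean_space set \<Rightarrow> ('a \<Rightarrow> complex) \<Rightarrow> real" where
  "l2norm D v = sqrt (l2inner D v v)"

definition weak_partial :: "'a::euclidean_space set \<Rightarrow> ('a \<Rightarrow> complex) \<Rightarrow> 'a \<Rightarrow> ('a \<Rightarrow> complex) \<Rightarrow> bool" where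
  "weak_partial D v b g \<longleftrightarrow> L2 D g \<and>
     (\<forall>\<phi>. test_fun D \<phi> \<longrightarrow>
        set_lebesgue_integral lebesgue D (\<lambda>x. v x * frechet_derivative \<phi> (at x) b)
        = - set_lebesgue_integral lebesgue D (\<lambda>x. g x * \<phi> x))"

definition wpd :: "'a::euclidean_space set \<Rightarrow> ('a \<Rightarrow> complex) \<Rightarrow> 'a \<Rightarrow> ('a \<Rightarrow> complex)" where
  "wpd D v b = (SOME g. weak_partial D v b g)"

definition H1 :: "'a::euclidean_space set \<Rightarrow> ('a \<Rightarrow> complex) \<Rightarrow> bool" where
  "H1 D v \<longleftrightarrow> L2 D v \<and> (\<forall>b\<in>Basis. \<exists>g. weak_partial D v b g)"

definition h1inner :: "'a::euclidean_space set \<Rightarrow> ('a \<Rightarrow> complex) \<Rightarrow> ('a \<Rightarrow> complex) \<Rightarrow> real" where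
  "h1inner D v w = l2inner D v w + (\<Sum>b\<in>Basis. l2inner D (wpd D v b) (wpd D w b))"

definition h1norm :: "'a::euclidean_space set \<Rightarrow> ('a \<Rightarrow> complex) \<Rightarrow> real" where
  "h1norm D v = sqrt (h1inner D v v)"

definition H10 :: "'a::euclidean_space set \<Rightarrow> ('a \<Rightarrow> complex) set" where
  "H10 D = {v. H1 D v \<and> (\<exists>\<phi>. (\<forall>k. test_fun D (\<phi> k)) \<and>
                 (\<lambda>k. h1norm D (\<lambda>x. \<phi> k x - v x)) \<longlonglongrightarrow> 0)}"

definition Sph :: "'a::euclidean_space set \<Rightarrow> ('a \<Rightarrow> complex) set" where
  "Sph D = {v \<in> H10 D. l2norm D v = 1}"

definition L3 :: "'a::euclidean_space set \<Rightarrow> 'a \<Rightarrow> 'a \<Rightarrow> ('a \<Rightarrow> complex) \<Rightarrow> ('a \<Rightarrow> complex)" where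
  "L3 D e1 e2 v = (\<lambda>x. - \<i> * (complex_of_real (x \<bullet> e1) * wpd D v e2 x
                              - complex_of_real (x \<bullet> e2) * wpd D v e1 x))"

definition energy :: "'a::euclidean_space set \<Rightarrow> ('a \<Rightarrow> real) \<Rightarrow> real \<Rightarrow> real \<Rightarrow> 'a \<Rightarrow> 'a
                      \<Rightarrow> ('a \<Rightarrow> complex) \<Rightarrow> real" where
  "energy D V \<beta> \<Omega> e1 e2 v = 1/2 *
     ((\<Sum>b\<in>Basis. l2inner D (wpd D v b) (wpd D v b))
      + set_lebesgue_integral lebesgue D (\<lambda>x. V x * (cmod (v x))^2)
      - \<Omega> * Re (set_lebesgue_integral lebesgue D (\<lambda>x. cnj (v x) * L3 D e1 e2 v x))
      + \<beta> / 2 * set_lebesgue_integral lebesgue D (\<lambda>x. (cmod (v x))^4))"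

definition Aform :: "'a::euclidean_space set \<Rightarrow> ('a \<Rightarrow> real) \<Rightarrow> real \<Rightarrow> real \<Rightarrow> 'a \<Rightarrow> 'a
                      \<Rightarrow> ('a \<Rightarrow> complex) \<Rightarrow> ('a \<Rightarrow> complex) \<Rightarrow> ('a \<Rightarrow> complex) \<Rightarrow> real" where
  "Aform D V \<beta> \<Omega> e1 e2 z v w =
     (\<Sum>b\<in>Basis. l2inner D (wpd D v b) (wpd D w b))
     + l2inner D (\<lambda>x. complex_of_real (V x) * v x) w
     - \<Omega> * l2inner D (L3 D e1 e2 v) w
     + \<beta> * l2inner D (\<lambda>x. complex_of_real ((cmod (z x))^2) * v x) w"

text \<open>A_{|z|}^{-1} I f : the (a.e. unique) solution q in H10 of the weak problem.\<close>
definition Ainv :: "'a::euclidean_space set \<Rightarrow> ('a \<Rightarrow> real) \<Rightarrow> real \<Rightarrow> real \<Rightarrow> 'a \<Rightarrow> 'a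
                      \<Rightarrow> ('a \<Rightarrow> complex) \<Rightarrow> ('a \<Rightarrow> complex) \<Rightarrow> ('a \<Rightarrow> complex)" where
  "Ainv D V \<beta> \<Omega> e1 e2 z f = (SOME q. q \<in> H10 D \<and>
      (\<forall>w\<in>H10 D. Aform D V \<beta> \<Omega> e1 e2 z q w = l2inner D f w))"

definition gam :: "'a::euclidean_space set \<Rightarrow> ('a \<Rightarrow> real) \<Rightarrow> real \<Rightarrow> real \<Rightarrow> 'a \<Rightarrow> 'a
                      \<Rightarrow> ('a \<Rightarrow> complex) \<Rightarrow> real" where
  "gam D V \<beta> \<Omega> e1 e2 v = inverse (l2inner D v (Ainv D V \<beta> \<Omega> e1 e2 v v))"

definition erg_step :: "'a::euclidean_space set \<Rightarrow> ('a \<Rightarrow> real) \<Rightarrow> real \<Rightarrow> real \<Rightarrow> 'a \<Rightarrow> 'a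
                      \<Rightarrow> real \<Rightarrow> ('a \<Rightarrow> complex) \<Rightarrow> ('a \<Rightarrow> complex)" where
  "erg_step D V \<beta> \<Omega> e1 e2 \<tau> v =
     (let uh = (\<lambda>x. complex_of_real (1 - \<tau>) * v x
                   + complex_of_real (\<tau> * gam D V \<beta> \<Omega> e1 e2 v) * Ainv D V \<beta> \<Omega> e1 e2 v v x)
      in (\<lambda>x. uh x / complex_of_real (l2norm D uh)))"

definition H10_frechet :: "'a::euclidean_space set \<Rightarrow> (('a \<Rightarrow> complex) \<Rightarrow> real) \<Rightarrow> ('a \<Rightarrow> complex)
                            \<Rightarrow> (('a \<Rightarrow> complex) \<Rightarrow> real) \<Rightarrow> bool" where
  "H10_frechet D F u ell \<longleftrightarrow>
     (\<forall>v\<in>H10 D. \<forall>w\<in>H10 D. ell (\<lambda>x. v x + w x) = ell v + ell w)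
   \<and> (\<forall>v\<in>H10 D. \<forall>c::real. ell (\<lambda>x. complex_of_real c * v x) = c * ell v)
   \<and> (\<exists>M. \<forall>v\<in>H10 D. \<bar>ell v\<bar> \<le> M * h1norm D v)
   \<and> (\<forall>\<epsilon>>0. \<exists>\<delta>>0. \<forall>h\<in>H10 D. h1norm D h < \<delta> \<longrightarrow>
         \<bar>F (\<lambda>x. u x + h x) - F u - ell h\<bar> \<le> \<epsilon> * h1norm D h)"

definition ground_state :: "'a::euclidean_space set \<Rightarrow> ('a \<Rightarrow> real) \<Rightarrow> real \<Rightarrow> real \<Rightarrow> 'a \<Rightarrow> 'a
                      \<Rightarrow> ('a \<Rightarrow> complex) \<Rightarrow> bool" where
  "ground_state D V \<beta> \<Omega> e1 e2 u \<longleftrightarrow> u \<in> Sph D \<and>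
     (\<forall>v\<in>Sph D. energy D V \<beta> \<Omega> e1 e2 u \<le> energy D V \<beta> \<Omega> e1 e2 v)"

definition curve_deriv :: "'a::euclidean_space set \<Rightarrow> (real \<Rightarrow> 'a \<Rightarrow> complex) \<Rightarrow> ('a \<Rightarrow> complex)
                            \<Rightarrow> real \<Rightarrow> bool" where
  "curve_deriv D c g t \<longleftrightarrow> g \<in> H10 D \<and>
     (\<forall>\<epsilon>>0. \<exists>\<delta>>0. \<forall>s. s \<noteq> 0 \<and> \<bar>s\<bar> < \<delta> \<longrightarrow>
        h1norm D (\<lambda>x. (c (t + s) x - c t x) / complex_of_real s - g x) \<le> \<epsilon>)"

definition smooth_curve :: "'a::euclidean_space set \<Rightarrow> (real \<Rightarrow> 'a \<Rightarrow> complex) \<Rightarrow> bool" where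
  "smooth_curve D c \<longleftrightarrow> (\<exists>F. c \<in> F \<and> (\<forall>a\<in>F. (\<forall>t\<in>{-1<..<1}. a t \<in> H10 D) \<and>
        (\<exists>a'\<in>F. \<forall>t\<in>{-1<..<1}. curve_deriv D a (a' t) t)))"

definition loc_quasi_unique :: "'a::euclidean_space set \<Rightarrow> ('a \<Rightarrow> real) \<Rightarrow> real \<Rightarrow> real \<Rightarrow> 'a \<Rightarrow> 'a
                      \<Rightarrow> ('a \<Rightarrow> complex) \<Rightarrow> bool" where
  "loc_quasi_unique D V \<beta> \<Omega> e1 e2 u \<longleftrightarrow>
     (\<forall>\<gamma> g. smooth_curve D \<gamma> \<and> (\<forall>t\<in>{-1<..<1}. \<gamma> t \<in> Sph D) \<and> \<gamma> 0 = u
        \<and> curve_deriv D \<gamma> g 0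
        \<and> l2inner D u g = 0 \<and> l2inner D (\<lambda>x. \<i> * u x) g = 0 \<and> h1norm D g \<noteq> 0
        \<longrightarrow> deriv (deriv (\<lambda>t. energy D V \<beta> \<Omega> e1 e2 (\<gamma> t))) 0 > 0)"

end

theory Submission
  imports Defs "HOL-Complex_Analysis.Great_Picard" "HOL-Library.Function_Algebras"
begin

text \<open>
  With \<open>A\<^sub>u\<close> for the operator $A_{|u|}$, the energy satisfies the exact identity
  $E(u+d) = E(u) + \langle A_u u, d\rangle + \frac12 \langle A_u d, d\rangle
  + \frac{\beta}{4}\int (|u+d|^2-|u|^2)^2$. Together with $H^1$ bounds on the sublevel set of the initial
  energy it shows that, for small steps, each iteration lowers the energy by at least a multiple of
  the squared residual $u - \gamma A_u^{-1} u$ plus half the squared step length. Hence the residuals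
  and the steps tend to 0. By Rellich compactness and the $L^4$ interpolation inequality a
  subsequence of $\gamma^n A_{u^n}^{-1} u^n$, and therefore of the iterates, converges in $H^1$ to an
  eigenfunction.

  A locally quasi-unique ground state $u$ has a positive second variation transversally to its phase
  orbit (test the definition with great circles through $u$). If there were critical points at the
  same energy, close to the orbit but not on it, their normalised differences from the orbit would
  be compact in $H^1$ and their limit would be a null direction of the second variation. So the
  orbit is isolated, and since the steps tend to 0 the overlap of the iterates with the orbit cannot
  leave a neighbourhood of 1: every limit point is a phase multiple of $u$. The modulus is a
  continuous map on $H^1_0$, which gives the convergence of the densities.
\<close>

section \<open>Gross--Pitaevskii energies on an abstract space of functions\<close>

text \<open>Three obstacles shape the proof. Functions are not identified almost everywhere and weak
  derivatives are picked by \<open>SOME\<close>, so limits and inverses are unique only up to null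
  functions; the abstract part therefore works with seminorms and takes inverses as arguments. The
  admissible step size must not shrink along the iteration. It is computed from the initial energy
  alone, and the decrease keeps the iterates below that energy. Normalisation does no harm: the
  residual is L^2-orthogonal to \<open>u\<close>, so the unnormalised iterate has norm at least 1
  and scaling it back can only lower the energy. The cubic nonlinearity has to be handled by
  \<open>n4 v ^ 4 \<le> Cs * b.nrm v * h.nrm v ^ 3\<close>. This bound upgrades L^2 compactness to
  L^4 compactness, and since it lets the L^4 norm grow only like the power 3/4 of the H^1 norm,
  differences of critical points that are normalised in L^2 stay bounded in H^1. No dimension enters
  the abstract part except through this inequality. The phase degeneracy is removed by rotating so
  that the overlap with the ground state becomes real and positive.\<close>

locale psd_form =
  fixes B :: "'v::real_vector \<Rightarrow> 'v \<Rightarrow> real"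
  assumes add_left: "B (x + y) z = B x z + B y z"
    and scale_left: "B (c *\<^sub>R x) z = c * B x z"
    and commute: "B x y = B y x"
    and nonneg: "0 \<le> B x x"
begin

lemma add_right: "B z (x + y) = B z x + B z y"
  by (metis add_left commute)

lemma scale_right: "B z (c *\<^sub>R x) = c * B z x"
  by (metis scale_left commute)

lemma minus_left: "B (- x) z = - B x z"
  using scale_left[of "-1" x z] by simp

lemma minus_right: "B z (- x) = - B z x"
  by (metis minus_left commute)

lemma diff_left: "B (x - y) z = B x z - B y z"
  using add_left[of x "-y" z] by (simp add: minus_left)

lemma diff_right: "B z (x - y) = B z x - B z y"
  by (metis diff_left commute)

lemma zero_left [simp]: "B 0 z = 0"
  using scale_left[of 0 0 z] by simp

lemma zero_right [simp]: "B z 0 = 0"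
  using scale_right[of z 0 0] by simp

lemmas bilin = add_left add_right diff_left diff_right scale_left scale_right minus_left minus_right

definition nrm :: "'v \<Rightarrow> real" where "nrm x = sqrt (B x x)"

lemma nrm_nonneg [simp]: "0 \<le> nrm x"
  by (simp add: nrm_def nonneg)

lemma nrm_sq: "(nrm x)\<^sup>2 = B x x"
  by (simp add: nrm_def nonneg)

lemma nrm_zero [simp]: "nrm 0 = 0"
  by (simp add: nrm_def)

lemma cauchy_schwarz: "\<bar>B x y\<bar> \<le> nrm x * nrm y"
proof -
  have *: "0 \<le> B x x * t\<^sup>2 + 2 * B x y * t + B y y" for t
  proof -
    have "0 \<le> B (t *\<^sub>R x + y) (t *\<^sub>R x + y)" by (rule nonneg)
    also have "\<dots> = B x x * t\<^sup>2 + 2 * B x y * t + B y y"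
      by (simp add: bilin commute[of y x] algebra_simps power2_eq_square)
    finally show ?thesis .
  qed
  have "(B x y)\<^sup>2 \<le> B x x * B y y"
  proof (cases "B x x = 0")
    case True
    have "B x y = 0"
    proof (rule ccontr)
      assume n: "B x y \<noteq> 0"
      \<comment> \<open>For \<open>B x x = 0\<close> the polynomial is affine in \<open>t\<close>; a
        nonzero slope lets it reach -1.\<close>
      have "0 \<le> 2 * B x y * (- (B y y + 1) / (2 * B x y)) + B y y"
        using *[of "- (B y y + 1) / (2 * B x y)"] True by simp
      also have "\<dots> = -1" using n by (simp add: field_simps)
      finally show False by simp
    qed
    then show ?thesis by (simp add: nonneg)
  next
    case False
    then have p: "B x x > 0" using nonneg[of x] by simp
    have "0 \<le> B x x * (- B x y / B x x)\<^sup>2 + 2 * B x y * (- B x y / B x x) + B y y" by (rule *)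
    also have "\<dots> = B y y - (B x y)\<^sup>2 / B x x"
      using p by (simp add: field_simps power2_eq_square)
    finally show ?thesis using p by (simp add: field_simps)
  qed
  then have "sqrt ((B x y)\<^sup>2) \<le> sqrt (B x x * B y y)" by (rule real_sqrt_le_mono)
  then show ?thesis by (simp add: nrm_def real_sqrt_mult)
qed

lemma cs_le: "B x y \<le> nrm x * nrm y"
  using cauchy_schwarz[of x y] by linarith

lemma nrm_scale: "nrm (c *\<^sub>R x) = \<bar>c\<bar> * nrm x"
proof -
  have "B (c *\<^sub>R x) (c *\<^sub>R x) = c\<^sup>2 * B x x" by (simp add: bilin power2_eq_square)
  then show ?thesis by (simp add: nrm_def real_sqrt_mult)
qed

lemma nrm_minus: "nrm (- x) = nrm x"
  using nrm_scale[of "-1" x] by simp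

lemma nrm_commute: "nrm (x - y) = nrm (y - x)"
  using nrm_minus[of "x - y"] by simp

lemma triangle: "nrm (x + y) \<le> nrm x + nrm y"
proof (rule power2_le_imp_le)
  have "(nrm (x + y))\<^sup>2 = B x x + 2 * B x y + B y y"
    by (simp add: nrm_sq bilin commute[of y x])
  also have "\<dots> \<le> (nrm x)\<^sup>2 + 2 * (nrm x * nrm y) + (nrm y)\<^sup>2"
    using cs_le[of x y] by (simp add: nrm_sq)
  also have "\<dots> = (nrm x + nrm y)\<^sup>2" by (simp add: power2_sum)
  finally show "(nrm (x + y))\<^sup>2 \<le> (nrm x + nrm y)\<^sup>2" .
qed simp

lemma triangle_diff: "nrm (x - y) \<le> nrm x + nrm y"
  using triangle[of x "-y"] by (simp add: nrm_minus)

lemma triangle_sub: "nrm x \<le> nrm (x - y) + nrm y"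
  using triangle[of "x - y" y] by simp

lemma triangle_mid: "nrm (x - z) \<le> nrm (x - y) + nrm (y - z)"
  using triangle[of "x - y" "y - z"] by simp

lemma nrm_diff_abs: "\<bar>nrm x - nrm y\<bar> \<le> nrm (x - y)"
  using triangle_sub[of x y] triangle_sub[of y x] nrm_commute[of x y] by linarith

lemma nrm_null_left: "nrm x = 0 \<Longrightarrow> B x y = 0"
  using cauchy_schwarz[of x y] by simp

end

section \<open>Elementary facts on real polynomials and sequences\<close>

lemma linear_coeff_eq_0:
  fixes \<alpha> \<kappa> :: real
  assumes "\<kappa> \<ge> 0" and "\<And>t. 0 \<le> 2 * t * \<alpha> + t\<^sup>2 * \<kappa>"
  shows "\<alpha> = 0"
proof (rule ccontr)
  assume n: "\<alpha> \<noteq> 0"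
  \<comment> \<open>The true minimiser is - \<alpha> / \<kappa>; the denominator \<kappa> + 1 also
    covers \<kappa> = 0 and still gives a negative value.\<close>
  have "0 \<le> 2 * (- \<alpha> / (\<kappa> + 1)) * \<alpha> + (- \<alpha> / (\<kappa> + 1))\<^sup>2 * \<kappa>" by (rule assms)
  also have "\<dots> = - (\<alpha>\<^sup>2 * (\<kappa> + 2)) / (\<kappa> + 1)\<^sup>2"
  proof -
    have "2 * (- \<alpha> * s) * \<alpha> + (- \<alpha> * s)\<^sup>2 * \<kappa> = - (\<alpha>\<^sup>2 * (\<kappa> + 2)) * s\<^sup>2"
      if "s * (\<kappa> + 1) = 1" for s :: real using that by algebra
    from this[of "1 / (\<kappa> + 1)"] show ?thesis using assms(1) by (simp add: power_divide)
  qed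
  also have "\<dots> < 0" using n assms(1) by (simp add: divide_neg_pos)
  finally show False by simp
qed

lemma tendsto_dist_bound:
  fixes f g :: "nat \<Rightarrow> real"
  assumes "\<And>n. \<bar>f n - l\<bar> \<le> g n" "g \<longlonglongrightarrow> 0" shows "f \<longlonglongrightarrow> l"
  by (rule LIM_zero_cancel, rule Lim_null_comparison[OF _ assms(2)]) (simp add: assms(1))

lemma frequently_subseq:
  assumes "\<And>M::nat. \<exists>n\<ge>M. P n" shows "\<exists>s. strict_mono (s::nat\<Rightarrow>nat) \<and> (\<forall>j. P (s j))"
proof -
  have "infinite {n. P n}" unfolding infinite_nat_iff_unbounded_le using assms by blast
  then show ?thesis using infinite_enumerate by fastforce
qed

text \<open>Subsequence principle. The iterates have limits only along subsequences, with varying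
  phases, but all these limits share one density; this passes from subsequences to the full
  sequence.\<close>

lemma tendsto_zero_subseqI:
  fixes X :: "nat \<Rightarrow> real"
  assumes "\<And>s::nat\<Rightarrow>nat. strict_mono s \<Longrightarrow> \<exists>r. strict_mono (r::nat\<Rightarrow>nat) \<and> (\<lambda>j. X (s (r j))) \<longlonglongrightarrow> 0"
  shows "X \<longlonglongrightarrow> 0"
proof (rule ccontr)
  assume "\<not> ?thesis"
  then obtain e where e: "e > 0" "\<And>M. \<exists>n\<ge>M. \<bar>X n\<bar> \<ge> e" unfolding LIMSEQ_iff by (auto simp: not_less)
  then obtain s where s: "strict_mono (s::nat\<Rightarrow>nat)" "\<And>j. \<bar>X (s j)\<bar> \<ge> e"
    using frequently_subseq[of "\<lambda>n. \<bar>X n\<bar> \<ge> e"] by blast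
  obtain r where r: "strict_mono (r::nat\<Rightarrow>nat)" "(\<lambda>j. X (s (r j))) \<longlonglongrightarrow> 0" using assms[OF s(1)] by blast
  obtain N where "\<And>j. j \<ge> N \<Longrightarrow> \<bar>X (s (r j))\<bar> < e" using r(2) e(1) unfolding LIMSEQ_iff by auto
  then show False using s(2)[of "r N"] by force
qed

text \<open>Here \<open>h\<close> and \<open>b\<close> stand for the $H^1$ and $L^2$ inner products, \<open>a\<close> for the part of
  \<open>A\<^bsub>|z|\<^esub>\<close> that does not depend on \<open>z\<close>, \<open>J\<close> for multiplication by the imaginary unit, \<open>n4\<close> for the
  $L^4$ norm and \<open>R p q v w\<close> for the integral of \<open>Re (p * cnj q) * Re (v * cnj w)\<close>. The forms are only
  positive semidefinite, because functions that agree almost everywhere are not identified.\<close>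

locale gp = h: psd_form h + b: psd_form b + a: psd_form a
  for h b a :: "'v::real_vector \<Rightarrow> 'v \<Rightarrow> real" +
  fixes R :: "'v \<Rightarrow> 'v \<Rightarrow> 'v \<Rightarrow> 'v \<Rightarrow> real" and J :: "'v \<Rightarrow> 'v" and n4 :: "'v \<Rightarrow> real"
    and \<beta> c0 Ca Cs :: real
  assumes b_le_h: "b v v \<le> h v v"
    and b_null: "b v v = 0 \<Longrightarrow> h v v = 0"
    and c0: "c0 > 0" and coercive: "c0 * h v v \<le> a v v"
    and a_bound: "a v v \<le> Ca * h v v"
    and beta: "\<beta> \<ge> 0"
    and R_add: "R (p + p') q v w = R p q v w + R p' q v w"
    and R_scale: "R (c *\<^sub>R p) q v w = c * R p q v w"
    and R_comm: "R p q v w = R q p v w"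
    and R_swap: "R p q v w = R v w p q"
    and R_nonneg: "0 \<le> R p p v v"
    and n4_nonneg: "0 \<le> n4 v"
    and R_bound: "\<bar>R p q v w\<bar> \<le> n4 p * n4 q * n4 v * n4 w"
    and n4_interp: "n4 v ^ 4 \<le> Cs * b.nrm v * h.nrm v ^ 3"
    and J_add: "J (v + w) = J v + J w" and J_scale: "J (c *\<^sub>R v) = c *\<^sub>R J v"
    and h_J: "h (J v) (J w) = h v w" and h_skew: "h (J v) w = - h v (J w)"
    and b_J: "b (J v) (J w) = b v w" and b_skew: "b (J v) w = - b v (J w)"
    and a_J: "a (J v) (J w) = a v w" and a_skew: "a (J v) w = - a v (J w)"
    and R_J: "R (J p) (J q) v w = R p q v w" and R_skew: "R (J p) q v w = - R p (J q) v w"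
    and complete: "(\<And>e. e > 0 \<Longrightarrow> \<exists>N. \<forall>m\<ge>N. \<forall>n\<ge>N. h.nrm (x m - x n) < e)
        \<Longrightarrow> \<exists>l. (\<lambda>n. h.nrm (x n - l)) \<longlonglongrightarrow> 0"
    and compact: "(\<And>n::nat. h.nrm (x n) \<le> K)
        \<Longrightarrow> \<exists>r::nat\<Rightarrow>nat. strict_mono r \<and> (\<forall>e>0. \<exists>N. \<forall>m\<ge>N. \<forall>n\<ge>N. b.nrm (x (r m) - x (r n)) < e)"
begin

lemma R_add2: "R q (p + p') v w = R q p v w + R q p' v w"
  by (metis R_add R_comm)
lemma R_add3: "R v w (p + p') q = R v w p q + R v w p' q"
  by (metis R_add R_swap)
lemma R_add4: "R v w q (p + p') = R v w q p + R v w q p'"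
  by (metis R_add2 R_swap)
lemma R_scale2: "R q (c *\<^sub>R p) v w = c * R q p v w"
  by (metis R_scale R_comm)
lemma R_scale3: "R v w (c *\<^sub>R p) q = c * R v w p q"
  by (metis R_scale R_swap)
lemma R_scale4: "R v w q (c *\<^sub>R p) = c * R v w q p"
  by (metis R_scale2 R_swap)
lemma R_comm2: "R p q v w = R p q w v"
  by (metis R_comm R_swap)
lemma R_minus: "R (- p) q v w = - R p q v w"
  using R_scale[of "-1" p q v w] by simp
lemma R_minus2: "R q (- p) v w = - R q p v w"
  by (metis R_minus R_comm)
lemma R_minus3: "R v w (- p) q = - R v w p q"
  by (metis R_minus R_swap)
lemma R_minus4: "R v w q (- p) = - R v w q p"
  by (metis R_minus2 R_swap)
lemma R_diff: "R (p - p') q v w = R p q v w - R p' q v w"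
  using R_add[of p "-p'" q v w] by (simp add: R_minus)
lemma R_diff2: "R q (p - p') v w = R q p v w - R q p' v w"
  by (metis R_diff R_comm)
lemma R_diff3: "R v w (p - p') q = R v w p q - R v w p' q"
  by (metis R_diff R_swap)
lemma R_diff4: "R v w q (p - p') = R v w q p - R v w q p'"
  by (metis R_diff2 R_swap)

lemmas R_lin = R_add R_add2 R_add3 R_add4 R_diff R_diff2 R_diff3 R_diff4
  R_scale R_scale2 R_scale3 R_scale4 R_minus R_minus2 R_minus3 R_minus4

text \<open>Polarised form of |v|^2 - |u|^2 = Re((v - u) cnj(v + u)). It exposes the factor
  \<open>v - u\<close>, whose L^4 norm is the small quantity in all later estimates.\<close>

lemma R_sq_diff: "R v v x y - R u u x y = R (v - u) (v + u) x y"
  by (simp add: R_lin R_comm[of u v])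

section \<open>Bounds and continuity of the forms in the H^1 seminorm\<close>

abbreviation N :: "'v \<Rightarrow> real" where "N \<equiv> h.nrm"

lemma b_le_N: "b.nrm v \<le> N v"
  by (simp add: h.nrm_def b.nrm_def b_le_h)

lemma b_bound: "\<bar>b v w\<bar> \<le> N v * N w"
  by (rule order_trans[OF b.cauchy_schwarz]) (intro mult_mono b_le_N; simp)

text \<open>A Sobolev constant for the embedding into L^4. Being at least 1 and at least
  \<open>Cs\<close>, it satisfies \<open>Cs \<le> K4 ^ 4\<close>, so no fourth root has to be
  taken.\<close>

definition K4 :: real where "K4 = 1 + max Cs 0"

lemma K4_pos: "K4 > 0" by (simp add: K4_def add_pos_nonneg)

lemma n4_le: "n4 v \<le> K4 * N v"
proof (rule power_le_imp_le_base[of _ 3])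
  have "n4 v ^ 4 \<le> max Cs 0 * N v * N v ^ 3"
    using n4_interp[of v] b_le_N[of v]
    by (smt (verit) b.nrm_nonneg h.nrm_nonneg max.cobounded1 max.cobounded2 mult_mono mult_nonneg_nonneg zero_le_power)
  also have "\<dots> \<le> K4 ^ 4 * N v ^ 4"
  proof -
    have "max Cs 0 \<le> K4" by (simp add: K4_def)
    also have "\<dots> \<le> K4 ^ 4" by (rule self_le_power) (simp_all add: K4_def)
    finally have "max Cs 0 * N v ^ 4 \<le> K4 ^ 4 * N v ^ 4" by (rule mult_right_mono) simp
    then show ?thesis by (simp add: eval_nat_numeral mult.assoc)
  qed
  finally show "n4 v ^ Suc 3 \<le> (K4 * N v) ^ Suc 3" by (simp add: eval_nat_numeral mult_ac)
qed (simp add: K4_pos less_imp_le)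

lemma R_boundN: "\<bar>R p q v w\<bar> \<le> K4 ^ 4 * (N p * N q * N v * N w)"
proof -
  have "\<bar>R p q v w\<bar> \<le> (K4 * N p) * (K4 * N q) * (K4 * N v) * (K4 * N w)"
    by (rule order_trans[OF R_bound]) (intro mult_mono n4_le; simp add: n4_nonneg K4_pos less_imp_le)
  then show ?thesis by (simp add: power_eq_if algebra_simps)
qed

definition A :: "'v \<Rightarrow> 'v \<Rightarrow> 'v \<Rightarrow> real" where "A z v w = a v w + \<beta> * R z z v w"

definition E :: "'v \<Rightarrow> real" where "E v = 1/2 * a v v + \<beta>/4 * R v v v v"

text \<open>For each frozen density |z|^2 the operator is itself an inner product; Cauchy-Schwarz in
  the solution-dependent metric is used for the residual and for the multiplier \<gamma>.\<close>

sublocale A: psd_form "A z" for z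
proof
  show "A z (x + y) w = A z x w + A z y w" for x y w by (simp add: A_def a.bilin R_lin algebra_simps)
  show "A z (c *\<^sub>R x) w = c * A z x w" for c x w by (simp add: A_def a.bilin R_lin algebra_simps)
  show "A z x y = A z y x" for x y by (simp add: A_def a.commute[of x y] R_comm2[of z z x y])
  show "0 \<le> A z x x" for x by (simp add: A_def a.nonneg R_nonneg beta)
qed

lemma A_coercive: "c0 * (N v)\<^sup>2 \<le> A z v v"
proof -
  have "0 \<le> \<beta> * R z z v v" by (simp add: beta R_nonneg)
  then show ?thesis using coercive[of v] by (simp add: A_def h.nrm_sq)
qed

lemma a_bound2: "\<bar>a v w\<bar> \<le> max Ca 0 * N v * N w"
proof -
  have *: "a.nrm v \<le> sqrt (max Ca 0) * N v" for v
  proof -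
    have "a v v \<le> max Ca 0 * h v v" using a_bound[of v] h.nonneg[of v]
      by (meson max.cobounded1 mult_right_mono order_trans)
    then show ?thesis by (simp add: a.nrm_def h.nrm_def flip: real_sqrt_mult)
  qed
  have "a.nrm v * a.nrm w \<le> (sqrt (max Ca 0) * N v) * (sqrt (max Ca 0) * N w)"
    by (intro mult_mono *; simp)
  also have "\<dots> = max Ca 0 * N v * N w" by simp
  finally show ?thesis using a.cauchy_schwarz[of v w] by linarith
qed

definition CA :: "real \<Rightarrow> real" where "CA K = max Ca 0 + \<beta> * K4 ^ 4 * K\<^sup>2"

lemma CA_nonneg: "CA K \<ge> 0" by (simp add: CA_def beta K4_pos)

lemma A_bound:
  assumes "N z \<le> K" shows "\<bar>A z v w\<bar> \<le> CA K * N v * N w"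
proof -
  have "\<bar>\<beta> * R z z v w\<bar> \<le> \<beta> * (K4 ^ 4 * (N z * N z * N v * N w))"
    using beta R_boundN[of z z v w] by (simp add: abs_mult mult_left_mono)
  also have "\<dots> \<le> \<beta> * (K4 ^ 4 * (K * K * N v * N w))"
    using assms K4_pos beta
    by (intro mult_left_mono mult_right_mono mult_mono; simp add: order_trans[OF h.nrm_nonneg])
  finally have "\<bar>\<beta> * R z z v w\<bar> \<le> \<beta> * K4 ^ 4 * K\<^sup>2 * N v * N w"
    by (simp add: power2_eq_square mult.assoc)
  then show ?thesis using a_bound2[of v w] by (simp add: A_def CA_def algebra_simps)
qed

text \<open>A relation and not a topological limit: \<open>l\<close> is determined only up to
  \<open>N (l - k) = 0\<close>, see \<open>conv_null\<close>.\<close>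

definition conv :: "(nat \<Rightarrow> 'v) \<Rightarrow> 'v \<Rightarrow> bool" where
  "conv x l \<longleftrightarrow> (\<lambda>n. N (x n - l)) \<longlonglongrightarrow> 0"

lemma conv_const: "conv (\<lambda>_. l) l" by (simp add: conv_def)

lemma conv_N: "conv x l \<Longrightarrow> (\<lambda>n. N (x n)) \<longlonglongrightarrow> N l"
  unfolding conv_def
  by (rule Lim_null[THEN iffD2], rule Lim_null_comparison[of _ "\<lambda>n. N (x n - l)"])
    (simp_all add: h.nrm_diff_abs)

lemma conv_add: "conv x l \<Longrightarrow> conv y k \<Longrightarrow> conv (\<lambda>n. x n + y n) (l + k)"
  unfolding conv_def
proof (rule Lim_null_comparison[of _ "\<lambda>n. N (x n - l) + N (y n - k)"])
  have "N (x n + y n - (l + k)) \<le> N (x n - l) + N (y n - k)" for n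
    using h.triangle[of "x n - l" "y n - k"] by (simp add: add_diff_add)
  then show "\<forall>\<^sub>F n in sequentially. norm (N (x n + y n - (l + k))) \<le> N (x n - l) + N (y n - k)"
    by simp
  assume "(\<lambda>n. N (x n - l)) \<longlonglongrightarrow> 0" "(\<lambda>n. N (y n - k)) \<longlonglongrightarrow> 0"
  then show "(\<lambda>n. N (x n - l) + N (y n - k)) \<longlonglongrightarrow> 0" by (rule tendsto_add_zero)
qed

lemma conv_scale:
  assumes "conv x l" "c \<longlonglongrightarrow> (c' :: real)" shows "conv (\<lambda>n. c n *\<^sub>R x n) (c' *\<^sub>R l)"
  unfolding conv_def
proof (rule Lim_null_comparison[of _ "\<lambda>n. \<bar>c n\<bar> * N (x n - l) + \<bar>c n - c'\<bar> * N l"])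
  have "N (c n *\<^sub>R x n - c' *\<^sub>R l) \<le> \<bar>c n\<bar> * N (x n - l) + \<bar>c n - c'\<bar> * N l" for n
    using h.triangle[of "c n *\<^sub>R (x n - l)" "(c n - c') *\<^sub>R l"]
    by (simp only: h.nrm_scale) (simp add: algebra_simps)
  then show "\<forall>\<^sub>F n in sequentially. norm (N (c n *\<^sub>R x n - c' *\<^sub>R l)) \<le> \<bar>c n\<bar> * N (x n - l) + \<bar>c n - c'\<bar> * N l"
    by simp
  have "(\<lambda>n. \<bar>c n\<bar> * N (x n - l) + \<bar>c n - c'\<bar> * N l) \<longlonglongrightarrow> \<bar>c'\<bar> * 0 + \<bar>c' - c'\<bar> * N l"
    using assms by (intro tendsto_intros; simp add: conv_def)
  then show "(\<lambda>n. \<bar>c n\<bar> * N (x n - l) + \<bar>c n - c'\<bar> * N l) \<longlonglongrightarrow> 0" by simp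
qed

lemma conv_diff: "conv x l \<Longrightarrow> conv y k \<Longrightarrow> conv (\<lambda>n. x n - y n) (l - k)"
  using conv_add[of x l "\<lambda>n. (-1) *\<^sub>R y n" "(-1) *\<^sub>R k"] conv_scale[of y k "\<lambda>_. -1" "-1"] by simp

lemma conv_subseq: "conv x l \<Longrightarrow> strict_mono r \<Longrightarrow> conv (\<lambda>n. x (r n)) l"
  unfolding conv_def using LIMSEQ_subseq_LIMSEQ[of "\<lambda>n. N (x n - l)" 0 r] by (simp add: o_def)

lemma tendsto_form:
  assumes B: "psd_form B" and bd: "\<And>v w. \<bar>B v w\<bar> \<le> C * N v * N w"
    and x: "conv x l" and y: "conv y k"
  shows "(\<lambda>n. B (x n) (y n)) \<longlonglongrightarrow> B l k"
proof -
  interpret B: psd_form B by (rule B)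
  have eq: "B (x n) (y n) - B l k = B (x n - l) (y n) + B l (y n - k)" for n
    by (simp add: B.bilin)
  have "\<bar>B (x n) (y n) - B l k\<bar> \<le> C * N (x n - l) * N (y n) + C * N l * N (y n - k)" for n
    unfolding eq using bd[of "x n - l" "y n"] bd[of l "y n - k"] by linarith
  moreover have "(\<lambda>n. C * N (x n - l) * N (y n) + C * N l * N (y n - k)) \<longlonglongrightarrow> C * 0 * N k + C * N l * 0"
    using x y conv_N[OF y] by (intro tendsto_intros; simp add: conv_def)
  ultimately show ?thesis
    using tendsto_dist_bound[of _ _ "\<lambda>n. C * N (x n - l) * N (y n) + C * N l * N (y n - k)"] by simp
qed

lemma tendsto_b: "conv x l \<Longrightarrow> conv y k \<Longrightarrow> (\<lambda>n. b (x n) (y n)) \<longlonglongrightarrow> b l k"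
  by (rule tendsto_form[OF b.psd_form_axioms, of 1]) (simp_all add: b_bound)

lemma tendsto_a: "conv x l \<Longrightarrow> conv y k \<Longrightarrow> (\<lambda>n. a (x n) (y n)) \<longlonglongrightarrow> a l k"
  by (rule tendsto_form[OF a.psd_form_axioms, of "max Ca 0"]) (simp_all add: a_bound2)

lemma tendsto_R:
  assumes "conv p p0" "conv q q0" "conv v v0" "conv w w0"
  shows "(\<lambda>n. R (p n) (q n) (v n) (w n)) \<longlonglongrightarrow> R p0 q0 v0 w0"
proof -
  let ?F = "\<lambda>n. K4^4 * (N (p n - p0) * N (q n) * N (v n) * N (w n))
     + K4^4 * (N p0 * N (q n - q0) * N (v n) * N (w n))
     + K4^4 * (N p0 * N q0 * N (v n - v0) * N (w n)) + K4^4 * (N p0 * N q0 * N v0 * N (w n - w0))"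
  have eq: "R (p n) (q n) (v n) (w n) - R p0 q0 v0 w0 = R (p n - p0) (q n) (v n) (w n)
     + R p0 (q n - q0) (v n) (w n) + R p0 q0 (v n - v0) (w n) + R p0 q0 v0 (w n - w0)" for n
    by (simp add: R_lin)
  have "\<bar>R (p n) (q n) (v n) (w n) - R p0 q0 v0 w0\<bar> \<le> ?F n" for n
    unfolding eq using R_boundN[of "p n - p0" "q n" "v n" "w n"] R_boundN[of p0 "q n - q0" "v n" "w n"]
      R_boundN[of p0 q0 "v n - v0" "w n"] R_boundN[of p0 q0 v0 "w n - w0"] by linarith
  moreover have "?F \<longlonglongrightarrow> K4^4 * (0 * N q0 * N v0 * N w0) + K4^4 * (N p0 * 0 * N v0 * N w0)
     + K4^4 * (N p0 * N q0 * 0 * N w0) + K4^4 * (N p0 * N q0 * N v0 * 0)"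
    using assms conv_N[OF assms(2)] conv_N[OF assms(3)] conv_N[OF assms(4)]
    by (intro tendsto_intros; simp add: conv_def)
  ultimately show ?thesis
    using tendsto_dist_bound[of _ _ ?F] by simp
qed

lemma tendsto_A:
  "conv z z0 \<Longrightarrow> conv x l \<Longrightarrow> conv y k \<Longrightarrow> (\<lambda>n. A (z n) (x n) (y n)) \<longlonglongrightarrow> A z0 l k"
  unfolding A_def by (intro tendsto_intros tendsto_a tendsto_R)

lemma tendsto_E: "conv x l \<Longrightarrow> (\<lambda>n. E (x n)) \<longlonglongrightarrow> E l"
  unfolding E_def by (intro tendsto_intros tendsto_a tendsto_R)

lemma conv_null: "conv x l \<Longrightarrow> N (l - k) = 0 \<Longrightarrow> conv x k"
  unfolding conv_def
proof (rule tendsto_dist_bound[of _ _ "\<lambda>n. N (x n - l)"])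
  assume "N (l - k) = 0"
  then show "\<bar>N (x n - k) - 0\<bar> \<le> N (x n - l)" for n
    using h.triangle_mid[of "x n" k l] by simp
qed

text \<open>Direct method in place of a representation theorem: the quadratic functional
  \<open>F\<close> is bounded below by coercivity, its minimising sequences are Cauchy, and the
  first variation at the limit is the weak equation.\<close>

lemma exists_inverse: "\<exists>q. \<forall>w. A z q w = b f w"
proof -
  define F where "F x = A z x x - 2 * b f x" for x
  have lower: "F x \<ge> - (b.nrm f)\<^sup>2 / c0" for x
  proof -
    have "\<bar>b f x\<bar> \<le> b.nrm f * N x"
      using b.cauchy_schwarz[of f x] b_le_N[of x] by (meson b.nrm_nonneg mult_left_mono order_trans)
    then have "F x \<ge> c0 * (N x)\<^sup>2 - 2 * (b.nrm f * N x)"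
      using A_coercive[of x z] unfolding F_def by linarith
    moreover have "c0 * (N x)\<^sup>2 - 2 * (b.nrm f * N x) + (b.nrm f)\<^sup>2 / c0 = (c0 * N x - b.nrm f)\<^sup>2 / c0"
      using c0 by (simp add: field_simps power2_eq_square)
    moreover have "(c0 * N x - b.nrm f)\<^sup>2 / c0 \<ge> 0" using c0 by simp
    ultimately show ?thesis by linarith
  qed
  define m where "m = Inf (range F)"
  have bdd: "bdd_below (range F)" using lower by (meson bdd_belowI2)
  have m_le: "m \<le> F x" for x unfolding m_def by (simp add: bdd cInf_lower)
  have "\<exists>x. F x < m + 1 / real (Suc n)" for n
    using cInf_lessD[of "range F" "m + 1 / real (Suc n)"] by (auto simp: m_def)
  then obtain x where x: "\<And>n. F (x n) < m + 1 / real (Suc n)" by metis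
  \<comment> \<open>Parallelogram identity: the midpoint of two almost minimal points has energy at
    least \<open>m\<close>, so the points must be close.\<close>
  have par: "F ((1/2) *\<^sub>R (u + v)) = 1/2 * F u + 1/2 * F v - 1/4 * A z (u - v) (u - v)" for u v
    by (simp add: F_def A.bilin b.bilin A.commute[of z v u] algebra_simps)
  have diff: "c0 * (N (x i - x j))\<^sup>2 \<le> 2 * (1 / real (Suc i) + 1 / real (Suc j))" for i j
  proof -
    have "c0 * (N (x i - x j))\<^sup>2 \<le> A z (x i - x j) (x i - x j)" by (rule A_coercive)
    also have "\<dots> = 2 * F (x i) + 2 * F (x j) - 4 * F ((1/2) *\<^sub>R (x i + x j))" by (simp add: par)
    also have "\<dots> \<le> 2 * (1 / real (Suc i) + 1 / real (Suc j))"
      using add_strict_mono[OF x[of i] x[of j]] m_le[of "(1/2) *\<^sub>R (x i + x j)"] by argo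
    finally show ?thesis .
  qed
  have "\<exists>l. (\<lambda>n. N (x n - l)) \<longlonglongrightarrow> 0"
  proof (rule complete)
    fix e :: real assume e: "e > 0"
    then obtain M where M: "1 / real (Suc M) < c0 * e\<^sup>2 / 4"
      using c0 nat_approx_posE[of "c0 * e\<^sup>2 / 4"] by auto
    show "\<exists>M. \<forall>i\<ge>M. \<forall>j\<ge>M. N (x i - x j) < e"
    proof (intro exI allI impI)
      fix i j assume "M \<le> i" "M \<le> j"
      then have "1 / real (Suc i) \<le> 1 / real (Suc M)" "1 / real (Suc j) \<le> 1 / real (Suc M)"
        by (auto simp: frac_le)
      then have "c0 * (N (x i - x j))\<^sup>2 < c0 * e\<^sup>2" using diff[of i j] M by argo
      then show "N (x i - x j) < e" using c0 e by (simp add: power2_less_imp_less)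
    qed
  qed
  then obtain q where q: "conv x q" by (auto simp: conv_def)
  have "A z q w = b f w" for w
  proof -
    have "0 \<le> 2 * t * (A z q w - b f w) + t\<^sup>2 * A z w w" for t
    proof -
      \<comment> \<open>Almost minimality of \<open>x n\<close> tested in direction
        \<open>w\<close>; letting n grow leaves a nonnegative quadratic in \<open>t\<close> without
        constant term.\<close>
      have "- 1 / real (Suc n) \<le> 2 * t * (A z (x n) w - b f w) + t\<^sup>2 * A z w w" for n
      proof -
        have "F (x n + t *\<^sub>R w) - F (x n) = 2 * t * (A z (x n) w - b f w) + t\<^sup>2 * A z w w"
          by (simp add: F_def A.bilin b.bilin A.commute[of z w "x n"] algebra_simps power2_eq_square)
        then show ?thesis using m_le[of "x n + t *\<^sub>R w"] x[of n] by simp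
      qed
      moreover have "(\<lambda>n. 2 * t * (A z (x n) w - b f w) + t\<^sup>2 * A z w w)
          \<longlonglongrightarrow> 2 * t * (A z q w - b f w) + t\<^sup>2 * A z w w"
        by (intro tendsto_intros tendsto_A conv_const q)
      moreover have "(\<lambda>n. - 1 / real (Suc n)) \<longlonglongrightarrow> 0"
        using tendsto_minus[OF LIMSEQ_inverse_real_of_nat] by (simp add: inverse_eq_divide)
      ultimately show ?thesis by (intro LIMSEQ_le[of "\<lambda>n. - 1 / real (Suc n)"]) auto
    qed
    then show ?thesis using linear_coeff_eq_0[OF A.nonneg[of z w], of "A z q w - b f w"] by simp
  qed
  then show ?thesis by blast
qed

lemma inverse_unique:
  assumes "\<And>w. A z q w = b f w" "\<And>w. A z q' w = b f w" shows "N (q - q') = 0"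
proof -
  have "A z (q - q') (q - q') = 0" using assms by (simp add: A.diff_left)
  then have "c0 * (N (q - q'))\<^sup>2 \<le> 0" using A_coercive[of "q - q'" z] by simp
  then show ?thesis using c0 by (simp add: mult_le_0_iff)
qed

text \<open>The bracket is the integral of (2 Re(u cnj d) + |d|^2)^2, kept as three terms so that
  the second, third and fourth powers of \<open>d\<close> can be estimated separately.\<close>

lemma E_expand:
  "E (u + d) = E u + A u u d + 1/2 * A u d d
     + \<beta>/4 * (4 * R u d u d + 4 * R u d d d + R d d d d)"
proof -
  have s: "R d u x y = R u d x y" "R x y d u = R x y u d" for x y
    by (simp_all add: R_comm[of d u] R_comm2[of x y d u])
  show ?thesis
    unfolding E_def A_def
    by (simp add: a.bilin R_lin s a.commute[of d u] R_swap[of u d u u] R_swap[of d d u u]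
        R_swap[of d d u d] algebra_simps)
qed


section \<open>Energy decrease achieved by one step\<close>

lemma N_le_of_E:
  assumes "E u \<le> E0" shows "(N u)\<^sup>2 \<le> 2 * E0 / c0"
proof -
  have "0 \<le> \<beta>/4 * R u u u u" using beta R_nonneg by simp
  then have "c0 * (N u)\<^sup>2 \<le> 2 * E0"
    using coercive[of u] assms by (simp add: E_def h.nrm_sq)
  then show ?thesis using c0 by (simp add: field_simps)
qed

text \<open>Since \<open>A u q\<close> represents \<open>b u\<close>, being
  \<open>A u\<close>-orthogonal to \<open>q\<close> and being L^2-orthogonal to \<open>u\<close> are
  the same thing. The vector \<open>d\<close> has this property, so
  \<open>u = d + \<gamma> q\<close> is a Pythagorean splitting in the metric \<open>A u\<close>,
  with A(u,u) = A(d,d) + \<gamma>; this gives the facts on \<open>d\<close>. The last two bounds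
  control \<gamma> from above and from below.\<close>

lemma inverse_facts:
  assumes u: "b u u = 1" and q: "\<And>w. A u q w = b u w"
  defines "\<gamma> \<equiv> inverse (b u q)" and "d \<equiv> u - inverse (b u q) *\<^sub>R q"
  shows "b u q > 0" "N q \<le> 1 / c0" "\<gamma> * b u q = 1" "b u d = 0" "A u d d = A u u d" "A u d d \<le> A u u u"
    "1 \<le> A u u u * b u q" "b u q \<le> 1 / c0"
proof -
  have qq: "A u q q = b u q" using q by simp
  have uq: "A u u q = 1" using q[of u] u by (simp add: A.commute[of u u q])
  have pos: "b u q \<noteq> 0"
  proof
    assume "b u q = 0"
    then have "A.nrm u q = 0" using qq by (simp add: A.nrm_def)
    then have "A u q u = 0" by (rule A.nrm_null_left)
    then show False using uq by (simp add: A.commute[of u u q])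
  qed
  then show p: "b u q > 0" using A.nonneg[of u q] qq by simp
  show g: "\<gamma> * b u q = 1" using pos by (simp add: \<gamma>_def)
  have nu: "b.nrm u = 1" using u by (simp add: b.nrm_def)
  have bq: "b u q \<le> N q" using b.cs_le[of u q] b_le_N[of q] nu by simp
  have "c0 * (N q)\<^sup>2 \<le> N q" using A_coercive[of q u] qq bq by simp
  then have "c0 * N q \<le> 1" using h.nrm_nonneg[of q]
    by (cases "N q = 0") (simp_all add: power2_eq_square)
  then show Nq: "N q \<le> 1 / c0" using c0 by (simp add: field_simps)
  show "b u q \<le> 1 / c0" using bq Nq by linarith
  show bd: "b u d = 0" using g u by (simp add: d_def \<gamma>_def b.bilin)
  have Ad: "A u d w = A u u w - \<gamma> * b u w" for w
    by (simp add: d_def \<gamma>_def A.bilin q)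
  show dd: "A u d d = A u u d" using Ad[of d] bd by simp
  have "A u u u - A u d d = \<gamma>"
  proof -
    have "A u d d = A u d u" using dd by (simp add: A.commute[of u u d])
    also have "\<dots> = A u u u - \<gamma>" using Ad[of u] u by simp
    finally show ?thesis by simp
  qed
  moreover have "\<gamma> > 0" using p by (simp add: \<gamma>_def)
  ultimately show "A u d d \<le> A u u u" by simp
  have "(A u u q)\<^sup>2 \<le> (A.nrm u u * A.nrm u q)\<^sup>2"
    using A.cs_le[of u u q] uq by (intro power_mono) auto
  then show "1 \<le> A u u u * b u q" using uq qq by (simp add: power_mult_distrib A.nrm_sq)
qed

text \<open>The inverse \<open>q\<close> is an argument because it is determined only up to null
  functions.\<close>

definition ustep :: "real \<Rightarrow> 'v \<Rightarrow> 'v \<Rightarrow> 'v" where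
  "ustep \<tau> u q = (let x = (1 - \<tau>) *\<^sub>R u + (\<tau> * inverse (b u q)) *\<^sub>R q in (1 / b.nrm x) *\<^sub>R x)"

text \<open>The Riemannian gradient of \<open>E\<close> at a normalised \<open>u\<close> in the
  metric \<open>A u\<close>; before normalisation a step is
  \<open>u - \<tau> *\<^sub>R resid u q\<close>.\<close>

definition resid :: "'v \<Rightarrow> 'v \<Rightarrow> 'v" where "resid u q = u - inverse (b u q) *\<^sub>R q"

text \<open>The slope of \<open>E\<close> along the negative residual \<open>d\<close> is minus
  A(d,d), and everything of second order is a multiple of \<tau>^2 A(d,d). \<open>K\<close> bounds
  \<open>N u\<close> by coercivity of the energy, and \<open>K2\<close> bounds both
  \<open>N u\<close> and \<open>N d\<close>. The three summands of \<open>C\<close> belong to the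
  quadratic term of the expansion, to the quartic bracket, and to the squared step length that the
  conclusion adds.\<close>

lemma step_decrease:
  assumes u: "b u u = 1" and q: "\<And>w. A u q w = b u w" and Eu: "E u \<le> E0"
    and K: "K = 1 + 2 * E0 / c0" and \<tau>: "0 < \<tau>" "\<tau> \<le> 1"
    and K2: "K2 = 1 + CA K * K\<^sup>2 / c0 + K"
    and C: "C = 1/2 + 3 * \<beta> * K4^4 * K2\<^sup>2 / c0 + (1 + K2\<^sup>2)\<^sup>2 / (2 * c0)"
    and small: "\<tau> * C \<le> 1/2"
  shows "b (ustep \<tau> u q) (ustep \<tau> u q) = 1"
    "E u - E (ustep \<tau> u q) \<ge> \<tau> / 2 * c0 * (N (resid u q))\<^sup>2 + 1/2 * (N (ustep \<tau> u q - u))\<^sup>2"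
proof -
  define d where "d = resid u q"
  note f = inverse_facts[OF u q, folded resid_def, folded d_def]
  have sq1: "x \<le> 1 + x\<^sup>2" for x :: real
    using sum_power2_ge_zero[of "x - 1/2" 0] by (simp add: power2_eq_square algebra_simps) 
  have E0: "E0 \<ge> 0"
  proof -
    have "0 \<le> (N u)\<^sup>2" by simp
    also have "\<dots> \<le> 2 * E0 / c0" by (rule N_le_of_E[OF Eu])
    finally show ?thesis using c0 by (simp add: zero_le_divide_iff)
  qed
  have Kpos: "K \<ge> 1" using K E0 c0 by simp
  have Nu: "N u \<le> K" using sq1[of "N u"] N_le_of_E[OF Eu] K by linarith
  have Auu: "A u u u \<le> CA K * K\<^sup>2"
  proof -
    have "A u u u \<le> CA K * N u * N u" using A_bound[OF Nu, of u u] by linarith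
    also have "\<dots> \<le> CA K * K * K" using Nu CA_nonneg[of K] Kpos by (intro mult_mono) auto
    finally show ?thesis by (simp add: power2_eq_square mult.assoc)
  qed
  have Ndd: "(N d)\<^sup>2 \<le> A u d d / c0" using A_coercive[of d u] c0 by (simp add: field_simps)
  have "(N d)\<^sup>2 \<le> CA K * K\<^sup>2 / c0"
    using order_trans[OF Ndd divide_right_mono[OF order_trans[OF f(6) Auu], of c0]] c0 by simp
  then have Nd: "N d \<le> K2" using sq1[of "N d"] Kpos unfolding K2 by linarith
  have Nu2: "N u \<le> K2"
  proof -
    have "0 \<le> CA K * K\<^sup>2 / c0" using CA_nonneg[of K] c0 by simp
    then show ?thesis using Nu unfolding K2 by linarith
  qed
  have K2: "K2 \<ge> 0" using Nd h.nrm_nonneg[of d] by linarith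
  have Rb: "\<bar>R x y d d\<bar> \<le> K4^4 * K2\<^sup>2 * (N d)\<^sup>2" if "N x \<le> K2" "N y \<le> K2" for x y
  proof -
    have "\<bar>R x y d d\<bar> \<le> K4^4 * (N x * N y * N d * N d)" by (rule R_boundN)
    also have "\<dots> \<le> K4^4 * (K2 * K2 * N d * N d)"
      using that K2 K4_pos by (intro mult_left_mono mult_right_mono mult_mono) auto
    finally show ?thesis by (simp add: power2_eq_square mult.assoc)
  qed
  have Rud: "\<bar>R u d u d\<bar> \<le> K4^4 * K2\<^sup>2 * (N d)\<^sup>2"
  proof -
    have "\<bar>R u d u d\<bar> \<le> K4^4 * (N u * N d * N u * N d)" by (rule R_boundN)
    also have "\<dots> = K4^4 * (N u * N u * N d * N d)" by simp
    also have "\<dots> \<le> K4^4 * (K2 * K2 * N d * N d)"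
      using Nu2 K2 K4_pos by (intro mult_left_mono mult_right_mono mult_mono) auto
    finally show ?thesis by (simp add: power2_eq_square mult.assoc)
  qed
  define x where "x = u + (- \<tau>) *\<^sub>R d"
  have x_alt: "(1 - \<tau>) *\<^sub>R u + (\<tau> * inverse (b u q)) *\<^sub>R q = x"
    by (simp add: x_def d_def resid_def algebra_simps)
  define s where "s = b.nrm x"
  have us: "ustep \<tau> u q = (1 / s) *\<^sub>R x" by (simp add: ustep_def x_alt s_def Let_def)
  \<comment> \<open>Orthogonality of \<open>d\<close> to \<open>u\<close> removes the linear term,
    so the unnormalised iterate has norm at least 1.\<close>
  have bxx: "b x x = 1 + \<tau>\<^sup>2 * b d d"
    using u f(4) by (simp add: x_def b.bilin b.commute[of d u] power2_eq_square)
  have s2: "s\<^sup>2 = 1 + \<tau>\<^sup>2 * b d d" by (simp add: s_def b.nrm_sq bxx)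
  have s2_ge: "s\<^sup>2 \<ge> 1\<^sup>2" using s2 b.nonneg[of d] by simp
  have s1: "s \<ge> 1" by (rule power2_le_imp_le[OF s2_ge]) (simp add: s_def)
  show "b (ustep \<tau> u q) (ustep \<tau> u q) = 1"
    using s1 by (simp add: us b.bilin b.nrm_sq[of x, folded s_def, symmetric] power2_eq_square)
  define P where "P = A u d d"
  have P0: "P \<ge> 0" by (simp add: P_def A.nonneg)
  define Q where "Q = K4^4 * K2\<^sup>2 * (N d)\<^sup>2"
  have Q0: "Q \<ge> 0" by (simp add: Q_def)
  have QP: "Q \<le> K4^4 * K2\<^sup>2 / c0 * P"
    using mult_left_mono[OF Ndd, of "K4^4 * K2\<^sup>2"] by (simp add: Q_def P_def)
  \<comment> \<open>Because \<tau> is at most 1, the cubic and quartic terms can be charged to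
    \<tau>^2.\<close>
  have t3: "\<tau>^3 \<le> \<tau>\<^sup>2" "\<tau>^4 \<le> \<tau>\<^sup>2"
    using \<tau> power_decreasing[of 2 3 \<tau>] power_decreasing[of 2 4 \<tau>] by auto
  have "E x = E u - \<tau> * P + \<tau>\<^sup>2 / 2 * P
       + \<beta>/4 * (4 * \<tau>\<^sup>2 * R u d u d - 4 * \<tau>^3 * R u d d d + \<tau>^4 * R d d d d)"
    unfolding x_def E_expand P_def
    by (simp add: A.bilin R_lin f(5) power2_eq_square power3_eq_cube power4_eq_xxxx algebra_simps)
  \<comment> \<open>Each product is at most \<tau>^2 \<open>Q\<close> with weights 4, 4 and 1; the
    sum 9 is rounded up to 12 so that the factor \<beta>/4 turns it into 3 \<beta>.\<close>
  moreover have "4 * \<tau>\<^sup>2 * R u d u d - 4 * \<tau>^3 * R u d d d + \<tau>^4 * R d d d d \<le> 12 * \<tau>\<^sup>2 * Q"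
  proof -
    have "\<tau>\<^sup>2 * R u d u d \<le> \<tau>\<^sup>2 * Q" using Rud by (intro mult_left_mono) (auto simp: Q_def)
    moreover have "\<tau>^3 * - R u d d d \<le> \<tau>\<^sup>2 * Q"
      using Rb[OF Nu2 Nd] t3 \<tau> Q0 unfolding Q_def[symmetric] by (intro order_trans[OF mult_left_mono[of _ Q] mult_right_mono]) auto
    moreover have "\<tau>^4 * R d d d d \<le> \<tau>\<^sup>2 * Q"
      using Rb[OF Nd Nd] t3 \<tau> Q0 unfolding Q_def[symmetric] by (intro order_trans[OF mult_left_mono[of _ Q] mult_right_mono]) auto
    moreover have "0 \<le> \<tau>\<^sup>2 * Q" using Q0 by simp
    ultimately show ?thesis by (simp add: mult.assoc)
  qed
  ultimately have "E x \<le> E u - \<tau> * P + \<tau>\<^sup>2 / 2 * P + \<beta>/4 * (12 * \<tau>\<^sup>2 * Q)"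
    using mult_left_mono[of _ "12 * \<tau>\<^sup>2 * Q" "\<beta>/4"] beta by fastforce
  moreover have "\<beta>/4 * (12 * \<tau>\<^sup>2 * Q) \<le> \<tau>\<^sup>2 * (3 * \<beta> * K4^4 * K2\<^sup>2 / c0) * P"
    using mult_left_mono[OF QP, of "3 * \<beta> * \<tau>\<^sup>2"] beta by (simp add: mult_ac)
  ultimately have Ex: "E x \<le> E u - \<tau> * P + \<tau>\<^sup>2 * (1/2 + 3 * \<beta> * K4^4 * K2\<^sup>2 / c0) * P"
    by (simp add: algebra_simps)
  \<comment> \<open>Normalisation scales by 1/s with s at least 1, which lowers the nonnegative
    quadratic and quartic parts alike.\<close>
  have E_us: "E (ustep \<tau> u q) \<le> E x"
  proof -
    have i: "1 / s \<le> 1" "0 < 1 / s" using s1 by auto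
    then have "(1/s)^2 \<le> 1" "(1/s)^4 \<le> 1" by (auto intro: power_le_one)
    then have "(1/s)^2 * a x x \<le> 1 * a x x" "(1/s)^4 * R x x x x \<le> 1 * R x x x x"
      by (intro mult_right_mono; simp add: a.nonneg R_nonneg)+
    moreover have "E (ustep \<tau> u q) = 1/2 * ((1/s)^2 * a x x) + \<beta>/4 * ((1/s)^4 * R x x x x)"
      by (simp add: E_def us a.bilin R_lin power2_eq_square power4_eq_xxxx)
    ultimately show ?thesis using mult_left_mono[of "(1/s)^4 * R x x x x" "1 * R x x x x" "\<beta>/4"] beta
      unfolding E_def by linarith
  qed
  \<comment> \<open>The step is the move along \<open>d\<close> plus the correction
    \<open>s - 1\<close> of the length; the latter is of order \<tau>^2 |d|^2 and is absorbed with
    the crude bounds \<open>N d \<le> K2\<close> and \<open>N u \<le> K2\<close>.\<close>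
  have Nstep: "N (ustep \<tau> u q - u) \<le> \<tau> * (1 + K2\<^sup>2) * N d"
  proof -
    have eq: "ustep \<tau> u q - u = (1/s) *\<^sub>R ((- \<tau>) *\<^sub>R d + (- (s - 1)) *\<^sub>R u)"
      using s1 by (simp add: us x_def algebra_simps)
    have "N (ustep \<tau> u q - u) \<le> 1 * N ((- \<tau>) *\<^sub>R d + (- (s - 1)) *\<^sub>R u)"
      unfolding eq h.nrm_scale using s1 by (intro mult_right_mono) auto
    also have "\<dots> \<le> \<tau> * N d + (s - 1) * N u"
      using h.triangle[of "(- \<tau>) *\<^sub>R d" "(- (s - 1)) *\<^sub>R u"] \<tau> s1 by (simp only: h.nrm_scale) simp
    also have "(s - 1) * N u \<le> \<tau> * (K2 * N d) * K2"
    proof (rule mult_mono)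
      have "s - 1 \<le> s\<^sup>2 - 1" using s1 by (simp add: power2_eq_square)
      also have "\<dots> = \<tau>\<^sup>2 * b d d" using s2 by simp
      also have "\<dots> \<le> \<tau> * (K2 * N d)"
      proof (rule mult_mono)
        show "\<tau>\<^sup>2 \<le> \<tau>" using \<tau> by (simp add: power2_eq_square)
        have "b d d \<le> N d * N d" using b_bound[of d d] by linarith
        also have "\<dots> \<le> K2 * N d" using Nd by (intro mult_right_mono) auto
        finally show "b d d \<le> K2 * N d" .
      qed (use \<tau> b.nonneg in auto)
      finally show "s - 1 \<le> \<tau> * (K2 * N d)" .
    qed (use Nu2 \<tau> K2 in auto)
    finally show ?thesis by (simp add: algebra_simps power2_eq_square)
  qed
  have "1/2 * (N (ustep \<tau> u q - u))\<^sup>2 \<le> \<tau>\<^sup>2 * ((1 + K2\<^sup>2)\<^sup>2 / (2 * c0)) * P"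
  proof -
    have "(N (ustep \<tau> u q - u))\<^sup>2 \<le> (\<tau> * (1 + K2\<^sup>2) * N d)\<^sup>2" by (rule power_mono[OF Nstep]) simp
    also have "\<dots> = \<tau>\<^sup>2 * (1 + K2\<^sup>2)\<^sup>2 * (N d)\<^sup>2" by (simp add: power_mult_distrib)
    also have "\<dots> \<le> \<tau>\<^sup>2 * (1 + K2\<^sup>2)\<^sup>2 * (P / c0)"
      using Ndd by (intro mult_left_mono) (auto simp: P_def)
    finally show ?thesis by simp
  qed
  with Ex E_us have "E u - E (ustep \<tau> u q) \<ge> \<tau> * P - \<tau>\<^sup>2 * C * P + 1/2 * (N (ustep \<tau> u q - u))\<^sup>2"
    by (simp add: C algebra_simps)
  \<comment> \<open>Half of the linear gain pays for all second-order terms; the other half remains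
    in the conclusion.\<close>
  moreover have "\<tau>\<^sup>2 * C * P \<le> \<tau> / 2 * P"
    using mult_right_mono[OF mult_left_mono[OF small, of \<tau>] P0] \<tau> by (simp add: power2_eq_square mult_ac)
  moreover have "\<tau> / 2 * (c0 * (N d)\<^sup>2) \<le> \<tau> / 2 * P"
    unfolding P_def by (intro mult_left_mono A_coercive) (use \<tau> in auto)
  ultimately show "E u - E (ustep \<tau> u q) \<ge> \<tau> / 2 * c0 * (N (resid u q))\<^sup>2 + 1/2 * (N (ustep \<tau> u q - u))\<^sup>2"
    unfolding d_def[symmetric] by (simp add: mult.assoc)
qed

text \<open>The threshold depends on the energy bound \<open>E0\<close> alone. As the step preserves
  both the normalisation and this bound, a single threshold serves a whole iteration.\<close>

lemma uniform_decrease: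
  "\<exists>T>0. \<forall>u q \<tau>. b u u = 1 \<longrightarrow> (\<forall>w. A u q w = b u w) \<longrightarrow> E u \<le> E0 \<longrightarrow> 0 < \<tau> \<longrightarrow> \<tau> \<le> T \<longrightarrow>
     b (ustep \<tau> u q) (ustep \<tau> u q) = 1 \<and>
     E u - E (ustep \<tau> u q) \<ge> \<tau> / 2 * c0 * (N (resid u q))\<^sup>2 + 1/2 * (N (ustep \<tau> u q - u))\<^sup>2"
proof -
  define K where "K = 1 + 2 * E0 / c0"
  define K2 where "K2 = 1 + CA K * K\<^sup>2 / c0 + K"
  define C where "C = 1/2 + 3 * \<beta> * K4^4 * K2\<^sup>2 / c0 + (1 + K2\<^sup>2)\<^sup>2 / (2 * c0)"
  have C: "C \<ge> 1/2" unfolding C_def using beta c0 by (simp add: add_nonneg_nonneg)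
  have small: "\<tau> * C \<le> 1/2" if "0 < \<tau>" "\<tau> \<le> min 1 (1 / (2 * C))" for \<tau>
    using that C by (simp add: field_simps)
  show ?thesis
  proof (intro exI[of _ "min 1 (1 / (2 * C))"] conjI allI impI)
    fix u q \<tau>
    assume *: "b u u = 1" "\<forall>w. A u q w = b u w" "E u \<le> E0" "0 < \<tau>" "\<tau> \<le> min 1 (1 / (2 * C))"
    then have "\<tau> \<le> 1" by simp
    note st = step_decrease[OF *(1) *(2)[rule_format] *(3) K_def *(4) this K2_def C_def small[OF *(4,5)]]
    show "b (ustep \<tau> u q) (ustep \<tau> u q) = 1"
      "E u - E (ustep \<tau> u q) \<ge> \<tau> / 2 * c0 * (N (resid u q))\<^sup>2 + 1/2 * (N (ustep \<tau> u q - u))\<^sup>2"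
      by (rule st)+
  qed (use C in simp)
qed

text \<open>Subtracting the two equations leaves only \<open>u - u'\<close> on the right, measured
  in L^2 and L^4. By interpolation, L^2 convergence of an H^1-bounded sequence \<open>u\<close> thus
  yields H^1 convergence of the inverses: this is the gain of regularity behind the compactness
  argument.\<close>

lemma inverse_stability:
  assumes q: "\<And>w. A u q w = b u w" and q': "\<And>w. A u' q' w = b u' w"
    and K: "N u \<le> K" "N u' \<le> K" "N q' \<le> K"
  shows "c0 * N (q - q') \<le> b.nrm (u - u') + 2 * \<beta> * K4^3 * K\<^sup>2 * n4 (u - u')"
proof -
  let ?x = "q - q'"
  have K0: "K \<ge> 0" using K(1) h.nrm_nonneg[of u] by linarith
  have "A u ?x ?x = b (u - u') ?x - \<beta> * R (u - u') (u + u') q' ?x"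
  proof -
    have "A u ?x ?x = b u ?x - A u q' ?x" by (simp add: A.diff_left[of u q q'] q)
    also have "A u q' ?x = b u' ?x + \<beta> * (R u u q' ?x - R u' u' q' ?x)"
      using q'[of ?x] by (simp add: A_def algebra_simps)
    finally show ?thesis by (simp add: R_sq_diff b.diff_left)
  qed
  moreover have "b (u - u') ?x \<le> b.nrm (u - u') * N ?x"
    using b.cs_le[of "u - u'" ?x] mult_left_mono[OF b_le_N[of ?x] b.nrm_nonneg[of "u - u'"]] by linarith
  moreover have "- (\<beta> * R (u - u') (u + u') q' ?x) \<le> \<beta> * (2 * K4^3 * K\<^sup>2 * n4 (u - u')) * N ?x"
  proof -
    have nn: "n4 (u + u') \<le> K4 * (2 * K)" "n4 q' \<le> K4 * K"
      using n4_le[of "u + u'"] h.triangle[of u u'] K n4_le[of q'] K4_pos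
      by (smt (verit) mult_left_mono)+
    have "- R (u - u') (u + u') q' ?x \<le> n4 (u - u') * n4 (u + u') * n4 q' * n4 ?x"
      using R_bound[of "u - u'" "u + u'" q' ?x] by linarith
    also have "\<dots> \<le> n4 (u - u') * (K4 * (2 * K)) * (K4 * K) * (K4 * N ?x)"
      by (intro mult_mono nn n4_le) (simp_all add: n4_nonneg K4_pos K0 less_imp_le)
    finally show ?thesis using mult_left_mono[OF _ beta] by (force simp: power3_eq_cube power2_eq_square mult_ac)
  qed
  ultimately have "c0 * (N ?x)\<^sup>2 \<le> (b.nrm (u - u') + 2 * \<beta> * K4^3 * K\<^sup>2 * n4 (u - u')) * N ?x"
    using A_coercive[of ?x u] by (simp add: algebra_simps)
  then show ?thesis
  proof (cases "N ?x = 0")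
    case True
    then show ?thesis using beta K4_pos n4_nonneg[of "u - u'"] by simp
  next
    case False
    then have "N ?x > 0" using h.nrm_nonneg[of ?x] by linarith
    with \<open>c0 * (N ?x)\<^sup>2 \<le> _\<close> show ?thesis by (simp add: power2_eq_square mult.assoc[symmetric])
  qed
qed

section \<open>Compactness of sequences with vanishing residual\<close>

definition cauchyN :: "(nat \<Rightarrow> 'v) \<Rightarrow> bool" where
  "cauchyN x \<longleftrightarrow> (\<forall>e>0. \<exists>M. \<forall>m\<ge>M. \<forall>n\<ge>M. N (x m - x n) < e)"

definition cauchyb :: "(nat \<Rightarrow> 'v) \<Rightarrow> bool" where
  "cauchyb x \<longleftrightarrow> (\<forall>e>0. \<exists>M. \<forall>m\<ge>M. \<forall>n\<ge>M. b.nrm (x m - x n) < e)"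

lemma cauchyN_conv: "cauchyN x \<Longrightarrow> \<exists>l. conv x l"
  unfolding cauchyN_def conv_def by (rule complete) blast

text \<open>Interpolation: on H^1-bounded sets, small L^2 norm forces small L^4 norm. The threshold
  \<open>d\<close> is read off from \<open>n4_interp\<close>.\<close>

lemma n4_small:
  assumes "e > 0" and K: "K > 0"
  shows "\<exists>d>0. \<forall>x. N x \<le> K \<longrightarrow> b.nrm x < d \<longrightarrow> n4 x < e"
proof -
  define d where "d = e ^ 4 / ((1 + \<bar>Cs\<bar>) * K ^ 3)"
  have d: "d > 0" using assms by (simp add: d_def)
  moreover have "n4 x < e" if x: "N x \<le> K" "b.nrm x < d" for x
  proof (rule power_less_imp_less_base)
    have "n4 x ^ 4 \<le> Cs * b.nrm x * N x ^ 3" by (rule n4_interp)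
    also have "\<dots> \<le> (1 + \<bar>Cs\<bar>) * b.nrm x * K ^ 3"
      using x K by (intro mult_mono power_mono) auto
    also have "\<dots> < (1 + \<bar>Cs\<bar>) * d * K ^ 3"
      using x K by (intro mult_strict_right_mono mult_strict_left_mono) auto
    also have "\<dots> = e ^ 4" using K by (simp add: d_def)
    finally show "n4 x ^ 4 < e ^ 4" .
  qed (use assms in simp)
  ultimately show ?thesis by blast
qed

lemma cauchyb_n4:
  assumes "cauchyb x" and K: "\<And>n. N (x n) \<le> K" and e: "e > 0"
  shows "\<exists>M. \<forall>m\<ge>M. \<forall>n\<ge>M. n4 (x m - x n) < e \<and> b.nrm (x m - x n) < e"
proof -
  have K0: "K \<ge> 0" using K[of 0] h.nrm_nonneg[of "x 0"] by linarith
  obtain d where d: "d > 0" "\<And>y. N y \<le> 2 * K + 1 \<Longrightarrow> b.nrm y < d \<Longrightarrow> n4 y < e"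
    using n4_small[OF e, of "2 * K + 1"] K0 by auto
  obtain M where M: "\<And>m n. m \<ge> M \<Longrightarrow> n \<ge> M \<Longrightarrow> b.nrm (x m - x n) < min d e"
    using assms(1) d e unfolding cauchyb_def by (meson min_less_iff_conj)
  have "N (x m - x n) \<le> 2 * K + 1" for m n
    using h.triangle_diff[of "x m" "x n"] K[of m] K[of n] by linarith
  then show ?thesis using M d(2) by (intro exI[of _ M]) auto
qed


lemma bounded_of_E:
  assumes "E u \<le> E0" shows "N u \<le> 1 + 2 * E0 / c0"
proof -
  have "N u \<le> 1 + (N u)\<^sup>2"
    using sum_power2_ge_zero[of "N u - 1/2" 0] by (simp add: power2_eq_square algebra_simps)
  then show ?thesis using N_le_of_E[OF assms] by linarith
qed

text \<open>A Palais-Smale condition. Compactness gives L^2 convergence of a subsequence of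
  \<open>u\<close>, stability of the inverse gives H^1 convergence of \<open>q\<close>, and a
  vanishing residual says that \<open>u\<close> is asymptotically a multiple of \<open>q\<close>, so
  \<open>u\<close> converges in H^1 as well.\<close>

lemma conv_of_resid:
  assumes u: "\<And>n. b (u n) (u n) = 1" and q: "\<And>n w. A (u n) (q n) w = b (u n) w"
    and Eu: "\<And>n. E (u n) \<le> E0" and res: "(\<lambda>n. N (resid (u n) (q n))) \<longlonglongrightarrow> 0"
  shows "\<exists>r w p. strict_mono (r::nat\<Rightarrow>nat) \<and> b w w = 1 \<and> conv (\<lambda>j. u (r j)) w \<and> (\<forall>x. A w p x = b w x)
     \<and> (\<lambda>j. inverse (b (u (r j)) (q (r j)))) \<longlonglongrightarrow> inverse (b w p) \<and> w = inverse (b w p) *\<^sub>R p"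
proof -
  define K where "K = max (1 + 2 * E0 / c0) (1 / c0)"
  have Nu: "N (u n) \<le> K" for n using bounded_of_E[OF Eu[of n]] by (simp add: K_def)
  have Nq: "N (q n) \<le> K" for n using inverse_facts(2)[OF u q, of n] by (simp add: K_def)
  obtain r1 :: "nat \<Rightarrow> nat" where r1: "strict_mono r1" "cauchyb (\<lambda>n. u (r1 n))"
    using compact[of u K, OF Nu] unfolding cauchyb_def by blast
  \<comment> \<open>Cauchy-Schwarz in the metric \<open>A u\<close> bounds the multiplier \<gamma>
    by A(u,u), which is bounded on the sublevel set; so a subsequence of the multipliers
    converges.\<close>
  define G where "G = max (CA K * K * K) 1"
  have gbd: "inverse (b (u n) (q n)) \<in> {0..G}" for n
  proof -
    note f = inverse_facts[OF u[of n] q[of n]]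
    have "A (u n) (u n) (u n) \<le> CA K * N (u n) * N (u n)" using A_bound[OF Nu[of n], of "u n" "u n"] by linarith
    also have "\<dots> \<le> CA K * K * K" using Nu[of n] CA_nonneg[of K] h.nrm_nonneg[of "u n"]
      by (intro mult_mono mult_nonneg_nonneg) (linarith | simp)+
    finally have "1 \<le> G * b (u n) (q n)" using f(7) f(1)
      by (smt (verit) G_def max.cobounded1 mult_right_mono)
    then show ?thesis using f(1) by (simp add: field_simps)
  qed
  have "bounded (range (\<lambda>n. inverse (b (u (r1 n)) (q (r1 n)))))"
    by (rule bounded_subset[of "{0..G}"]) (use gbd in auto)
  then obtain g r2 where r2: "strict_mono (r2::nat\<Rightarrow>nat)"
      "((\<lambda>n. inverse (b (u (r1 n)) (q (r1 n)))) \<circ> r2) \<longlonglongrightarrow> g"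
    using bounded_imp_convergent_subsequence by blast
  define r where "r = r1 \<circ> r2"
  have r: "strict_mono r" using r1 r2 by (simp add: r_def strict_mono_o)
  have g: "(\<lambda>j. inverse (b (u (r j)) (q (r j)))) \<longlonglongrightarrow> g" using r2(2) by (simp add: r_def o_def)
  have cb: "cauchyb (\<lambda>j. u (r j))"
    unfolding cauchyb_def
  proof (intro allI impI)
    fix e :: real assume "e > 0"
    then obtain M where M: "\<forall>m\<ge>M. \<forall>n\<ge>M. b.nrm (u (r1 m) - u (r1 n)) < e"
      using r1(2) unfolding cauchyb_def by blast
    have "r2 m \<ge> M" if "m \<ge> M" for m using seq_suble[OF r2(1), of m] that by linarith
    then show "\<exists>M. \<forall>m\<ge>M. \<forall>n\<ge>M. b.nrm (u (r m) - u (r n)) < e" using M by (intro exI[of _ M]) (auto simp: r_def)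
  qed
  have "cauchyN (\<lambda>j. q (r j))"
    unfolding cauchyN_def
  proof (intro allI impI)
    fix e :: real assume e: "e > 0"
    define C where "C = 1 + 2 * \<beta> * K4^3 * K\<^sup>2"
    have C: "C \<ge> 1" using beta K4_pos by (simp add: C_def)
    obtain M where M: "\<And>m n. m \<ge> M \<Longrightarrow> n \<ge> M \<Longrightarrow>
        n4 (u (r m) - u (r n)) < c0 * e / C \<and> b.nrm (u (r m) - u (r n)) < c0 * e / C"
      using cauchyb_n4[OF cb, of K "c0 * e / C"] Nu e c0 C by auto
    show "\<exists>M. \<forall>m\<ge>M. \<forall>n\<ge>M. N (q (r m) - q (r n)) < e"
    proof (intro exI allI impI)
      fix m n assume mn: "M \<le> m" "M \<le> n"
      have "c0 * N (q (r m) - q (r n)) \<le> b.nrm (u (r m) - u (r n)) + 2 * \<beta> * K4^3 * K\<^sup>2 * n4 (u (r m) - u (r n))"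
        by (rule inverse_stability[OF q q Nu Nu Nq])
      also have "\<dots> < c0 * e / C + 2 * \<beta> * K4^3 * K\<^sup>2 * (c0 * e / C)"
        using M[OF mn] beta K4_pos by (intro add_less_le_mono mult_left_mono) auto
      also have "\<dots> = C * (c0 * e / C)" by (simp only: C_def distrib_right mult_1)
      also have "\<dots> = c0 * e" using C by simp
      finally show "N (q (r m) - q (r n)) < e" using c0 by simp
    qed
  qed
  then obtain p where p: "conv (\<lambda>j. q (r j)) p" using cauchyN_conv by blast
  \<comment> \<open>The limit is dictated by the vanishing residual: \<open>u (r j)\<close> differs
    from \<open>\<gamma> q\<close> by a null sequence.\<close>
  define w where "w = g *\<^sub>R p"
  have cw: "conv (\<lambda>j. u (r j)) w"
  proof -
    have "conv (\<lambda>j. resid (u (r j)) (q (r j))) 0"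
      using LIMSEQ_subseq_LIMSEQ[OF res r] by (simp add: conv_def o_def)
    from conv_add[OF this conv_scale[OF p g]] show ?thesis by (simp add: resid_def w_def)
  qed
  have "(\<lambda>j. b (u (r j)) (u (r j))) \<longlonglongrightarrow> b w w" by (rule tendsto_b[OF cw cw])
  then have bw: "b w w = 1" using u LIMSEQ_unique[of "\<lambda>_. 1"] by auto
  have Ap: "A w p x = b w x" for x
  proof -
    have "(\<lambda>j. A (u (r j)) (q (r j)) x) \<longlonglongrightarrow> A w p x" by (rule tendsto_A[OF cw p conv_const])
    moreover have "(\<lambda>j. A (u (r j)) (q (r j)) x) \<longlonglongrightarrow> b w x" unfolding q by (rule tendsto_b[OF cw conv_const])
    ultimately show ?thesis by (rule LIMSEQ_unique)
  qed
  \<comment> \<open>A nonzero pairing lets the reciprocals converge, which identifies the limit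
    \<open>g\<close> of the multipliers.\<close>
  have "b w p \<noteq> 0" using inverse_facts(1)[OF bw Ap] by simp
  then have "(\<lambda>j. inverse (b (u (r j)) (q (r j)))) \<longlonglongrightarrow> inverse (b w p)"
    by (intro tendsto_inverse tendsto_b[OF cw p])
  moreover from this g have "g = inverse (b w p)" by (metis LIMSEQ_unique)
  ultimately show ?thesis using r bw cw Ap w_def by blast
qed

text \<open>For \<open>N x \<le> 1\<close> the cubic and quartic terms of the expansion are
  dominated by \<open>(N x)^2\<close>; this is the Frechet estimate for the energy at
  \<open>w\<close>.\<close>

lemma E_quadratic_remainder:
  assumes "N x \<le> 1"
  shows "\<bar>E (w + x) - E w - A w w x\<bar> \<le> (CA (N w) + \<beta> * K4^4 * (N w + 1)\<^sup>2) * (N x)\<^sup>2"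
proof -
  have R1: "\<bar>R w x w x\<bar> \<le> K4^4 * (N w)\<^sup>2 * (N x)\<^sup>2"
    using R_boundN[of w x w x] by (simp add: power2_eq_square mult_ac)
  have R2: "\<bar>R w x x x\<bar> \<le> K4^4 * N w * (N x)\<^sup>2"
  proof -
    have "\<bar>R w x x x\<bar> \<le> K4^4 * (N w * N x * N x * N x)" by (rule R_boundN)
    also have "\<dots> \<le> K4^4 * (N w * 1 * N x * N x)"
      using assms K4_pos by (intro mult_left_mono mult_right_mono) auto
    finally show ?thesis by (simp add: power2_eq_square mult_ac)
  qed
  have R3: "\<bar>R x x x x\<bar> \<le> K4^4 * (N x)\<^sup>2"
  proof -
    have "\<bar>R x x x x\<bar> \<le> K4^4 * (N x * N x * N x * N x)" by (rule R_boundN)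
    also have "\<dots> \<le> K4^4 * (1 * 1 * N x * N x)"
      using assms K4_pos by (intro mult_left_mono mult_right_mono mult_mono) auto
    finally show ?thesis by (simp add: power2_eq_square mult_ac)
  qed
  have A1: "\<bar>A w x x\<bar> \<le> CA (N w) * (N x)\<^sup>2"
    using A_bound[of w "N w" x x] by (simp add: power2_eq_square mult_ac)
  have "\<bar>4 * R w x w x + 4 * R w x x x + R x x x x\<bar> \<le> 4 * (K4^4 * (N w + 1)\<^sup>2 * (N x)\<^sup>2)"
  proof -
    have "4 * (K4^4 * (N w + 1)\<^sup>2 * (N x)\<^sup>2) = 4 * (K4^4 * (N w)\<^sup>2 * (N x)\<^sup>2)
        + 8 * (K4^4 * N w * (N x)\<^sup>2) + 4 * (K4^4 * (N x)\<^sup>2)" by (simp add: power2_eq_square algebra_simps)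
    moreover have "0 \<le> K4^4 * N w * (N x)\<^sup>2" "0 \<le> K4^4 * (N x)\<^sup>2" using K4_pos by simp_all
    ultimately show ?thesis using R1 R2 R3 by linarith
  qed
  then have "\<bar>\<beta>/4 * (4 * R w x w x + 4 * R w x x x + R x x x x)\<bar> \<le> \<beta> * K4^4 * (N w + 1)\<^sup>2 * (N x)\<^sup>2"
    using mult_left_mono[of _ "4 * (K4^4 * (N w + 1)\<^sup>2 * (N x)\<^sup>2)" "\<beta>/4"] beta by (simp add: abs_mult mult.assoc)
  moreover have "E (w + x) - E w - A w w x = 1/2 * A w x x + \<beta>/4 * (4 * R w x w x + 4 * R w x x x + R x x x x)"
    by (simp add: E_expand)
  moreover have "0 \<le> CA (N w) * (N x)\<^sup>2" using CA_nonneg by simp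
  ultimately show ?thesis using A1 by (simp add: algebra_simps)
qed

text \<open>Linearisation at \<open>w\<close>. The differences \<open>v k - w\<close> are normalised
  in L^2 to \<open>e k\<close>; dividing the difference of the two eigenvalue equations by
  \<open>s k\<close> gives an almost linear equation for \<open>e k\<close>. Interpolation bounds
  \<open>e k\<close> in H^1, compactness gives a limit \<open>e0\<close> of L^2 norm 1, orthogonal
  to \<open>w\<close> and \<open>J w\<close>, on which the second variation vanishes, contradicting
  \<open>pos\<close>.\<close>

lemma isolated_critical_point:
  assumes w: "b w w = 1" and ELw: "\<And>x. A w w x = l * b w x"
    and pos: "\<And>g. b w g = 0 \<Longrightarrow> b (J w) g = 0 \<Longrightarrow> h g g \<noteq> 0 \<Longrightarrow>
        a g g + \<beta> * R w w g g + 2 * \<beta> * R w g w g > l * b g g"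
    and v: "\<And>k. b (v k) (v k) = 1" and ELv: "\<And>k x. A (v k) (v k) x = L k * b (v k) x"
    and cv: "conv v w" and ne: "\<And>k. b.nrm (v k - w) \<noteq> 0" and vJ: "\<And>k. b (v k) (J w) = 0"
    and half: "\<And>k. b (v k) w \<ge> 1/2"
  shows False
proof -
  define s where "s k = b.nrm (v k - w)" for k
  define e where "e k = (1 / s k) *\<^sub>R (v k - w)" for k
  define \<mu> where "\<mu> k = (L k - l) / s k" for k
  have s: "s k > 0" for k using ne[of k] b.nrm_nonneg[of "v k - w"] unfolding s_def by linarith
  have ve: "v k - w = s k *\<^sub>R e k" for k using s[of k] by (simp add: e_def)
  have be: "b (e k) (e k) = 1" for k
  proof -
    have "b (v k - w) (v k - w) = (s k)\<^sup>2" by (simp add: s_def b.nrm_sq)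
    then have "s k * (s k * b (e k) (e k)) = (s k)\<^sup>2" unfolding ve b.bilin .
    then show ?thesis using s[of k] by (simp add: power2_eq_square)
  qed
  have ne1: "b.nrm (e k) = 1" for k by (simp add: b.nrm_def be)
  have nw1: "b.nrm w = 1" by (simp add: b.nrm_def w)
  \<comment> \<open>Both functions are normalised, so their difference is orthogonal to
    \<open>w\<close> up to second order.\<close>
  have bwe: "b w (e k) = - s k / 2" for k
  proof -
    have "(s k)\<^sup>2 = 2 - 2 * b w (v k)" using v[of k] w by (simp add: s_def b.nrm_sq b.bilin b.commute[of "v k" w])
    moreover have "s k * b w (e k) = b w (v k) - 1"
      using w ve[of k] b.scale_right[of w "s k" "e k"] by (metis b.diff_right)
    ultimately have "s k * b w (e k) = s k * (- s k / 2)" by (simp add: power2_eq_square field_simps)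
    then show ?thesis using s[of k] mult_left_cancel[of "s k"] by (metis less_irrefl)
  qed
  have bJe: "b (J w) (e k) = 0" for k
    using vJ[of k] b_skew[of w w] b.commute[of "J w" w] b.commute[of "J w" "v k"] by (simp add: e_def b.bilin)
  have L: "L k = A (v k) (v k) (v k)" for k using ELv[of k "v k"] v by simp
  have l: "l = A w w w" using ELw[of w] w by simp
  have Llim: "L \<longlonglongrightarrow> l" unfolding L l by (rule tendsto_A[OF cv cv cv])
  \<comment> \<open>The exact difference of the eigenvalue equations of \<open>v k\<close> and
    \<open>w\<close>, divided by \<open>s k\<close>; the quotient \<open>\<mu> k\<close> of the
    multipliers is still uncontrolled.\<close>
  have lin: "A w (e k) x = L k * b (e k) x + \<mu> k * b w x - \<beta> * R (v k + w) (e k) (v k) x" for k x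
  proof -
    have "A w (v k) x = L k * b (v k) x - \<beta> * (R (v k) (v k) (v k) x - R w w (v k) x)"
      using ELv[of k x] by (simp add: A_def algebra_simps)
    then have "A w (v k - w) x = L k * b (v k - w) x + (L k - l) * b w x - \<beta> * R (v k + w) (v k - w) (v k) x"
      using ELw[of x] by (simp add: A.diff_left b.diff_left R_sq_diff R_comm[of "v k - w"] algebra_simps)
    then have "s k * A w (e k) x = L k * (s k * b (e k) x) + (L k - l) * b w x - \<beta> * (s k * R (v k + w) (e k) (v k) x)"
      unfolding ve by (simp only: A.scale_left b.scale_left R_scale2)
    moreover have "L k - l = s k * \<mu> k" using s[of k] by (simp add: \<mu>_def)
    ultimately have "s k * A w (e k) x = s k * (L k * b (e k) x + \<mu> k * b w x - \<beta> * R (v k + w) (e k) (v k) x)"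
      by (simp add: algebra_simps)
    then show ?thesis using s[of k] by simp
  qed
  obtain K0 where K0: "\<And>k. N (v k) \<le> K0"
    using conv_N[OF cv, THEN convergentI, THEN convergent_imp_Bseq] by (auto simp: Bseq_def)
  define K where "K = 1 + max K0 (N w)"
  have K1: "K \<ge> 1" using h.nrm_nonneg[of w] by (simp add: K_def add_increasing2 max.coboundedI2)
  have vK: "N (v k) \<le> K" for k using K0[of k] by (simp add: K_def)
  have wK: "N w \<le> K" by (simp add: K_def)
  have vwK: "N (v k + w) \<le> 2 * K" for k using h.triangle[of "v k" w] vK[of k] wK by linarith
  have n4bd: "n4 y \<le> K4 * K" if "N y \<le> K" for y using n4_le[of y] mult_left_mono[OF that, of K4] K4_pos by linarith
  have n4vw: "n4 (v k + w) \<le> K4 * (2 * K)" for k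
    using n4_le[of "v k + w"] mult_left_mono[OF vwK[of k], of K4] K4_pos by linarith
  have Rb: "\<bar>R (v k + w) (e k) (v k) x\<bar> \<le> (2 * K4^2 * K^2) * n4 (e k) * n4 x" for k x
  proof -
    have "\<bar>R (v k + w) (e k) (v k) x\<bar> \<le> n4 (v k + w) * n4 (e k) * n4 (v k) * n4 x" by (rule R_bound)
    also have "\<dots> \<le> (K4 * (2 * K)) * n4 (e k) * (K4 * K) * n4 x"
      using n4vw[of k] n4bd[OF vK[of k]] K1 K4_pos by (intro mult_mono) (simp_all add: n4_nonneg)
    finally show ?thesis by (simp add: power2_eq_square mult_ac)
  qed
  define G2 where "G2 = 2 * K4^2 * K^2"
  have G2: "G2 \<ge> 0" by (simp add: G2_def)
  define G3 where "G3 = 2 * \<beta> * G2 * (K4 * K)"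
  have G3: "G3 \<ge> 0" using beta G2 K4_pos K1 by (simp add: G3_def)
  \<comment> \<open>Testing with \<open>w\<close> itself isolates \<open>\<mu> k\<close>: the left
    side is the equation of \<open>w\<close>, and what remains is
    \<open>\<mu> k * b (v k) w\<close>, where the overlap is at least 1/2.\<close>
  have mu: "\<bar>\<mu> k\<bar> \<le> G3 * n4 (e k)" for k
  proof -
    have "A w (e k) w = l * b w (e k)" using ELw[of "e k"] by (simp add: A.commute[of w "e k" w])
    then have "\<mu> k * 1 = (l - L k) * b w (e k) + \<beta> * R (v k + w) (e k) (v k) w"
      using lin[of k w] w by (simp add: b.commute[of "e k" w] algebra_simps)
    moreover have "(l - L k) * b w (e k) = - \<mu> k * (s k * b w (e k))" using s[of k] by (simp add: \<mu>_def) (simp add: algebra_simps)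
    moreover have "s k * b w (e k) = b (v k) w - 1"
      using w ve[of k] b.scale_right[of w "s k" "e k"] b.diff_right[of w "v k" w] by (simp add: b.commute[of "v k" w])
    ultimately have "\<mu> k * b (v k) w = \<beta> * R (v k + w) (e k) (v k) w" by (simp add: algebra_simps)
    moreover have "\<bar>\<mu> k\<bar> * (1/2) \<le> \<bar>\<mu> k\<bar> * \<bar>b (v k) w\<bar>" using half[of k] by (intro mult_left_mono) auto
    moreover have "\<beta> * \<bar>R (v k + w) (e k) (v k) w\<bar> \<le> \<beta> * (G2 * n4 (e k) * (K4 * K))"
    proof (intro mult_left_mono beta)
      have "\<bar>R (v k + w) (e k) (v k) w\<bar> \<le> G2 * n4 (e k) * n4 w" using Rb[of k w] by (simp add: G2_def)
      also have "\<dots> \<le> G2 * n4 (e k) * (K4 * K)"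
        using n4bd[OF wK] G2 n4_nonneg by (intro mult_left_mono) auto
      finally show "\<bar>R (v k + w) (e k) (v k) w\<bar> \<le> G2 * n4 (e k) * (K4 * K)" .
    qed
    ultimately show ?thesis using beta by (simp add: G3_def abs_mult[symmetric]) (simp add: abs_mult mult_ac)
  qed
  obtain LB where LB: "\<And>k. \<bar>L k\<bar> \<le> LB"
    using Llim[THEN convergentI, THEN convergent_imp_Bseq] by (auto simp: Bseq_def)
  have LB0: "LB \<ge> 0" using LB[of 0] by linarith
  define G4 where "G4 = LB + G3 + \<beta> * G2"
  have G4: "G4 \<ge> 0" using LB0 G3 G2 beta by (simp add: G4_def)
  text \<open>The interpolation exponent 3/4 < 1 makes the normalised differences bounded in energy.\<close>
  have Fk: "\<bar>A w (e k) x\<bar> \<le> G4 * (1 + n4 (e k)) * (b.nrm x + n4 x)" for k x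
  proof -
    have "\<bar>L k * b (e k) x\<bar> \<le> LB * b.nrm x"
      using b.cauchy_schwarz[of "e k" x] LB[of k] ne1[of k] LB0 by (simp add: abs_mult mult_mono)
    moreover have "\<bar>\<mu> k * b w x\<bar> \<le> G3 * n4 (e k) * b.nrm x"
      using b.cauchy_schwarz[of w x] mu[of k] nw1 G3 n4_nonneg[of "e k"] unfolding abs_mult by (intro mult_mono) auto
    moreover have "\<bar>\<beta> * R (v k + w) (e k) (v k) x\<bar> \<le> \<beta> * (G2 * n4 (e k) * n4 x)"
      using Rb[of k x] beta by (simp add: abs_mult G2_def mult_left_mono)
    ultimately have "\<bar>A w (e k) x\<bar> \<le> LB * b.nrm x + G3 * n4 (e k) * b.nrm x + \<beta> * (G2 * n4 (e k) * n4 x)"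
      unfolding lin by linarith
    also have "\<dots> \<le> LB * ((1 + n4 (e k)) * (b.nrm x + n4 x)) + G3 * ((1 + n4 (e k)) * (b.nrm x + n4 x))
        + \<beta> * G2 * ((1 + n4 (e k)) * (b.nrm x + n4 x))"
    proof -
      have n: "0 \<le> n4 (e k)" "0 \<le> n4 x" "0 \<le> b.nrm x" by (simp_all add: n4_nonneg)
      then have "b.nrm x \<le> (1 + n4 (e k)) * (b.nrm x + n4 x)" "n4 (e k) * b.nrm x \<le> (1 + n4 (e k)) * (b.nrm x + n4 x)"
        "n4 (e k) * n4 x \<le> (1 + n4 (e k)) * (b.nrm x + n4 x)" by (simp_all add: algebra_simps)
      then show ?thesis using LB0 G3 beta G2 by (intro add_mono) (simp_all add: mult_left_mono mult.assoc)
    qed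
    finally show ?thesis by (simp add: G4_def algebra_simps)
  qed
  have "\<exists>B. \<forall>k. N (e k) \<le> B"
  proof -
    \<comment> \<open>Coercivity and \<open>Fk\<close> give c0 X^2 at most G4 (1 + Y)^2, and
      interpolation gives Y^4 at most |Cs| X^3, hence X^4 is bounded by a multiple of X^3. The
      constants are generous: 2 G5 is 64 G4^2 / c0^2, where 8 would suffice.\<close>
    define G5 where "G5 = 8 * (4 * G4^2 / c0^2)"
    define B where "B = 1 + 2 * G5 * (1 + \<bar>Cs\<bar>)"
    have G5: "G5 \<ge> 0" by (simp add: G5_def)
    have "N (e k) \<le> B" for k
    proof (rule ccontr)
      define X Y where "X = N (e k)" and "Y = n4 (e k)"
      assume "\<not> N (e k) \<le> B"
      then have XB: "X > B" by (simp add: X_def)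
      then have X1: "X > 1" using G5 by (smt (verit) B_def abs_ge_zero mult_nonneg_nonneg)
      have Y0: "Y \<ge> 0" by (simp add: Y_def n4_nonneg)
      have "Y^4 \<le> Cs * X^3" using n4_interp[of "e k"] by (simp add: ne1 X_def Y_def)
      also have "\<dots> \<le> \<bar>Cs\<bar> * X^3" using X1 by (intro mult_right_mono) auto
      finally have Y4: "Y^4 \<le> \<bar>Cs\<bar> * X^3" .
      have "c0 * X\<^sup>2 \<le> G4 * (1 + Y) * (1 + Y)"
        using A_coercive[of "e k" w] Fk[of k "e k"] by (simp add: ne1 X_def Y_def)
      then have "(c0 * X\<^sup>2)\<^sup>2 \<le> (G4 * (1 + Y) * (1 + Y))\<^sup>2"
        using c0 by (intro power_mono) auto
      also have "\<dots> = G4\<^sup>2 * (1 + Y)^4" by (simp add: power2_eq_square power4_eq_xxxx algebra_simps)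
      also have "\<dots> \<le> G4\<^sup>2 * (8 * (1 + Y^4))"
      proof (intro mult_left_mono)
        have "(1 + Y)\<^sup>2 \<le> 2 * (1 + Y\<^sup>2)" using sum_power2_ge_zero[of "1 - Y" 0] by (simp add: power2_eq_square algebra_simps)
        then have "((1 + Y)\<^sup>2)\<^sup>2 \<le> (2 * (1 + Y\<^sup>2))\<^sup>2" by (intro power_mono) auto
        also have "\<dots> \<le> 8 * (1 + Y^4)" using sum_power2_ge_zero[of "1 - Y\<^sup>2" 0]
          by (simp add: power2_eq_square power4_eq_xxxx algebra_simps)
        finally show "(1 + Y)^4 \<le> 8 * (1 + Y^4)" by (simp flip: power_mult)
      qed simp
      also have "\<dots> \<le> G4\<^sup>2 * (8 * (1 + \<bar>Cs\<bar> * X^3))" using Y4 by (intro mult_left_mono) auto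
      also have "\<dots> \<le> G4\<^sup>2 * (8 * ((1 + \<bar>Cs\<bar>) * X^3))"
        using one_le_power[of X 3] X1 by (intro mult_left_mono) (auto simp: algebra_simps)
      finally have "c0\<^sup>2 * (X * X^3) \<le> G4\<^sup>2 * (8 * (1 + \<bar>Cs\<bar>)) * X^3"
        by (simp add: power2_eq_square power3_eq_cube mult_ac)
      then have "(c0\<^sup>2 * X) * X^3 \<le> (G4\<^sup>2 * (8 * (1 + \<bar>Cs\<bar>))) * X^3" by (simp add: mult_ac)
      then have "c0\<^sup>2 * X \<le> G4\<^sup>2 * (8 * (1 + \<bar>Cs\<bar>))" using X1 by (simp add: mult_le_cancel_right)
      then have "X \<le> 8 * (G4\<^sup>2 / c0\<^sup>2) * (1 + \<bar>Cs\<bar>)" using c0 by (simp add: field_simps)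
      also have "\<dots> \<le> 2 * G5 * (1 + \<bar>Cs\<bar>)"
      proof (intro mult_right_mono)
        have "0 \<le> G4\<^sup>2 / c0\<^sup>2" by simp
        moreover have "2 * G5 = 64 * (G4\<^sup>2 / c0\<^sup>2)" by (simp add: G5_def)
        ultimately show "8 * (G4\<^sup>2 / c0\<^sup>2) \<le> 2 * G5" by linarith
      qed simp
      finally show False using XB by (simp add: B_def)
    qed
    then show ?thesis by blast
  qed
  then obtain B where B: "\<And>k. N (e k) \<le> B" by blast
  have B0: "B \<ge> 0" using B[of 0] h.nrm_nonneg[of "e 0"] by linarith
  have n4B: "n4 (e k) \<le> K4 * B" for k using n4_le[of "e k"] mult_left_mono[OF B[of k], of K4] K4_pos by linarith
  obtain r where r: "strict_mono (r::nat\<Rightarrow>nat)" "cauchyb (\<lambda>k. e (r k))"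
    using compact[of e B, OF B] unfolding cauchyb_def by blast
  \<comment> \<open>Two tested equations, each with an L^2 and an L^4 term, produce the factor 4;
    the added 1 makes the final inequality strict.\<close>
  define G6 where "G6 = 1 + 4 * (G4 * (1 + K4 * B))"
  have G6: "G6 > 0" using G4 K4_pos B0 by (simp add: G6_def add_pos_nonneg)
  have "cauchyN (\<lambda>k. e (r k))"
    unfolding cauchyN_def
  proof (intro allI impI)
    fix \<epsilon> :: real assume \<epsilon>: "\<epsilon> > 0"
    obtain M where M: "\<And>m n. m \<ge> M \<Longrightarrow> n \<ge> M \<Longrightarrow>
        n4 (e (r m) - e (r n)) < c0 * \<epsilon>\<^sup>2 / G6 \<and> b.nrm (e (r m) - e (r n)) < c0 * \<epsilon>\<^sup>2 / G6"
      using cauchyb_n4[OF r(2), of B "c0 * \<epsilon>\<^sup>2 / G6"] B \<epsilon> c0 G6 by auto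
    show "\<exists>M. \<forall>m\<ge>M. \<forall>n\<ge>M. N (e (r m) - e (r n)) < \<epsilon>"
    proof (intro exI allI impI)
      fix m n assume mn: "M \<le> m" "M \<le> n"
      let ?x = "e (r m) - e (r n)"
      have Fb: "\<bar>A w (e k) ?x\<bar> \<le> G4 * (1 + K4 * B) * (b.nrm ?x + n4 ?x)" for k
        by (rule order_trans[OF Fk]) (use G4 n4B[of k] n4_nonneg in \<open>intro mult_left_mono mult_right_mono; simp\<close>)
      have "c0 * (N ?x)\<^sup>2 \<le> A w ?x ?x" by (rule A_coercive)
      also have "\<dots> = A w (e (r m)) ?x - A w (e (r n)) ?x" by (rule A.diff_left)
      also have "\<dots> \<le> 2 * (G4 * (1 + K4 * B) * (b.nrm ?x + n4 ?x))" using Fb[of "r m"] Fb[of "r n"] by linarith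
      also have "\<dots> \<le> 2 * (G4 * (1 + K4 * B) * (2 * (c0 * \<epsilon>\<^sup>2 / G6)))"
        using M[OF mn] G4 K4_pos B0 by (intro mult_left_mono) auto
      also have "\<dots> = 4 * (G4 * (1 + K4 * B)) * (c0 * \<epsilon>\<^sup>2 / G6)" by simp
      also have "\<dots> < G6 * (c0 * \<epsilon>\<^sup>2 / G6)" using c0 \<epsilon> G6 by (intro mult_strict_right_mono) (auto simp: G6_def)
      also have "\<dots> = c0 * \<epsilon>\<^sup>2" using G6 by simp
      finally have "(N ?x)\<^sup>2 < \<epsilon>\<^sup>2" using c0 by simp
      then show "N ?x < \<epsilon>" using \<epsilon> by (simp add: power2_less_imp_less)
    qed
  qed
  then obtain e0 where e0: "conv (\<lambda>k. e (r k)) e0" using cauchyN_conv by blast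
  have "(\<lambda>k. b (e (r k)) (e (r k))) \<longlonglongrightarrow> b e0 e0" by (rule tendsto_b[OF e0 e0])
  then have be0: "b e0 e0 = 1" using be LIMSEQ_unique[of "\<lambda>_. 1"] by auto
  have s0: "(\<lambda>k. s (r k)) \<longlonglongrightarrow> 0"
  proof -
    have "(\<lambda>k. N (v (r k) - w)) \<longlonglongrightarrow> 0" using conv_subseq[OF cv r(1)] by (simp add: conv_def)
    then show ?thesis by (rule tendsto_dist_bound[rotated]) (simp add: s_def b_le_N)
  qed
  have we: "(\<lambda>k. b w (e (r k))) \<longlonglongrightarrow> 0" unfolding bwe using tendsto_divide[OF tendsto_minus[OF s0] tendsto_const[of 2]] by simp
  have "b w e0 = 0" using LIMSEQ_unique[OF tendsto_b[OF conv_const e0] we] by simp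
  moreover have "b (J w) e0 = 0"
    using tendsto_b[OF conv_const e0, of "J w"] bJe LIMSEQ_unique[of "\<lambda>_. 0"] by auto
  moreover have "h e0 e0 \<noteq> 0" using b_le_h[of e0] be0 by auto
  ultimately have "a e0 e0 + \<beta> * R w w e0 e0 + 2 * \<beta> * R w e0 w e0 > l" using pos[of e0] be0 by simp
  \<comment> \<open>Limit of the linearised equation tested with \<open>e k\<close> itself. The
    multiplier term drops out because \<open>\<mu> k\<close> is bounded while
    \<open>b w (e k)\<close> is of order \<open>s k\<close>.\<close>
  moreover have "A w e0 e0 = l * 1 + 0 - \<beta> * R (w + w) e0 w e0"
  proof (rule LIMSEQ_unique[OF tendsto_A[OF conv_const e0 e0]])
    have mu0: "(\<lambda>k. \<mu> (r k) * b w (e (r k))) \<longlonglongrightarrow> 0"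
    proof (rule tendsto_dist_bound)
      show "\<bar>\<mu> (r k) * b w (e (r k)) - 0\<bar> \<le> G3 * (K4 * B) * \<bar>b w (e (r k))\<bar>" for k
      proof -
        have "\<bar>\<mu> (r k)\<bar> \<le> G3 * (K4 * B)" using mu[of "r k"] mult_left_mono[OF n4B[of "r k"] G3] by linarith
        then show ?thesis by (simp add: abs_mult mult_right_mono)
      qed
      show "(\<lambda>k. G3 * (K4 * B) * \<bar>b w (e (r k))\<bar>) \<longlonglongrightarrow> 0"
        using tendsto_mult[OF tendsto_const[of "G3 * (K4 * B)"] tendsto_rabs[OF we]] by simp
    qed
    have cvr: "conv (\<lambda>k. v (r k)) w" by (rule conv_subseq[OF cv r(1)])
    have Lr: "(\<lambda>k. L (r k)) \<longlonglongrightarrow> l" using LIMSEQ_subseq_LIMSEQ[OF Llim r(1)] by (simp add: o_def)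
    show "(\<lambda>k. A w (e (r k)) (e (r k))) \<longlonglongrightarrow> l * 1 + 0 - \<beta> * R (w + w) e0 w e0"
      unfolding lin be
      by (intro tendsto_diff tendsto_add tendsto_mult tendsto_const mu0 Lr tendsto_R conv_add conv_const cvr e0)
  qed
  ultimately show False by (simp add: A_def R_lin)
qed


section \<open>Phase rotations, minimisers and their orbits\<close>

lemma b_w_Jw: "b w (J w) = 0"
  using b_skew[of w w] b.commute[of "J w" w] by simp

text \<open>\<open>J\<close> is an isometry and skew for every form, so mixed terms in
  \<open>v\<close> and \<open>J v\<close> cancel; in particular the density of \<open>v\<close> is
  unchanged.\<close>

lemma rotation_invariance:
  assumes "c\<^sup>2 + s\<^sup>2 = 1" and "v' = c *\<^sub>R v + s *\<^sub>R J v"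
  shows "b v' v' = b v v" "E v' = E v"
proof -
  have cs: "c * c + s * s = 1" using assms(1) by (simp add: power2_eq_square)
  have f: "c * (c * x) + s * (s * x) = x" for x :: real
    using cs by (metis distrib_right mult.assoc mult_1)
  have "a v (J v) = 0" using a_skew[of v v] a.commute[of "J v" v] by simp
  then have av: "a v' v' = a v v" using f[of "a v v"]
    by (simp add: assms(2) a.bilin a_J a.commute[of "J v" v])
  show "b v' v' = b v v" using f[of "b v v"] b_w_Jw[of v]
    by (simp add: assms(2) b.bilin b_J b.commute[of "J v" v])
  have Rx: "R v' v' x y = R v v x y" for x y
  proof -
    have "R v (J v) x y = 0" using R_skew[of v v x y] R_comm[of "J v" v x y] by simp
    then show ?thesis using f[of "R v v x y"] by (simp add: assms(2) R_lin R_J R_comm[of "J v" v])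
  qed
  have "R v' v' v' v' = R v v v v" using Rx R_swap by metis
  then show "E v' = E v" by (simp add: E_def av)
qed

text \<open>No multiplier calculus is involved: from a point with nonzero residual one gradient step
  would lower the energy. A vanishing residual says that \<open>w\<close> is a multiple of its
  inverse up to null functions, which is the eigenvalue equation.\<close>

lemma minimizer_EL:
  assumes w: "b w w = 1" and min: "\<And>v. b v v = 1 \<Longrightarrow> E w \<le> E v"
  shows "A w w x = A w w w * b w x" "\<And>q. (\<And>x. A w q x = b w x) \<Longrightarrow> N (resid w q) = 0"
proof -
  show res: "N (resid w q) = 0" if q: "\<And>x. A w q x = b w x" for q
  proof -
    obtain T where T: "T > 0" "b (ustep T w q) (ustep T w q) = 1"
      "E w - E (ustep T w q) \<ge> T / 2 * c0 * (N (resid w q))\<^sup>2 + 1/2 * (N (ustep T w q - w))\<^sup>2"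
      using uniform_decrease[of "E w"] w q by blast
    have "T / 2 * c0 * (N (resid w q))\<^sup>2 + 1/2 * (N (ustep T w q - w))\<^sup>2 \<le> 0"
      using T(3) min[OF T(2)] by linarith
    moreover have "0 \<le> 1/2 * (N (ustep T w q - w))\<^sup>2" by simp
    ultimately have "T / 2 * c0 * (N (resid w q))\<^sup>2 \<le> 0" by linarith
    then show ?thesis using T(1) c0 by (simp add: mult_le_0_iff)
  qed
  obtain q where q: "\<And>x. A w q x = b w x" using exists_inverse by blast
  define g where "g = inverse (b w q)"
  have EL: "A w w x = g * b w x" for x
  proof -
    have "A w (resid w q) (resid w q) \<le> 0"
      using A_bound[of w "N w" "resid w q" "resid w q"] res[OF q] by simp
    then have "A.nrm w (resid w q) = 0" using A.nonneg[of w "resid w q"] by (simp add: A.nrm_def)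
    then have "A w (resid w q) x = 0" by (rule A.nrm_null_left)
    then show ?thesis by (simp add: resid_def A.bilin q g_def)
  qed
  then show "A w w x = A w w w * b w x" using EL[of w] w by simp
qed

text \<open>The modulus of the complex L^2 product of \<open>v\<close> and \<open>w\<close>: the
  second entry is its imaginary part. It does not see the phase of \<open>v\<close>.\<close>

definition ovl :: "'v \<Rightarrow> 'v \<Rightarrow> real" where "ovl w v = sqrt ((b v w)\<^sup>2 + (b v (J w))\<^sup>2)"

text \<open>Pythagoras for the orthonormal pair \<open>w\<close>, \<open>J w\<close>: the overlap of
  normalised functions is 1 exactly when \<open>v\<close> is, up to a null function, a phase
  rotation of \<open>w\<close>.\<close>

lemma ovl_defect:
  assumes "b w w = 1" "b v v = 1"
  shows "(b.nrm (v - (b v w *\<^sub>R w + b v (J w) *\<^sub>R J w)))\<^sup>2 = 1 - (ovl w v)\<^sup>2"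
proof -
  have "(ovl w v)\<^sup>2 = b v w * b v w + b v (J w) * b v (J w)" by (simp add: ovl_def power2_eq_square)
  then show ?thesis
    using assms b_w_Jw[of w] unfolding b.nrm_sq
    by (simp add: b.bilin b_J b.commute[of w v] b.commute[of "J w" v] b.commute[of "J w" w] algebra_simps)
qed

lemma ovl_le_1:
  assumes "b w w = 1" "b v v = 1" shows "ovl w v \<le> 1"
proof -
  have "(ovl w v)\<^sup>2 \<le> 1"
    using ovl_defect[OF assms] zero_le_power2[of "b.nrm (v - (b v w *\<^sub>R w + b v (J w) *\<^sub>R J w))"] by linarith
  then show ?thesis by (simp add: abs_square_le_1)
qed

lemma ovl_lipschitz:
  assumes "b w w = 1" shows "\<bar>ovl w v - ovl w v'\<bar> \<le> 2 * b.nrm (v - v')"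
proof -
  have n: "b.nrm w = 1" "b.nrm (J w) = 1" using assms by (simp_all add: b.nrm_def b_J)
  have ov: "ovl w x = cmod (Complex (b x w) (b x (J w)))" for x by (simp add: ovl_def cmod_def)
  have "\<bar>ovl w v - ovl w v'\<bar> \<le> cmod (Complex (b v w) (b v (J w)) - Complex (b v' w) (b v' (J w)))"
    unfolding ov by (rule norm_triangle_ineq3)
  also have "\<dots> \<le> \<bar>b (v - v') w\<bar> + \<bar>b (v - v') (J w)\<bar>"
    using cmod_le[of "Complex (b v w) (b v (J w)) - Complex (b v' w) (b v' (J w))"] by (simp add: b.diff_left)
  also have "\<dots> \<le> 2 * b.nrm (v - v')"
    using b.cauchy_schwarz[of "v - v'" w] b.cauchy_schwarz[of "v - v'" "J w"] n by simp
  finally show ?thesis .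
qed

text \<open>Functions of the same energy with overlaps tending to 1 are minimisers, hence critical
  points. After rotating each to a real positive overlap with \<open>w\<close>, a subsequence
  converges to \<open>w\<close> without reaching it, which \<open>isolated_critical_point\<close>
  forbids.\<close>

lemma minimizer_isolated:
  assumes w: "b w w = 1" and min: "\<And>v. b v v = 1 \<Longrightarrow> E w \<le> E v"
    and pos: "\<And>g. b w g = 0 \<Longrightarrow> b (J w) g = 0 \<Longrightarrow> h g g \<noteq> 0 \<Longrightarrow>
        a g g + \<beta> * R w w g g + 2 * \<beta> * R w g w g > A w w w * b g g"
  shows "\<exists>\<delta>>0. \<forall>v. b v v = 1 \<longrightarrow> E v = E w \<longrightarrow> \<not> (1 - \<delta> < ovl w v \<and> ovl w v < 1)"
proof (rule ccontr)
  assume "\<not> ?thesis"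
  then have "\<forall>\<delta>>0. \<exists>v. b v v = 1 \<and> E v = E w \<and> 1 - \<delta> < ovl w v \<and> ovl w v < 1" by blast
  \<comment> \<open>Starting at 1/2 keeps every overlap at least 1/2, so that it can be divided by
    and serves as the lower bound required later.\<close>
  then have "\<exists>v. b v v = 1 \<and> E v = E w \<and> 1 - 1 / real (Suc (Suc k)) < ovl w v \<and> ovl w v < 1" for k
    by (metis of_nat_0_less_iff zero_less_Suc zero_less_divide_1_iff)
  then obtain x where x: "\<And>k. b (x k) (x k) = 1" "\<And>k. E (x k) = E w"
      "\<And>k. 1 - 1 / real (Suc (Suc k)) < ovl w (x k)" "\<And>k. ovl w (x k) < 1" by metis
  define m where "m k = ovl w (x k)" for k
  have m: "1/2 \<le> m k" "m k < 1" for k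
  proof -
    have "1 / real (Suc (Suc k)) \<le> 1/2" by (simp add: field_simps)
    then have "1 - 1/2 \<le> 1 - 1 / real (Suc (Suc k))" by (rule diff_left_mono)
    also note x(3)[of k, folded m_def]
    finally show "1/2 \<le> m k" by simp
    show "m k < 1" using x(4) by (simp add: m_def)
  qed
  \<comment> \<open>Multiplication of \<open>x k\<close> by the conjugate phase of its overlap with
    \<open>w\<close>: the new overlap is the real number \<open>m k\<close>, and the component along
    \<open>J w\<close> vanishes.\<close>
  define v where "v k = (b (x k) w / m k) *\<^sub>R x k + (- b (x k) (J w) / m k) *\<^sub>R J (x k)" for k
  have m2: "(m k)\<^sup>2 = (b (x k) w)\<^sup>2 + (b (x k) (J w))\<^sup>2" for k by (simp add: m_def ovl_def)
  have "(b (x k) w / m k)\<^sup>2 + (- b (x k) (J w) / m k)\<^sup>2 = 1" for k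
  proof -
    have "(m k)\<^sup>2 \<noteq> 0" using m(1)[of k] by simp
    then show ?thesis using m2[of k] by (simp add: power_divide flip: add_divide_distrib)
  qed
  from rotation_invariance[OF this v_def] x(1,2)
  have v1: "b (v k) (v k) = 1" and vE: "E (v k) = E w" for k by auto
  have vw: "b (v k) w = m k" for k
    using m2[of k] m(1)[of k] by (simp add: v_def b.bilin b_skew[of "x k" w] power2_eq_square field_simps)
  have vJ: "b (v k) (J w) = 0" for k by (simp add: v_def b.bilin b_J)
  have vmin: "E (v k) \<le> E y" if "b y y = 1" for y k using min[OF that] vE by simp
  have "\<forall>k. \<exists>q. \<forall>y. A (v k) q y = b (v k) y" using exists_inverse by blast
  then obtain q where q: "\<And>k y. A (v k) (q k) y = b (v k) y" by metis
  have "(\<lambda>k. N (resid (v k) (q k))) \<longlonglongrightarrow> 0" using minimizer_EL(2)[OF v1 vmin q] by simp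
  from conv_of_resid[OF v1 q eq_refl[OF vE] this] obtain r w' where
    r: "strict_mono (r::nat\<Rightarrow>nat)" "conv (\<lambda>j. v (r j)) w'" by blast
  have sn: "(b.nrm (v k - w))\<^sup>2 = 2 - 2 * m k" for k
    using v1[of k] w vw[of k] by (simp add: b.nrm_sq b.bilin b.commute[of w "v k"])
  have mlim: "m \<longlonglongrightarrow> 1"
  proof (rule tendsto_dist_bound)
    show "\<bar>m k - 1\<bar> \<le> 1 / real (Suc k)" for k
    proof -
      have "1 / real (Suc (Suc k)) \<le> 1 / real (Suc k)" by (simp add: frac_le)
      from diff_left_mono[OF this, of 1] have "1 - 1 / real (Suc k) < m k" using x(3)[of k, folded m_def] by (rule order.strict_trans1)
      then show ?thesis using m(2)[of k] by (simp add: abs_if)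
    qed
    show "(\<lambda>k. 1 / real (Suc k)) \<longlonglongrightarrow> 0" using LIMSEQ_inverse_real_of_nat by (simp add: inverse_eq_divide)
  qed
  \<comment> \<open>The squared L^2 distance of \<open>v k\<close> to \<open>w\<close> is
    \<open>2 - 2 * m k\<close>, which tends to 0, so the H^1 limit agrees with \<open>w\<close> up
    to a null function.\<close>
  have "N (w' - w) = 0"
  proof -
    have "(\<lambda>j. b (v (r j) - w) (v (r j) - w)) \<longlonglongrightarrow> b (w' - w) (w' - w)"
      by (intro tendsto_b conv_diff r conv_const)
    moreover have "(\<lambda>j. b (v (r j) - w) (v (r j) - w)) \<longlonglongrightarrow> 2 - 2 * 1"
      unfolding b.nrm_sq[symmetric] sn
      by (intro tendsto_intros) (use LIMSEQ_subseq_LIMSEQ[OF mlim r(1)] in \<open>simp add: o_def\<close>)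
    ultimately have "b (w' - w) (w' - w) = 0" using LIMSEQ_unique by fastforce
    then show ?thesis using b_null[of "w' - w"] by (simp add: h.nrm_def)
  qed
  then have cv: "conv (\<lambda>j. v (r j)) w" using conv_null[OF r(2)] by blast
  show False
  proof (rule isolated_critical_point[OF w minimizer_EL(1)[OF w min] pos v1 minimizer_EL(1)[OF v1 vmin] cv])
    show "b.nrm (v (r k) - w) \<noteq> 0" for k using sn[of "r k"] m(2)[of "r k"] by auto
    show "1/2 \<le> b (v (r k)) w" for k using m(1) by (simp add: vw)
  qed (simp_all add: vJ)
qed

text \<open>A discrete connectedness argument. The overlap is Lipschitz and the steps tend to 0, so
  leaving the orbit infinitely often forces infinitely many iterates into a band of overlaps
  strictly between 1 - \<delta> and 1. A limit point in that band has the energy of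
  \<open>w\<close>, contrary to isolation. Hence every limit point has overlap 1 and lies on the
  orbit.\<close>

lemma orbit_convergence:
  assumes u: "\<And>n. b (u n) (u n) = 1" and q: "\<And>n x. A (u n) (q n) x = b (u n) x"
    and Eu: "\<And>n. E (u n) \<le> E0" and res: "(\<lambda>n. N (resid (u n) (q n))) \<longlonglongrightarrow> 0"
    and inc: "(\<lambda>n. N (u (Suc n) - u n)) \<longlonglongrightarrow> 0" and Ec: "convergent (\<lambda>n. E (u n))"
    and \<rho>: "strict_mono (\<rho>::nat\<Rightarrow>nat)" "conv (\<lambda>j. u (\<rho> j)) w"
    and w: "b w w = 1" and min: "\<And>v. b v v = 1 \<Longrightarrow> E w \<le> E v"
    and pos: "\<And>g. b w g = 0 \<Longrightarrow> b (J w) g = 0 \<Longrightarrow> h g g \<noteq> 0 \<Longrightarrow>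
        a g g + \<beta> * R w w g g + 2 * \<beta> * R w g w g > A w w w * b g g"
    and s: "strict_mono (s::nat\<Rightarrow>nat)"
  shows "\<exists>r c d. strict_mono (r::nat\<Rightarrow>nat) \<and> c\<^sup>2 + d\<^sup>2 = 1 \<and> conv (\<lambda>j. u (s (r j))) (c *\<^sub>R w + d *\<^sub>R J w)"
proof -
  obtain \<delta> where \<delta>: "\<delta> > 0" "\<And>v. b v v = 1 \<Longrightarrow> E v = E w \<Longrightarrow> \<not> (1 - \<delta> < ovl w v \<and> ovl w v < 1)"
    using minimizer_isolated[OF w min pos] by blast
  obtain L where L: "(\<lambda>n. E (u n)) \<longlonglongrightarrow> L" using Ec by (auto simp: convergent_def)
  have Lsub: "(\<lambda>n. E (u (t n))) \<longlonglongrightarrow> L" if "strict_mono t" for t :: "nat \<Rightarrow> nat"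
    using LIMSEQ_subseq_LIMSEQ[OF L that] by (simp add: o_def)
  have Lw: "L = E w" using LIMSEQ_unique[OF Lsub[OF \<rho>(1)] tendsto_E[OF \<rho>(2)]] .
  have ovl_conv: "(\<lambda>n. ovl w (y n)) \<longlonglongrightarrow> ovl w l" if "conv y l" for y l
  proof (rule tendsto_dist_bound)
    show "\<bar>ovl w (y n) - ovl w l\<bar> \<le> 2 * N (y n - l)" for n
      using ovl_lipschitz[OF w, of "y n" l] b_le_N[of "y n - l"] by linarith
    show "(\<lambda>n. 2 * N (y n - l)) \<longlonglongrightarrow> 0" using tendsto_mult[OF tendsto_const[of 2] that[unfolded conv_def]] by simp
  qed
  have sub: "\<exists>r w'. strict_mono (r::nat\<Rightarrow>nat) \<and> b w' w' = 1 \<and> E w' = E w \<and> conv (\<lambda>j. u (t (r j))) w'"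
    if t: "strict_mono t" for t :: "nat \<Rightarrow> nat"
  proof -
    have "(\<lambda>n. N (resid (u (t n)) (q (t n)))) \<longlonglongrightarrow> 0" using LIMSEQ_subseq_LIMSEQ[OF res t] by (simp add: o_def)
    from conv_of_resid[OF u q Eu this] obtain r w' where
      r: "strict_mono (r::nat\<Rightarrow>nat)" "b w' w' = 1" "conv (\<lambda>j. u (t (r j))) w'" by blast
    have "E w' = L" using LIMSEQ_unique[OF tendsto_E[OF r(3)] Lsub[OF strict_mono_o[OF t r(1), unfolded o_def]]] .
    then show ?thesis using r Lw by blast
  qed
  have ovl1: "(\<lambda>n. ovl w (u n)) \<longlonglongrightarrow> 1"
  proof (rule ccontr)
    assume "\<not> ?thesis"
    then obtain e where e: "e > 0" "\<And>M. \<exists>n\<ge>M. \<bar>ovl w (u n) - 1\<bar> \<ge> e"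
      unfolding LIMSEQ_iff by (auto simp: not_less)
    \<comment> \<open>Below \<delta>, so that the band from 1 - \<epsilon> to 1 - \<epsilon>/2 lies
      in the forbidden range; below \<open>e\<close>, so that the overlap falls under the band
      infinitely often.\<close>
    define \<epsilon> where "\<epsilon> = min e (\<delta>/2)"
    have \<epsilon>: "0 < \<epsilon>" "\<epsilon> < \<delta>" "\<epsilon> \<le> e" using e \<delta> by (auto simp: \<epsilon>_def)
    have low: "\<exists>n\<ge>M. ovl w (u n) \<le> 1 - \<epsilon>" for M
    proof -
      obtain n where "n \<ge> M" "\<bar>ovl w (u n) - 1\<bar> \<ge> e" using e(2) by blast
      then show ?thesis using ovl_le_1[OF w u[of n]] \<epsilon> by (intro exI[of _ n]) auto
    qed
    have "ovl w w = 1" using w b_w_Jw[of w] by (simp add: ovl_def)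
    then have "(\<lambda>j. ovl w (u (\<rho> j))) \<longlonglongrightarrow> 1" using ovl_conv[OF \<rho>(2)] by simp
    then obtain J0 where J0: "\<And>j. j \<ge> J0 \<Longrightarrow> \<bar>ovl w (u (\<rho> j)) - 1\<bar> < \<epsilon>/2"
      using \<epsilon> unfolding LIMSEQ_iff by (metis half_gt_zero real_norm_def)
    obtain M0 where M0: "\<And>n. n \<ge> M0 \<Longrightarrow> N (u (Suc n) - u n) < \<epsilon>/4"
      using inc \<epsilon> unfolding LIMSEQ_iff by (metis abs_of_nonneg diff_zero h.nrm_nonneg real_norm_def zero_less_divide_iff zero_less_numeral)
    have "\<exists>n\<ge>M. 1 - \<epsilon> \<le> ovl w (u n) \<and> ovl w (u n) \<le> 1 - \<epsilon>/2" for M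
    proof -
      define j where "j = max J0 (max M M0)"
      define n1 where "n1 = \<rho> j"
      have n1: "n1 \<ge> M" "n1 \<ge> M0" using seq_suble[OF \<rho>(1), of j] by (auto simp: n1_def j_def)
      have o1: "ovl w (u n1) > 1 - \<epsilon>/2" using J0[of j, folded n1_def] unfolding j_def abs_less_iff by linarith
      obtain n2 where n2: "n2 \<ge> n1" "ovl w (u n2) \<le> 1 - \<epsilon>" using low by blast
      \<comment> \<open>First index after \<open>n1\<close> with overlap at most 1 - \<epsilon>/2.
        Its predecessor lies above, and one step changes the overlap by at most 2 * \<epsilon>/4, so
        the band cannot be jumped over.\<close>
      define n where "n = (LEAST n. n \<ge> n1 \<and> ovl w (u n) \<le> 1 - \<epsilon>/2)"
      have ex: "n2 \<ge> n1 \<and> ovl w (u n2) \<le> 1 - \<epsilon>/2" using n2 \<epsilon> by auto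
      have n: "n \<ge> n1" "ovl w (u n) \<le> 1 - \<epsilon>/2"
        using LeastI[of "\<lambda>n. n \<ge> n1 \<and> ovl w (u n) \<le> 1 - \<epsilon>/2", OF ex] by (auto simp: n_def)
      have "n \<noteq> n1" using n(2) o1 by auto
      with n(1) obtain k where k: "n = Suc k" "k \<ge> n1" by (cases n) auto
      have "\<not> (k \<ge> n1 \<and> ovl w (u k) \<le> 1 - \<epsilon>/2)" by (rule not_less_Least) (use k in \<open>simp flip: n_def\<close>)
      then have "ovl w (u k) > 1 - \<epsilon>/2" using k by simp
      moreover have "\<bar>ovl w (u (Suc k)) - ovl w (u k)\<bar> \<le> 2 * (\<epsilon>/4)"
        using ovl_lipschitz[OF w, of "u (Suc k)" "u k"] b_le_N[of "u (Suc k) - u k"] M0[of k] k n1 by linarith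
      ultimately have "1 - \<epsilon> \<le> ovl w (u n)" unfolding k(1) by linarith
      then show ?thesis using n n1 by (intro exI[of _ n]) auto
    qed
    then obtain t where t: "strict_mono (t::nat\<Rightarrow>nat)"
        "\<And>j. 1 - \<epsilon> \<le> ovl w (u (t j)) \<and> ovl w (u (t j)) \<le> 1 - \<epsilon>/2"
      using frequently_subseq[of "\<lambda>n. 1 - \<epsilon> \<le> ovl w (u n) \<and> ovl w (u n) \<le> 1 - \<epsilon>/2"] by blast
    obtain r w' where r: "strict_mono (r::nat\<Rightarrow>nat)" "b w' w' = 1" "E w' = E w" "conv (\<lambda>j. u (t (r j))) w'"
      using sub[OF t(1)] by blast
    have "1 - \<epsilon> \<le> ovl w w'" "ovl w w' \<le> 1 - \<epsilon>/2"
      using LIMSEQ_le_const[OF ovl_conv[OF r(4)]] LIMSEQ_le_const2[OF ovl_conv[OF r(4)]] t(2) by blast+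
    then show False using \<delta>(2)[OF r(2,3)] \<epsilon> by auto
  qed
  obtain r w' where r: "strict_mono (r::nat\<Rightarrow>nat)" "b w' w' = 1" "conv (\<lambda>j. u (s (r j))) w'"
    using sub[OF s] by blast
  have "(\<lambda>j. ovl w (u (s (r j)))) \<longlonglongrightarrow> 1"
    using LIMSEQ_subseq_LIMSEQ[OF ovl1 strict_mono_o[OF s r(1)]] by (simp add: o_def)
  then have o1: "ovl w w' = 1" using LIMSEQ_unique[OF ovl_conv[OF r(3)]] by blast
  \<comment> \<open>Overlap 1 leaves no component of \<open>w'\<close> orthogonal to the orbit
    plane; \<open>b_null\<close> lifts this from L^2 to H^1.\<close>
  have "b.nrm (w' - (b w' w *\<^sub>R w + b w' (J w) *\<^sub>R J w)) = 0" using ovl_defect[OF w r(2)] o1 by simp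
  then have "N (w' - (b w' w *\<^sub>R w + b w' (J w) *\<^sub>R J w)) = 0"
    using b_null b.nrm_sq by (metis h.nrm_def power_zero_numeral real_sqrt_zero)
  then have "conv (\<lambda>j. u (s (r j))) (b w' w *\<^sub>R w + b w' (J w) *\<^sub>R J w)" by (rule conv_null[OF r(3)])
  moreover have "(b w' w)\<^sup>2 + (b w' (J w))\<^sup>2 = 1" using o1 by (simp add: ovl_def)
  ultimately show ?thesis using r(1) by blast
qed

section \<open>The abstract iteration: monotone energy, vanishing residuals and steps\<close>

lemma iteration_basic:
  assumes T: "\<And>u q \<tau>. b u u = 1 \<Longrightarrow> (\<And>x. A u q x = b u x) \<Longrightarrow> E u \<le> E0 \<Longrightarrow> 0 < \<tau> \<Longrightarrow> \<tau> \<le> T \<Longrightarrow>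
     b (ustep \<tau> u q) (ustep \<tau> u q) = 1 \<and>
     E u - E (ustep \<tau> u q) \<ge> \<tau> / 2 * c0 * (N (resid u q))\<^sup>2 + 1/2 * (N (ustep \<tau> u q - u))\<^sup>2"
    and u0: "b (u 0) (u 0) = 1" "E (u 0) \<le> E0" and q: "\<And>n x. A (u n) (q n) x = b (u n) x"
    and \<tau>: "\<tau>min > 0" "\<And>n. \<tau>min \<le> \<tau> n \<and> \<tau> n \<le> T"
    and step: "\<And>n. u (Suc n) = ustep (\<tau> n) (u n) (q n)"
  shows "\<And>n. b (u n) (u n) = 1" "\<And>n. E (u n) \<le> E0"
    "\<And>n. E (u n) - E (u (Suc n)) \<ge> 1/2 * (N (u (Suc n) - u n))\<^sup>2"
    "convergent (\<lambda>n. E (u n))" "(\<lambda>n. N (resid (u n) (q n))) \<longlonglongrightarrow> 0" "(\<lambda>n. N (u (Suc n) - u n)) \<longlonglongrightarrow> 0"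
proof -
  have tp: "0 < \<tau> n" "\<tau> n \<le> T" for n using \<tau>(1) \<tau>(2)[of n] by linarith+
  \<comment> \<open>Normalisation and the energy bound are proved together, since the next step
    needs both.\<close>
  have both: "b (u n) (u n) = 1 \<and> E (u n) \<le> E0" for n
  proof (induction n)
    case (Suc n)
    have *: "b (u (Suc n)) (u (Suc n)) = 1"
        "E (u n) - E (u (Suc n)) \<ge> \<tau> n / 2 * c0 * (N (resid (u n) (q n)))\<^sup>2 + 1/2 * (N (u (Suc n) - u n))\<^sup>2"
      using T[of "u n" "q n" "\<tau> n"] Suc q tp[of n] by (auto simp: step)
    have "0 \<le> \<tau> n / 2 * c0 * (N (resid (u n) (q n)))\<^sup>2 + 1/2 * (N (u (Suc n) - u n))\<^sup>2"
      using tp[of n] c0 by (simp add: add_nonneg_nonneg)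
    then show ?case using * Suc by linarith
  qed (use u0 in simp)
  then show bu: "\<And>n. b (u n) (u n) = 1" and Eu: "\<And>n. E (u n) \<le> E0" by auto
  have dec: "E (u n) - E (u (Suc n)) \<ge> \<tau> n / 2 * c0 * (N (resid (u n) (q n)))\<^sup>2 + 1/2 * (N (u (Suc n) - u n))\<^sup>2" for n
    using T[of "u n" "q n" "\<tau> n", OF bu q Eu tp] by (simp add: step)
  have p1: "0 \<le> \<tau> n / 2 * c0 * (N (resid (u n) (q n)))\<^sup>2" for n using tp[of n] c0 by simp
  show d2: "E (u n) - E (u (Suc n)) \<ge> 1/2 * (N (u (Suc n) - u n))\<^sup>2" for n using dec[of n] p1[of n] by linarith
  \<comment> \<open>Here the positive lower bound on the step sizes enters: without it the energy
    drop would not control the residual uniformly.\<close>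
  have d1: "E (u n) - E (u (Suc n)) \<ge> \<tau>min / 2 * c0 * (N (resid (u n) (q n)))\<^sup>2" for n
  proof -
    have "\<tau>min / 2 * c0 * (N (resid (u n) (q n)))\<^sup>2 \<le> \<tau> n / 2 * c0 * (N (resid (u n) (q n)))\<^sup>2"
      using \<tau>(2)[of n] c0 by (intro mult_right_mono) auto
    moreover have "0 \<le> 1/2 * (N (u (Suc n) - u n))\<^sup>2" by simp
    ultimately show ?thesis using dec[of n] by linarith
  qed
  have "decseq (\<lambda>n. E (u n))"
  proof (rule decseq_SucI)
    fix n have "0 \<le> 1/2 * (N (u (Suc n) - u n))\<^sup>2" by simp
    then show "E (u (Suc n)) \<le> E (u n)" using d2[of n] by linarith
  qed
  moreover have "0 \<le> E (u n)" for n unfolding E_def using a.nonneg R_nonneg beta by simp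
  ultimately obtain L where L: "(\<lambda>n. E (u n)) \<longlonglongrightarrow> L" using decseq_convergent[of "\<lambda>n. E (u n)" 0] by blast
  then show "convergent (\<lambda>n. E (u n))" by (auto simp: convergent_def)
  have D: "(\<lambda>n. E (u n) - E (u (Suc n))) \<longlonglongrightarrow> 0"
    using tendsto_diff[OF L LIMSEQ_Suc[OF L]] by simp
  have sq: "(\<lambda>n. f n) \<longlonglongrightarrow> 0" if "k > 0" "\<And>n. k * (f n)\<^sup>2 \<le> E (u n) - E (u (Suc n))" "\<And>n. f n \<ge> 0" for f k
  proof -
    have "(\<lambda>n. (f n)\<^sup>2) \<longlonglongrightarrow> 0"
    proof (rule tendsto_dist_bound)
      show "\<bar>(f n)\<^sup>2 - 0\<bar> \<le> (E (u n) - E (u (Suc n))) / k" for n using that(1) that(2)[of n] by (simp add: field_simps)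
      show "(\<lambda>n. (E (u n) - E (u (Suc n))) / k) \<longlonglongrightarrow> 0" using tendsto_divide[OF D tendsto_const[of k]] that(1) by simp
    qed
    then have "(\<lambda>n. sqrt ((f n)\<^sup>2)) \<longlonglongrightarrow> sqrt 0" by (rule tendsto_real_sqrt)
    then show ?thesis using that(3) by simp
  qed
  show "(\<lambda>n. N (resid (u n) (q n))) \<longlonglongrightarrow> 0" by (rule sq[OF _ d1]) (use \<tau> c0 in auto)
  show "(\<lambda>n. N (u (Suc n) - u n)) \<longlonglongrightarrow> 0" by (rule sq[OF _ d2]) auto
qed

end

section \<open>Square integrable functions\<close>

text \<open>Over an arbitrary measure, because the same facts are applied to Lebesgue measure on the
  domain, to \<open>lborel\<close>, and to its restrictions to balls and intervals.\<close>

definition sqi :: "'a measure \<Rightarrow> ('a \<Rightarrow> complex) \<Rightarrow> bool" where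
  "sqi M f \<longleftrightarrow> f \<in> borel_measurable M \<and> integrable M (\<lambda>x. (cmod (f x))\<^sup>2)"

definition nrm2 :: "'a measure \<Rightarrow> ('a \<Rightarrow> complex) \<Rightarrow> real" where
  "nrm2 M f = sqrt (\<integral>x. (cmod (f x))\<^sup>2 \<partial>M)"

lemma sqi_meas: "sqi M f \<Longrightarrow> f \<in> borel_measurable M"
  by (simp add: sqi_def)

lemma sqi_int: "sqi M f \<Longrightarrow> integrable M (\<lambda>x. (cmod (f x))\<^sup>2)"
  by (simp add: sqi_def)

lemma nrm2_nonneg [simp]: "0 \<le> nrm2 M f"
  by (simp add: nrm2_def)

lemma nrm2_sq: "(nrm2 M f)\<^sup>2 = (\<integral>x. (cmod (f x))\<^sup>2 \<partial>M)"
  by (simp add: nrm2_def)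

lemma sqi_mono:
  assumes "g \<in> borel_measurable M" "sqi M f" "AE x in M. cmod (g x) \<le> C * cmod (f x)"
  shows "sqi M g"
proof -
  have [measurable]: "g \<in> borel_measurable M" by (rule assms)
  have "integrable M (\<lambda>x. C\<^sup>2 * (cmod (f x))\<^sup>2)" using assms(2) by (simp add: sqi_def)
  then have "integrable M (\<lambda>x. (cmod (g x))\<^sup>2)"
  proof (rule Bochner_Integration.integrable_bound)
    show "AE x in M. norm ((cmod (g x))\<^sup>2) \<le> norm (C\<^sup>2 * (cmod (f x))\<^sup>2)"
      using assms(3)
    proof eventually_elim
      case (elim x)
      then have "(cmod (g x))\<^sup>2 \<le> (C * cmod (f x))\<^sup>2" by (intro power_mono) auto
      then show ?case by (simp add: power_mult_distrib)
    qed
  qed measurable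
  then show ?thesis by (simp add: sqi_def assms)
qed

lemma sqi_add:
  assumes "sqi M f" "sqi M g" shows "sqi M (\<lambda>x. f x + g x)"
proof -
  have [measurable]: "f \<in> borel_measurable M" "g \<in> borel_measurable M" using assms by (auto simp: sqi_def)
  have "integrable M (\<lambda>x. 2 * (cmod (f x))\<^sup>2 + 2 * (cmod (g x))\<^sup>2)" using assms by (simp add: sqi_def)
  then have "integrable M (\<lambda>x. (cmod (f x + g x))\<^sup>2)"
  proof (rule Bochner_Integration.integrable_bound)
    show "AE x in M. norm ((cmod (f x + g x))\<^sup>2) \<le> norm (2 * (cmod (f x))\<^sup>2 + 2 * (cmod (g x))\<^sup>2)"
    proof (rule AE_I2)
      fix x
      have "(cmod (f x + g x))\<^sup>2 \<le> (cmod (f x) + cmod (g x))\<^sup>2" by (intro power_mono norm_triangle_ineq) simp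
      also have "\<dots> \<le> 2 * (cmod (f x))\<^sup>2 + 2 * (cmod (g x))\<^sup>2"
        using sum_power2_ge_zero[of "cmod (f x) - cmod (g x)" 0] by (simp add: power2_eq_square algebra_simps)
      finally show "norm ((cmod (f x + g x))\<^sup>2) \<le> norm (2 * (cmod (f x))\<^sup>2 + 2 * (cmod (g x))\<^sup>2)" by simp
    qed
  qed measurable
  then show ?thesis by (simp add: sqi_def)
qed

lemma sqi_cmult: "sqi M f \<Longrightarrow> sqi M (\<lambda>x. c * f x)"
  by (rule sqi_mono[of _ _ f "cmod c"]) (auto simp: sqi_def norm_mult)

lemma sqi_diff: "sqi M f \<Longrightarrow> sqi M g \<Longrightarrow> sqi M (\<lambda>x. f x - g x)"
  using sqi_add[of M f "\<lambda>x. (-1) * g x"] sqi_cmult[of M g "-1"] by simp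

lemma sqi_cnj: "sqi M f \<Longrightarrow> sqi M (\<lambda>x. cnj (f x))"
  by (rule sqi_mono[of _ _ f 1]) (auto simp: sqi_def intro: measurable_compose[OF _ borel_measurable_continuous_onI[OF continuous_on_cnj[OF continuous_on_id]]])

lemma sqi_zero: "sqi M (\<lambda>x. 0)" by (simp add: sqi_def)

lemma sqi_mult_integrable:
  assumes "sqi M f" "sqi M g" shows "integrable M (\<lambda>x. f x * g x)"
proof -
  have [measurable]: "f \<in> borel_measurable M" "g \<in> borel_measurable M" using assms by (auto simp: sqi_def)
  have "integrable M (\<lambda>x. (cmod (f x))\<^sup>2 + (cmod (g x))\<^sup>2)" using assms by (simp add: sqi_def)
  then show ?thesis
  proof (rule Bochner_Integration.integrable_bound)
    show "AE x in M. norm (f x * g x) \<le> norm ((cmod (f x))\<^sup>2 + (cmod (g x))\<^sup>2)"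
    proof (rule AE_I2)
      fix x
      have "2 * (cmod (f x) * cmod (g x)) \<le> (cmod (f x))\<^sup>2 + (cmod (g x))\<^sup>2"
        using sum_power2_ge_zero[of "cmod (f x) - cmod (g x)" 0] by (simp add: power2_eq_square algebra_simps)
      moreover have "0 \<le> cmod (f x) * cmod (g x)" by simp
      ultimately have "cmod (f x) * cmod (g x) \<le> (cmod (f x))\<^sup>2 + (cmod (g x))\<^sup>2" by linarith
      then show "norm (f x * g x) \<le> norm ((cmod (f x))\<^sup>2 + (cmod (g x))\<^sup>2)" by (simp add: norm_mult)
    qed
  qed measurable
qed

lemma sqi_mult_cnj_integrable: "sqi M f \<Longrightarrow> sqi M g \<Longrightarrow> integrable M (\<lambda>x. f x * cnj (g x))"
  by (intro sqi_mult_integrable sqi_cnj)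

lemma norm_integral_mult_le:
  assumes "sqi M f" "sqi M g"
  shows "(\<integral>x. cmod (f x) * cmod (g x) \<partial>M) \<le> nrm2 M f * nrm2 M g"
    and "cmod (\<integral>x. f x * g x \<partial>M) \<le> nrm2 M f * nrm2 M g"
proof -
  have [measurable]: "f \<in> borel_measurable M" "g \<in> borel_measurable M" using assms by (auto simp: sqi_def)
  have int: "integrable M (\<lambda>x. cmod (f x) * cmod (g x))"
    using integrable_norm[OF sqi_mult_integrable[OF assms]] by (simp add: norm_mult)
  show *: "(\<integral>x. cmod (f x) * cmod (g x) \<partial>M) \<le> nrm2 M f * nrm2 M g"
  proof (rule power2_le_imp_le)
    have "ennreal ((\<integral>x. cmod (f x) * cmod (g x) \<partial>M)\<^sup>2) = (\<integral>\<^sup>+x. ennreal (cmod (f x)) * ennreal (cmod (g x)) \<partial>M)\<^sup>2"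
      using nn_integral_eq_integral[OF int] by (simp add: ennreal_mult flip: ennreal_power)
    also have "\<dots> \<le> (\<integral>\<^sup>+x. (ennreal (cmod (f x)))\<^sup>2 \<partial>M) * (\<integral>\<^sup>+x. (ennreal (cmod (g x)))\<^sup>2 \<partial>M)"
      by (rule Cauchy_Schwarz_nn_integral) measurable
    also have "\<dots> = ennreal ((nrm2 M f * nrm2 M g)\<^sup>2)"
      using nn_integral_eq_integral[OF sqi_int[OF assms(1)]] nn_integral_eq_integral[OF sqi_int[OF assms(2)]]
      by (simp add: power_mult_distrib nrm2_sq ennreal_mult ennreal_power)
    finally show "(\<integral>x. cmod (f x) * cmod (g x) \<partial>M)\<^sup>2 \<le> (nrm2 M f * nrm2 M g)\<^sup>2"
      by (subst (asm) ennreal_le_iff) auto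
  qed simp
  have "cmod (\<integral>x. f x * g x \<partial>M) \<le> (\<integral>x. cmod (f x) * cmod (g x) \<partial>M)"
    using integral_norm_bound[of M "\<lambda>x. f x * g x"] by (simp add: norm_mult)
  with * show "cmod (\<integral>x. f x * g x \<partial>M) \<le> nrm2 M f * nrm2 M g" by linarith
qed

lemma nrm2_cmult: "nrm2 M (\<lambda>x. c * f x) = cmod c * nrm2 M f"
  by (simp add: nrm2_def norm_mult power_mult_distrib real_sqrt_mult)

lemma nrm2_cnj: "nrm2 M (\<lambda>x. cnj (f x)) = nrm2 M f"
  by (simp add: nrm2_def)

lemma nrm2_mono:
  assumes "sqi M g" "f \<in> borel_measurable M" "AE x in M. cmod (f x) \<le> cmod (g x)"
  shows "nrm2 M f \<le> nrm2 M g"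
  unfolding nrm2_def
proof (intro real_sqrt_le_mono integral_mono_AE)
  have "sqi M f" by (rule sqi_mono[of f M g 1]) (use assms in auto)
  then show "integrable M (\<lambda>x. (cmod (f x))\<^sup>2)" by (rule sqi_int)
  show "integrable M (\<lambda>x. (cmod (g x))\<^sup>2)" using assms(1) by (rule sqi_int)
  show "AE x in M. (cmod (f x))\<^sup>2 \<le> (cmod (g x))\<^sup>2" using assms(3) by (auto intro: power_mono)
qed

lemma nrm2_triangle:
  assumes "sqi M f" "sqi M g" shows "nrm2 M (\<lambda>x. f x + g x) \<le> nrm2 M f + nrm2 M g"
proof (rule power2_le_imp_le)
  have [measurable]: "f \<in> borel_measurable M" "g \<in> borel_measurable M" using assms by (auto simp: sqi_def)
  have int: "integrable M (\<lambda>x. cmod (f x) * cmod (g x))"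
    using integrable_norm[OF sqi_mult_integrable[OF assms]] by (simp add: norm_mult)
  have "(nrm2 M (\<lambda>x. f x + g x))\<^sup>2 \<le> (\<integral>x. (cmod (f x))\<^sup>2 + 2 * (cmod (f x) * cmod (g x)) + (cmod (g x))\<^sup>2 \<partial>M)"
    unfolding nrm2_sq
  proof (rule integral_mono)
    show "(cmod (f x + g x))\<^sup>2 \<le> (cmod (f x))\<^sup>2 + 2 * (cmod (f x) * cmod (g x)) + (cmod (g x))\<^sup>2" for x
    proof -
      have "(cmod (f x + g x))\<^sup>2 \<le> (cmod (f x) + cmod (g x))\<^sup>2" by (intro power_mono norm_triangle_ineq) simp
      then show ?thesis by (simp add: power2_sum)
    qed
  qed (use sqi_int[OF sqi_add[OF assms]] sqi_int[OF assms(1)] sqi_int[OF assms(2)] int in auto)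
  also have "\<dots> = (nrm2 M f)\<^sup>2 + 2 * (\<integral>x. cmod (f x) * cmod (g x) \<partial>M) + (nrm2 M g)\<^sup>2"
    using sqi_int[OF assms(1)] sqi_int[OF assms(2)] int by (simp add: nrm2_sq)
  also have "\<dots> \<le> (nrm2 M f + nrm2 M g)\<^sup>2"
    using norm_integral_mult_le(1)[OF assms] by (simp add: power2_sum)
  finally show "(nrm2 M (\<lambda>x. f x + g x))\<^sup>2 \<le> (nrm2 M f + nrm2 M g)\<^sup>2" .
qed simp

lemma nrm2_minus_commute: "nrm2 M (\<lambda>x. f x - g x) = nrm2 M (\<lambda>x. g x - f x)"
  by (simp add: nrm2_def norm_minus_commute)

lemma nrm2_diff_triangle:
  assumes "sqi M f" "sqi M g" "sqi M k"
  shows "nrm2 M (\<lambda>x. f x - k x) \<le> nrm2 M (\<lambda>x. f x - g x) + nrm2 M (\<lambda>x. g x - k x)"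
  using nrm2_triangle[OF sqi_diff[OF assms(1,2)] sqi_diff[OF assms(2,3)]] by simp

lemma nrm2_eq_0_iff: "sqi M f \<Longrightarrow> nrm2 M f = 0 \<longleftrightarrow> (AE x in M. f x = 0)"
  unfolding nrm2_def using integral_nonneg_eq_0_iff_AE[OF sqi_int[of M f]] by simp

lemma nrm2_AE_cong: "AE x in M. f x = g x \<Longrightarrow> f \<in> borel_measurable M \<Longrightarrow> g \<in> borel_measurable M \<Longrightarrow> nrm2 M f = nrm2 M g"
  unfolding nrm2_def by (intro arg_cong[of _ _ sqrt] integral_cong_AE) auto

section \<open>Almost everywhere limits and completeness of L^2\<close>

lemma nrm2_tendsto_AE_subseq:
  assumes f: "\<And>n. sqi M (f n)" and g: "sqi M g" and lim: "(\<lambda>n. nrm2 M (\<lambda>x. f n x - g x)) \<longlonglongrightarrow> 0"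
  shows "\<exists>r::nat\<Rightarrow>nat. strict_mono r \<and> (AE x in M. (\<lambda>n. f (r n) x) \<longlonglongrightarrow> g x)"
proof -
  have "(\<lambda>n. \<integral>x. norm ((cmod (f n x - g x))\<^sup>2) \<partial>M) \<longlonglongrightarrow> 0"
    using tendsto_power[OF lim, of 2] by (simp add: nrm2_sq)
  from tendsto_L1_AE_subseq[OF sqi_int[OF sqi_diff[OF f g]] this] obtain r :: "nat \<Rightarrow> nat" where
    r: "strict_mono r" "AE x in M. (\<lambda>n. (cmod (f (r n) x - g x))\<^sup>2) \<longlonglongrightarrow> 0" by blast
  have "AE x in M. (\<lambda>n. f (r n) x) \<longlonglongrightarrow> g x"
    using r(2)
  proof eventually_elim
    case (elim x)
    from tendsto_real_sqrt[OF this] have "(\<lambda>n. cmod (f (r n) x - g x)) \<longlonglongrightarrow> 0" by simp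
    then show ?case by (simp add: tendsto_norm_zero_iff LIM_zero_cancel)
  qed
  with r(1) show ?thesis by blast
qed

text \<open>Square integrability of the limit is part of the conclusion. This matters where only
  pointwise convergence and norm bounds are known, as for squares of H^1_0 functions.\<close>

lemma sqi_fatou:
  assumes f: "\<And>n. sqi M (f n)" and g: "g \<in> borel_measurable M"
    and lim: "AE x in M. (\<lambda>n. f n x) \<longlonglongrightarrow> g x" and bd: "\<And>n. nrm2 M (f n) \<le> C"
  shows "sqi M g" "nrm2 M g \<le> C"
proof -
  have [measurable]: "\<And>n. f n \<in> borel_measurable M" "g \<in> borel_measurable M" using f g by (auto simp: sqi_def)
  have C: "C \<ge> 0" using bd[of 0] nrm2_nonneg[of M "f 0"] by linarith
  have "(\<integral>\<^sup>+x. ennreal ((cmod (g x))\<^sup>2) \<partial>M) \<le> (\<integral>\<^sup>+x. liminf (\<lambda>n. ennreal ((cmod (f n x))\<^sup>2)) \<partial>M)"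
  proof (rule nn_integral_mono_AE)
    show "AE x in M. ennreal ((cmod (g x))\<^sup>2) \<le> liminf (\<lambda>n. ennreal ((cmod (f n x))\<^sup>2))"
      using lim
    proof eventually_elim
      case (elim x)
      then have "(\<lambda>n. ennreal ((cmod (f n x))\<^sup>2)) \<longlonglongrightarrow> ennreal ((cmod (g x))\<^sup>2)"
        by (intro tendsto_ennrealI tendsto_intros)
      from lim_imp_Liminf[OF trivial_limit_sequentially this] show ?case by (rule eq_refl[OF sym])
    qed
  qed
  also have "\<dots> \<le> liminf (\<lambda>n. \<integral>\<^sup>+x. ennreal ((cmod (f n x))\<^sup>2) \<partial>M)" by (rule nn_integral_liminf) measurable
  also have "\<dots> \<le> liminf (\<lambda>n::nat. ennreal (C\<^sup>2))"
  proof (rule Liminf_mono, rule always_eventually, rule allI)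
    fix n
    have "(\<integral>\<^sup>+x. ennreal ((cmod (f n x))\<^sup>2) \<partial>M) = ennreal ((nrm2 M (f n))\<^sup>2)"
      using nn_integral_eq_integral[OF sqi_int[OF f[of n]]] by (simp add: nrm2_sq)
    then show "(\<integral>\<^sup>+x. ennreal ((cmod (f n x))\<^sup>2) \<partial>M) \<le> ennreal (C\<^sup>2)"
      using bd[of n] by (simp add: power_mono ennreal_leI)
  qed
  also have "\<dots> = ennreal (C\<^sup>2)" by (simp add: Liminf_const)
  finally have *: "(\<integral>\<^sup>+x. ennreal ((cmod (g x))\<^sup>2) \<partial>M) \<le> ennreal (C\<^sup>2)" .
  then have "integrable M (\<lambda>x. (cmod (g x))\<^sup>2)"
    by (intro integrableI_bounded) (auto intro: order.strict_trans1)
  then show gs: "sqi M g" by (simp add: sqi_def)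
  have "ennreal ((nrm2 M g)\<^sup>2) \<le> ennreal (C\<^sup>2)" using * nn_integral_eq_integral[OF sqi_int[OF gs]] by (simp add: nrm2_sq)
  then have "(nrm2 M g)\<^sup>2 \<le> C\<^sup>2" by (simp add: ennreal_le_iff)
  then show "nrm2 M g \<le> C" using C by (rule power2_le_imp_le)
qed

lemma cauchy_fast_subseq:
  assumes "\<And>e. e > 0 \<Longrightarrow> \<exists>N::nat. \<forall>m\<ge>N. \<forall>n\<ge>N. d m n < (e::real)" and \<epsilon>: "\<And>k::nat. \<epsilon> k > 0"
  shows "\<exists>r. strict_mono (r::nat\<Rightarrow>nat) \<and> (\<forall>k. d (r (Suc k)) (r k) < \<epsilon> k)"
proof -
  have "\<forall>k. \<exists>N. \<forall>m\<ge>N. \<forall>n\<ge>N. d m n < \<epsilon> k" using assms(1)[OF \<epsilon>] by blast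
  then obtain N where N: "\<And>k m n. m \<ge> N k \<Longrightarrow> n \<ge> N k \<Longrightarrow> d m n < \<epsilon> k" by metis
  define r where "r = rec_nat (N 0) (\<lambda>k x. max (Suc x) (N (Suc k)))"
  have r: "r 0 = N 0" "\<And>k. r (Suc k) = max (Suc (r k)) (N (Suc k))" by (simp_all add: r_def)
  have "strict_mono r" by (simp add: strict_mono_Suc_iff r less_max_iff_disj)
  moreover have "r k \<ge> N k" for k by (cases k) (auto simp: r)
  moreover have "r (Suc k) \<ge> N k" for k
    using calculation(2)[of k] r(2)[of k] by linarith
  ultimately show ?thesis using N by blast
qed

text \<open>Riesz-Fischer: a fast subsequence converges almost everywhere because its increments are
  absolutely summable there, and Fatou turns pointwise into norm convergence.\<close>

theorem sqi_complete:
  assumes f: "\<And>n. sqi M (f n)" and C: "\<And>e. e > 0 \<Longrightarrow> \<exists>N. \<forall>m\<ge>N. \<forall>n\<ge>N. nrm2 M (\<lambda>x. f m x - f n x) < e"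
  shows "\<exists>g. sqi M g \<and> (\<lambda>n. nrm2 M (\<lambda>x. f n x - g x)) \<longlonglongrightarrow> 0"
proof -
  have [measurable]: "\<And>n. f n \<in> borel_measurable M" using f by (auto simp: sqi_def)
  obtain r where r: "strict_mono (r::nat\<Rightarrow>nat)" "\<And>k. nrm2 M (\<lambda>x. f (r (Suc k)) x - f (r k) x) < (1/4)^k"
    using cauchy_fast_subseq[of "\<lambda>m n. nrm2 M (\<lambda>x. f m x - f n x)" "\<lambda>k. (1/4)^k"] C by auto
  define \<Delta> where "\<Delta> k x = cmod (f (r (Suc k)) x - f (r k) x)" for k x
  have [measurable]: "\<And>k. \<Delta> k \<in> borel_measurable M" unfolding \<Delta>_def by measurable
  \<comment> \<open>The weight 2^k is affordable against the factor (1/16)^k of the squared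
    increments and makes the unsquared increments summable below.\<close>
  have int\<Delta>: "(\<integral>\<^sup>+x. ennreal (2^k * (\<Delta> k x)\<^sup>2) \<partial>M) \<le> ennreal ((1/2)^k)" for k
  proof -
    have i: "integrable M (\<lambda>x. 2^k * (\<Delta> k x)\<^sup>2)" unfolding \<Delta>_def using sqi_int[OF sqi_diff[OF f f]] by simp
    have "(\<integral>x. 2^k * (\<Delta> k x)\<^sup>2 \<partial>M) = 2^k * (nrm2 M (\<lambda>x. f (r (Suc k)) x - f (r k) x))\<^sup>2"
      by (simp add: nrm2_sq \<Delta>_def)
    also have "\<dots> \<le> 2^k * ((1/4)^k)\<^sup>2" using r(2)[of k] by (intro mult_left_mono power_mono) auto
    also have "\<dots> \<le> (1/2)^k"
    proof -
      have "2^k * ((1/4)^k)\<^sup>2 = ((1/8)^k :: real)"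
        by (simp add: power2_eq_square flip: power_mult_distrib)
      also have "\<dots> \<le> (1/2)^k" by (rule power_mono) auto
      finally show ?thesis .
    qed
    finally show ?thesis using nn_integral_eq_integral[OF i] by (simp add: ennreal_leI)
  qed
  have "(\<integral>\<^sup>+x. (\<Sum>k. ennreal (2^k * (\<Delta> k x)\<^sup>2)) \<partial>M) = (\<Sum>k. \<integral>\<^sup>+x. ennreal (2^k * (\<Delta> k x)\<^sup>2) \<partial>M)"
    by (rule nn_integral_suminf) measurable
  also have "\<dots> \<le> (\<Sum>k. ennreal ((1/2)^k))" by (intro suminf_le int\<Delta>) auto
  also have "\<dots> = ennreal (\<Sum>k. (1/2)^k)" by (intro suminf_ennreal2 summable_geometric) auto
  finally have "(\<integral>\<^sup>+x. (\<Sum>k. ennreal (2^k * (\<Delta> k x)\<^sup>2)) \<partial>M) \<noteq> \<infinity>"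
    by (simp add: top_unique) (metis ennreal_neq_top neq_top_trans)
  then have "AE x in M. (\<Sum>k. ennreal (2^k * (\<Delta> k x)\<^sup>2)) \<noteq> \<infinity>"
    by (intro nn_integral_PInf_AE) measurable
  then have conv: "AE x in M. (\<lambda>k. f (r k) x) \<longlonglongrightarrow> lim (\<lambda>k. f (r k) x)"
  proof eventually_elim
    case (elim x)
    have "summable (\<lambda>k. 2^k * (\<Delta> k x)\<^sup>2)" using elim by (intro summable_suminf_not_top) auto
    moreover have "summable (\<lambda>k. (1/2)^k :: real)" by (intro summable_geometric) auto
    ultimately have "summable (\<lambda>k. (1/2)^k + 2^k * (\<Delta> k x)\<^sup>2)" by (intro summable_add)
    then have "summable (\<lambda>k. \<Delta> k x)"
    proof (rule summable_comparison_test[rotated], intro exI[of _ 0] allI impI)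
      fix k
      \<comment> \<open>Arithmetic-geometric inequality with p = 2^k and q = (1/2)^k: it bounds the
        increment by the sum of a geometric term and the weighted square.\<close>
      have eq: "q * (1 - p * y)\<^sup>2 = q + p * y\<^sup>2 - 2 * y" if "q * p = 1" for p q y :: real
        using that by algebra
      have "0 \<le> (1/2)^k * (1 - 2^k * \<Delta> k x)\<^sup>2" by simp
      also have "\<dots> = (1/2)^k + 2^k * (\<Delta> k x)\<^sup>2 - 2 * \<Delta> k x"
        by (rule eq) (simp flip: power_mult_distrib)
      finally have "2 * \<Delta> k x \<le> (1/2)^k + 2^k * (\<Delta> k x)\<^sup>2" by linarith
      moreover have "\<Delta> k x \<ge> 0" by (simp add: \<Delta>_def)
      ultimately show "norm (\<Delta> k x) \<le> (1/2)^k + 2^k * (\<Delta> k x)\<^sup>2" by simp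
    qed
    then have "summable (\<lambda>k. f (r (Suc k)) x - f (r k) x)" unfolding \<Delta>_def by (rule summable_norm_cancel)
    then have "(\<lambda>n. \<Sum>k<n. f (r (Suc k)) x - f (r k) x) \<longlonglongrightarrow> (\<Sum>k. f (r (Suc k)) x - f (r k) x)"
      by (rule summable_LIMSEQ)
    then have "(\<lambda>n. f (r n) x - f (r 0) x) \<longlonglongrightarrow> (\<Sum>k. f (r (Suc k)) x - f (r k) x)"
      by (simp add: sum_lessThan_telescope[of "\<lambda>k. f (r k) x"])
    from tendsto_add[OF this tendsto_const[of "f (r 0) x"]] have "convergent (\<lambda>k. f (r k) x)"
      by (auto simp: convergent_def)
    then show ?case by (simp add: convergent_LIMSEQ_iff)
  qed
  define g where "g x = lim (\<lambda>k. f (r k) x)" for x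
  have gm [measurable]: "g \<in> borel_measurable M" unfolding g_def by measurable
  \<comment> \<open>The index \<open>m\<close> stays fixed while the subsequence runs, so the
    estimate concerns the whole sequence and not only the subsequence.\<close>
  have fatou: "sqi M (\<lambda>x. f m x - g x) \<and> nrm2 M (\<lambda>x. f m x - g x) \<le> e"
    if "m \<ge> N" "\<And>m n. m \<ge> N \<Longrightarrow> n \<ge> N \<Longrightarrow> nrm2 M (\<lambda>x. f m x - f n x) < e" for m N e
  proof -
    have "r (N + k) \<ge> N" for k using seq_suble[OF r(1), of "N + k"] by linarith
    then have b: "nrm2 M (\<lambda>x. f m x - f (r (k + N)) x) \<le> e" for k using that by (metis add.commute less_imp_le)
    have l: "AE x in M. (\<lambda>k. f m x - f (r (k + N)) x) \<longlonglongrightarrow> f m x - g x"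
      using conv by eventually_elim (auto simp: g_def intro!: tendsto_intros LIMSEQ_ignore_initial_segment)
    show ?thesis using sqi_fatou[OF sqi_diff[OF f f] _ l b] by auto
  qed
  obtain N0 where "\<And>m n. m \<ge> N0 \<Longrightarrow> n \<ge> N0 \<Longrightarrow> nrm2 M (\<lambda>x. f m x - f n x) < 1" using C[of 1] by auto
  then have "sqi M (\<lambda>x. f N0 x - g x)" using fatou[of N0 N0 1] by auto
  from sqi_diff[OF f[of N0] this] have "sqi M g" by simp
  moreover have "(\<lambda>n. nrm2 M (\<lambda>x. f n x - g x)) \<longlonglongrightarrow> 0"
  proof (rule LIMSEQ_I)
    fix e :: real assume "e > 0"
    then obtain N where "\<And>m n. m \<ge> N \<Longrightarrow> n \<ge> N \<Longrightarrow> nrm2 M (\<lambda>x. f m x - f n x) < e/2" using C[of "e/2"] by auto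
    then have "nrm2 M (\<lambda>x. f n x - g x) \<le> e/2" if "n \<ge> N" for n using fatou[of N n "e/2"] that by auto
    then show "\<exists>N. \<forall>n\<ge>N. norm (nrm2 M (\<lambda>x. f n x - g x) - 0) < e"
      using \<open>e > 0\<close> by (intro exI[of _ N]) force
  qed
  ultimately show ?thesis by blast
qed

lemma tendsto_integral_mult:
  assumes f: "\<And>n. sqi M (f n)" and F: "sqi M F" and g: "\<And>n. sqi M (g n)" and G: "sqi M G"
    and lf: "(\<lambda>n. nrm2 M (\<lambda>x. f n x - F x)) \<longlonglongrightarrow> 0" and lg: "(\<lambda>n. nrm2 M (\<lambda>x. g n x - G x)) \<longlonglongrightarrow> 0"
  shows "(\<lambda>n. \<integral>x. f n x * g n x \<partial>M) \<longlonglongrightarrow> (\<integral>x. F x * G x \<partial>M)"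
proof -
  let ?b = "\<lambda>n. nrm2 M (\<lambda>x. f n x - F x) * (nrm2 M (\<lambda>x. g n x - G x) + nrm2 M G) + nrm2 M F * nrm2 M (\<lambda>x. g n x - G x)"
  have "cmod ((\<integral>x. f n x * g n x \<partial>M) - (\<integral>x. F x * G x \<partial>M)) \<le> ?b n" for n
  proof -
    have "(\<integral>x. f n x * g n x \<partial>M) - (\<integral>x. F x * G x \<partial>M) = (\<integral>x. (f n x - F x) * g n x + F x * (g n x - G x) \<partial>M)"
      by (subst Bochner_Integration.integral_diff[symmetric])
        (auto simp: algebra_simps intro!: sqi_mult_integrable f F g G)
    also have "\<dots> = (\<integral>x. (f n x - F x) * g n x \<partial>M) + (\<integral>x. F x * (g n x - G x) \<partial>M)"
      by (intro Bochner_Integration.integral_add sqi_mult_integrable sqi_diff f F g G)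
    finally have "cmod ((\<integral>x. f n x * g n x \<partial>M) - (\<integral>x. F x * G x \<partial>M))
       \<le> nrm2 M (\<lambda>x. f n x - F x) * nrm2 M (g n) + nrm2 M F * nrm2 M (\<lambda>x. g n x - G x)"
      using norm_integral_mult_le(2)[OF sqi_diff[OF f[of n] F] g[of n]] norm_integral_mult_le(2)[OF F sqi_diff[OF g[of n] G]]
      by (auto intro: order_trans[OF norm_triangle_ineq])
    also have "\<dots> \<le> ?b n"
      using nrm2_triangle[OF sqi_diff[OF g[of n] G] G] by (simp add: mult_left_mono)
    finally show ?thesis .
  qed
  moreover have "?b \<longlonglongrightarrow> 0 * (0 + nrm2 M G) + nrm2 M F * 0" by (intro tendsto_intros lf lg)
  ultimately have "(\<lambda>n. (\<integral>x. f n x * g n x \<partial>M) - (\<integral>x. F x * G x \<partial>M)) \<longlonglongrightarrow> 0"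
    using Lim_null_comparison[of "\<lambda>n. (\<integral>x. f n x * g n x \<partial>M) - (\<integral>x. F x * G x \<partial>M)" ?b sequentially] by simp
  then show ?thesis by (rule LIM_zero_cancel)
qed

section \<open>Test functions\<close>

lemma smooth_fun_differentiable: "smooth_fun g \<Longrightarrow> g differentiable (at x)"
  unfolding smooth_fun_def by blast

lemma smooth_fun_has_derivative: "smooth_fun g \<Longrightarrow> (g has_derivative frechet_derivative g (at x)) (at x)"
  using smooth_fun_differentiable frechet_derivative_works by blast

lemma smooth_fun_partial:
  "smooth_fun g \<Longrightarrow> b \<in> Basis \<Longrightarrow> smooth_fun (\<lambda>x. frechet_derivative g (at x) b)"
  unfolding smooth_fun_def by blast

lemma smooth_fun_continuous: "smooth_fun g \<Longrightarrow> continuous_on UNIV g"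
  by (meson differentiable_at_withinI differentiable_imp_continuous_on differentiable_on_def smooth_fun_differentiable)

text \<open>The witness for the family \<open>F\<close> that \<open>smooth_fun\<close> asks for: an
  algebra generated by functions whose partial derivatives lie in that algebra again.\<close>

inductive_set algebra_gen :: "('a \<Rightarrow> complex) set \<Rightarrow> ('a \<Rightarrow> complex) set" for S where
  base: "g \<in> S \<Longrightarrow> g \<in> algebra_gen S"
| add: "f \<in> algebra_gen S \<Longrightarrow> g \<in> algebra_gen S \<Longrightarrow> (\<lambda>x. f x + g x) \<in> algebra_gen S"
| mult: "f \<in> algebra_gen S \<Longrightarrow> g \<in> algebra_gen S \<Longrightarrow> (\<lambda>x. f x * g x) \<in> algebra_gen S"

text \<open>Sum and product rule propagate closure under partial derivatives from the generators to
  the algebra, so smoothness has to be checked on generators only.\<close>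

lemma algebra_gen_smooth:
  fixes S :: "('a::euclidean_space \<Rightarrow> complex) set"
  assumes S: "\<And>g. g \<in> S \<Longrightarrow> \<exists>g'. (\<forall>x. (g has_derivative g' x) (at x)) \<and> (\<forall>b\<in>Basis. (\<lambda>x. g' x b) \<in> algebra_gen S)"
    and f: "f \<in> algebra_gen S"
  shows "smooth_fun f"
proof -
  have *: "\<exists>g'. (\<forall>x. (g has_derivative g' x) (at x)) \<and> (\<forall>b\<in>Basis. (\<lambda>x. g' x b) \<in> algebra_gen S)"
    if "g \<in> algebra_gen S" for g
    using that
  proof induction
    case (base g)
    then show ?case by (rule S)
  next
    case (add f g)
    then obtain f' g' where "\<forall>x. (f has_derivative f' x) (at x)" "\<forall>x. (g has_derivative g' x) (at x)"
      "\<forall>b\<in>Basis. (\<lambda>x. f' x b) \<in> algebra_gen S" "\<forall>b\<in>Basis. (\<lambda>x. g' x b) \<in> algebra_gen S" by blast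
    then show ?case
      by (intro exI[of _ "\<lambda>x v. f' x v + g' x v"]) (auto intro!: has_derivative_add algebra_gen.add)
  next
    case (mult f g)
    then obtain f' g' where "\<forall>x. (f has_derivative f' x) (at x)" "\<forall>x. (g has_derivative g' x) (at x)"
      "\<forall>b\<in>Basis. (\<lambda>x. f' x b) \<in> algebra_gen S" "\<forall>b\<in>Basis. (\<lambda>x. g' x b) \<in> algebra_gen S" by blast
    then show ?case using mult.hyps
      by (intro exI[of _ "\<lambda>x v. f x * g' x v + f' x v * g x"])
        (auto intro!: has_derivative_mult algebra_gen.add algebra_gen.mult)
  qed
  show ?thesis unfolding smooth_fun_def
  proof (intro exI[of _ "algebra_gen S"] conjI ballI allI f)
    fix g assume "g \<in> algebra_gen S"
    then obtain g' where g': "\<And>x. (g has_derivative g' x) (at x)" "\<And>b. b \<in> Basis \<Longrightarrow> (\<lambda>x. g' x b) \<in> algebra_gen S"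
      using * by blast
    have "g' = (\<lambda>x. frechet_derivative g (at x))" using frechet_derivative_at[OF g'(1)] by blast
    then show "g differentiable at x" "b \<in> Basis \<Longrightarrow> (\<lambda>x. frechet_derivative g (at x) b) \<in> algebra_gen S" for x b
      using g' by (auto simp: differentiable_def)
  qed
qed

lemma algebra_gen_smooth_fun:
  fixes f :: "'a::euclidean_space \<Rightarrow> complex"
  shows "f \<in> algebra_gen (Collect smooth_fun) \<Longrightarrow> smooth_fun f"
proof (erule algebra_gen_smooth[rotated])
  fix g :: "'a \<Rightarrow> complex" assume "g \<in> Collect smooth_fun"
  then show "\<exists>g'. (\<forall>x. (g has_derivative g' x) (at x)) \<and> (\<forall>b\<in>Basis. (\<lambda>x. g' x b) \<in> algebra_gen (Collect smooth_fun))"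
    by (intro exI[of _ "\<lambda>x. frechet_derivative g (at x)"])
      (auto intro: smooth_fun_has_derivative smooth_fun_partial algebra_gen.base)
qed

lemma smooth_fun_add: "smooth_fun f \<Longrightarrow> smooth_fun g \<Longrightarrow> smooth_fun (\<lambda>x. f x + g x)"
  by (rule algebra_gen_smooth_fun) (auto intro: algebra_gen.intros)

lemma smooth_fun_mult: "smooth_fun f \<Longrightarrow> smooth_fun g \<Longrightarrow> smooth_fun (\<lambda>x. f x * g x)"
  by (rule algebra_gen_smooth_fun) (auto intro: algebra_gen.intros)

lemma smooth_fun_const: "smooth_fun (\<lambda>x. c)"
  by (rule algebra_gen_smooth[of "range (\<lambda>c x. c)"]) (auto intro!: algebra_gen.base exI[of _ "\<lambda>x v. 0"])

lemma smooth_fun_prod: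
  "finite A \<Longrightarrow> (\<And>i. i \<in> A \<Longrightarrow> smooth_fun (f i)) \<Longrightarrow> smooth_fun (\<lambda>x. \<Prod>i\<in>A. f i x)"
  by (induction A rule: finite_induct) (auto intro: smooth_fun_const smooth_fun_mult)

lemma smooth_fun_inner: "smooth_fun (\<lambda>x. complex_of_real (x \<bullet> v))"
proof (rule algebra_gen_smooth[of "insert (\<lambda>x. complex_of_real (x \<bullet> v)) (range (\<lambda>c x. c))"])
  fix g assume "g \<in> insert (\<lambda>x. complex_of_real (x \<bullet> v)) (range (\<lambda>c x. c))"
  then consider "g = (\<lambda>x. complex_of_real (x \<bullet> v))" | c where "g = (\<lambda>x. c)" by blast
  then show "\<exists>g'. (\<forall>x. (g has_derivative g' x) (at x)) \<and>
     (\<forall>b\<in>Basis. (\<lambda>x. g' x b) \<in> algebra_gen (insert (\<lambda>x. complex_of_real (x \<bullet> v)) (range (\<lambda>c x. c))))"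
  proof cases
    case 1
    then show ?thesis
      by (intro exI[of _ "\<lambda>x h. complex_of_real (h \<bullet> v)"])
        (auto intro!: algebra_gen.base derivative_eq_intros bounded_linear.has_derivative[OF bounded_linear_of_real])
  next
    case 2
    then show ?thesis by (intro exI[of _ "\<lambda>x h. 0"]) (auto intro!: algebra_gen.base)
  qed
qed (auto intro: algebra_gen.base)

lemma smooth_fun_cnj: "smooth_fun f \<Longrightarrow> smooth_fun (\<lambda>x. cnj (f x))"
proof (rule algebra_gen_smooth[of "(\<lambda>g x. cnj (g x)) ` Collect smooth_fun"])
  fix g assume "g \<in> (\<lambda>g x. cnj (g x)) ` Collect smooth_fun"
  then obtain k where k: "smooth_fun k" "g = (\<lambda>x. cnj (k x))" by blast
  then show "\<exists>g'. (\<forall>x. (g has_derivative g' x) (at x)) \<and>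
     (\<forall>b\<in>Basis. (\<lambda>x. g' x b) \<in> algebra_gen ((\<lambda>g x. cnj (g x)) ` Collect smooth_fun))"
    by (intro exI[of _ "\<lambda>x h. cnj (frechet_derivative k (at x) h)"])
      (auto intro!: algebra_gen.base bounded_linear.has_derivative[OF bounded_linear_cnj]
        smooth_fun_has_derivative smooth_fun_partial imageI)
qed (auto intro: algebra_gen.base)

section \<open>Smooth bumps and the fundamental lemma of the calculus of variations\<close>

definition bmp :: "real \<Rightarrow> nat \<Rightarrow> real \<Rightarrow> real" where
  "bmp e n t = (if t > 0 then (1/t)^n * exp (- e / t) else 0)"

text \<open>In the variable e/t, which tends to infinity from the right of 0, the exponential beats
  every power.\<close>

lemma bmp_lim: "e > 0 \<Longrightarrow> (bmp e n \<longlongrightarrow> 0) (at 0)"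
proof -
  assume e: "e > 0"
  have 1: "filterlim (\<lambda>t. e / t) at_top (at_right 0)"
    using filterlim_tendsto_pos_mult_at_top[OF tendsto_const e filterlim_inverse_at_top_right]
    by (simp add: field_class.field_divide_inverse)
  have "((\<lambda>t. (e/t)^n / exp (e/t)) \<longlongrightarrow> 0) (at_right 0)"
    by (rule filterlim_compose[OF tendsto_power_div_exp_0 1])
  then have lim: "((\<lambda>t. (1/e)^n * ((e/t)^n / exp (e/t))) \<longlongrightarrow> (1/e)^n * 0) (at_right 0)" by (intro tendsto_intros)
  have "(bmp e n \<longlongrightarrow> 0) (at_right 0)"
  proof (rule Lim_transform_eventually[OF lim[unfolded mult_zero_right]])
    show "\<forall>\<^sub>F t in at_right 0. (1/e)^n * ((e/t)^n / exp (e/t)) = bmp e n t"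
      using e by (auto simp: eventually_at_right bmp_def exp_minus field_simps power_divide intro!: exI[of _ 1])
  qed
  moreover have "(bmp e n \<longlongrightarrow> 0) (at_left 0)"
    by (rule Lim_transform_eventually[OF tendsto_const])
      (auto simp: eventually_at_filter bmp_def intro!: always_eventually)
  ultimately show ?thesis by (rule filterlim_split_at[rotated])
qed

text \<open>Differentiation raises the power of 1/t by one or two but stays inside the family
  \<open>bmp e\<close>; this is why the exponent \<open>n\<close> is a parameter. At 0 the
  difference quotient is \<open>bmp e (Suc n)\<close> itself, so flatness gives derivative
  0.\<close>

lemma bmp_deriv:
  assumes e: "e > 0"
  shows "(bmp e n has_field_derivative (- real n * bmp e (Suc n) t + e * bmp e (Suc (Suc n)) t)) (at t)"
proof -
  consider "t > 0" | "t < 0" | "t = 0" by linarith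
  then show ?thesis
  proof cases
    case 1
    have "((\<lambda>t. (1/t)^n * exp (- e / t)) has_field_derivative
        (- real n * bmp e (Suc n) t + e * bmp e (Suc (Suc n)) t)) (at t)"
    proof (cases n)
      case 0
      then show ?thesis using 1 by (auto intro!: derivative_eq_intros simp: bmp_def field_simps power2_eq_square)
    next
      case (Suc m)
      have i: "((\<lambda>t. 1 / t) has_field_derivative - ((1/t)\<^sup>2)) (at t)"
        using 1 by (auto intro!: derivative_eq_intros simp: power2_eq_square)
      have "((\<lambda>t. (1/t)^n) has_field_derivative (- real n * (1/t)^(Suc n))) (at t)"
      proof (rule DERIV_cong[OF DERIV_power[OF i]])
        have "real n * (- (s\<^sup>2) * s ^ (n - Suc 0)) = - real n * s ^ Suc n" for s :: real
          by (simp add: Suc power2_eq_square algebra_simps)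
        from this[of "1/t"] show "real n * (- ((1/t)\<^sup>2) * (1/t) ^ (n - Suc 0)) = - real n * (1/t) ^ Suc n" .
      qed
      moreover have "((\<lambda>t. exp (- e / t)) has_field_derivative (e * (1/t)^2 * exp (- e / t))) (at t)"
        using DERIV_fun_exp[OF DERIV_cmult[OF i, of "- e"]] by (simp add: algebra_simps)
      ultimately show ?thesis
        by (rule DERIV_cong[OF DERIV_mult]) (use 1 in \<open>simp add: bmp_def power2_eq_square algebra_simps\<close>)
    qed
    then show ?thesis
      by (rule has_field_derivative_transform_within_open[of _ _ _ "{0<..}"]) (use 1 in \<open>auto simp: bmp_def\<close>)
  next
    case 2
    have "((\<lambda>t. 0) has_field_derivative (- real n * bmp e (Suc n) t + e * bmp e (Suc (Suc n)) t)) (at t)"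
      using 2 by (simp add: bmp_def)
    then show ?thesis
      by (rule has_field_derivative_transform_within_open[of _ _ _ "{..<0}"]) (use 2 in \<open>auto simp: bmp_def\<close>)
  next
    case 3
    have "((\<lambda>h. (bmp e n (0 + h) - bmp e n 0) / h) \<longlongrightarrow> 0) (at 0)"
      by (rule Lim_transform_eventually[OF bmp_lim[OF e, of "Suc n"]])
        (auto simp: eventually_at_filter bmp_def)
    then have "(bmp e n has_field_derivative 0) (at 0)" by (simp add: DERIV_def)
    then show ?thesis using 3 by (simp add: bmp_def)
  qed
qed

lemma smooth_fun_bmp:
  assumes e: "e > 0" shows "smooth_fun (\<lambda>x. complex_of_real (bmp e n (x \<bullet> v + r)))"
proof -
  define S where "S = range (\<lambda>n x. complex_of_real (bmp e n (x \<bullet> v + r))) \<union> range (\<lambda>c x. c)"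
  show ?thesis
  proof (rule algebra_gen_smooth[of S])
    fix g assume "g \<in> S"
    then consider k where "g = (\<lambda>x. complex_of_real (bmp e k (x \<bullet> v + r)))" | c where "g = (\<lambda>x. c)"
      unfolding S_def by blast
    then show "\<exists>g'. (\<forall>x. (g has_derivative g' x) (at x)) \<and> (\<forall>b\<in>Basis. (\<lambda>x. g' x b) \<in> algebra_gen S)"
    proof cases
      case 1
      define D where "D x = - real k * bmp e (Suc k) (x \<bullet> v + r) + e * bmp e (Suc (Suc k)) (x \<bullet> v + r)" for x
      have "(g has_derivative (\<lambda>h. complex_of_real (D x * (h \<bullet> v)))) (at x)" for x
      proof -
        have "((\<lambda>x. x \<bullet> v + r) has_derivative (\<lambda>h. h \<bullet> v)) (at x)" by (auto intro!: derivative_eq_intros)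
        from has_derivative_compose[OF this bmp_deriv[OF e, of k, THEN has_field_derivative_imp_has_derivative]]
        have "((\<lambda>x. bmp e k (x \<bullet> v + r)) has_derivative (\<lambda>h. D x * (h \<bullet> v))) (at x)" by (simp add: D_def)
        then show ?thesis unfolding 1 by (rule bounded_linear.has_derivative[OF bounded_linear_of_real])
      qed
      moreover have "(\<lambda>x. complex_of_real (D x * (b \<bullet> v))) \<in> algebra_gen S" for b
      proof -
        have "(\<lambda>x. complex_of_real (D x * (b \<bullet> v))) = (\<lambda>x. complex_of_real (- real k * (b \<bullet> v)) * complex_of_real (bmp e (Suc k) (x \<bullet> v + r))
            + complex_of_real (e * (b \<bullet> v)) * complex_of_real (bmp e (Suc (Suc k)) (x \<bullet> v + r)))"
          by (simp add: D_def algebra_simps)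
        also have "\<dots> \<in> algebra_gen S"
          by (intro algebra_gen.add algebra_gen.mult algebra_gen.base) (auto simp: S_def)
        finally show ?thesis .
      qed
      ultimately show ?thesis by (intro exI[of _ "\<lambda>x h. complex_of_real (D x * (h \<bullet> v))"]) auto
    next
      case 2
      then show ?thesis by (intro exI[of _ "\<lambda>x h. 0"]) (auto intro!: algebra_gen.base simp: S_def)
    qed
  qed (auto intro!: algebra_gen.base simp: S_def)
qed

text \<open>One pair of factors per coordinate, positive exactly between the two faces of the box;
  as \<open>e\<close> tends to 0 the product tends pointwise to the indicator of the open
  box.\<close>

definition box_bump :: "'a::euclidean_space \<Rightarrow> 'a \<Rightarrow> real \<Rightarrow> 'a \<Rightarrow> complex" where
  "box_bump a c e x = (\<Prod>b\<in>Basis. complex_of_real (bmp e 0 (x \<bullet> b + - (a \<bullet> b))) * complex_of_real (bmp e 0 (x \<bullet> (- b) + c \<bullet> b)))"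

lemma box_bump_smooth: "e > 0 \<Longrightarrow> smooth_fun (box_bump a c e)"
  unfolding box_bump_def by (intro smooth_fun_prod smooth_fun_mult smooth_fun_bmp) auto

lemma box_bump_outside: "x \<notin> box a c \<Longrightarrow> box_bump a c e x = 0"
  by (auto simp: box_bump_def mem_box bmp_def)

lemma box_bump_test:
  assumes "e > 0" "cbox a c \<subseteq> D" shows "test_fun D (box_bump a c e)"
proof -
  have "{x. box_bump a c e x \<noteq> 0} \<subseteq> cbox a c" using box_bump_outside box_subset_cbox by blast
  then have "closure {x. box_bump a c e x \<noteq> 0} \<subseteq> cbox a c" by (intro closure_minimal) auto
  moreover from this have "compact (closure {x. box_bump a c e x \<noteq> 0})"
    by (metis bounded_cbox bounded_subset closed_closure compact_eq_bounded_closed)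
  ultimately show ?thesis unfolding test_fun_def using assms box_bump_smooth[of e a c] by auto
qed

lemma box_bump_norm_le: "e > 0 \<Longrightarrow> cmod (box_bump a c e x) \<le> 1"
  unfolding box_bump_def prod_norm[symmetric] norm_mult
  by (intro prod_le_1) (auto simp: bmp_def intro!: mult_le_one)

lemma box_bump_lim: "(\<lambda>n. box_bump a c (1 / real (Suc n)) x) \<longlonglongrightarrow> indicator (box a c) x"
proof (cases "x \<in> box a c")
  case True
  have b: "(\<lambda>n. bmp (1 / real (Suc n)) 0 t) \<longlonglongrightarrow> 1" if "t > 0" for t
  proof -
    have "(\<lambda>n. - (1 / real (Suc n)) / t) \<longlonglongrightarrow> - 0 / t"
      using LIMSEQ_inverse_real_of_nat that by (intro tendsto_intros) (auto simp: inverse_eq_divide)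
    then have "(\<lambda>n. exp (- (1 / real (Suc n)) / t)) \<longlonglongrightarrow> exp (- 0 / t)" by (rule tendsto_exp)
    then show ?thesis using that by (simp add: bmp_def)
  qed
  have "(\<lambda>n. box_bump a c (1 / real (Suc n)) x) \<longlonglongrightarrow> (\<Prod>b\<in>(Basis::'a set). complex_of_real 1 * complex_of_real 1)"
    unfolding box_bump_def
    by (intro tendsto_prod tendsto_mult tendsto_of_real b) (use True in \<open>auto simp: mem_box\<close>)
  then show ?thesis using True by simp
next
  case False
  then show ?thesis by (simp add: box_bump_outside)
qed

lemma lebesgue_on_integral:
  fixes f :: "'a::euclidean_space \<Rightarrow> 'b::{banach, second_countable_topology}"
  assumes "D \<in> sets lebesgue"
  shows "integral\<^sup>L (lebesgue_on D) f = (LINT x:D|lebesgue. f x)"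
    "integrable (lebesgue_on D) f \<longleftrightarrow> set_integrable lebesgue D f"
  using assms by (simp_all add: integral_restrict_space integrable_restrict_space set_lebesgue_integral_def set_integrable_def)

text \<open>Box bumps converge boundedly to indicators, so the integral of \<open>g\<close> over
  every box inside the domain vanishes. Lebesgue differentiation along shrinking cubes then gives
  the pointwise statement.\<close>

theorem fundamental_lemma:
  fixes D :: "'a::euclidean_space set" and g :: "'a \<Rightarrow> complex"
  assumes D: "open D" and g: "integrable (lebesgue_on D) g"
    and zero: "\<And>\<phi>. test_fun D \<phi> \<Longrightarrow> (\<integral>x. g x * \<phi> x \<partial>lebesgue_on D) = 0"
  shows "AE x in lebesgue_on D. g x = 0"
proof -
  have Ds [measurable]: "D \<in> sets lebesgue" using D by auto
  define G where "G x = indicator D x *\<^sub>R g x" for x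
  have G: "integrable lebesgue G" using g unfolding G_def lebesgue_on_integral(2)[OF Ds] set_integrable_def .
  have box0: "integral (cbox a c) G = 0" if ac: "cbox a c \<subseteq> D" for a c
  proof -
    have "(\<lambda>n. \<integral>x. G x * box_bump a c (1 / real (Suc n)) x \<partial>lebesgue) \<longlonglongrightarrow> (\<integral>x. G x * indicator (box a c) x \<partial>lebesgue)"
    proof (rule integral_dominated_convergence[where w = "\<lambda>x. norm (G x)"])
      show "(\<lambda>x. G x * indicator (box a c) x) \<in> borel_measurable lebesgue"
        by (intro borel_measurable_times borel_measurable_integrable[OF G] borel_measurable_indicator) auto
      have "box_bump a c (1 / real (Suc n)) \<in> borel_measurable lebesgue" for n
        using borel_measurable_continuous_onI[OF smooth_fun_continuous[OF box_bump_smooth], of "1 / real (Suc n)" a c]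
        by (intro measurable_completion) auto
      then show "(\<lambda>x. G x * box_bump a c (1 / real (Suc n)) x) \<in> borel_measurable lebesgue" for n
        by (intro borel_measurable_times borel_measurable_integrable[OF G])
      show "AE x in lebesgue. (\<lambda>n. G x * box_bump a c (1 / real (Suc n)) x) \<longlonglongrightarrow> G x * indicator (box a c) x"
        by (intro AE_I2 tendsto_intros box_bump_lim)
      show "AE x in lebesgue. norm (G x * box_bump a c (1 / real (Suc n)) x) \<le> norm (G x)" for n
        using box_bump_norm_le[of "1 / real (Suc n)" a c] by (intro AE_I2) (simp add: norm_mult mult_left_le)
    qed (use G in auto)
    moreover have "(\<integral>x. G x * box_bump a c (1 / real (Suc n)) x \<partial>lebesgue) = 0" for n
      using zero[OF box_bump_test[OF _ ac], of "1 / real (Suc n)"]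
      by (simp add: lebesgue_on_integral(1)[OF Ds] set_lebesgue_integral_def G_def)
    ultimately have "(\<integral>x. G x * indicator (box a c) x \<partial>lebesgue) = 0" by (simp add: LIMSEQ_const_iff)
    then have "(LINT x:box a c|lebesgue. G x) = 0"
      unfolding set_lebesgue_integral_def by (simp add: scaleR_conv_of_real mult.commute of_real_indicator)
    moreover have "set_integrable lebesgue (box a c) G"
      unfolding set_integrable_def using G by (intro integrable_mult_indicator) auto
    ultimately have "integral (box a c) G = 0" using set_lebesgue_integral_eq_integral(2) by metis
    then show ?thesis by (simp add: integral_open_interval)
  qed
  have "G integrable_on cbox a c" for a c
    using integrable_on_lebesgue[OF G] integrable_on_subcbox by blast
  then obtain N where N: "negligible N"
      "\<And>x e. \<lbrakk>x \<notin> N; 0 < e\<rbrakk> \<Longrightarrow> \<exists>d>0. \<forall>h. 0 < h \<and> h < d \<longrightarrow>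
           norm (integral (cbox x (x + h *\<^sub>R One)) G /\<^sub>R h ^ DIM('a) - G x) < e"
    using integrable_ccontinuous_explicit[of G] by metis
  have zeroG: "G x = 0" if x: "x \<in> D" "x \<notin> N" for x
  proof (rule ccontr)
    assume "G x \<noteq> 0"
    then obtain d where d: "d > 0" "\<And>h. 0 < h \<Longrightarrow> h < d \<Longrightarrow>
        norm (integral (cbox x (x + h *\<^sub>R One)) G /\<^sub>R h ^ DIM('a) - G x) < norm (G x)"
      using N(2)[OF x(2), of "norm (G x)"] by auto
    obtain r where r: "r > 0" "cball x r \<subseteq> D" using D x(1) open_contains_cball by blast
    \<comment> \<open>The cube with corner \<open>x\<close> and side \<open>h\<close> has diameter
      \<open>h * norm One\<close>, which this choice keeps below \<open>r\<close>, so the cube stays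
      in the domain.\<close>
    define h where "h = min (d/2) (r / (1 + norm (One::'a)))"
    have h: "0 < h" "h < d" using d r by (auto simp: h_def min_less_iff_disj add_pos_nonneg)
    have "cbox x (x + h *\<^sub>R One) \<subseteq> cball x r"
    proof
      fix y assume y: "y \<in> cbox x (x + h *\<^sub>R One)"
      have "norm (y - x) \<le> norm (h *\<^sub>R One :: 'a)"
        by (rule norm_le_componentwise) (use y h in \<open>auto simp: mem_box inner_diff_left inner_add_left\<close>)
      also have "\<dots> = h * norm (One::'a)" using h by simp
      also have "\<dots> \<le> h * (1 + norm (One::'a))" using h by simp
      also have "\<dots> \<le> r / (1 + norm (One::'a)) * (1 + norm (One::'a))" by (intro mult_right_mono) (auto simp: h_def)
      also have "\<dots> = r" using norm_ge_zero[of "One::'a"] by (simp add: add_pos_nonneg less_imp_neq[symmetric])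
      finally show "y \<in> cball x r" by (simp add: dist_norm norm_minus_commute)
    qed
    then have "integral (cbox x (x + h *\<^sub>R One)) G = 0" using box0 r by blast
    then show False using d(2)[OF h] by simp
  qed
  have "AE x in lebesgue. x \<notin> N" using N(1) by (simp add: negligible_iff_null_sets AE_not_in)
  then have "AE x in lebesgue. x \<in> D \<longrightarrow> g x = 0"
    by eventually_elim (use zeroG in \<open>auto simp: G_def indicator_def split: if_splits\<close>)
  then show ?thesis by (subst AE_restrict_space_iff) auto
qed

section \<open>Supports, integrals and integration by parts for test functions\<close>

abbreviation pdv :: "('a::euclidean_space \<Rightarrow> complex) \<Rightarrow> 'a \<Rightarrow> 'a \<Rightarrow> complex" where
  "pdv \<phi> b x \<equiv> frechet_derivative \<phi> (at x) b"

lemma compact_closure_subset: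
  fixes K :: "'a::euclidean_space set"
  shows "compact K \<Longrightarrow> closure A \<subseteq> K \<Longrightarrow> compact (closure A)"
  by (meson bounded_subset closed_closure compact_eq_bounded_closed)

lemma test_fun_smooth: "test_fun D \<phi> \<Longrightarrow> smooth_fun \<phi>"
  by (simp add: test_fun_def)

lemma compact_support_partial_eq_0:
  assumes "closed K" "\<And>y. y \<notin> K \<Longrightarrow> f y = (0::complex)" "x \<notin> K" "(f has_derivative f') (at x)"
  shows "f' = (\<lambda>h. 0)"
proof -
  have "((\<lambda>y. 0) has_derivative f') (at x)"
    by (rule has_derivative_transform_within_open[OF assms(4), of "- K"]) (use assms in auto)
  then show ?thesis using has_derivative_unique[OF _ has_derivative_const] by blast
qed

lemma test_fun_pdv:
  assumes "test_fun D \<phi>" "b \<in> Basis" shows "test_fun D (pdv \<phi> b)"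
proof -
  let ?K = "closure {x. \<phi> x \<noteq> 0}"
  have "pdv \<phi> b x = 0" if "x \<notin> ?K" for x
    using compact_support_partial_eq_0[OF closed_closure _ that smooth_fun_has_derivative[OF test_fun_smooth[OF assms(1)]]]
      closure_subset[of "{x. \<phi> x \<noteq> 0}"] by (metis (mono_tags, lifting) mem_Collect_eq subsetD)
  then have "closure {x. pdv \<phi> b x \<noteq> 0} \<subseteq> ?K" by (intro closure_minimal) auto
  then show ?thesis using assms smooth_fun_partial[OF test_fun_smooth[OF assms(1)] assms(2)]
      compact_closure_subset[of ?K "{x. pdv \<phi> b x \<noteq> 0}"] unfolding test_fun_def by blast
qed

lemma test_fun_supportI:
  assumes "smooth_fun g" "test_fun D \<phi>" "test_fun D \<psi>" "\<And>x. \<phi> x = 0 \<Longrightarrow> \<psi> x = 0 \<Longrightarrow> g x = 0"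
  shows "test_fun D g"
proof -
  let ?K = "closure {x. \<phi> x \<noteq> 0} \<union> closure {x. \<psi> x \<noteq> 0}"
  have "{x. g x \<noteq> 0} \<subseteq> ?K"
    using assms(4) closure_subset[of "{x. \<phi> x \<noteq> 0}"] closure_subset[of "{x. \<psi> x \<noteq> 0}"] by blast
  then have "closure {x. g x \<noteq> 0} \<subseteq> ?K" by (intro closure_minimal) auto
  moreover have "compact ?K" using assms by (auto simp: test_fun_def)
  moreover have "?K \<subseteq> D" using assms by (auto simp: test_fun_def)
  ultimately show ?thesis using assms(1) compact_closure_subset[of ?K "{x. g x \<noteq> 0}"] unfolding test_fun_def by blast
qed

lemma test_fun_add: "test_fun D f \<Longrightarrow> test_fun D g \<Longrightarrow> test_fun D (\<lambda>x. f x + g x)"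
  by (rule test_fun_supportI[of _ D f g]) (auto intro: smooth_fun_add test_fun_smooth)

lemma test_fun_mult: "smooth_fun g \<Longrightarrow> test_fun D f \<Longrightarrow> test_fun D (\<lambda>x. g x * f x)"
  by (rule test_fun_supportI[of _ D f f]) (auto intro: smooth_fun_mult test_fun_smooth)

lemma test_fun_cmult: "test_fun D f \<Longrightarrow> test_fun D (\<lambda>x. c * f x)"
  by (rule test_fun_mult[OF smooth_fun_const])

lemma test_fun_cnj: "test_fun D f \<Longrightarrow> test_fun D (\<lambda>x. cnj (f x))"
  by (rule test_fun_supportI[of _ D f f]) (auto intro: smooth_fun_cnj test_fun_smooth)

lemma test_fun_zero: "test_fun D (\<lambda>x. 0)"
  by (simp add: test_fun_def smooth_fun_const)

lemma test_fun_outside: "test_fun D f \<Longrightarrow> x \<notin> D \<Longrightarrow> f x = 0"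
  using closure_subset[of "{x. f x \<noteq> 0}"] by (auto simp: test_fun_def)

lemma test_fun_continuous: "test_fun D f \<Longrightarrow> continuous_on S f"
  by (meson smooth_fun_continuous test_fun_smooth continuous_on_subset subset_UNIV)

lemma test_fun_borel [measurable_dest]: "test_fun D f \<Longrightarrow> f \<in> borel_measurable borel"
  by (rule borel_measurable_continuous_onI) (rule test_fun_continuous)

lemma emeasure_lborel_compact_finite: "compact K \<Longrightarrow> emeasure lborel K < top"
  using emeasure_bounded_finite[OF compact_imp_bounded[of K]] by simp

lemma continuous_bounded_of_support:
  assumes "compact K" "continuous_on UNIV f" "\<And>x. x \<notin> K \<Longrightarrow> f x = (0::complex)"
  shows "\<exists>B\<ge>0. \<forall>x. cmod (f x) \<le> B"
proof -
  have "bounded (f ` K)"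
    by (intro compact_imp_bounded compact_continuous_image continuous_on_subset[OF assms(2)] assms(1)) auto
  then obtain B where "\<And>x. x \<in> K \<Longrightarrow> cmod (f x) \<le> B" by (auto simp: bounded_iff)
  then show ?thesis using assms(3) by (intro exI[of _ "max B 0"]) (auto simp: le_max_iff_disj)
qed

lemma integrable_of_support:
  fixes f :: "'a::euclidean_space \<Rightarrow> complex"
  assumes "compact K" "continuous_on UNIV f" "\<And>x. x \<notin> K \<Longrightarrow> f x = 0"
  shows "integrable lborel f"
proof -
  obtain B where B: "B \<ge> 0" "\<And>x. cmod (f x) \<le> B" using continuous_bounded_of_support[OF assms] by blast
  have [measurable]: "f \<in> borel_measurable borel" by (rule borel_measurable_continuous_onI[OF assms(2)])
  have "integrable lborel (\<lambda>x. indicator K x *\<^sub>R B)"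
    using assms(1) by (intro integrable_scaleR_left integrable_real_indicator) (auto simp: emeasure_lborel_compact_finite compact_imp_closed)
  then show ?thesis
    by (rule Bochner_Integration.integrable_bound) (use B assms(3) in \<open>auto simp: indicator_def\<close>)
qed

lemma lborel_integral_shift:
  fixes f :: "'a::euclidean_space \<Rightarrow> 'b::{banach, second_countable_topology}"
  assumes "f \<in> borel_measurable borel"
  shows "(\<integral>x. f (x + z) \<partial>lborel) = (\<integral>x. f x \<partial>lborel)"
proof -
  have "(\<integral>x. f x \<partial>lborel) = (\<integral>x. f x \<partial>distr lborel borel ((+) z))" by (simp add: lborel_distr_plus)
  also have "\<dots> = (\<integral>x. f (z + x) \<partial>lborel)" by (rule integral_distr) (use assms in auto)
  finally show ?thesis by (simp add: add.commute)
qed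

lemma lborel_nn_integral_shift:
  fixes f :: "'a::euclidean_space \<Rightarrow> ennreal"
  assumes "f \<in> borel_measurable borel"
  shows "(\<integral>\<^sup>+x. f (x + z) \<partial>lborel) = (\<integral>\<^sup>+x. f x \<partial>lborel)"
proof -
  have "(\<integral>\<^sup>+x. f x \<partial>lborel) = (\<integral>\<^sup>+x. f x \<partial>distr lborel borel ((+) z))" by (simp add: lborel_distr_plus)
  also have "\<dots> = (\<integral>\<^sup>+x. f (z + x) \<partial>lborel)" by (rule nn_integral_distr) (use assms in auto)
  finally show ?thesis by (simp add: add.commute)
qed

text \<open>By translation invariance the integral of every difference quotient is 0; dominated
  convergence carries this over to the derivative.\<close>

lemma integral_partial_eq_0:
  fixes f :: "'a::euclidean_space \<Rightarrow> complex"
  assumes b: "b \<in> Basis" and d: "\<And>x. (f has_derivative f' x) (at x)"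
    and c: "continuous_on UNIV (\<lambda>x. f' x b)" and K: "compact K" "\<And>x. x \<notin> K \<Longrightarrow> f x = 0"
  shows "(\<integral>x. f' x b \<partial>lborel) = 0"
proof -
  have nb: "norm b = 1" using b by simp
  have fc: "continuous_on UNIV f" using has_derivative_continuous[OF d] by (simp add: continuous_on_eq_continuous_at)
  have f'0: "f' x b = 0" if "x \<notin> K" for x
    using compact_support_partial_eq_0[OF compact_imp_closed[OF K(1)] K(2) that d] by simp
  obtain B where B: "B \<ge> 0" "\<And>x. cmod (f' x b) \<le> B" using continuous_bounded_of_support[OF K(1) c f'0] by blast
  have [measurable]: "f \<in> borel_measurable borel" by (rule borel_measurable_continuous_onI[OF fc])
  have [measurable]: "(\<lambda>x. f' x b) \<in> borel_measurable borel" by (rule borel_measurable_continuous_onI[OF c])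
  have fi: "integrable lborel f" by (rule integrable_of_support[OF K(1) fc K(2)])
  define h where "h n = 1 / real (Suc n)" for n
  have h: "0 < h n" "h n \<le> 1" for n by (simp_all add: h_def)
  have h0: "h \<longlonglongrightarrow> 0" unfolding h_def using LIMSEQ_inverse_real_of_nat by (simp add: inverse_eq_divide)
  define q where "q n x = (f (x + h n *\<^sub>R b) - f x) / complex_of_real (h n)" for n x
  have [measurable]: "q n \<in> borel_measurable borel" for n unfolding q_def by measurable
  \<comment> \<open>The compact set of points from which a segment of length at most 1 in direction
    \<open>b\<close> meets \<open>K\<close>; it contains the supports of all difference quotients,
    so one dominating function suffices.\<close>
  define K' where "K' = (\<lambda>(x, t). x - t *\<^sub>R b) ` (K \<times> {0..1::real})"
  have K': "compact K'" unfolding K'_def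
    by (intro compact_continuous_image compact_Times K compact_Icc) (auto intro!: continuous_intros simp: case_prod_unfold)
  have q0: "q n x = 0" if "x \<notin> K'" for n x
  proof -
    have "x + t *\<^sub>R b \<notin> K" if t: "t \<in> {0..1}" for t
    proof
      assume "x + t *\<^sub>R b \<in> K"
      then have "(x + t *\<^sub>R b) - t *\<^sub>R b \<in> K'" unfolding K'_def using t by (intro image_eqI[of _ _ "(x + t *\<^sub>R b, t)"]) auto
      then show False using \<open>x \<notin> K'\<close> by simp
    qed
    from this[of 0] this[of "h n"] show ?thesis using h[of n] by (simp add: q_def K(2))
  qed
  \<comment> \<open>Mean value inequality along the segment: the quotients inherit the bound of the
    derivative.\<close>
  have qB: "cmod (q n x) \<le> B" for n x
  proof -
    have "\<exists>t\<in>{0<..<h n}. norm (f (x + h n *\<^sub>R b) - f (x + 0 *\<^sub>R b)) \<le> norm ((h n - 0) *\<^sub>R f' (x + t *\<^sub>R b) b)"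
    proof (rule mvt_general[of 0 "h n" "\<lambda>t. f (x + t *\<^sub>R b)" "\<lambda>t s. s *\<^sub>R f' (x + t *\<^sub>R b) b"])
      show "continuous_on {0..h n} (\<lambda>t. f (x + t *\<^sub>R b))"
        by (intro continuous_on_compose2[OF fc] continuous_intros) auto
      fix t
      have "((\<lambda>t. x + t *\<^sub>R b) has_derivative (\<lambda>s. s *\<^sub>R b)) (at t)" by (auto intro!: derivative_eq_intros)
      from has_derivative_compose[OF this d]
      show "((\<lambda>t. f (x + t *\<^sub>R b)) has_derivative (\<lambda>s. s *\<^sub>R f' (x + t *\<^sub>R b) b)) (at t)"
        using linear_cmul[OF has_derivative_linear[OF d]] by simp
    qed (rule h)
    then obtain t where "cmod (f (x + h n *\<^sub>R b) - f x) \<le> h n * cmod (f' (x + t *\<^sub>R b) b)" using h(1)[of n] by auto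
    also have "\<dots> \<le> h n * B" using h(1)[of n] B(2) by (intro mult_left_mono) auto
    finally show ?thesis using h(1)[of n] by (simp add: q_def norm_divide field_simps)
  qed
  have qi: "(\<integral>x. q n x \<partial>lborel) = 0" for n
  proof -
    have "integrable lborel (\<lambda>x. f (x + h n *\<^sub>R b))"
    proof -
      have "integrable (distr lborel borel ((+) (h n *\<^sub>R b))) f" using fi by (simp add: lborel_distr_plus)
      then have "integrable lborel (\<lambda>x. f (h n *\<^sub>R b + x))" by (rule integrable_distr[rotated]) simp
      then show ?thesis by (simp add: add.commute)
    qed
    then have "(\<integral>x. q n x \<partial>lborel) = ((\<integral>x. f (x + h n *\<^sub>R b) \<partial>lborel) - (\<integral>x. f x \<partial>lborel)) / complex_of_real (h n)"
      unfolding q_def using fi by (simp add: Bochner_Integration.integral_diff)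
    then show ?thesis using lborel_integral_shift[of f "h n *\<^sub>R b"] by simp
  qed
  have "(\<lambda>n. \<integral>x. q n x \<partial>lborel) \<longlonglongrightarrow> (\<integral>x. f' x b \<partial>lborel)"
  proof (rule integral_dominated_convergence[where w = "\<lambda>x. indicator K' x *\<^sub>R B"])
    show "integrable lborel (\<lambda>x. indicator K' x *\<^sub>R B)"
      using K' by (intro integrable_scaleR_left integrable_real_indicator) (auto simp: emeasure_lborel_compact_finite compact_imp_closed)
    show "AE x in lborel. norm (q n x) \<le> indicator K' x *\<^sub>R B" for n
      using qB q0 by (intro AE_I2) (auto simp: indicator_def)
    show "AE x in lborel. (\<lambda>n. q n x) \<longlonglongrightarrow> f' x b"
    proof (rule AE_I2)
      fix x
      have l: "((\<lambda>y. norm (f y - f x - f' x (y - x)) / norm (y - x)) \<longlongrightarrow> 0) (at x)"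
        using d[of x] by (simp add: has_derivative_iff_norm)
      have y: "filterlim (\<lambda>n. x + h n *\<^sub>R b) (at x) sequentially"
        unfolding filterlim_at
      proof
        show "\<forall>\<^sub>F n in sequentially. x + h n *\<^sub>R b \<in> UNIV \<and> x + h n *\<^sub>R b \<noteq> x" using h(1) nb by (auto simp: less_imp_neq[symmetric])
        have "(\<lambda>n. x + h n *\<^sub>R b) \<longlonglongrightarrow> x + 0 *\<^sub>R b" by (intro tendsto_intros h0)
        then show "(\<lambda>n. x + h n *\<^sub>R b) \<longlonglongrightarrow> x" by simp
      qed
      have "(\<lambda>n. norm (f (x + h n *\<^sub>R b) - f x - f' x (h n *\<^sub>R b)) / norm (h n *\<^sub>R b)) \<longlonglongrightarrow> 0"
        using filterlim_compose[OF l y] by simp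
      moreover have "norm (f (x + h n *\<^sub>R b) - f x - f' x (h n *\<^sub>R b)) / norm (h n *\<^sub>R b) = norm (q n x - f' x b)" for n
      proof -
        have "f' x (h n *\<^sub>R b) = complex_of_real (h n) * f' x b"
          using linear_cmul[OF has_derivative_linear[OF d]] by (simp add: scaleR_conv_of_real)
        then have "q n x - f' x b = (f (x + h n *\<^sub>R b) - f x - f' x (h n *\<^sub>R b)) / complex_of_real (h n)"
          using h(1)[of n] by (simp add: q_def field_simps)
        then show ?thesis using h(1)[of n] nb by (simp add: norm_divide)
      qed
      ultimately show "(\<lambda>n. q n x) \<longlonglongrightarrow> f' x b" by (simp add: tendsto_norm_zero_iff LIM_zero_cancel)
    qed
  qed measurable
  then show ?thesis by (simp add: qi LIMSEQ_const_iff)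
qed

lemma lebesgue_on_eq_lborel:
  fixes f :: "'a::euclidean_space \<Rightarrow> 'b::{banach, second_countable_topology}"
  assumes D: "D \<in> sets lebesgue" and f: "f \<in> borel_measurable borel" and z: "\<And>x. x \<notin> D \<Longrightarrow> f x = 0"
  shows "(\<integral>x. f x \<partial>lebesgue_on D) = (\<integral>x. f x \<partial>lborel)" "integrable (lebesgue_on D) f \<longleftrightarrow> integrable lborel f"
proof -
  have e: "(\<lambda>x. indicator D x *\<^sub>R f x) = f" using z by (auto simp: indicator_def fun_eq_iff)
  show "(\<integral>x. f x \<partial>lebesgue_on D) = (\<integral>x. f x \<partial>lborel)" "integrable (lebesgue_on D) f \<longleftrightarrow> integrable lborel f"
    using D f by (simp_all add: integral_restrict_space integrable_restrict_space e integral_completion integrable_completion)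
qed

lemma test_fun_integrable: "test_fun D f \<Longrightarrow> integrable lborel f"
  by (rule integrable_of_support[of "closure {x. f x \<noteq> 0}"])
    (use closure_subset[of "{x. f x \<noteq> 0}"] in \<open>auto simp: test_fun_def intro: smooth_fun_continuous\<close>)

lemma test_fun_sqi:
  assumes "test_fun D f" shows "sqi lborel f"
proof -
  have "integrable lborel (\<lambda>x. f x * cnj (f x))"
    by (rule test_fun_integrable[OF test_fun_mult[OF test_fun_smooth[OF assms] test_fun_cnj[OF assms]]])
  then have "integrable lborel (\<lambda>x. Re (f x * cnj (f x)))" by (rule integrable_Re)
  then show ?thesis using test_fun_borel[OF assms]
    by (simp add: sqi_def complex_mult_cnj cmod_power2)
qed

lemma borel_measurable_lebesgue_on:
  assumes "f \<in> borel_measurable borel" shows "f \<in> borel_measurable (lebesgue_on D)"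
  using assms by (intro measurable_restrict_space1 measurable_completion) simp

lemma test_fun_sqi_on:
  assumes "D \<in> sets lebesgue" "test_fun D f" shows "sqi (lebesgue_on D) f" "nrm2 (lebesgue_on D) f = nrm2 lborel f"
proof -
  have m: "(\<lambda>x. (cmod (f x))\<^sup>2) \<in> borel_measurable borel" using test_fun_borel[OF assms(2)] by measurable
  note e = lebesgue_on_eq_lborel[OF assms(1) m] test_fun_outside[OF assms(2)]
  show "sqi (lebesgue_on D) f" using e test_fun_sqi[OF assms(2)] borel_measurable_lebesgue_on[OF test_fun_borel[OF assms(2)]]
    by (simp add: sqi_def)
  show "nrm2 (lebesgue_on D) f = nrm2 lborel f" using e by (simp add: nrm2_def)
qed

text \<open>Only the product with \<eta> needs compact support. This generality serves compositions
  f(\<phi>) in the chain rule, which need not vanish where \<phi> does and are given only with a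
  continuous partial derivative.\<close>

lemma integration_by_parts:
  assumes D: "D \<in> sets lebesgue" and b: "b \<in> Basis" and d: "\<And>x. (f has_derivative f' x) (at x)"
    and c: "continuous_on UNIV (\<lambda>x. f' x b)" and t: "test_fun D \<eta>"
  shows "(\<integral>x. f x * pdv \<eta> b x \<partial>lebesgue_on D) = - (\<integral>x. f' x b * \<eta> x \<partial>lebesgue_on D)"
proof -
  let ?K = "closure {x. \<eta> x \<noteq> 0}"
  have K: "compact ?K" using t by (simp add: test_fun_def)
  have z: "\<eta> x = 0" if "x \<notin> ?K" for x using that closure_subset[of "{x. \<eta> x \<noteq> 0}"] by auto
  have z': "pdv \<eta> b x = 0" if "x \<notin> ?K" for x
    using compact_support_partial_eq_0[OF closed_closure z that smooth_fun_has_derivative[OF test_fun_smooth[OF t]]] by simp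
  have fc: "continuous_on UNIV f" using has_derivative_continuous[OF d] by (simp add: continuous_on_eq_continuous_at)
  have c1: "continuous_on UNIV (\<lambda>x. f x * pdv \<eta> b x)" "continuous_on UNIV (\<lambda>x. f' x b * \<eta> x)"
    by (intro continuous_intros fc c test_fun_continuous[OF t] test_fun_continuous[OF test_fun_pdv[OF t b]])+
  have i: "integrable lborel (\<lambda>x. f x * pdv \<eta> b x)" "integrable lborel (\<lambda>x. f' x b * \<eta> x)"
    by (rule integrable_of_support[OF K c1(1)], metis z' mult_zero_right,
        rule integrable_of_support[OF K c1(2)], metis z mult_zero_right)
  have "(\<integral>x. f x * pdv \<eta> b x + f' x b * \<eta> x \<partial>lborel) = 0"
  proof (rule integral_partial_eq_0[OF b, of "\<lambda>x. f x * \<eta> x" "\<lambda>x h. f x * pdv \<eta> h x + f' x h * \<eta> x"])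
    show "((\<lambda>x. f x * \<eta> x) has_derivative (\<lambda>h. f x * pdv \<eta> h x + f' x h * \<eta> x)) (at x)" for x
      by (rule has_derivative_mult[OF d smooth_fun_has_derivative[OF test_fun_smooth[OF t]]])
    show "continuous_on UNIV (\<lambda>x. f x * pdv \<eta> b x + f' x b * \<eta> x)" by (intro continuous_on_add c1)
  qed (fact K, metis z mult_zero_right)
  then have "(\<integral>x. f x * pdv \<eta> b x \<partial>lborel) = - (\<integral>x. f' x b * \<eta> x \<partial>lborel)"
    using i by (simp add: Bochner_Integration.integral_add add_eq_0_iff)
  moreover have "(\<integral>x. f x * pdv \<eta> b x \<partial>lebesgue_on D) = (\<integral>x. f x * pdv \<eta> b x \<partial>lborel)"
    by (rule lebesgue_on_eq_lborel[OF D borel_measurable_continuous_onI[OF c1(1)]]) (simp add: test_fun_outside[OF test_fun_pdv[OF t b]])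
  moreover have "(\<integral>x. f' x b * \<eta> x \<partial>lebesgue_on D) = (\<integral>x. f' x b * \<eta> x \<partial>lborel)"
    by (rule lebesgue_on_eq_lborel[OF D borel_measurable_continuous_onI[OF c1(2)]]) (simp add: test_fun_outside[OF t])
  ultimately show ?thesis by simp
qed

section \<open>Dirichlet integral and translation estimate\<close>

definition gradsq :: "('a::euclidean_space \<Rightarrow> complex) \<Rightarrow> real" where
  "gradsq \<phi> = (\<Sum>b\<in>Basis. (nrm2 lborel (pdv \<phi> b))\<^sup>2)"

lemma gradsq_nonneg: "0 \<le> gradsq \<phi>" by (simp add: gradsq_def sum_nonneg)

lemma derivative_norm_bound:
  fixes z :: "'a::euclidean_space"
  assumes "smooth_fun \<phi>"
  shows "(cmod (frechet_derivative \<phi> (at x) z))\<^sup>2 \<le> (norm z)\<^sup>2 * (\<Sum>b\<in>Basis. (cmod (pdv \<phi> b x))\<^sup>2)"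
proof -
  have lin: "linear (frechet_derivative \<phi> (at x))" using has_derivative_linear[OF smooth_fun_has_derivative[OF assms]] .
  have "frechet_derivative \<phi> (at x) z = frechet_derivative \<phi> (at x) (\<Sum>b\<in>Basis. (z \<bullet> b) *\<^sub>R b)"
    by (simp add: euclidean_representation)
  also have "\<dots> = (\<Sum>b\<in>Basis. (z \<bullet> b) *\<^sub>R pdv \<phi> b x)"
    by (simp add: linear_sum[OF lin] linear_cmul[OF lin])
  finally have "cmod (frechet_derivative \<phi> (at x) z) \<le> (\<Sum>b\<in>Basis. \<bar>z \<bullet> b\<bar> * cmod (pdv \<phi> b x))"
    by (metis (no_types, lifting) norm_scaleR norm_sum sum.cong)
  then have "(cmod (frechet_derivative \<phi> (at x) z))\<^sup>2 \<le> (\<Sum>b\<in>Basis. \<bar>z \<bullet> b\<bar> * cmod (pdv \<phi> b x))\<^sup>2"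
    by (intro power_mono) auto
  also have "\<dots> \<le> (\<Sum>b\<in>Basis. \<bar>z \<bullet> b\<bar>\<^sup>2) * (\<Sum>b\<in>Basis. (cmod (pdv \<phi> b x))\<^sup>2)"
    by (rule Cauchy_Schwarz_ineq_sum)
  also have "(\<Sum>b\<in>Basis. \<bar>z \<bullet> b\<bar>\<^sup>2) = (norm z)\<^sup>2"
    by (simp add: norm_eq_sqrt_inner euclidean_inner[of z z] power2_eq_square sum_nonneg)
  finally show ?thesis .
qed

text \<open>Fundamental theorem of calculus on the segment from \<open>x\<close> to
  \<open>x + z\<close>, then Cauchy-Schwarz against the constant 1 on the unit interval.\<close>

lemma line_sq_bound:
  fixes z :: "'a::euclidean_space"
  assumes "smooth_fun \<phi>" and c: "continuous_on UNIV (\<lambda>x. frechet_derivative \<phi> (at x) z)"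
  shows "ennreal ((cmod (\<phi> (x + z) - \<phi> x))\<^sup>2)
     \<le> (\<integral>\<^sup>+t. ennreal ((cmod (frechet_derivative \<phi> (at (x + t *\<^sub>R z)) z))\<^sup>2) * indicator {0..1} t \<partial>lborel)"
proof -
  let ?M = "restrict_space lborel {0..1::real}"
  let ?g = "\<lambda>t. frechet_derivative \<phi> (at (x + t *\<^sub>R z)) z"
  have gc: "continuous_on UNIV ?g" by (intro continuous_on_compose2[OF c] continuous_intros) auto
  have gm [measurable]: "?g \<in> borel_measurable borel" by (rule borel_measurable_continuous_onI[OF gc])
  have vd: "((\<lambda>t. \<phi> (x + t *\<^sub>R z)) has_vector_derivative ?g t) (at t within {0..1})" for t
  proof -
    have "((\<lambda>t. x + t *\<^sub>R z) has_derivative (\<lambda>s. s *\<^sub>R z)) (at t within {0..1})" by (auto intro!: derivative_eq_intros)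
    from has_derivative_compose[OF this smooth_fun_has_derivative[OF assms(1)]]
    show ?thesis using linear_cmul[OF has_derivative_linear[OF smooth_fun_has_derivative[OF assms(1)]]]
      by (simp add: has_vector_derivative_def)
  qed
  have eq: "(\<integral>t. ?g t \<partial>?M) = \<phi> (x + z) - \<phi> x"
    using integral_FTC_Icc[of 0 1 "\<lambda>t. \<phi> (x + t *\<^sub>R z)" ?g] vd continuous_on_subset[OF gc, of "{0..1}"]
    by (simp add: integral_restrict_space)
  have sq: "sqi ?M ?g"
  proof -
    have "set_integrable lborel {0..1} (\<lambda>t. (cmod (?g t))\<^sup>2)"
      unfolding set_integrable_def
      by (rule borel_integrable_compact) (auto intro!: continuous_intros continuous_on_subset[OF gc])
    then show ?thesis by (simp add: sqi_def integrable_restrict_space set_integrable_def measurable_restrict_space1)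
  qed
  have one: "sqi ?M (\<lambda>_. 1)" "nrm2 ?M (\<lambda>_. 1) = 1"
    by (auto simp: sqi_def integrable_restrict_space nrm2_def integral_restrict_space measure_restrict_space)
  have "cmod (\<integral>t. ?g t * 1 \<partial>?M) \<le> nrm2 ?M ?g * nrm2 ?M (\<lambda>_. 1)" by (rule norm_integral_mult_le(2)[OF sq one(1)])
  then have "(cmod (\<phi> (x + z) - \<phi> x))\<^sup>2 \<le> (nrm2 ?M ?g)\<^sup>2" using eq one(2) by (intro power_mono) auto
  then have "ennreal ((cmod (\<phi> (x + z) - \<phi> x))\<^sup>2) \<le> ennreal (\<integral>t. (cmod (?g t))\<^sup>2 \<partial>?M)" by (simp add: nrm2_sq ennreal_leI)
  also have "\<dots> = (\<integral>\<^sup>+t. ennreal ((cmod (?g t))\<^sup>2) \<partial>?M)" using nn_integral_eq_integral[OF sqi_int[OF sq]] by simp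
  also have "\<dots> = (\<integral>\<^sup>+t. ennreal ((cmod (?g t))\<^sup>2) * indicator {0..1} t \<partial>lborel)"
    by (simp add: nn_integral_restrict_space)
  finally show ?thesis .
qed

lemma continuous_on_test_derivative:
  fixes z :: "'a::euclidean_space"
  assumes "smooth_fun \<phi>"
  shows "continuous_on UNIV (\<lambda>x. frechet_derivative \<phi> (at x) z)"
proof -
  have "frechet_derivative \<phi> (at x) z = (\<Sum>b\<in>Basis. (z \<bullet> b) *\<^sub>R pdv \<phi> b x)" for x
  proof -
    have lin: "linear (frechet_derivative \<phi> (at x))" using has_derivative_linear[OF smooth_fun_has_derivative[OF assms]] .
    have "frechet_derivative \<phi> (at x) z = frechet_derivative \<phi> (at x) (\<Sum>b\<in>Basis. (z \<bullet> b) *\<^sub>R b)"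
      by (simp add: euclidean_representation)
    also have "\<dots> = (\<Sum>b\<in>Basis. (z \<bullet> b) *\<^sub>R pdv \<phi> b x)"
      by (simp add: linear_sum[OF lin] linear_cmul[OF lin])
    finally show ?thesis .
  qed
  then show ?thesis
    by (simp, intro continuous_intros smooth_fun_continuous smooth_fun_partial assms)
qed

text \<open>Integrating the segment bound over \<open>x\<close>, Tonelli moves the translation into
  the inner integral, where it disappears. Both the Poincare inequality and the compactness result
  rest on this estimate.\<close>

lemma translation_estimate:
  fixes z :: "'a::euclidean_space"
  assumes t: "test_fun D \<phi>"
  shows "(\<integral>\<^sup>+x. ennreal ((cmod (\<phi> (x + z) - \<phi> x))\<^sup>2) \<partial>lborel) \<le> ennreal ((norm z)\<^sup>2 * gradsq \<phi>)"
proof -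
  define F where "F y = ennreal ((cmod (frechet_derivative \<phi> (at y) z))\<^sup>2)" for y
  have c: "continuous_on UNIV (\<lambda>x. frechet_derivative \<phi> (at x) z)"
    by (rule continuous_on_test_derivative[OF test_fun_smooth[OF t]])
  have Fm [measurable]: "F \<in> borel_measurable borel" unfolding F_def
    using borel_measurable_continuous_onI[OF c] by measurable
  have "(\<integral>\<^sup>+x. ennreal ((cmod (\<phi> (x + z) - \<phi> x))\<^sup>2) \<partial>lborel) \<le> (\<integral>\<^sup>+x. \<integral>\<^sup>+t. F (x + t *\<^sub>R z) * indicator {0..1} t \<partial>lborel \<partial>lborel)"
    unfolding F_def by (intro nn_integral_mono line_sq_bound test_fun_smooth[OF t] c)
  also have "\<dots> = (\<integral>\<^sup>+t. \<integral>\<^sup>+x. F (x + t *\<^sub>R z) * indicator {0..1} t \<partial>lborel \<partial>lborel)"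
    by (rule lborel_pair.Fubini') measurable
  also have "\<dots> = (\<integral>\<^sup>+t. (\<integral>\<^sup>+x. F x \<partial>lborel) * indicator {0..1::real} t \<partial>lborel)"
    by (simp add: nn_integral_multc lborel_nn_integral_shift)
  also have "\<dots> = (\<integral>\<^sup>+x. F x \<partial>lborel)" by (simp add: nn_integral_cmult)
  also have "\<dots> \<le> (\<integral>\<^sup>+x. ennreal ((norm z)\<^sup>2 * (\<Sum>b\<in>Basis. (cmod (pdv \<phi> b x))\<^sup>2)) \<partial>lborel)"
    unfolding F_def by (intro nn_integral_mono ennreal_leI derivative_norm_bound test_fun_smooth[OF t])
  also have "\<dots> = ennreal (\<integral>x. (norm z)\<^sup>2 * (\<Sum>b\<in>Basis. (cmod (pdv \<phi> b x))\<^sup>2) \<partial>lborel)"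
    by (intro nn_integral_eq_integral integrable_mult_right Bochner_Integration.integrable_sum sqi_int test_fun_sqi[OF test_fun_pdv[OF t]])
      (auto intro!: mult_nonneg_nonneg sum_nonneg)
  also have "(\<integral>x. (norm z)\<^sup>2 * (\<Sum>b\<in>Basis. (cmod (pdv \<phi> b x))\<^sup>2) \<partial>lborel) = (norm z)\<^sup>2 * gradsq \<phi>"
    using sqi_int[OF test_fun_sqi[OF test_fun_pdv[OF t]]]
    by (simp add: gradsq_def nrm2_sq Bochner_Integration.integral_sum)
  finally show ?thesis .
qed

section \<open>Poincare, Rellich and Ladyzhenskaya inequalities\<close>

lemma nn_integral_sq_eq: "sqi M f \<Longrightarrow> (\<integral>\<^sup>+x. ennreal ((cmod (f x))\<^sup>2) \<partial>M) = ennreal ((nrm2 M f)\<^sup>2)"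
  using nn_integral_eq_integral[OF sqi_int[of M f]] by (simp add: nrm2_sq)

text \<open>A shift by more than the diameter moves the domain off itself, so at each point of the
  domain the function equals, up to sign, its own translation difference.\<close>

lemma poincare_test:
  fixes D :: "'a::euclidean_space set"
  assumes "bounded D"
  shows "\<exists>C\<ge>0. \<forall>\<phi>. test_fun D \<phi> \<longrightarrow> (nrm2 lborel \<phi>)\<^sup>2 \<le> C * gradsq \<phi>"
proof -
  obtain B where B: "\<And>x. x \<in> D \<Longrightarrow> norm x \<le> B" using assms by (auto simp: bounded_iff)
  obtain b :: 'a where b: "b \<in> Basis" using nonempty_Basis by blast
  define z where "z = (2 * \<bar>B\<bar> + 1) *\<^sub>R b"
  have nz: "norm z = 2 * \<bar>B\<bar> + 1" using b by (simp add: z_def)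
  have out: "x + z \<notin> D" if "x \<in> D" for x
  proof
    assume "x + z \<in> D"
    then have "norm (x + z) \<le> B" "norm x \<le> B" using B that by auto
    then show False using norm_triangle_ineq4[of "x + z" x] nz by simp
  qed
  have "(nrm2 lborel \<phi>)\<^sup>2 \<le> (norm z)\<^sup>2 * gradsq \<phi>" if t: "test_fun D \<phi>" for \<phi>
  proof -
    have "cmod (\<phi> x) \<le> cmod (\<phi> (x + z) - \<phi> x)" for x
      using test_fun_outside[OF t out[of x]] test_fun_outside[OF t, of x] by (cases "x \<in> D") auto
    then have "(\<integral>\<^sup>+x. ennreal ((cmod (\<phi> x))\<^sup>2) \<partial>lborel) \<le> (\<integral>\<^sup>+x. ennreal ((cmod (\<phi> (x + z) - \<phi> x))\<^sup>2) \<partial>lborel)"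
      by (intro nn_integral_mono ennreal_leI power_mono) auto
    also have "\<dots> \<le> ennreal ((norm z)\<^sup>2 * gradsq \<phi>)" by (rule translation_estimate[OF t])
    finally show ?thesis
      using gradsq_nonneg[of \<phi>] by (simp add: nn_integral_sq_eq[OF test_fun_sqi[OF t]] ennreal_le_iff)
  qed
  then show ?thesis by (intro exI[of _ "(norm z)\<^sup>2"]) auto
qed

section \<open>Ball means and compactness in L^2\<close>

definition ball_int :: "real \<Rightarrow> ('a::euclidean_space \<Rightarrow> complex) \<Rightarrow> 'a \<Rightarrow> complex" where
  "ball_int \<rho> \<phi> x = (\<integral>z. \<phi> (x + z) \<partial>restrict_space lborel (ball 0 \<rho>))"

context
  fixes D :: "'a::euclidean_space set" and \<phi> :: "'a \<Rightarrow> complex"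
  assumes t: "test_fun D \<phi>"
begin

lemma shift_sqi: "sqi lborel (\<lambda>z. \<phi> (z + x))" "nrm2 lborel (\<lambda>z. \<phi> (z + x)) = nrm2 lborel \<phi>"
proof -
  have m [measurable]: "\<phi> \<in> borel_measurable borel" by (rule test_fun_borel[OF t])
  have "integrable (distr lborel borel ((+) x)) (\<lambda>z. (cmod (\<phi> z))\<^sup>2)"
    using sqi_int[OF test_fun_sqi[OF t]] by (simp add: lborel_distr_plus)
  then have "integrable lborel (\<lambda>z. (cmod (\<phi> (x + z)))\<^sup>2)" by (rule integrable_distr[rotated]) simp
  then show "sqi lborel (\<lambda>z. \<phi> (z + x))" by (simp add: sqi_def add.commute)
  show "nrm2 lborel (\<lambda>z. \<phi> (z + x)) = nrm2 lborel \<phi>"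
    using lborel_integral_shift[of "\<lambda>z. (cmod (\<phi> z))\<^sup>2" x] by (simp add: nrm2_def)
qed

lemma ball_sqi:
  assumes "sqi lborel f" shows "sqi (restrict_space lborel (ball 0 \<rho>)) f"
    "nrm2 (restrict_space lborel (ball 0 \<rho>)) f \<le> nrm2 lborel f"
proof -
  have i: "integrable lborel (\<lambda>x. indicator (ball 0 \<rho>) x *\<^sub>R (cmod (f x))\<^sup>2)"
    by (rule integrable_mult_indicator[OF _ sqi_int[OF assms]]) simp
  show "sqi (restrict_space lborel (ball 0 \<rho>)) f"
    using assms i by (simp add: sqi_def integrable_restrict_space measurable_restrict_space1)
  have "(\<integral>x. indicator (ball 0 \<rho>) x *\<^sub>R (cmod (f x))\<^sup>2 \<partial>lborel) \<le> (\<integral>x. (cmod (f x))\<^sup>2 \<partial>lborel)"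
    by (rule integral_mono[OF i sqi_int[OF assms]]) (auto simp: indicator_def)
  then show "nrm2 (restrict_space lborel (ball 0 \<rho>)) f \<le> nrm2 lborel f"
    by (simp add: nrm2_def integral_restrict_space)
qed

lemma ball_one:
  "sqi (restrict_space lborel (ball (0::'a) \<rho>)) (\<lambda>_. 1)"
  "(nrm2 (restrict_space lborel (ball (0::'a) \<rho>)) (\<lambda>_. 1))\<^sup>2 = measure lborel (ball (0::'a) \<rho>)"
  by (auto simp: sqi_def integrable_restrict_space nrm2_sq integral_restrict_space measure_restrict_space
      emeasure_bounded_finite[OF bounded_ball, unfolded infinity_ennreal_def])

lemma ball_int_bound:
  "cmod (ball_int \<rho> \<phi> x) \<le> sqrt (measure lborel (ball (0::'a) \<rho>)) * nrm2 lborel \<phi>"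
proof -
  let ?M = "restrict_space lborel (ball (0::'a) \<rho>)"
  have s: "sqi lborel (\<lambda>z. \<phi> (x + z))" using shift_sqi(1)[of x] by (simp add: add.commute)
  have "cmod (\<integral>z. \<phi> (x + z) * 1 \<partial>?M) \<le> nrm2 ?M (\<lambda>z. \<phi> (x + z)) * nrm2 ?M (\<lambda>_. 1)"
    by (rule norm_integral_mult_le(2)[OF ball_sqi(1)[OF s] ball_one(1)])
  also have "\<dots> \<le> nrm2 lborel \<phi> * sqrt (measure lborel (ball (0::'a) \<rho>))"
  proof (rule mult_mono)
    show "nrm2 ?M (\<lambda>z. \<phi> (x + z)) \<le> nrm2 lborel \<phi>"
      using ball_sqi(2)[OF s, of \<rho>] shift_sqi(2)[of x] by (simp add: add.commute)
    show "nrm2 ?M (\<lambda>_. 1) \<le> sqrt (measure lborel (ball (0::'a) \<rho>))"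
      using ball_one(2)[of \<rho>] by (metis nrm2_nonneg order_refl real_sqrt_unique)
  qed auto
  finally show ?thesis by (simp add: ball_int_def mult.commute)
qed

lemma shift_diff_sqi: "sqi lborel (\<lambda>z. \<phi> (z + x) - \<phi> (z + y))"
  by (intro sqi_diff shift_sqi)

lemma nrm2_shift_diff: "nrm2 lborel (\<lambda>z. \<phi> (z + x) - \<phi> (z + y)) \<le> norm (x - y) * sqrt (gradsq \<phi>)"
proof (rule power2_le_imp_le)
  have m [measurable]: "\<phi> \<in> borel_measurable borel" by (rule test_fun_borel[OF t])
  have "ennreal ((nrm2 lborel (\<lambda>z. \<phi> (z + x) - \<phi> (z + y)))\<^sup>2) = (\<integral>\<^sup>+z. ennreal ((cmod (\<phi> (z + x) - \<phi> (z + y)))\<^sup>2) \<partial>lborel)"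
    by (rule nn_integral_sq_eq[OF shift_diff_sqi, symmetric])
  also have "\<dots> = (\<integral>\<^sup>+z. ennreal ((cmod (\<phi> (z + (x - y)) - \<phi> z))\<^sup>2) \<partial>lborel)"
    using lborel_nn_integral_shift[of "\<lambda>z. ennreal ((cmod (\<phi> (z + (x - y)) - \<phi> z))\<^sup>2)" y] by (simp add: add.assoc)
  also have "\<dots> \<le> ennreal ((norm (x - y))\<^sup>2 * gradsq \<phi>)" by (rule translation_estimate[OF t])
  finally show "(nrm2 lborel (\<lambda>z. \<phi> (z + x) - \<phi> (z + y)))\<^sup>2 \<le> (norm (x - y) * sqrt (gradsq \<phi>))\<^sup>2"
    using gradsq_nonneg[of \<phi>] by (simp add: ennreal_le_iff power_mult_distrib)
qed (simp add: gradsq_nonneg)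

text \<open>Averaging turns the L^2 bound on translation differences into a pointwise Lipschitz
  bound; the constant depends on the radius and the Dirichlet integral only, which gives
  equicontinuity for a bounded family.\<close>

lemma ball_int_lipschitz:
  "cmod (ball_int \<rho> \<phi> x - ball_int \<rho> \<phi> y) \<le> sqrt (measure lborel (ball (0::'a) \<rho>)) * (norm (x - y) * sqrt (gradsq \<phi>))"
proof -
  let ?M = "restrict_space lborel (ball (0::'a) \<rho>)"
  have s: "sqi lborel (\<lambda>z. \<phi> (x + z))" for x using shift_sqi(1)[of x] by (simp add: add.commute)
  have i: "integrable ?M (\<lambda>z. \<phi> (x + z))" for x
    using sqi_mult_integrable[OF ball_sqi(1)[OF s] ball_one(1)] by simp
  have "ball_int \<rho> \<phi> x - ball_int \<rho> \<phi> y = (\<integral>z. (\<phi> (x + z) - \<phi> (y + z)) * 1 \<partial>?M)"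
    unfolding ball_int_def by (simp add: Bochner_Integration.integral_diff[OF i i])
  also have "cmod \<dots> \<le> nrm2 ?M (\<lambda>z. \<phi> (x + z) - \<phi> (y + z)) * nrm2 ?M (\<lambda>_. 1)"
    by (rule norm_integral_mult_le(2)[OF ball_sqi(1)[OF sqi_diff[OF s s]] ball_one(1)])
  also have "\<dots> \<le> (norm (x - y) * sqrt (gradsq \<phi>)) * sqrt (measure lborel (ball (0::'a) \<rho>))"
  proof (rule mult_mono)
    show "nrm2 ?M (\<lambda>z. \<phi> (x + z) - \<phi> (y + z)) \<le> norm (x - y) * sqrt (gradsq \<phi>)"
      using ball_sqi(2)[OF sqi_diff[OF s s], of \<rho> x y] nrm2_shift_diff[of x y] by (simp add: add.commute)
    show "nrm2 ?M (\<lambda>_. 1) \<le> sqrt (measure lborel (ball (0::'a) \<rho>))"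
      using ball_one(2)[of \<rho>] by (metis nrm2_nonneg order_refl real_sqrt_unique)
  qed (auto simp: gradsq_nonneg)
  finally show ?thesis by (simp add: mult.commute)
qed

lemma ball_int_continuous: "continuous_on UNIV (ball_int \<rho> \<phi>)"
proof -
  have "(sqrt (measure lborel (ball (0::'a) \<rho>)) * sqrt (gradsq \<phi>))-lipschitz_on UNIV (ball_int \<rho> \<phi>)"
    by (rule lipschitz_onI) (use ball_int_lipschitz[of \<rho>] gradsq_nonneg[of \<phi>] in \<open>auto simp: dist_norm mult_ac\<close>)
  then show ?thesis by (rule lipschitz_on_continuous_on)
qed

text \<open>By Cauchy-Schwarz the squared error at \<open>x\<close> is at most the mean of
  |\<phi>(x+z) - \<phi>(x)|^2 over the ball. Integrating over \<open>x\<close> first, the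
  translation estimate bounds the contribution of each \<open>z\<close> by \<rho>^2 times the
  Dirichlet integral.\<close>

lemma ball_average_error:
  assumes \<rho>: "\<rho> > 0"
  shows "(\<integral>\<^sup>+x. ennreal ((cmod (\<phi> x - ball_int \<rho> \<phi> x / measure lborel (ball (0::'a) \<rho>)))\<^sup>2) \<partial>lborel) \<le> ennreal (\<rho>\<^sup>2 * gradsq \<phi>)"
proof -
  let ?M = "restrict_space lborel (ball (0::'a) \<rho>)"
  define V where "V = measure lborel (ball (0::'a) \<rho>)"
  have V: "V > 0" using content_ball_pos[OF \<rho>, of "0::'a"] by (simp add: V_def)
  have emV: "emeasure lborel (ball (0::'a) \<rho>) = ennreal V"
    unfolding V_def by (rule emeasure_eq_ennreal_measure) (use emeasure_bounded_finite[OF bounded_ball, of "0::'a" \<rho>] in auto)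
  have m [measurable]: "\<phi> \<in> borel_measurable borel" by (rule test_fun_borel[OF t])
  have bm [measurable]: "ball (0::'a) \<rho> \<in> sets borel" by simp
  define F where "F x z = ennreal ((cmod (\<phi> (x + z) - \<phi> x))\<^sup>2)" for x z
  have "ennreal ((cmod (\<phi> x - ball_int \<rho> \<phi> x / V))\<^sup>2) \<le> ennreal (1 / V) * (\<integral>\<^sup>+z. F x z * indicator (ball 0 \<rho>) z \<partial>lborel)" for x
  proof -
    have s: "sqi ?M (\<lambda>z. \<phi> (x + z))" using ball_sqi(1)[OF shift_sqi(1)[of x]] by (simp add: add.commute)
    have sc: "sqi ?M (\<lambda>z. \<phi> x)" using sqi_cmult[OF ball_one(1), of _ "\<phi> x"] by simp
    have i: "integrable ?M (\<lambda>z. \<phi> (x + z))" using sqi_mult_integrable[OF s ball_one(1)] by simp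
    have ic: "integrable ?M (\<lambda>z. \<phi> x)" using sqi_mult_integrable[OF sc ball_one(1)] by simp
    have "(\<integral>z. (\<phi> (x + z) - \<phi> x) * 1 \<partial>?M) = ball_int \<rho> \<phi> x - V * \<phi> x"
      unfolding ball_int_def using Bochner_Integration.integral_diff[OF i ic]
      by (simp add: measure_restrict_space V_def scaleR_conv_of_real)
    then have "cmod (ball_int \<rho> \<phi> x - V * \<phi> x) \<le> nrm2 ?M (\<lambda>z. \<phi> (x + z) - \<phi> x) * nrm2 ?M (\<lambda>_. 1)"
      using norm_integral_mult_le(2)[OF sqi_diff[OF s sc] ball_one(1)] by metis
    then have "(cmod (ball_int \<rho> \<phi> x - V * \<phi> x))\<^sup>2 \<le> (nrm2 ?M (\<lambda>z. \<phi> (x + z) - \<phi> x))\<^sup>2 * V"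
      using ball_one(2)[of \<rho>] by (metis V_def norm_ge_zero power_mono power_mult_distrib)
    moreover have "cmod (\<phi> x - ball_int \<rho> \<phi> x / V) = cmod (ball_int \<rho> \<phi> x - V * \<phi> x) / V"
    proof -
      have "\<phi> x - ball_int \<rho> \<phi> x / V = (V * \<phi> x - ball_int \<rho> \<phi> x) / V" using V by (simp add: diff_divide_distrib)
      then show ?thesis using V by (simp add: norm_divide norm_minus_commute)
    qed
    moreover have "(y / V)\<^sup>2 \<le> 1 / V * k\<^sup>2" if "y\<^sup>2 \<le> k\<^sup>2 * V" for y k :: real
      using divide_right_mono[OF that, of "V\<^sup>2"] V by (simp add: power_divide power2_eq_square)
    ultimately have "(cmod (\<phi> x - ball_int \<rho> \<phi> x / V))\<^sup>2 \<le> 1 / V * (nrm2 ?M (\<lambda>z. \<phi> (x + z) - \<phi> x))\<^sup>2" by metis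
    then have "ennreal ((cmod (\<phi> x - ball_int \<rho> \<phi> x / V))\<^sup>2) \<le> ennreal (1 / V) * ennreal ((nrm2 ?M (\<lambda>z. \<phi> (x + z) - \<phi> x))\<^sup>2)"
      using V by (subst ennreal_mult[symmetric]) (auto intro: ennreal_leI)
    also have "ennreal ((nrm2 ?M (\<lambda>z. \<phi> (x + z) - \<phi> x))\<^sup>2) = (\<integral>\<^sup>+z. F x z * indicator (ball 0 \<rho>) z \<partial>lborel)"
      using nn_integral_sq_eq[OF sqi_diff[OF s sc]] by (simp add: F_def nn_integral_restrict_space)
    finally show ?thesis .
  qed
  then have "(\<integral>\<^sup>+x. ennreal ((cmod (\<phi> x - ball_int \<rho> \<phi> x / V))\<^sup>2) \<partial>lborel)
     \<le> (\<integral>\<^sup>+x. ennreal (1 / V) * (\<integral>\<^sup>+z. F x z * indicator (ball 0 \<rho>) z \<partial>lborel) \<partial>lborel)" by (rule nn_integral_mono)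
  also have "\<dots> = ennreal (1 / V) * (\<integral>\<^sup>+x. \<integral>\<^sup>+z. F x z * indicator (ball 0 \<rho>) z \<partial>lborel \<partial>lborel)"
    unfolding F_def by (rule nn_integral_cmult) measurable
  also have "(\<integral>\<^sup>+x. \<integral>\<^sup>+z. F x z * indicator (ball 0 \<rho>) z \<partial>lborel \<partial>lborel) = (\<integral>\<^sup>+z. \<integral>\<^sup>+x. F x z * indicator (ball 0 \<rho>) z \<partial>lborel \<partial>lborel)"
    unfolding F_def by (rule lborel_pair.Fubini') measurable
  also have "\<dots> \<le> (\<integral>\<^sup>+z. ennreal (\<rho>\<^sup>2 * gradsq \<phi>) * indicator (ball (0::'a) \<rho>) z \<partial>lborel)"
  proof (rule nn_integral_mono)
    fix z :: 'a
    have "(\<integral>\<^sup>+x. F x z * indicator (ball 0 \<rho>) z \<partial>lborel) = (\<integral>\<^sup>+x. F x z \<partial>lborel) * indicator (ball 0 \<rho>) z"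
      unfolding F_def by (rule nn_integral_multc) measurable
    also have "\<dots> \<le> ennreal ((norm z)\<^sup>2 * gradsq \<phi>) * indicator (ball 0 \<rho>) z"
      unfolding F_def by (intro mult_right_mono translation_estimate[OF t]) auto
    also have "\<dots> \<le> ennreal (\<rho>\<^sup>2 * gradsq \<phi>) * indicator (ball 0 \<rho>) z"
      using gradsq_nonneg[of \<phi>] by (auto simp: indicator_def intro!: ennreal_leI mult_right_mono power_mono)
    finally show "(\<integral>\<^sup>+x. F x z * indicator (ball 0 \<rho>) z \<partial>lborel) \<le> ennreal (\<rho>\<^sup>2 * gradsq \<phi>) * indicator (ball 0 \<rho>) z" .
  qed
  also have "\<dots> = ennreal (\<rho>\<^sup>2 * gradsq \<phi>) * ennreal V" using emV by (subst nn_integral_cmult_indicator) auto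
  also have "ennreal (1 / V) * (ennreal (\<rho>\<^sup>2 * gradsq \<phi>) * ennreal V) = ennreal (\<rho>\<^sup>2 * gradsq \<phi>)"
    using V gradsq_nonneg[of \<phi>] by (simp flip: ennreal_mult)
  finally show ?thesis by (simp add: V_def mult_left_mono)
qed

end

text \<open>Frechet-Kolmogorov argument. Ball means of fixed radius are uniformly bounded and
  equi-Lipschitz, so a subsequence converges pointwise and, on the bounded domain, in L^2; replacing
  a function by its mean costs at most the radius times \<open>K\<close>.\<close>

theorem rellich_test:
  fixes D :: "'a::euclidean_space set"
  assumes D: "open D" "bounded D" and t: "\<And>k. test_fun D (\<phi> k)"
    and n: "\<And>k. nrm2 lborel (\<phi> k) \<le> K" and g: "\<And>k. gradsq (\<phi> k) \<le> K\<^sup>2"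
  shows "\<exists>r::nat\<Rightarrow>nat. strict_mono r \<and>
     (\<forall>e>0. \<exists>N. \<forall>i\<ge>N. \<forall>j\<ge>N. nrm2 (lebesgue_on D) (\<lambda>x. \<phi> (r i) x - \<phi> (r j) x) < e)"
proof -
  let ?M = "lebesgue_on D"
  have Ds: "D \<in> sets lebesgue" using D by auto
  interpret M: finite_measure ?M
    by (rule finite_measure_lebesgue_on[OF bounded_set_imp_lmeasurable[OF D(2) Ds]])
  have K: "K \<ge> 0" using n[of 0] nrm2_nonneg[of lborel "\<phi> 0"] by linarith
  have sg: "sqrt (gradsq (\<phi> k)) \<le> K" for k using g[of k] K by (simp add: real_le_lsqrt)
  define \<rho> where "\<rho> m = 1 / real (Suc m)" for m
  have \<rho>: "0 < \<rho> m" "\<rho> m \<le> 1" for m by (simp_all add: \<rho>_def)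
  define V where "V m = measure lborel (ball (0::'a) (\<rho> m))" for m
  have V: "V m > 0" for m using content_ball_pos[OF \<rho>(1), of "0::'a" m] by (simp add: V_def)
  define V1 where "V1 = sqrt (measure lborel (ball (0::'a) 1))"
  have V1: "sqrt (V m) \<le> V1" for m unfolding V_def V1_def
    using \<rho>[of m] emeasure_bounded_finite[OF bounded_ball, of "0::'a" 1]
    by (intro real_sqrt_le_mono measure_mono_fmeasurable) (auto intro!: fmeasurableI subset_ball)
  have V10: "V1 \<ge> 0" by (simp add: V1_def)
  define I where "I k m x = ball_int (\<rho> m) (\<phi> k) x" for k m x
  have Ib: "cmod (I k m x) \<le> V1 * K" for k m x
    unfolding I_def
    by (rule order_trans[OF ball_int_bound[OF t]]) (use V1[of m] n[of k] V10 in \<open>auto simp: V_def[symmetric] intro!: mult_mono\<close>)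
  have Il: "cmod (I k m x - I k m y) \<le> V1 * K * norm (x - y)" for k m x y
  proof -
    have "cmod (I k m x - I k m y) \<le> sqrt (V m) * (norm (x - y) * sqrt (gradsq (\<phi> k)))"
      unfolding I_def V_def by (rule ball_int_lipschitz[OF t])
    also have "\<dots> \<le> V1 * (norm (x - y) * K)"
      using V1[of m] sg[of k] V10 K by (intro mult_mono) (auto simp: gradsq_nonneg)
    finally show ?thesis by (simp add: mult_ac)
  qed
  obtain Q :: "'a set" where Q: "countable Q" "\<And>X. open X \<Longrightarrow> X \<noteq> {} \<Longrightarrow> \<exists>d\<in>Q. d \<in> X"
    using countable_dense_setE by blast
  \<comment> \<open>Pairs of a radius index and a point of a dense set: one extraction over this
    countable set handles all radii at once.\<close>
  have "countable (UNIV \<times> Q :: (nat \<times> 'a) set)" using Q by auto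
  then obtain r where r: "strict_mono (r::nat\<Rightarrow>nat)"
      "\<And>p. p \<in> UNIV \<times> Q \<Longrightarrow> \<exists>l. (\<lambda>k. (\<lambda>k (m, x). I k m x) (r k) p) \<longlonglongrightarrow> l"
    by (rule function_convergent_subsequence[of "UNIV \<times> Q" "\<lambda>k (m, x). I k m x" "V1 * K"]) (auto simp: Ib)
  \<comment> \<open>The common Lipschitz constant extends convergence from the dense set to every
    point.\<close>
  have conv: "convergent (\<lambda>k. I (r k) m x)" for m x
  proof (rule Cauchy_convergent, rule metric_CauchyI)
    fix e :: real assume e: "e > 0"
    define \<delta> where "\<delta> = e / (3 * (V1 * K + 1))"
    have VK: "0 \<le> V1 * K" using V10 K by simp
    have \<delta>: "\<delta> > 0" using e VK by (simp add: \<delta>_def add_nonneg_pos)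
    obtain p where p: "p \<in> Q" "p \<in> ball x \<delta>" using Q(2)[of "ball x \<delta>"] \<delta> by auto
    have "\<exists>l. (\<lambda>k. I (r k) m p) \<longlonglongrightarrow> l" using r(2)[of "(m, p)"] p by auto
    then have "Cauchy (\<lambda>k. I (r k) m p)" using LIMSEQ_imp_Cauchy by blast
    then obtain N where N: "\<And>i j. i \<ge> N \<Longrightarrow> j \<ge> N \<Longrightarrow> dist (I (r i) m p) (I (r j) m p) < e / 3"
      using metric_CauchyD[of _ "e/3"] e by (metis zero_less_divide_iff zero_less_numeral)
    have near: "dist (I k m x) (I k m p) \<le> e / 3" for k
    proof -
      have "dist (I k m x) (I k m p) \<le> V1 * K * norm (x - p)" using Il by (simp add: dist_norm)
      also have "\<dots> \<le> (V1 * K + 1) * \<delta>" using p(2) VK \<delta> by (intro mult_mono) (auto simp: dist_norm)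
      also have "\<dots> = e / 3" using VK by (simp add: \<delta>_def field_simps add_nonneg_pos less_imp_neq[symmetric])
      finally show ?thesis .
    qed
    have "dist (I (r i) m x) (I (r j) m x) < e" if "i \<ge> N" "j \<ge> N" for i j
    proof -
      have "dist (I (r i) m x) (I (r j) m x) \<le> dist (I (r i) m x) (I (r i) m p) + dist (I (r i) m p) (I (r j) m p) + dist (I (r j) m p) (I (r j) m x)"
        by (meson add_mono dist_triangle order_trans order_refl add_right_mono)
      then show ?thesis using near[of "r i"] near[of "r j"] N[OF that] by (simp add: dist_commute)
    qed
    then show "\<exists>N. \<forall>i\<ge>N. \<forall>j\<ge>N. dist (I (r i) m x) (I (r j) m x) < e" by blast
  qed
  define L where "L m x = lim (\<lambda>k. I (r k) m x)" for m x
  have L: "(\<lambda>k. I (r k) m x) \<longlonglongrightarrow> L m x" for m x using conv by (simp add: L_def convergent_LIMSEQ_iff)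
  have Lb: "cmod (L m x) \<le> V1 * K" for m x
    by (rule LIMSEQ_le_const2[OF tendsto_norm[OF L]]) (use Ib in auto)
  have Im [measurable]: "I k m \<in> borel_measurable ?M" for k m
    unfolding I_def by (intro borel_measurable_lebesgue_on borel_measurable_continuous_onI ball_int_continuous[OF t])
  have Lm [measurable]: "L m \<in> borel_measurable ?M" for m unfolding L_def by measurable
  have bs: "sqi ?M f" if "f \<in> borel_measurable ?M" "\<And>x. cmod (f x) \<le> B" for f B
    by (rule sqi_mono[of _ _ "\<lambda>_. 1" B]) (use that in \<open>auto simp: sqi_def\<close>)
  have Is: "sqi ?M (I k m)" for k m by (rule bs[OF Im Ib])
  have Ls: "sqi ?M (L m)" for m by (rule bs[OF Lm Lb])
  have IL: "(\<lambda>k. nrm2 ?M (\<lambda>x. I (r k) m x - L m x)) \<longlonglongrightarrow> 0" for m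
  proof -
    have "(\<lambda>k. \<integral>x. (cmod (I (r k) m x - L m x))\<^sup>2 \<partial>?M) \<longlonglongrightarrow> (\<integral>x. 0 \<partial>?M)"
    proof (rule integral_dominated_convergence[where w = "\<lambda>x. (2 * (V1 * K))\<^sup>2"])
      show "AE x in ?M. (\<lambda>k. (cmod (I (r k) m x - L m x))\<^sup>2) \<longlonglongrightarrow> 0"
      proof (rule AE_I2)
        fix x
        show "(\<lambda>k. (cmod (I (r k) m x - L m x))\<^sup>2) \<longlonglongrightarrow> 0"
          using tendsto_power[OF tendsto_norm_zero[OF LIM_zero[OF L[of m x]]], of 2] by simp
      qed
      show "AE x in ?M. norm ((cmod (I (r k) m x - L m x))\<^sup>2) \<le> (2 * (V1 * K))\<^sup>2" for k
      proof (rule AE_I2)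
        fix x
        have "cmod (I (r k) m x - L m x) \<le> 2 * (V1 * K)"
          using norm_triangle_ineq4[of "I (r k) m x" "L m x"] Ib[of "r k" m x] Lb[of m x] by linarith
        then show "norm ((cmod (I (r k) m x - L m x))\<^sup>2) \<le> (2 * (V1 * K))\<^sup>2"
          unfolding real_norm_def abs_power2 by (intro power_mono) auto
      qed
    qed auto
    from tendsto_real_sqrt[OF this] show ?thesis by (simp add: nrm2_def)
  qed
  have ps: "sqi ?M (\<phi> k)" for k by (rule test_fun_sqi_on(1)[OF Ds t])
  have Av: "sqi ?M (\<lambda>x. I k m x / V m)" for k m using sqi_cmult[OF Is[of k m], of "1 / V m"] by simp
  have err: "nrm2 ?M (\<lambda>x. \<phi> k x - I k m x / V m) \<le> \<rho> m * K" for k m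
  proof (rule power2_le_imp_le)
    have "ennreal ((nrm2 ?M (\<lambda>x. \<phi> k x - I k m x / V m))\<^sup>2) = (\<integral>\<^sup>+x. ennreal ((cmod (\<phi> k x - I k m x / V m))\<^sup>2) \<partial>?M)"
      by (rule nn_integral_sq_eq[OF sqi_diff[OF ps Av], symmetric])
    also have "\<dots> = (\<integral>\<^sup>+x. ennreal ((cmod (\<phi> k x - I k m x / V m))\<^sup>2) * indicator D x \<partial>lebesgue)"
      using Ds by (subst nn_integral_restrict_space) auto
    also have "\<dots> \<le> (\<integral>\<^sup>+x. ennreal ((cmod (\<phi> k x - I k m x / V m))\<^sup>2) \<partial>lebesgue)"
      by (intro nn_integral_mono) (auto simp: indicator_def)
    also have "\<dots> = (\<integral>\<^sup>+x. ennreal ((cmod (\<phi> k x - I k m x / V m))\<^sup>2) \<partial>lborel)" by (rule nn_integral_completion)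
    also have "\<dots> \<le> ennreal ((\<rho> m)\<^sup>2 * gradsq (\<phi> k))" unfolding I_def V_def by (rule ball_average_error[OF t \<rho>(1)])
    also have "\<dots> \<le> ennreal ((\<rho> m * K)\<^sup>2)" using g[of k] by (intro ennreal_leI) (auto simp: power_mult_distrib intro: mult_left_mono)
    finally show "(nrm2 ?M (\<lambda>x. \<phi> k x - I k m x / V m))\<^sup>2 \<le> (\<rho> m * K)\<^sup>2" by (simp add: ennreal_le_iff)
  qed (use \<rho> K in \<open>simp add: less_imp_le\<close>)
  have "\<exists>N. \<forall>i\<ge>N. \<forall>j\<ge>N. nrm2 ?M (\<lambda>x. \<phi> (r i) x - \<phi> (r j) x) < e" if e: "e > 0" for e
  proof -
    \<comment> \<open>The radius is fixed first, so that replacing by means costs at most e/4;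
      afterwards \<open>N\<close> is chosen for this radius, the factor \<open>V m\<close> undoing
      the missing normalisation of \<open>ball_int\<close>.\<close>
    obtain m where m: "\<rho> m < e / (4 * (K + 1))" using nat_approx_posE[of "e / (4 * (K + 1))"] e K by (auto simp: \<rho>_def)
    have \<rho>K: "\<rho> m * K \<le> e / 4"
    proof -
      have "\<rho> m * K \<le> (e / (4 * (K + 1))) * (K + 1)" using m K e by (intro mult_mono) auto
      also have "\<dots> = e / 4" using K by (simp add: field_simps)
      finally show ?thesis .
    qed
    have "(\<lambda>k. nrm2 ?M (\<lambda>x. I (r k) m x - L m x)) \<longlonglongrightarrow> 0" by (rule IL)
    then obtain N where N: "\<And>k. k \<ge> N \<Longrightarrow> nrm2 ?M (\<lambda>x. I (r k) m x - L m x) < e * V m / 4"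
      using LIMSEQ_D[OF IL[of m], of "e * V m / 4"] e V[of m] by auto
    have "nrm2 ?M (\<lambda>x. \<phi> (r i) x - \<phi> (r j) x) < e" if ij: "i \<ge> N" "j \<ge> N" for i j
    proof -
      let ?Lm = "\<lambda>x. L m x / V m"
      have sL: "sqi ?M ?Lm" using sqi_cmult[OF Ls[of m], of "1 / V m"] by simp
      have one: "nrm2 ?M (\<lambda>x. \<phi> (r k) x - ?Lm x) < e / 2" if "k \<ge> N" for k
      proof -
        have "nrm2 ?M (\<lambda>x. I (r k) m x / V m - ?Lm x) = nrm2 ?M (\<lambda>x. (1 / V m) * (I (r k) m x - L m x))"
          by (simp add: diff_divide_distrib)
        also have "\<dots> = nrm2 ?M (\<lambda>x. I (r k) m x - L m x) / V m" using V[of m] nrm2_cmult[of ?M "1 / V m"] by (simp add: norm_divide)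
        also have "\<dots> < e / 4" using N[OF that] V[of m] by (simp add: field_simps)
        finally show ?thesis using nrm2_diff_triangle[OF ps Av sL, of "r k" "r k" m] err[of "r k" m] \<rho>K by linarith
      qed
      have "nrm2 ?M (\<lambda>x. \<phi> (r i) x - \<phi> (r j) x) \<le> nrm2 ?M (\<lambda>x. \<phi> (r i) x - ?Lm x) + nrm2 ?M (\<lambda>x. ?Lm x - \<phi> (r j) x)"
        by (rule nrm2_diff_triangle[OF ps sL ps])
      then show ?thesis using one[OF ij(1)] one[OF ij(2)] nrm2_minus_commute[of ?M ?Lm "\<phi> (r j)"] by linarith
    qed
    then show ?thesis by blast
  qed
  then show ?thesis using r(1) by blast
qed

section \<open>Ladyzhenskaya inequality for test functions\<close>

definition Gd :: "('a::euclidean_space \<Rightarrow> complex) \<Rightarrow> 'a \<Rightarrow> 'a \<Rightarrow> ennreal" where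
  "Gd \<phi> b y = 2 * ennreal (cmod (\<phi> y)) * ennreal (cmod (pdv \<phi> b y))"

lemma Gd_measurable [measurable]:
  assumes "test_fun D \<phi>" "b \<in> Basis" shows "Gd \<phi> b \<in> borel_measurable borel"
  unfolding Gd_def using test_fun_borel[OF assms(1)] test_fun_borel[OF test_fun_pdv[OF assms]] by measurable

lemma nn_integral_Gd:
  assumes "test_fun D \<phi>" "b \<in> Basis"
  shows "(\<integral>\<^sup>+x. Gd \<phi> b x \<partial>lborel) \<le> ennreal (2 * nrm2 lborel \<phi> * nrm2 lborel (pdv \<phi> b))"
proof -
  have s: "sqi lborel \<phi>" "sqi lborel (pdv \<phi> b)" using assms test_fun_sqi test_fun_pdv by blast+
  have i: "integrable lborel (\<lambda>x. 2 * (cmod (\<phi> x) * cmod (pdv \<phi> b x)))"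
    using integrable_norm[OF sqi_mult_integrable[OF s]] by (simp add: norm_mult)
  have "(\<integral>\<^sup>+x. Gd \<phi> b x \<partial>lborel) = (\<integral>\<^sup>+x. ennreal (2 * (cmod (\<phi> x) * cmod (pdv \<phi> b x))) \<partial>lborel)"
    by (simp add: Gd_def ennreal_mult mult.assoc)
  also have "\<dots> = ennreal (2 * (\<integral>x. cmod (\<phi> x) * cmod (pdv \<phi> b x) \<partial>lborel))"
    using nn_integral_eq_integral[OF i] by simp
  also have "\<dots> \<le> ennreal (2 * nrm2 lborel \<phi> * nrm2 lborel (pdv \<phi> b))"
    using norm_integral_mult_le(1)[OF s] by (intro ennreal_leI) simp
  finally show ?thesis .
qed

text \<open>Fundamental theorem of calculus for |\<phi>|^2, starting from a point outside the
  support. \<open>Gd\<close> dominates the derivative of |\<phi>|^2 in direction \<open>b\<close>;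
  it takes values in \<open>ennreal\<close> so that line and plane integrals can be formed and
  interchanged freely.\<close>

lemma line_bound:
  fixes \<phi> :: "'a::euclidean_space \<Rightarrow> complex"
  assumes t: "test_fun D \<phi>" and b: "b \<in> Basis"
  shows "ennreal ((cmod (\<phi> x))\<^sup>2) \<le> (\<integral>\<^sup>+s. Gd \<phi> b (x + s *\<^sub>R b) \<partial>lborel)"
proof -
  have "bounded {x. \<phi> x \<noteq> 0}" using t unfolding test_fun_def
    using bounded_closure compact_imp_bounded bounded_subset closure_subset by metis
  then obtain B where B: "\<And>y. \<phi> y \<noteq> 0 \<Longrightarrow> norm y \<le> B" by (auto simp: bounded_iff)
  \<comment> \<open>Far enough that \<open>x - T b\<close> has norm above \<open>B\<close>, where
    the function vanishes.\<close>
  define T where "T = \<bar>B\<bar> + norm x + 1"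
  have T: "T > 0" by (simp add: T_def add_nonneg_pos)
  have z: "\<phi> (x + (- T) *\<^sub>R b) = 0"
  proof (rule ccontr)
    assume "\<phi> (x + (- T) *\<^sub>R b) \<noteq> 0"
    then have "norm (x + (- T) *\<^sub>R b) \<le> B" by (rule B)
    moreover have "norm ((- T) *\<^sub>R b) \<le> norm (x + (- T) *\<^sub>R b) + norm x" using norm_triangle_ineq4[of "x + (- T) *\<^sub>R b" x] by simp
    moreover have "norm ((- T) *\<^sub>R b) = T" using T b by simp
    ultimately show False by (simp add: T_def)
  qed
  define \<psi> where "\<psi> s = \<phi> (x + s *\<^sub>R b)" for s
  define \<psi>' where "\<psi>' s = pdv \<phi> b (x + s *\<^sub>R b)" for s
  have d: "(\<psi> has_vector_derivative \<psi>' s) (at s within S)" for s S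
  proof -
    have "((\<lambda>t. x + t *\<^sub>R b) has_derivative (\<lambda>s. s *\<^sub>R b)) (at s within S)" by (auto intro!: derivative_eq_intros)
    from has_derivative_compose[OF this smooth_fun_has_derivative[OF test_fun_smooth[OF t]]]
    show ?thesis using linear_cmul[OF has_derivative_linear[OF smooth_fun_has_derivative[OF test_fun_smooth[OF t]]]]
      by (simp add: has_vector_derivative_def \<psi>_def[abs_def] \<psi>'_def)
  qed
  have c: "continuous_on S \<psi>" "continuous_on S \<psi>'" for S
    unfolding \<psi>_def \<psi>'_def
    by (intro continuous_on_compose2[OF test_fun_continuous[OF t, of UNIV]]
        continuous_on_compose2[OF test_fun_continuous[OF test_fun_pdv[OF t b], of UNIV]] continuous_intros; simp)+
  let ?f = "\<lambda>s. \<psi> s \<bullet> \<psi>' s + \<psi>' s \<bullet> \<psi> s"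
  have dd: "((\<lambda>s. \<psi> s \<bullet> \<psi> s) has_vector_derivative ?f s) (at s within S)" for s S
    by (rule bounded_bilinear.has_vector_derivative[OF bounded_bilinear_inner d d])
  have hb: "has_bochner_integral lborel (\<lambda>s. indicator {-T..0} s *\<^sub>R ?f s) (\<psi> 0 \<bullet> \<psi> 0 - \<psi> (-T) \<bullet> \<psi> (-T))"
    by (rule has_bochner_integral_FTC_Icc) (use T dd in \<open>auto intro!: continuous_intros c\<close>)
  have "ennreal (norm (\<psi> 0 \<bullet> \<psi> 0 - \<psi> (-T) \<bullet> \<psi> (-T))) \<le> (\<integral>\<^sup>+s. ennreal (norm (indicator {-T..0} s *\<^sub>R ?f s)) \<partial>lborel)"
    using integral_norm_bound_ennreal[OF integrable.intros[OF hb]] has_bochner_integral_integral_eq[OF hb] by simp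
  also have "\<dots> \<le> (\<integral>\<^sup>+s. Gd \<phi> b (x + s *\<^sub>R b) \<partial>lborel)"
  proof (rule nn_integral_mono)
    fix s :: real
    have "norm (indicator {-T..0} s *\<^sub>R ?f s) \<le> 2 * (cmod (\<psi> s) * cmod (\<psi>' s))"
      using Cauchy_Schwarz_ineq2[of "\<psi> s" "\<psi>' s"] by (auto simp: indicator_def inner_commute[of "\<psi>' s"])
    then have "ennreal (norm (indicator {-T..0} s *\<^sub>R ?f s)) \<le> ennreal (2 * (cmod (\<psi> s) * cmod (\<psi>' s)))" by (rule ennreal_leI)
    also have "\<dots> = Gd \<phi> b (x + s *\<^sub>R b)" by (simp add: Gd_def \<psi>_def \<psi>'_def ennreal_mult mult.assoc)
    finally show "ennreal (norm (indicator {-T..0} s *\<^sub>R ?f s)) \<le> Gd \<phi> b (x + s *\<^sub>R b)" .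
  qed
  finally show ?thesis using z by (simp add: \<psi>_def dot_square_norm)
qed

text \<open>Lebesgue measure is the image of the product measure indexed by \<open>Basis\<close>;
  peeling off one index yields iterated integrals along the basis vectors.\<close>

lemma nn_integral_coords2:
  fixes F :: "'a::euclidean_space \<Rightarrow> ennreal"
  assumes B: "Basis = {e, f::'a}" "e \<noteq> f" and F: "F \<in> borel_measurable borel"
  shows "(\<integral>\<^sup>+x. F x \<partial>lborel) = (\<integral>\<^sup>+s. \<integral>\<^sup>+t. F (s *\<^sub>R e + t *\<^sub>R f) \<partial>lborel \<partial>lborel)"
proof -
  interpret product_sigma_finite "\<lambda>_::'a. lborel :: real measure" by standard
  have m: "(\<lambda>x. \<Sum>b\<in>I. x b *\<^sub>R b) \<in> borel_measurable (Pi\<^sub>M I (\<lambda>_. lborel))" for I :: "'a set"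
    by (intro borel_measurable_sum borel_measurable_scaleR measurable_const)
      (use measurable_component_singleton[of _ I "\<lambda>_. lborel :: real measure"] in auto)
  have "(\<integral>\<^sup>+x. F x \<partial>lborel) = (\<integral>\<^sup>+x. F (\<Sum>b\<in>{e,f}. x b *\<^sub>R b) \<partial>Pi\<^sub>M {e,f} (\<lambda>_. lborel))"
    unfolding lborel_eq[where 'a='a] B(1) by (rule nn_integral_distr) (use m F in auto)
  also have "\<dots> = (\<integral>\<^sup>+s. \<integral>\<^sup>+x. F (\<Sum>b\<in>{e,f}. (x(e := s)) b *\<^sub>R b) \<partial>Pi\<^sub>M {f} (\<lambda>_. lborel) \<partial>lborel)"
    by (rule product_nn_integral_insert_rev) (use B measurable_compose[OF m F] in auto)
  also have "\<dots> = (\<integral>\<^sup>+s. \<integral>\<^sup>+x. F (s *\<^sub>R e + x f *\<^sub>R f) \<partial>Pi\<^sub>M {f} (\<lambda>_. lborel) \<partial>lborel)"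
    using B(2) by simp
  also have "\<dots> = (\<integral>\<^sup>+s. \<integral>\<^sup>+t. F (s *\<^sub>R e + t *\<^sub>R f) \<partial>lborel \<partial>lborel)"
    by (intro nn_integral_cong product_nn_integral_singleton) (use F in measurable)
  finally show ?thesis .
qed

lemma nn_integral_coords3:
  fixes F :: "'a::euclidean_space \<Rightarrow> ennreal"
  assumes B: "Basis = {g, e, f::'a}" "g \<noteq> e" "g \<noteq> f" "e \<noteq> f" and F: "F \<in> borel_measurable borel"
  shows "(\<integral>\<^sup>+x. F x \<partial>lborel) = (\<integral>\<^sup>+r. \<integral>\<^sup>+s. \<integral>\<^sup>+t. F (r *\<^sub>R g + s *\<^sub>R e + t *\<^sub>R f) \<partial>lborel \<partial>lborel \<partial>lborel)"
proof -
  interpret product_sigma_finite "\<lambda>_::'a. lborel :: real measure" by standard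
  have m: "(\<lambda>x. \<Sum>b\<in>I. x b *\<^sub>R b) \<in> borel_measurable (Pi\<^sub>M I (\<lambda>_. lborel))" for I :: "'a set"
    by (intro borel_measurable_sum borel_measurable_scaleR measurable_const)
      (use measurable_component_singleton[of _ I "\<lambda>_. lborel :: real measure"] in auto)
  have m2: "(\<lambda>x. F (c + (\<Sum>b\<in>{e, f}. x b *\<^sub>R b))) \<in> borel_measurable (Pi\<^sub>M {e, f} (\<lambda>_. lborel))" for c
    by (rule measurable_compose[OF borel_measurable_add[OF borel_measurable_const m] F])
  have "(\<integral>\<^sup>+x. F x \<partial>lborel) = (\<integral>\<^sup>+x. F (\<Sum>b\<in>{g,e,f}. x b *\<^sub>R b) \<partial>Pi\<^sub>M {g,e,f} (\<lambda>_. lborel))"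
    unfolding lborel_eq[where 'a='a] B(1) by (rule nn_integral_distr) (use m F in auto)
  also have "\<dots> = (\<integral>\<^sup>+r. \<integral>\<^sup>+x. F (\<Sum>b\<in>{g,e,f}. (x(g := r)) b *\<^sub>R b) \<partial>Pi\<^sub>M {e,f} (\<lambda>_. lborel) \<partial>lborel)"
    by (rule product_nn_integral_insert_rev) (use B measurable_compose[OF m F] in auto)
  also have "\<dots> = (\<integral>\<^sup>+r. \<integral>\<^sup>+x. F (r *\<^sub>R g + (\<Sum>b\<in>{e,f}. x b *\<^sub>R b)) \<partial>Pi\<^sub>M {e,f} (\<lambda>_. lborel) \<partial>lborel)"
    using B(2-4) by simp
  also have "\<dots> = (\<integral>\<^sup>+r. \<integral>\<^sup>+s. \<integral>\<^sup>+x. F (r *\<^sub>R g + (\<Sum>b\<in>{e,f}. (x(e := s)) b *\<^sub>R b)) \<partial>Pi\<^sub>M {f} (\<lambda>_. lborel) \<partial>lborel \<partial>lborel)"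
    by (intro nn_integral_cong product_nn_integral_insert_rev) (use B m2 in auto)
  also have "\<dots> = (\<integral>\<^sup>+r. \<integral>\<^sup>+s. \<integral>\<^sup>+x. F (r *\<^sub>R g + s *\<^sub>R e + x f *\<^sub>R f) \<partial>Pi\<^sub>M {f} (\<lambda>_. lborel) \<partial>lborel \<partial>lborel)"
    using B(2-4) by (simp add: add.assoc)
  also have "\<dots> = (\<integral>\<^sup>+r. \<integral>\<^sup>+s. \<integral>\<^sup>+t. F (r *\<^sub>R g + s *\<^sub>R e + t *\<^sub>R f) \<partial>lborel \<partial>lborel \<partial>lborel)"
    by (intro nn_integral_cong product_nn_integral_singleton) (use F in measurable)
  finally show ?thesis .
qed

text \<open>The fourth power is a product of two squares. Bounding one by its line integral in
  direction \<open>e\<close> and the other in direction \<open>f\<close> separates the variables.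
  The base point \<open>x0\<close> allows the bound on every plane of a three-dimensional
  space.\<close>

lemma slice_bound:
  fixes \<phi> :: "'a::euclidean_space \<Rightarrow> complex"
  assumes t: "test_fun D \<phi>" and b: "e \<in> Basis" "f \<in> Basis"
  shows "(\<integral>\<^sup>+s. \<integral>\<^sup>+t. ennreal (cmod (\<phi> (x0 + s *\<^sub>R e + t *\<^sub>R f)) ^ 4) \<partial>lborel \<partial>lborel)
    \<le> (\<integral>\<^sup>+s. \<integral>\<^sup>+t. Gd \<phi> e (x0 + s *\<^sub>R e + t *\<^sub>R f) \<partial>lborel \<partial>lborel) *
      (\<integral>\<^sup>+s. \<integral>\<^sup>+t. Gd \<phi> f (x0 + s *\<^sub>R e + t *\<^sub>R f) \<partial>lborel \<partial>lborel)"
proof -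
  have Gm [measurable]: "Gd \<phi> e \<in> borel_measurable borel" "Gd \<phi> f \<in> borel_measurable borel"
    using Gd_measurable[OF t] b by auto
  define A where "A t = (\<integral>\<^sup>+s. Gd \<phi> e (x0 + s *\<^sub>R e + t *\<^sub>R f) \<partial>lborel)" for t
  define B where "B s = (\<integral>\<^sup>+t. Gd \<phi> f (x0 + s *\<^sub>R e + t *\<^sub>R f) \<partial>lborel)" for s
  have [measurable]: "A \<in> borel_measurable borel" "B \<in> borel_measurable borel"
    unfolding A_def B_def by measurable
  have pA: "ennreal ((cmod (\<phi> (x0 + s *\<^sub>R e + t' *\<^sub>R f)))\<^sup>2) \<le> A t'" for s t'
  proof -
    have "ennreal ((cmod (\<phi> (x0 + s *\<^sub>R e + t' *\<^sub>R f)))\<^sup>2) \<le> (\<integral>\<^sup>+\<tau>. Gd \<phi> e ((x0 + s *\<^sub>R e + t' *\<^sub>R f) + \<tau> *\<^sub>R e) \<partial>lborel)"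
      by (rule line_bound[OF t b(1)])
    also have "\<dots> = (\<integral>\<^sup>+\<tau>. Gd \<phi> e (x0 + (\<tau> + s) *\<^sub>R e + t' *\<^sub>R f) \<partial>lborel)" by (simp add: algebra_simps)
    also have "\<dots> = A t'" unfolding A_def
      using lborel_nn_integral_shift[of "\<lambda>\<tau>. Gd \<phi> e (x0 + \<tau> *\<^sub>R e + t' *\<^sub>R f)" s] by simp
    finally show ?thesis .
  qed
  have pB: "ennreal ((cmod (\<phi> (x0 + s *\<^sub>R e + t' *\<^sub>R f)))\<^sup>2) \<le> B s" for s t'
  proof -
    have "ennreal ((cmod (\<phi> (x0 + s *\<^sub>R e + t' *\<^sub>R f)))\<^sup>2) \<le> (\<integral>\<^sup>+\<tau>. Gd \<phi> f ((x0 + s *\<^sub>R e + t' *\<^sub>R f) + \<tau> *\<^sub>R f) \<partial>lborel)"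
      by (rule line_bound[OF t b(2)])
    also have "\<dots> = (\<integral>\<^sup>+\<tau>. Gd \<phi> f (x0 + s *\<^sub>R e + (\<tau> + t') *\<^sub>R f) \<partial>lborel)" by (simp add: algebra_simps)
    also have "\<dots> = B s" unfolding B_def
      using lborel_nn_integral_shift[of "\<lambda>\<tau>. Gd \<phi> f (x0 + s *\<^sub>R e + \<tau> *\<^sub>R f)" t'] by simp
    finally show ?thesis .
  qed
  have "(\<integral>\<^sup>+s. \<integral>\<^sup>+t. ennreal (cmod (\<phi> (x0 + s *\<^sub>R e + t *\<^sub>R f)) ^ 4) \<partial>lborel \<partial>lborel) \<le> (\<integral>\<^sup>+s. \<integral>\<^sup>+t. A t * B s \<partial>lborel \<partial>lborel)"
  proof (intro nn_integral_mono)
    fix s t'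
    have "ennreal (cmod (\<phi> (x0 + s *\<^sub>R e + t' *\<^sub>R f)) ^ 4)
       = ennreal ((cmod (\<phi> (x0 + s *\<^sub>R e + t' *\<^sub>R f)))\<^sup>2) * ennreal ((cmod (\<phi> (x0 + s *\<^sub>R e + t' *\<^sub>R f)))\<^sup>2)"
      by (subst ennreal_mult[symmetric]) (simp_all flip: power_add)
    also have "\<dots> \<le> A t' * B s" by (intro mult_mono pA pB) auto
    finally show "ennreal (cmod (\<phi> (x0 + s *\<^sub>R e + t' *\<^sub>R f)) ^ 4) \<le> A t' * B s" .
  qed
  also have "\<dots> = (\<integral>\<^sup>+t. A t \<partial>lborel) * (\<integral>\<^sup>+s. B s \<partial>lborel)"
    by (simp add: nn_integral_multc nn_integral_cmult)
  also have "(\<integral>\<^sup>+t. A t \<partial>lborel) = (\<integral>\<^sup>+s. \<integral>\<^sup>+t. Gd \<phi> e (x0 + s *\<^sub>R e + t *\<^sub>R f) \<partial>lborel \<partial>lborel)"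
    unfolding A_def by (rule lborel_pair.Fubini') measurable
  finally show ?thesis unfolding B_def .
qed

text \<open>The factor 4 is the square of the 2 in \<open>Gd\<close>; the double integral is read as
  one integral over a product measure so that Cauchy-Schwarz applies once.\<close>

lemma slice_cauchy_schwarz:
  fixes \<phi> :: "'a::euclidean_space \<Rightarrow> complex"
  assumes t: "test_fun D \<phi>" and b: "b \<in> Basis"
  shows "(\<integral>\<^sup>+s. \<integral>\<^sup>+t. Gd \<phi> b (x0 + s *\<^sub>R e + t *\<^sub>R f) \<partial>lborel \<partial>lborel)\<^sup>2 \<le>
     4 * (\<integral>\<^sup>+s. \<integral>\<^sup>+t. ennreal ((cmod (\<phi> (x0 + s *\<^sub>R e + t *\<^sub>R f)))\<^sup>2) \<partial>lborel \<partial>lborel) *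
      (\<integral>\<^sup>+s. \<integral>\<^sup>+t. ennreal ((cmod (pdv \<phi> b (x0 + s *\<^sub>R e + t *\<^sub>R f)))\<^sup>2) \<partial>lborel \<partial>lborel)"
proof -
  have [measurable]: "\<phi> \<in> borel_measurable borel" "pdv \<phi> b \<in> borel_measurable borel"
    using test_fun_borel[OF t] test_fun_borel[OF test_fun_pdv[OF t b]] by auto
  let ?P = "(lborel :: real measure) \<Otimes>\<^sub>M (lborel :: real measure)"
  define y where "y p = x0 + fst p *\<^sub>R e + snd p *\<^sub>R f" for p :: "real \<times> real"
  have ym [measurable]: "y \<in> borel_measurable ?P" unfolding y_def by measurable
  have it: "(\<integral>\<^sup>+s. \<integral>\<^sup>+t. F (x0 + s *\<^sub>R e + t *\<^sub>R f) \<partial>lborel \<partial>lborel) = (\<integral>\<^sup>+p. F (y p) \<partial>?P)"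
    if [measurable]: "F \<in> borel_measurable borel" for F :: "'a \<Rightarrow> ennreal"
    using lborel.nn_integral_fst[of "\<lambda>p. F (y p)" lborel] by (simp add: y_def)
  have "(\<integral>\<^sup>+p. (2 * ennreal (cmod (\<phi> (y p)))) * ennreal (cmod (pdv \<phi> b (y p))) \<partial>?P)\<^sup>2
     \<le> (\<integral>\<^sup>+p. (2 * ennreal (cmod (\<phi> (y p))))\<^sup>2 \<partial>?P) * (\<integral>\<^sup>+p. (ennreal (cmod (pdv \<phi> b (y p))))\<^sup>2 \<partial>?P)"
    by (rule Cauchy_Schwarz_nn_integral) measurable
  also have "(\<integral>\<^sup>+p. (2 * ennreal (cmod (\<phi> (y p))))\<^sup>2 \<partial>?P) = 4 * (\<integral>\<^sup>+p. ennreal ((cmod (\<phi> (y p)))\<^sup>2) \<partial>?P)"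
    by (subst nn_integral_cmult[symmetric]) (auto simp: power_mult_distrib ennreal_power)
  also have "(\<integral>\<^sup>+p. (ennreal (cmod (pdv \<phi> b (y p))))\<^sup>2 \<partial>?P) = (\<integral>\<^sup>+p. ennreal ((cmod (pdv \<phi> b (y p)))\<^sup>2) \<partial>?P)"
    by (simp add: ennreal_power)
  finally show ?thesis
    using it[OF Gd_measurable[OF t b]] it[of "\<lambda>z. ennreal ((cmod (\<phi> z))\<^sup>2)"] it[of "\<lambda>z. ennreal ((cmod (pdv \<phi> b z))\<^sup>2)"]
    by (simp add: Gd_def)
qed

lemma ladyzhenskaya2:
  fixes \<phi> :: "'a::euclidean_space \<Rightarrow> complex"
  assumes B: "Basis = {e, f::'a}" "e \<noteq> f" and t: "test_fun D \<phi>"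
  shows "(\<integral>\<^sup>+x. ennreal (cmod (\<phi> x) ^ 4) \<partial>lborel) \<le> ennreal (4 * (nrm2 lborel \<phi>)\<^sup>2 * gradsq \<phi>)"
proof -
  have b: "e \<in> Basis" "f \<in> Basis" using B by auto
  have [measurable]: "\<phi> \<in> borel_measurable borel" using test_fun_borel[OF t] .
  have nb: "nrm2 lborel (pdv \<phi> b) \<le> sqrt (gradsq \<phi>)" if "b \<in> Basis" for b
    unfolding gradsq_def by (rule real_le_rsqrt) (rule member_le_sum[OF that], auto)
  have "(\<integral>\<^sup>+x. ennreal (cmod (\<phi> x) ^ 4) \<partial>lborel) = (\<integral>\<^sup>+s. \<integral>\<^sup>+t. ennreal (cmod (\<phi> (0 + s *\<^sub>R e + t *\<^sub>R f)) ^ 4) \<partial>lborel \<partial>lborel)"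
    by (subst nn_integral_coords2[OF B]) auto
  also have "\<dots> \<le> (\<integral>\<^sup>+s. \<integral>\<^sup>+t. Gd \<phi> e (0 + s *\<^sub>R e + t *\<^sub>R f) \<partial>lborel \<partial>lborel) *
      (\<integral>\<^sup>+s. \<integral>\<^sup>+t. Gd \<phi> f (0 + s *\<^sub>R e + t *\<^sub>R f) \<partial>lborel \<partial>lborel)" by (rule slice_bound[OF t b])
  also have "\<dots> = (\<integral>\<^sup>+x. Gd \<phi> e x \<partial>lborel) * (\<integral>\<^sup>+x. Gd \<phi> f x \<partial>lborel)"
    by (simp add: nn_integral_coords2[OF B Gd_measurable[OF t b(1)]] nn_integral_coords2[OF B Gd_measurable[OF t b(2)]])
  also have "\<dots> \<le> ennreal (2 * nrm2 lborel \<phi> * sqrt (gradsq \<phi>)) * ennreal (2 * nrm2 lborel \<phi> * sqrt (gradsq \<phi>))"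
    using nn_integral_Gd[OF t] b nb
    by (intro mult_mono order_trans[OF nn_integral_Gd[OF t]] ennreal_leI mult_left_mono) auto
  also have "\<dots> = ennreal (4 * (nrm2 lborel \<phi>)\<^sup>2 * gradsq \<phi>)"
    using gradsq_nonneg[of \<phi>] by (subst ennreal_mult[symmetric]) (auto simp: power2_eq_square mult_ac)
  finally show ?thesis .
qed

lemma ennreal_mult_le_squares: "(x::ennreal) * y \<le> x\<^sup>2 + y\<^sup>2"
proof (cases "x \<le> y")
  case True
  then have "x * y \<le> y * y" by (rule mult_right_mono) simp
  also have "\<dots> \<le> x\<^sup>2 + y\<^sup>2" by (simp add: power2_eq_square)
  finally show ?thesis .
next
  case False
  then have "x * y \<le> x * x" by (intro mult_left_mono) auto
  also have "\<dots> \<le> x\<^sup>2 + y\<^sup>2" by (simp add: power2_eq_square)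
  finally show ?thesis .
qed

text \<open>On each plane orthogonal to \<open>g\<close> the planar argument gives 4 m(r) (d_e(r) +
  d_f(r)). The mass \<open>m r\<close> of a slice is bounded uniformly by a line estimate in
  direction \<open>g\<close>, and only the gradient terms are integrated over
  \<open>r\<close>.\<close>

lemma ladyzhenskaya3:
  fixes \<phi> :: "'a::euclidean_space \<Rightarrow> complex"
  assumes B: "Basis = {g, e, f::'a}" "g \<noteq> e" "g \<noteq> f" "e \<noteq> f" and t: "test_fun D \<phi>"
  shows "(\<integral>\<^sup>+x. ennreal (cmod (\<phi> x) ^ 4) \<partial>lborel) \<le> ennreal (8 * nrm2 lborel \<phi> * (sqrt (gradsq \<phi>))^3)"
proof -
  have b: "g \<in> Basis" "e \<in> Basis" "f \<in> Basis" using B by auto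
  have m [measurable]: "\<phi> \<in> borel_measurable borel" using test_fun_borel[OF t] .
  have [measurable]: "pdv \<phi> e \<in> borel_measurable borel" "pdv \<phi> f \<in> borel_measurable borel" "Gd \<phi> g \<in> borel_measurable borel"
      "Gd \<phi> e \<in> borel_measurable borel" "Gd \<phi> f \<in> borel_measurable borel"
    using test_fun_borel[OF test_fun_pdv[OF t]] Gd_measurable[OF t] b by auto
  define S where "S = (\<integral>\<^sup>+x. Gd \<phi> g x \<partial>lborel)"
  define P where "P b r = (\<integral>\<^sup>+s. \<integral>\<^sup>+t. Gd \<phi> b (r *\<^sub>R g + s *\<^sub>R e + t *\<^sub>R f) \<partial>lborel \<partial>lborel)" for b r
  define m where "m r = (\<integral>\<^sup>+s. \<integral>\<^sup>+t. ennreal ((cmod (\<phi> (r *\<^sub>R g + s *\<^sub>R e + t *\<^sub>R f)))\<^sup>2) \<partial>lborel \<partial>lborel)" for r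
  define d where "d b r = (\<integral>\<^sup>+s. \<integral>\<^sup>+t. ennreal ((cmod (pdv \<phi> b (r *\<^sub>R g + s *\<^sub>R e + t *\<^sub>R f)))\<^sup>2) \<partial>lborel \<partial>lborel)" for b r
  have [measurable]: "d e \<in> borel_measurable borel" "d f \<in> borel_measurable borel" unfolding d_def by measurable
  \<comment> \<open>Each point of the slice is estimated along the full line through it, so the
    bound no longer depends on \<open>r\<close>.\<close>
  have mS: "m r \<le> S" for r
  proof -
    have "m r \<le> (\<integral>\<^sup>+s. \<integral>\<^sup>+t. \<integral>\<^sup>+\<tau>. Gd \<phi> g (\<tau> *\<^sub>R g + s *\<^sub>R e + t *\<^sub>R f) \<partial>lborel \<partial>lborel \<partial>lborel)"
      unfolding m_def
    proof (intro nn_integral_mono)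
      fix s t'
      have "ennreal ((cmod (\<phi> (r *\<^sub>R g + s *\<^sub>R e + t' *\<^sub>R f)))\<^sup>2) \<le> (\<integral>\<^sup>+\<tau>. Gd \<phi> g ((r *\<^sub>R g + s *\<^sub>R e + t' *\<^sub>R f) + \<tau> *\<^sub>R g) \<partial>lborel)"
        by (rule line_bound[OF t b(1)])
      also have "\<dots> = (\<integral>\<^sup>+\<tau>. Gd \<phi> g ((\<tau> + r) *\<^sub>R g + s *\<^sub>R e + t' *\<^sub>R f) \<partial>lborel)" by (simp add: algebra_simps)
      also have "\<dots> = (\<integral>\<^sup>+\<tau>. Gd \<phi> g (\<tau> *\<^sub>R g + s *\<^sub>R e + t' *\<^sub>R f) \<partial>lborel)"
        using lborel_nn_integral_shift[of "\<lambda>\<tau>. Gd \<phi> g (\<tau> *\<^sub>R g + s *\<^sub>R e + t' *\<^sub>R f)" r] by simp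
      finally show "ennreal ((cmod (\<phi> (r *\<^sub>R g + s *\<^sub>R e + t' *\<^sub>R f)))\<^sup>2) \<le> (\<integral>\<^sup>+\<tau>. Gd \<phi> g (\<tau> *\<^sub>R g + s *\<^sub>R e + t' *\<^sub>R f) \<partial>lborel)" .
    qed
    also have "\<dots> = (\<integral>\<^sup>+s. \<integral>\<^sup>+\<tau>. \<integral>\<^sup>+t. Gd \<phi> g (\<tau> *\<^sub>R g + s *\<^sub>R e + t *\<^sub>R f) \<partial>lborel \<partial>lborel \<partial>lborel)"
      by (intro nn_integral_cong lborel_pair.Fubini') measurable
    also have "\<dots> = (\<integral>\<^sup>+\<tau>. \<integral>\<^sup>+s. \<integral>\<^sup>+t. Gd \<phi> g (\<tau> *\<^sub>R g + s *\<^sub>R e + t *\<^sub>R f) \<partial>lborel \<partial>lborel \<partial>lborel)"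
      by (rule lborel_pair.Fubini') measurable
    also have "\<dots> = S" unfolding S_def by (rule nn_integral_coords3[OF B, symmetric]) measurable
    finally show ?thesis .
  qed
  have D: "(\<integral>\<^sup>+r. d b r \<partial>lborel) = ennreal ((nrm2 lborel (pdv \<phi> b))\<^sup>2)" if "b \<in> Basis" for b
  proof -
    have [measurable]: "pdv \<phi> b \<in> borel_measurable borel" using test_fun_borel[OF test_fun_pdv[OF t that]] .
    have "(\<integral>\<^sup>+r. d b r \<partial>lborel) = (\<integral>\<^sup>+x. ennreal ((cmod (pdv \<phi> b x))\<^sup>2) \<partial>lborel)"
      unfolding d_def by (rule nn_integral_coords3[OF B, symmetric]) measurable
    then show ?thesis using nn_integral_sq_eq[OF test_fun_sqi[OF test_fun_pdv[OF t that]]] by simp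
  qed
  have "(\<integral>\<^sup>+x. ennreal (cmod (\<phi> x) ^ 4) \<partial>lborel)
     = (\<integral>\<^sup>+r. \<integral>\<^sup>+s. \<integral>\<^sup>+t. ennreal (cmod (\<phi> (r *\<^sub>R g + s *\<^sub>R e + t *\<^sub>R f)) ^ 4) \<partial>lborel \<partial>lborel \<partial>lborel)"
    by (rule nn_integral_coords3[OF B]) measurable
  also have "\<dots> \<le> (\<integral>\<^sup>+r. 4 * S * (d e r + d f r) \<partial>lborel)"
  proof (rule nn_integral_mono)
    fix r
    have "(\<integral>\<^sup>+s. \<integral>\<^sup>+t. ennreal (cmod (\<phi> (r *\<^sub>R g + s *\<^sub>R e + t *\<^sub>R f)) ^ 4) \<partial>lborel \<partial>lborel) \<le> P e r * P f r"
      unfolding P_def by (rule slice_bound[OF t b(2,3)])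
    also have "\<dots> \<le> (P e r)\<^sup>2 + (P f r)\<^sup>2" by (rule ennreal_mult_le_squares)
    also have "\<dots> \<le> 4 * m r * d e r + 4 * m r * d f r"
      unfolding P_def m_def d_def by (intro add_mono slice_cauchy_schwarz[OF t] b)
    also have "\<dots> \<le> 4 * S * d e r + 4 * S * d f r"
      by (intro add_mono mult_right_mono mult_left_mono mS) auto
    finally show "(\<integral>\<^sup>+s. \<integral>\<^sup>+t. ennreal (cmod (\<phi> (r *\<^sub>R g + s *\<^sub>R e + t *\<^sub>R f)) ^ 4) \<partial>lborel \<partial>lborel) \<le> 4 * S * (d e r + d f r)"
      by (simp add: distrib_left)
  qed
  also have "\<dots> = 4 * S * (ennreal ((nrm2 lborel (pdv \<phi> e))\<^sup>2) + ennreal ((nrm2 lborel (pdv \<phi> f))\<^sup>2))"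
    using b D by (simp add: nn_integral_cmult nn_integral_add)
  also have "\<dots> \<le> 4 * ennreal (2 * nrm2 lborel \<phi> * sqrt (gradsq \<phi>)) * ennreal (gradsq \<phi>)"
  proof (intro mult_mono)
    have "nrm2 lborel (pdv \<phi> g) \<le> sqrt (gradsq \<phi>)"
      unfolding gradsq_def by (rule real_le_rsqrt) (rule member_le_sum[OF b(1)], auto)
    then show "S \<le> ennreal (2 * nrm2 lborel \<phi> * sqrt (gradsq \<phi>))"
      unfolding S_def by (intro order_trans[OF nn_integral_Gd[OF t b(1)]] ennreal_leI mult_left_mono) auto
    have "(nrm2 lborel (pdv \<phi> e))\<^sup>2 + (nrm2 lborel (pdv \<phi> f))\<^sup>2 \<le> gradsq \<phi>"
      unfolding gradsq_def B(1) using B(2-4) by simp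
    then show "ennreal ((nrm2 lborel (pdv \<phi> e))\<^sup>2) + ennreal ((nrm2 lborel (pdv \<phi> f))\<^sup>2) \<le> ennreal (gradsq \<phi>)"
      by (simp flip: ennreal_plus add: ennreal_leI)
  qed auto
  also have "\<dots> = ennreal (4 * (2 * nrm2 lborel \<phi> * sqrt (gradsq \<phi>)) * gradsq \<phi>)"
  proof -
    have "4 * ennreal X * ennreal Y = ennreal (4 * X * Y)" if "X \<ge> 0" "Y \<ge> 0" for X Y
      using that by (simp add: ennreal_mult)
    then show ?thesis using gradsq_nonneg[of \<phi>] by simp
  qed
  also have "4 * (2 * nrm2 lborel \<phi> * sqrt (gradsq \<phi>)) * gradsq \<phi> = 8 * nrm2 lborel \<phi> * (sqrt (gradsq \<phi>))^3"
    using gradsq_nonneg[of \<phi>] by (simp add: power3_eq_cube)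
  finally show ?thesis .
qed

text \<open>In the plane the natural exponents are 2 and 2; the Poincare inequality trades one power
  of the L^2 norm for a gradient, so both dimensions share the exponents 1 and 3.\<close>

theorem ladyzhenskaya_test:
  fixes D :: "'a::euclidean_space set"
  assumes dim: "DIM('a) = 2 \<or> DIM('a) = 3" and D: "bounded D"
  shows "\<exists>C\<ge>0. \<forall>\<phi>. test_fun D \<phi> \<longrightarrow>
     (\<integral>\<^sup>+x. ennreal (cmod (\<phi> x) ^ 4) \<partial>lborel) \<le> ennreal (C * nrm2 lborel \<phi> * (sqrt (gradsq \<phi>))^3)"
  using dim
proof
  assume "DIM('a) = 2"
  then obtain e f :: 'a where B: "Basis = {e, f}" "e \<noteq> f" by (auto simp: card_2_iff)
  obtain C where C: "C \<ge> 0" "\<And>\<phi>. test_fun D \<phi> \<Longrightarrow> (nrm2 lborel \<phi>)\<^sup>2 \<le> C * gradsq \<phi>"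
    using poincare_test[OF D] by blast
  show ?thesis
  proof (intro exI[of _ "4 * sqrt C"] conjI allI impI)
    fix \<phi> :: "'a \<Rightarrow> complex" assume t: "test_fun D \<phi>"
    have n: "nrm2 lborel \<phi> \<le> sqrt C * sqrt (gradsq \<phi>)"
      using real_sqrt_le_mono[OF C(2)[OF t]] by (simp add: real_sqrt_mult)
    have "4 * (nrm2 lborel \<phi>)\<^sup>2 * gradsq \<phi> = 4 * nrm2 lborel \<phi> * gradsq \<phi> * nrm2 lborel \<phi>" by (simp add: power2_eq_square)
    also have "\<dots> \<le> 4 * nrm2 lborel \<phi> * gradsq \<phi> * (sqrt C * sqrt (gradsq \<phi>))"
      using n gradsq_nonneg[of \<phi>] by (intro mult_left_mono) auto
    also have "\<dots> = 4 * sqrt C * nrm2 lborel \<phi> * (sqrt (gradsq \<phi>))^3"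
      using gradsq_nonneg[of \<phi>] by (simp add: power3_eq_cube)
    finally show "(\<integral>\<^sup>+x. ennreal (cmod (\<phi> x) ^ 4) \<partial>lborel) \<le> ennreal (4 * sqrt C * nrm2 lborel \<phi> * (sqrt (gradsq \<phi>))^3)"
      using ladyzhenskaya2[OF B t] by (meson ennreal_leI order_trans)
  qed (use C in simp)
next
  assume "DIM('a) = 3"
  then obtain g e f :: 'a where B: "Basis = {g, e, f}" "g \<noteq> e" "g \<noteq> f" "e \<noteq> f" by (auto simp: card_3_iff)
  show ?thesis using ladyzhenskaya3[OF B] by (intro exI[of _ 8]) auto
qed

section \<open>Sobolev spaces on a bounded domain\<close>

locale bounded_domain =
  fixes D :: "'a::euclidean_space set"
  assumes openD: "open D" and boundedD: "bounded D"
begin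

abbreviation M :: "'a measure" where "M \<equiv> lebesgue_on D"

lemma sets_D [simp, intro]: "D \<in> sets lebesgue" using openD by auto

lemma finite_M: "finite_measure M"
  by (rule finite_measure_lebesgue_on[OF bounded_set_imp_lmeasurable[OF boundedD sets_D]])

sublocale M: finite_measure M by (rule finite_M)

lemma L2_iff: "L2 D f \<longleftrightarrow> sqi M f"
  by (simp add: L2_def sqi_def set_borel_measurable_def borel_measurable_restrict_space_iff lebesgue_on_integral(2))

lemma l2inner_eq: "l2inner D v w = Re (\<integral>x. v x * cnj (w x) \<partial>M)"
  by (simp add: l2inner_def lebesgue_on_integral(1))

lemma l2inner_self: "l2inner D v v = (nrm2 M v)\<^sup>2"
proof -
  have "(\<lambda>x. v x * cnj (v x)) = (\<lambda>x. complex_of_real ((cmod (v x))\<^sup>2))"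
    by (simp add: complex_norm_square[symmetric] del: of_real_power)
  then show ?thesis by (simp add: l2inner_eq nrm2_sq del: of_real_power)
qed

lemma l2norm_eq: "l2norm D v = nrm2 M v"
  by (simp add: l2norm_def l2inner_self)

lemma weak_partial_iff:
  "weak_partial D v b g \<longleftrightarrow> sqi M g \<and> (\<forall>\<phi>. test_fun D \<phi> \<longrightarrow>
      (\<integral>x. v x * pdv \<phi> b x \<partial>M) = - (\<integral>x. g x * \<phi> x \<partial>M))"
  by (simp add: weak_partial_def L2_iff lebesgue_on_integral(1))

lemma sqi_one: "sqi M (\<lambda>_. 1)" by (simp add: sqi_def)

lemma sqi_integrable: "sqi M f \<Longrightarrow> integrable M f"
  using sqi_mult_integrable[OF _ sqi_one] by force

lemma sqi_test: "test_fun D \<phi> \<Longrightarrow> sqi M \<phi>"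
  by (rule test_fun_sqi_on(1)) auto

lemma sqi_test_pdv: "test_fun D \<phi> \<Longrightarrow> b \<in> Basis \<Longrightarrow> sqi M (pdv \<phi> b)"
  by (intro sqi_test test_fun_pdv)

lemma test_AE_eq:
  assumes "sqi M g" "sqi M g'" "\<And>\<phi>. test_fun D \<phi> \<Longrightarrow> (\<integral>x. g x * \<phi> x \<partial>M) = (\<integral>x. g' x * \<phi> x \<partial>M)"
  shows "AE x in M. g x = g' x"
proof -
  have "AE x in M. g x - g' x = 0"
  proof (rule fundamental_lemma[OF openD])
    show "integrable M (\<lambda>x. g x - g' x)" by (intro sqi_integrable sqi_diff assms)
    fix \<phi> assume t: "test_fun D \<phi>"
    show "(\<integral>x. (g x - g' x) * \<phi> x \<partial>M) = 0"
      unfolding left_diff_distrib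
      by (subst Bochner_Integration.integral_diff) (auto intro!: sqi_mult_integrable assms sqi_test t simp: assms(3)[OF t])
  qed
  then show ?thesis by simp
qed

lemma weak_partial_unique:
  assumes "weak_partial D v b g" "weak_partial D v b g'" shows "AE x in M. g x = g' x"
  by (rule test_AE_eq) (use assms in \<open>auto simp: weak_partial_iff\<close>)

lemma weak_partial_sqi: "weak_partial D v b g \<Longrightarrow> sqi M g" by (simp add: weak_partial_iff)

lemma H1_sqi: "H1 D v \<Longrightarrow> sqi M v" by (simp add: H1_def L2_iff)

lemma H1_wpd: "H1 D v \<Longrightarrow> b \<in> Basis \<Longrightarrow> weak_partial D v b (wpd D v b)"
  unfolding H1_def wpd_def using someI_ex[of "weak_partial D v b"] by blast

lemma H1_wpd_sqi: "H1 D v \<Longrightarrow> b \<in> Basis \<Longrightarrow> sqi M (wpd D v b)"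
  using H1_wpd weak_partial_sqi by blast

text \<open>\<open>wpd\<close> is an arbitrary choice among weak derivatives, hence every rule of
  calculation for it holds almost everywhere only and is transferred to norms and inner products by
  congruence.\<close>

lemma wpd_AE: "weak_partial D v b g \<Longrightarrow> AE x in M. wpd D v b x = g x"
  unfolding wpd_def using weak_partial_unique[OF someI[of "weak_partial D v b"]] by blast

lemma H1I: "sqi M v \<Longrightarrow> (\<And>b. b \<in> Basis \<Longrightarrow> weak_partial D v b (g b)) \<Longrightarrow> H1 D v"
  unfolding H1_def L2_iff by blast

lemma weak_partial_add:
  assumes "sqi M v" "sqi M w" "weak_partial D v b g" "weak_partial D w b k" "b \<in> Basis"
  shows "weak_partial D (\<lambda>x. v x + w x) b (\<lambda>x. g x + k x)"
proof -
  have s: "sqi M g" "sqi M k" using assms weak_partial_sqi by auto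
  show ?thesis unfolding weak_partial_iff
  proof (intro conjI allI impI)
    show "sqi M (\<lambda>x. g x + k x)" by (intro sqi_add s)
    fix \<phi> assume t: "test_fun D \<phi>"
    show "(\<integral>x. (v x + w x) * pdv \<phi> b x \<partial>M) = - (\<integral>x. (g x + k x) * \<phi> x \<partial>M)"
      using assms s t unfolding distrib_right
      by (simp add: weak_partial_iff sqi_mult_integrable sqi_test sqi_test_pdv)
  qed
qed

lemma weak_partial_cmult:
  assumes "sqi M v" "weak_partial D v b g" "b \<in> Basis"
  shows "weak_partial D (\<lambda>x. c * v x) b (\<lambda>x. c * g x)"
  using assms by (auto simp: weak_partial_iff mult.assoc intro: sqi_cmult)

lemma weak_partial_test:
  assumes "test_fun D \<phi>" "b \<in> Basis" shows "weak_partial D \<phi> b (pdv \<phi> b)"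
  unfolding weak_partial_iff
proof (intro conjI allI impI sqi_test_pdv assms)
  fix \<eta> assume t: "test_fun D \<eta>"
  show "(\<integral>x. \<phi> x * pdv \<eta> b x \<partial>M) = - (\<integral>x. pdv \<phi> b x * \<eta> x \<partial>M)"
    by (rule integration_by_parts[OF sets_D assms(2) smooth_fun_has_derivative[OF test_fun_smooth[OF assms(1)]]
          test_fun_continuous[OF test_fun_pdv[OF assms]] t])
qed

lemma H1_test: "test_fun D \<phi> \<Longrightarrow> H1 D \<phi>"
  by (rule H1I[OF sqi_test weak_partial_test])

lemma wpd_test: "test_fun D \<phi> \<Longrightarrow> b \<in> Basis \<Longrightarrow> AE x in M. wpd D \<phi> b x = pdv \<phi> b x"
  by (rule wpd_AE[OF weak_partial_test])

lemma H1_add: "H1 D v \<Longrightarrow> H1 D w \<Longrightarrow> H1 D (\<lambda>x. v x + w x)"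
  by (rule H1I[OF sqi_add weak_partial_add]) (auto intro: H1_sqi H1_wpd)

lemma H1_cmult: "H1 D v \<Longrightarrow> H1 D (\<lambda>x. c * v x)"
  by (rule H1I[OF sqi_cmult weak_partial_cmult]) (auto intro: H1_sqi H1_wpd)

lemma H1_diff: "H1 D v \<Longrightarrow> H1 D w \<Longrightarrow> H1 D (\<lambda>x. v x - w x)"
  using H1_add[of v "\<lambda>x. (-1) * w x"] H1_cmult[of w "-1"] by simp

lemma wpd_add: "H1 D v \<Longrightarrow> H1 D w \<Longrightarrow> b \<in> Basis \<Longrightarrow> AE x in M. wpd D (\<lambda>x. v x + w x) b x = wpd D v b x + wpd D w b x"
  by (rule wpd_AE[OF weak_partial_add]) (auto intro: H1_sqi H1_wpd)

lemma wpd_cmult: "H1 D v \<Longrightarrow> b \<in> Basis \<Longrightarrow> AE x in M. wpd D (\<lambda>x. c * v x) b x = c * wpd D v b x"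
  by (rule wpd_AE[OF weak_partial_cmult]) (auto intro: H1_sqi H1_wpd)

lemma wpd_diff:
  assumes "H1 D v" "H1 D w" "b \<in> Basis"
  shows "AE x in M. wpd D (\<lambda>x. v x - w x) b x = wpd D v b x - wpd D w b x"
  using wpd_add[OF assms(1) H1_cmult[OF assms(2), of "-1"] assms(3)] wpd_cmult[OF assms(2,3), of "-1"]
  by (auto elim!: AE_mp)

text \<open>The zero function is a weak derivative of any null function. This is what makes the H^1
  seminorm vanish as soon as the L^2 seminorm does.\<close>

lemma wpd_null:
  assumes "AE x in M. v x = 0" "b \<in> Basis" shows "AE x in M. wpd D v b x = 0"
proof (rule wpd_AE)
  have "(\<integral>x. v x * pdv \<phi> b x \<partial>M) = 0" for \<phi> :: "'a \<Rightarrow> complex"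
    using assms(1) by (intro integral_eq_zero_AE) auto
  then show "weak_partial D v b (\<lambda>x. 0)" unfolding weak_partial_iff by (simp add: sqi_zero)
qed

section \<open>Norm and convergence in H^1\<close>

definition grd :: "('a \<Rightarrow> complex) \<Rightarrow> real" where
  "grd v = (\<Sum>b\<in>Basis. (nrm2 M (wpd D v b))\<^sup>2)"

lemma grd_nonneg: "0 \<le> grd v" by (simp add: grd_def sum_nonneg)

lemma h1norm_eq: "h1norm D v = sqrt ((nrm2 M v)\<^sup>2 + grd v)"
  by (simp add: h1norm_def h1inner_def l2inner_self grd_def)

lemma h1norm_sq: "(h1norm D v)\<^sup>2 = (nrm2 M v)\<^sup>2 + grd v"
  using grd_nonneg[of v] by (simp add: h1norm_eq)

lemma h1norm_nonneg: "0 \<le> h1norm D v" using grd_nonneg[of v] by (simp add: h1norm_eq)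

lemma nrm2_le_h1norm: "nrm2 M v \<le> h1norm D v"
  by (rule power2_le_imp_le) (simp_all add: h1norm_sq grd_nonneg h1norm_nonneg)

lemma nrm2_wpd_le_h1norm: "b \<in> Basis \<Longrightarrow> nrm2 M (wpd D v b) \<le> h1norm D v"
proof (rule power2_le_imp_le)
  assume "b \<in> Basis"
  then have "(nrm2 M (wpd D v b))\<^sup>2 \<le> grd v" unfolding grd_def by (intro member_le_sum) auto
  then show "(nrm2 M (wpd D v b))\<^sup>2 \<le> (h1norm D v)\<^sup>2" unfolding h1norm_sq using zero_le_power2[of "nrm2 M v"] by linarith
qed (rule h1norm_nonneg)

lemma grd_test: "test_fun D \<phi> \<Longrightarrow> grd \<phi> = gradsq \<phi>"
proof -
  assume t: "test_fun D \<phi>"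
  have "nrm2 M (wpd D \<phi> b) = nrm2 lborel (pdv \<phi> b)" if b: "b \<in> Basis" for b
  proof -
    have "nrm2 M (wpd D \<phi> b) = nrm2 M (pdv \<phi> b)"
      by (rule nrm2_AE_cong[OF wpd_test[OF t b]]) (use H1_wpd_sqi[OF H1_test[OF t] b] sqi_test_pdv[OF t b] in \<open>auto simp: sqi_def\<close>)
    also have "\<dots> = nrm2 lborel (pdv \<phi> b)" by (rule test_fun_sqi_on(2)[OF sets_D test_fun_pdv[OF t b]])
    finally show ?thesis .
  qed
  then show ?thesis by (simp add: grd_def gradsq_def)
qed

lemma nrm2_wpd_diff:
  assumes "H1 D v" "H1 D w" "b \<in> Basis"
  shows "nrm2 M (wpd D (\<lambda>x. v x - w x) b) = nrm2 M (\<lambda>x. wpd D v b x - wpd D w b x)"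
  by (rule nrm2_AE_cong[OF wpd_diff[OF assms]])
    (use H1_wpd_sqi[OF H1_diff[OF assms(1,2)] assms(3)] sqi_diff[OF H1_wpd_sqi[OF assms(1,3)] H1_wpd_sqi[OF assms(2,3)]] in \<open>auto simp: sqi_def\<close>)

lemma h1_tendsto_iff:
  assumes "\<And>n. H1 D (v n)" "H1 D w"
  shows "(\<lambda>n. h1norm D (\<lambda>x. v n x - w x)) \<longlonglongrightarrow> 0 \<longleftrightarrow>
     (\<lambda>n. nrm2 M (\<lambda>x. v n x - w x)) \<longlonglongrightarrow> 0 \<and> (\<forall>b\<in>Basis. (\<lambda>n. nrm2 M (\<lambda>x. wpd D (v n) b x - wpd D w b x)) \<longlonglongrightarrow> 0)"
    (is "?L \<longleftrightarrow> ?R")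
proof
  assume L: ?L
  show ?R
  proof (intro conjI ballI)
    show "(\<lambda>n. nrm2 M (\<lambda>x. v n x - w x)) \<longlonglongrightarrow> 0"
      by (rule tendsto_dist_bound[OF _ L]) (simp add: nrm2_le_h1norm)
    fix b :: 'a assume b: "b \<in> Basis"
    show "(\<lambda>n. nrm2 M (\<lambda>x. wpd D (v n) b x - wpd D w b x)) \<longlonglongrightarrow> 0"
      by (rule tendsto_dist_bound[OF _ L]) (simp add: nrm2_wpd_diff[OF assms b, symmetric] nrm2_wpd_le_h1norm[OF b])
  qed
next
  assume R: ?R
  have "(\<lambda>n. sqrt ((nrm2 M (\<lambda>x. v n x - w x))\<^sup>2 + (\<Sum>b\<in>Basis. (nrm2 M (\<lambda>x. wpd D (v n) b x - wpd D w b x))\<^sup>2)))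
     \<longlonglongrightarrow> sqrt (0\<^sup>2 + (\<Sum>b\<in>(Basis::'a set). 0\<^sup>2))"
    using R by (intro tendsto_intros) auto
  then show ?L by (simp add: h1norm_eq grd_def nrm2_wpd_diff[OF assms])
qed

lemma h1norm_triangle:
  assumes "H1 D v" "H1 D w" shows "h1norm D (\<lambda>x. v x + w x) \<le> h1norm D v + h1norm D w"
proof -
  \<comment> \<open>The H^1 norm is a Euclidean norm of component norms, \<open>None\<close>
    indexing the function and \<open>Some b\<close> its partial derivatives; the triangle inequality
    then follows from Minkowski for finite sums.\<close>
  define f where "f u c = (case c of None \<Rightarrow> nrm2 M u | Some b \<Rightarrow> nrm2 M (wpd D u b))" for u c
  have L: "h1norm D u = L2_set (f u) (insert None (Some ` Basis))" for u
    by (simp add: h1norm_eq L2_set_def grd_def f_def sum.reindex)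
  have "f (\<lambda>x. v x + w x) c \<le> f v c + f w c" if "c \<in> insert None (Some ` Basis)" for c
  proof (cases c)
    case None
    then show ?thesis using nrm2_triangle[OF H1_sqi[OF assms(1)] H1_sqi[OF assms(2)]] by (simp add: f_def)
  next
    case (Some b)
    then have b: "b \<in> Basis" using that by auto
    have "nrm2 M (wpd D (\<lambda>x. v x + w x) b) = nrm2 M (\<lambda>x. wpd D v b x + wpd D w b x)"
      by (rule nrm2_AE_cong[OF wpd_add[OF assms b]])
        (use H1_wpd_sqi[OF H1_add[OF assms] b] sqi_add[OF H1_wpd_sqi[OF assms(1) b] H1_wpd_sqi[OF assms(2) b]] in \<open>auto simp: sqi_def\<close>)
    then show ?thesis using Some nrm2_triangle[OF H1_wpd_sqi[OF assms(1) b] H1_wpd_sqi[OF assms(2) b]] by (simp add: f_def)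
  qed
  then have "L2_set (f (\<lambda>x. v x + w x)) (insert None (Some ` Basis)) \<le> L2_set (\<lambda>c. f v c + f w c) (insert None (Some ` Basis))"
    by (intro L2_set_mono) (auto simp: f_def split: option.split)
  also have "\<dots> \<le> L2_set (f v) (insert None (Some ` Basis)) + L2_set (f w) (insert None (Some ` Basis))"
    by (rule L2_set_triangle_ineq)
  finally show ?thesis by (simp add: L)
qed

lemma h1norm_diff_triangle:
  assumes "H1 D u" "H1 D v" "H1 D w"
  shows "h1norm D (\<lambda>x. u x - w x) \<le> h1norm D (\<lambda>x. u x - v x) + h1norm D (\<lambda>x. v x - w x)"
  using h1norm_triangle[OF H1_diff[OF assms(1,2)] H1_diff[OF assms(2,3)]] by simp

lemma h1norm_cmult:
  assumes "H1 D v" shows "h1norm D (\<lambda>x. c * v x) = cmod c * h1norm D v"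
proof -
  have "nrm2 M (wpd D (\<lambda>x. c * v x) b) = cmod c * nrm2 M (wpd D v b)" if b: "b \<in> Basis" for b
  proof -
    have "nrm2 M (wpd D (\<lambda>x. c * v x) b) = nrm2 M (\<lambda>x. c * wpd D v b x)"
      by (rule nrm2_AE_cong[OF wpd_cmult[OF assms b]])
        (use H1_wpd_sqi[OF H1_cmult[OF assms] b] sqi_cmult[OF H1_wpd_sqi[OF assms b]] in \<open>auto simp: sqi_def\<close>)
    then show ?thesis by (simp add: nrm2_cmult)
  qed
  then have "(nrm2 M (\<lambda>x. c * v x))\<^sup>2 + grd (\<lambda>x. c * v x) = (cmod c)\<^sup>2 * ((nrm2 M v)\<^sup>2 + grd v)"
    by (simp add: grd_def nrm2_cmult power_mult_distrib distrib_left sum_distrib_left)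
  then show ?thesis by (simp add: h1norm_eq real_sqrt_mult)
qed

section \<open>The space H^1_0: density of test functions and completeness\<close>

lemma H10_H1: "v \<in> H10 D \<Longrightarrow> H1 D v" by (simp add: H10_def)

lemma H10_sqi: "v \<in> H10 D \<Longrightarrow> sqi M v" by (simp add: H10_H1 H1_sqi)

lemma H10_approx:
  assumes "v \<in> H10 D" "e > 0" shows "\<exists>\<phi>. test_fun D \<phi> \<and> h1norm D (\<lambda>x. \<phi> x - v x) < e"
proof -
  obtain \<phi> where \<phi>: "\<And>k::nat. test_fun D (\<phi> k)" "(\<lambda>k. h1norm D (\<lambda>x. \<phi> k x - v x)) \<longlonglongrightarrow> 0"
    using assms by (auto simp: H10_def)
  then have "\<forall>\<^sub>F k in sequentially. h1norm D (\<lambda>x. \<phi> k x - v x) < e" using assms(2) by (intro order_tendstoD(2))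
  then obtain k where "h1norm D (\<lambda>x. \<phi> k x - v x) < e" by (auto simp: eventually_sequentially)
  then show ?thesis using \<phi>(1) by blast
qed

lemma H10I:
  assumes "H1 D v" "\<And>e. e > 0 \<Longrightarrow> \<exists>\<phi>. test_fun D \<phi> \<and> h1norm D (\<lambda>x. \<phi> x - v x) < e"
  shows "v \<in> H10 D"
proof -
  have "\<forall>k. \<exists>\<phi>. test_fun D \<phi> \<and> h1norm D (\<lambda>x. \<phi> x - v x) < 1 / real (Suc k)" using assms(2) by simp
  then obtain \<phi> where \<phi>: "\<And>k. test_fun D (\<phi> k)" "\<And>k. h1norm D (\<lambda>x. \<phi> k x - v x) < 1 / real (Suc k)" by metis
  have "(\<lambda>k. h1norm D (\<lambda>x. \<phi> k x - v x)) \<longlonglongrightarrow> 0"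
  proof (rule tendsto_dist_bound)
    show "\<bar>h1norm D (\<lambda>x. \<phi> k x - v x) - 0\<bar> \<le> 1 / real (Suc k)" for k using \<phi>(2)[of k] by (simp add: h1norm_nonneg less_imp_le)
    show "(\<lambda>k. 1 / real (Suc k)) \<longlonglongrightarrow> 0" using LIMSEQ_inverse_real_of_nat by (simp add: inverse_eq_divide)
  qed
  then show ?thesis using assms(1) \<phi>(1) unfolding H10_def by blast
qed

text \<open>Approximation with classical partial derivatives in place of the chosen weak ones, since
  integration by parts and the inequalities for test functions speak of classical
  derivatives.\<close>

lemma H10_seq:
  assumes "v \<in> H10 D"
  shows "\<exists>\<phi>. (\<forall>k::nat. test_fun D (\<phi> k)) \<and> (\<lambda>k. nrm2 M (\<lambda>x. \<phi> k x - v x)) \<longlonglongrightarrow> 0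
     \<and> (\<forall>b\<in>Basis. (\<lambda>k. nrm2 M (\<lambda>x. pdv (\<phi> k) b x - wpd D v b x)) \<longlonglongrightarrow> 0)"
proof -
  obtain \<phi> where \<phi>: "\<And>k::nat. test_fun D (\<phi> k)" "(\<lambda>k. h1norm D (\<lambda>x. \<phi> k x - v x)) \<longlonglongrightarrow> 0"
    using assms by (auto simp: H10_def)
  have l: "(\<lambda>k. nrm2 M (\<lambda>x. \<phi> k x - v x)) \<longlonglongrightarrow> 0" "\<And>b. b \<in> Basis \<Longrightarrow> (\<lambda>k. nrm2 M (\<lambda>x. wpd D (\<phi> k) b x - wpd D v b x)) \<longlonglongrightarrow> 0"
    using \<phi>(2) h1_tendsto_iff[OF H1_test[OF \<phi>(1)] H10_H1[OF assms]] by auto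
  have "nrm2 M (\<lambda>x. wpd D (\<phi> k) b x - wpd D v b x) = nrm2 M (\<lambda>x. pdv (\<phi> k) b x - wpd D v b x)" if b: "b \<in> Basis" for k b
    by (rule nrm2_AE_cong)
      (use wpd_test[OF \<phi>(1) b, of k] sqi_diff[OF H1_wpd_sqi[OF H1_test[OF \<phi>(1)] b] H1_wpd_sqi[OF H10_H1[OF assms] b]]
        sqi_diff[OF sqi_test_pdv[OF \<phi>(1) b] H1_wpd_sqi[OF H10_H1[OF assms] b]] in \<open>auto simp: sqi_def\<close>)
  then show ?thesis using l \<phi>(1) by auto
qed

lemma H10_add:
  assumes "v \<in> H10 D" "w \<in> H10 D" shows "(\<lambda>x. v x + w x) \<in> H10 D"
proof (rule H10I)
  show "H1 D (\<lambda>x. v x + w x)" by (intro H1_add H10_H1 assms)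
  fix e :: real assume "e > 0"
  then obtain \<phi> \<psi> where t: "test_fun D \<phi>" "test_fun D \<psi>" and l: "h1norm D (\<lambda>x. \<phi> x - v x) < e/2" "h1norm D (\<lambda>x. \<psi> x - w x) < e/2"
    using H10_approx[OF assms(1), of "e/2"] H10_approx[OF assms(2), of "e/2"] by auto
  have "h1norm D (\<lambda>x. (\<phi> x - v x) + (\<psi> x - w x)) \<le> h1norm D (\<lambda>x. \<phi> x - v x) + h1norm D (\<lambda>x. \<psi> x - w x)"
    by (intro h1norm_triangle H1_diff H1_test H10_H1 t assms)
  then have "h1norm D (\<lambda>x. (\<phi> x + \<psi> x) - (v x + w x)) < e" using l by (simp add: algebra_simps)
  then show "\<exists>\<phi>. test_fun D \<phi> \<and> h1norm D (\<lambda>x. \<phi> x - (v x + w x)) < e" using test_fun_add[OF t] by blast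
qed

lemma H10_cmult:
  assumes "v \<in> H10 D" shows "(\<lambda>x. c * v x) \<in> H10 D"
proof (rule H10I)
  show "H1 D (\<lambda>x. c * v x)" by (intro H1_cmult H10_H1 assms)
  fix e :: real assume e: "e > 0"
  then obtain \<phi> where t: "test_fun D \<phi>" and l: "h1norm D (\<lambda>x. \<phi> x - v x) < e / (cmod c + 1)"
    using H10_approx[OF assms, of "e / (cmod c + 1)"] by (auto simp: add_nonneg_pos)
  have "h1norm D (\<lambda>x. c * (\<phi> x - v x)) = cmod c * h1norm D (\<lambda>x. \<phi> x - v x)"
    by (intro h1norm_cmult H1_diff H1_test H10_H1 t assms)
  also have "\<dots> \<le> cmod c * (e / (cmod c + 1))" using l by (intro mult_left_mono) auto
  also have "\<dots> < e" using e by (simp add: pos_divide_less_eq add_nonneg_pos distrib_left)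
  finally have "h1norm D (\<lambda>x. c * \<phi> x - c * v x) < e" by (simp add: algebra_simps)
  then show "\<exists>\<phi>. test_fun D \<phi> \<and> h1norm D (\<lambda>x. \<phi> x - c * v x) < e" using test_fun_cmult[OF t] by blast
qed

lemma H10_diff: "v \<in> H10 D \<Longrightarrow> w \<in> H10 D \<Longrightarrow> (\<lambda>x. v x - w x) \<in> H10 D"
  using H10_add[of v "\<lambda>x. (-1) * w x"] H10_cmult[of w "-1"] by simp

lemma H10_test: "test_fun D \<phi> \<Longrightarrow> \<phi> \<in> H10 D"
  by (rule H10I[OF H1_test]) (use h1norm_cmult[OF H1_test, of \<phi> 0] in \<open>auto intro!: exI[of _ \<phi>]\<close>)

lemma H10_zero: "(\<lambda>x. 0) \<in> H10 D" by (rule H10_test[OF test_fun_zero])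

text \<open>Function and partial derivatives converge separately in L^2; the integral identity
  defining weak derivatives passes to the limit and ties the limits together. Membership in H^1_0
  follows by approximating an approximant.\<close>

theorem H10_complete:
  assumes v: "\<And>n. v n \<in> H10 D" and C: "\<And>e. e > 0 \<Longrightarrow> \<exists>N. \<forall>m\<ge>N. \<forall>n\<ge>N. h1norm D (\<lambda>x. v m x - v n x) < e"
  shows "\<exists>w\<in>H10 D. (\<lambda>n. h1norm D (\<lambda>x. v n x - w x)) \<longlonglongrightarrow> 0"
proof -
  note H = H10_H1[OF v]
  have "\<exists>g. sqi M g \<and> (\<lambda>n. nrm2 M (\<lambda>x. v n x - g x)) \<longlonglongrightarrow> 0"
  proof (rule sqi_complete[OF H1_sqi[OF H]])
    fix e :: real assume "e > 0"
    then obtain N where "\<forall>m\<ge>N. \<forall>n\<ge>N. h1norm D (\<lambda>x. v m x - v n x) < e" using C by blast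
    then show "\<exists>N. \<forall>m\<ge>N. \<forall>n\<ge>N. nrm2 M (\<lambda>x. v m x - v n x) < e"
      by (intro exI[of _ N] allI impI order.strict_trans1[OF nrm2_le_h1norm]) auto
  qed
  then obtain w where w: "sqi M w" "(\<lambda>n. nrm2 M (\<lambda>x. v n x - w x)) \<longlonglongrightarrow> 0" by blast
  have "\<exists>g. sqi M g \<and> (\<lambda>n. nrm2 M (\<lambda>x. wpd D (v n) b x - g x)) \<longlonglongrightarrow> 0" if b: "b \<in> Basis" for b
  proof (rule sqi_complete[OF H1_wpd_sqi[OF H b]])
    fix e :: real assume "e > 0"
    then obtain N where "\<forall>m\<ge>N. \<forall>n\<ge>N. h1norm D (\<lambda>x. v m x - v n x) < e" using C by blast
    then show "\<exists>N. \<forall>m\<ge>N. \<forall>n\<ge>N. nrm2 M (\<lambda>x. wpd D (v m) b x - wpd D (v n) b x) < e"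
      unfolding nrm2_wpd_diff[OF H H b, symmetric]
      by (intro exI[of _ N] allI impI order.strict_trans1[OF nrm2_wpd_le_h1norm[OF b]]) auto
  qed
  then obtain g where g: "\<And>b. b \<in> Basis \<Longrightarrow> sqi M (g b)"
     "\<And>b. b \<in> Basis \<Longrightarrow> (\<lambda>n. nrm2 M (\<lambda>x. wpd D (v n) b x - g b x)) \<longlonglongrightarrow> 0" by metis
  have wp: "weak_partial D w b (g b)" if b: "b \<in> Basis" for b
    unfolding weak_partial_iff
  proof (intro conjI allI impI g b)
    fix \<phi> assume t: "test_fun D \<phi>"
    have c0: "(\<lambda>n. nrm2 M (\<lambda>x. f x - f x)) \<longlonglongrightarrow> 0" for f :: "'a \<Rightarrow> complex" by (simp add: nrm2_def)
    have "(\<lambda>n. \<integral>x. v n x * pdv \<phi> b x \<partial>M) \<longlonglongrightarrow> (\<integral>x. w x * pdv \<phi> b x \<partial>M)"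
      by (rule tendsto_integral_mult[OF H1_sqi[OF H] w(1) sqi_test_pdv[OF t b] sqi_test_pdv[OF t b] w(2) c0])
    moreover have "(\<lambda>n. - (\<integral>x. wpd D (v n) b x * \<phi> x \<partial>M)) \<longlonglongrightarrow> - (\<integral>x. g b x * \<phi> x \<partial>M)"
      by (rule tendsto_minus, rule tendsto_integral_mult[OF H1_wpd_sqi[OF H b] g(1)[OF b] sqi_test[OF t] sqi_test[OF t] g(2)[OF b] c0])
    moreover have "(\<integral>x. v n x * pdv \<phi> b x \<partial>M) = - (\<integral>x. wpd D (v n) b x * \<phi> x \<partial>M)" for n
      using H1_wpd[OF H b] t by (simp add: weak_partial_iff)
    ultimately show "(\<integral>x. w x * pdv \<phi> b x \<partial>M) = - (\<integral>x. g b x * \<phi> x \<partial>M)" by (simp add: LIMSEQ_unique)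
  qed
  have Hw: "H1 D w" by (rule H1I[OF w(1) wp])
  have "nrm2 M (\<lambda>x. wpd D (v n) b x - g b x) = nrm2 M (\<lambda>x. wpd D (v n) b x - wpd D w b x)" if b: "b \<in> Basis" for b n
    by (rule nrm2_AE_cong)
      (use wpd_AE[OF wp[OF b]] sqi_diff[OF H1_wpd_sqi[OF H b] H1_wpd_sqi[OF Hw b]] sqi_diff[OF H1_wpd_sqi[OF H b] g(1)[OF b]] in \<open>auto simp: sqi_def\<close>)
  then have lim: "(\<lambda>n. h1norm D (\<lambda>x. v n x - w x)) \<longlonglongrightarrow> 0"
    unfolding h1_tendsto_iff[OF H Hw] using w(2) g(2) by simp
  have "w \<in> H10 D"
  proof (rule H10I[OF Hw])
    fix e :: real assume e: "e > 0"
    then have "\<forall>\<^sub>F n in sequentially. h1norm D (\<lambda>x. v n x - w x) < e/2" using lim by (intro order_tendstoD(2)) auto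
    then obtain n where n: "h1norm D (\<lambda>x. v n x - w x) < e/2" by (auto simp: eventually_sequentially)
    obtain \<phi> where \<phi>: "test_fun D \<phi>" "h1norm D (\<lambda>x. \<phi> x - v n x) < e/2" using H10_approx[OF v, of "e/2"] e by auto
    have "h1norm D (\<lambda>x. \<phi> x - w x) < e" using h1norm_diff_triangle[OF H1_test[OF \<phi>(1)] H[of n] Hw] n \<phi>(2) by linarith
    then show "\<exists>\<phi>. test_fun D \<phi> \<and> h1norm D (\<lambda>x. \<phi> x - w x) < e" using \<phi>(1) by blast
  qed
  then show ?thesis using lim by blast
qed

section \<open>Inequalities carried over from test functions to H^1_0\<close>

lemma nrm2_tendsto:
  assumes "\<And>n. sqi M (f n)" "sqi M g" "(\<lambda>n. nrm2 M (\<lambda>x. f n x - g x)) \<longlonglongrightarrow> 0"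
  shows "(\<lambda>n. nrm2 M (f n)) \<longlonglongrightarrow> nrm2 M g"
proof (rule tendsto_dist_bound[OF _ assms(3)])
  fix n
  show "\<bar>nrm2 M (f n) - nrm2 M g\<bar> \<le> nrm2 M (\<lambda>x. f n x - g x)"
    using nrm2_triangle[OF sqi_diff[OF assms(1)[of n] assms(2)] assms(2)]
      nrm2_triangle[OF sqi_diff[OF assms(2) assms(1)[of n]] assms(1)[of n]] nrm2_minus_commute[of M g "f n"] by simp
qed

lemma H10_seq_grad:
  assumes "v \<in> H10 D"
  shows "\<exists>\<phi>. (\<forall>k::nat. test_fun D (\<phi> k)) \<and> (\<lambda>k. nrm2 M (\<lambda>x. \<phi> k x - v x)) \<longlonglongrightarrow> 0
     \<and> (\<lambda>k. nrm2 lborel (\<phi> k)) \<longlonglongrightarrow> nrm2 M v \<and> (\<lambda>k. gradsq (\<phi> k)) \<longlonglongrightarrow> grd v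
     \<and> (AE x in M. (\<lambda>k. \<phi> k x) \<longlonglongrightarrow> v x)"
proof -
  note H = H10_H1[OF assms]
  obtain \<phi> where \<phi>: "\<And>k::nat. test_fun D (\<phi> k)" "(\<lambda>k. nrm2 M (\<lambda>x. \<phi> k x - v x)) \<longlonglongrightarrow> 0"
     "\<And>b. b\<in>Basis \<Longrightarrow> (\<lambda>k. nrm2 M (\<lambda>x. pdv (\<phi> k) b x - wpd D v b x)) \<longlonglongrightarrow> 0" using H10_seq[OF assms] by blast
  obtain r where r: "strict_mono (r::nat\<Rightarrow>nat)" "AE x in M. (\<lambda>k. \<phi> (r k) x) \<longlonglongrightarrow> v x"
    using nrm2_tendsto_AE_subseq[OF sqi_test[OF \<phi>(1)] H1_sqi[OF H] \<phi>(2)] by blast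
  have 1: "(\<lambda>k. nrm2 M (\<lambda>x. \<phi> (r k) x - v x)) \<longlonglongrightarrow> 0" using LIMSEQ_subseq_LIMSEQ[OF \<phi>(2) r(1)] by (simp add: o_def)
  have "(\<lambda>k. nrm2 M (\<phi> (r k))) \<longlonglongrightarrow> nrm2 M v" by (rule nrm2_tendsto[OF sqi_test[OF \<phi>(1)] H1_sqi[OF H] 1])
  then have 2: "(\<lambda>k. nrm2 lborel (\<phi> (r k))) \<longlonglongrightarrow> nrm2 M v" by (simp add: test_fun_sqi_on(2)[OF sets_D \<phi>(1)])
  have "(\<lambda>k. \<Sum>b\<in>Basis. (nrm2 M (pdv (\<phi> (r k)) b))\<^sup>2) \<longlonglongrightarrow> (\<Sum>b\<in>Basis. (nrm2 M (wpd D v b))\<^sup>2)"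
  proof (intro tendsto_intros)
    fix b :: 'a assume b: "b \<in> Basis"
    show "(\<lambda>k. nrm2 M (pdv (\<phi> (r k)) b)) \<longlonglongrightarrow> nrm2 M (wpd D v b)"
      by (rule nrm2_tendsto[OF sqi_test_pdv[OF \<phi>(1) b] H1_wpd_sqi[OF H b]])
        (use LIMSEQ_subseq_LIMSEQ[OF \<phi>(3)[OF b] r(1)] in \<open>simp add: o_def\<close>)
  qed
  then have "(\<lambda>k. gradsq (\<phi> (r k))) \<longlonglongrightarrow> grd v"
    by (simp add: grd_def gradsq_def test_fun_sqi_on(2)[OF sets_D test_fun_pdv[OF \<phi>(1)]] cong: sum.cong)
  then show ?thesis using \<phi>(1) r(2) 1 2 by (intro exI[of _ "\<lambda>k. \<phi> (r k)"]) auto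
qed

theorem poincare:
  "\<exists>C\<ge>0. \<forall>v\<in>H10 D. (nrm2 M v)\<^sup>2 \<le> C * grd v"
proof -
  obtain C where C: "C \<ge> 0" "\<And>\<phi>. test_fun D \<phi> \<Longrightarrow> (nrm2 lborel \<phi>)\<^sup>2 \<le> C * gradsq \<phi>"
    using poincare_test[OF boundedD] by blast
  have "(nrm2 M v)\<^sup>2 \<le> C * grd v" if v: "v \<in> H10 D" for v
  proof -
    obtain \<phi> where \<phi>: "\<And>k::nat. test_fun D (\<phi> k)" "(\<lambda>k. nrm2 lborel (\<phi> k)) \<longlonglongrightarrow> nrm2 M v" "(\<lambda>k. gradsq (\<phi> k)) \<longlonglongrightarrow> grd v"
      using H10_seq_grad[OF v] by blast
    have "(\<lambda>k. (nrm2 lborel (\<phi> k))\<^sup>2) \<longlonglongrightarrow> (nrm2 M v)\<^sup>2" "(\<lambda>k. C * gradsq (\<phi> k)) \<longlonglongrightarrow> C * grd v"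
      by (intro tendsto_intros \<phi>)+
    then show ?thesis by (rule LIMSEQ_le) (use C(2)[OF \<phi>(1)] in auto)
  qed
  then show ?thesis using C(1) by blast
qed

text \<open>The square of \<open>v\<close> is not known to be in L^2 beforehand, so the inequality
  passes to the limit by Fatou along an almost everywhere convergent approximation.\<close>

theorem ladyzhenskaya:
  assumes dim: "DIM('a) = 2 \<or> DIM('a) = 3"
  shows "\<exists>C\<ge>0. \<forall>v\<in>H10 D. sqi M (\<lambda>x. v x * v x) \<and> (nrm2 M (\<lambda>x. v x * v x))\<^sup>2 \<le> C * nrm2 M v * (sqrt (grd v))^3"
proof -
  obtain C where C: "C \<ge> 0" "\<And>\<phi>. test_fun D \<phi> \<Longrightarrow>
     (\<integral>\<^sup>+x. ennreal (cmod (\<phi> x) ^ 4) \<partial>lborel) \<le> ennreal (C * nrm2 lborel \<phi> * (sqrt (gradsq \<phi>))^3)"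
    using ladyzhenskaya_test[OF dim boundedD] by blast
  have "sqi M (\<lambda>x. v x * v x) \<and> (nrm2 M (\<lambda>x. v x * v x))\<^sup>2 \<le> C * nrm2 M v * (sqrt (grd v))^3" if v: "v \<in> H10 D" for v
  proof -
    obtain \<phi> where \<phi>: "\<And>k::nat. test_fun D (\<phi> k)" "(\<lambda>k. nrm2 lborel (\<phi> k)) \<longlonglongrightarrow> nrm2 M v" "(\<lambda>k. gradsq (\<phi> k)) \<longlonglongrightarrow> grd v"
       "AE x in M. (\<lambda>k. \<phi> k x) \<longlonglongrightarrow> v x"
      using H10_seq_grad[OF v] by blast
    define B where "B k = C * nrm2 lborel (\<phi> k) * (sqrt (gradsq (\<phi> k)))^3" for k
    define B0 where "B0 = C * nrm2 M v * (sqrt (grd v))^3"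
    have B0: "B0 \<ge> 0" using C(1) grd_nonneg[of v] by (simp add: B0_def)
    have Bl: "B \<longlonglongrightarrow> B0" unfolding B_def B0_def by (intro tendsto_intros \<phi>)
    have ts: "sqi M (\<lambda>x. \<phi> k x * \<phi> k x)" for k by (rule sqi_test[OF test_fun_mult[OF test_fun_smooth[OF \<phi>(1)] \<phi>(1)]])
    have tb: "(nrm2 M (\<lambda>x. \<phi> k x * \<phi> k x))\<^sup>2 \<le> B k" for k
    proof -
      have t2: "test_fun D (\<lambda>x. \<phi> k x * \<phi> k x)" by (rule test_fun_mult[OF test_fun_smooth[OF \<phi>(1)] \<phi>(1)])
      have "ennreal ((nrm2 M (\<lambda>x. \<phi> k x * \<phi> k x))\<^sup>2) = (\<integral>\<^sup>+x. ennreal ((cmod (\<phi> k x * \<phi> k x))\<^sup>2) \<partial>lborel)"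
        using nn_integral_sq_eq[OF test_fun_sqi[OF t2]] by (simp add: test_fun_sqi_on(2)[OF sets_D t2])
      also have "\<dots> = (\<integral>\<^sup>+x. ennreal (cmod (\<phi> k x) ^ 4) \<partial>lborel)"
        by (simp add: norm_mult power_mult_distrib flip: power_add)
      also have "\<dots> \<le> ennreal (B k)" unfolding B_def by (rule C(2)[OF \<phi>(1)])
      finally show ?thesis using C(1) gradsq_nonneg[of "\<phi> k"] by (simp add: B_def ennreal_le_iff)
    qed
    have lim: "AE x in M. (\<lambda>k. \<phi> k x * \<phi> k x) \<longlonglongrightarrow> v x * v x" using \<phi>(4) by eventually_elim (intro tendsto_intros)
    have vm: "(\<lambda>x. v x * v x) \<in> borel_measurable M" using sqi_meas[OF H10_sqi[OF v]] by measurable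
    \<comment> \<open>The bounds \<open>B k\<close> merely converge, so Fatou is applied to a tail
      where they are below \<open>B0 + \<epsilon>\<close>; the slack is removed at the end.\<close>
    have fat: "sqi M (\<lambda>x. v x * v x) \<and> nrm2 M (\<lambda>x. v x * v x) \<le> sqrt (B0 + \<epsilon>)" if "\<epsilon> > 0" for \<epsilon>
    proof -
      have "\<forall>\<^sub>F k in sequentially. B k < B0 + \<epsilon>" using Bl that by (intro order_tendstoD(2)) auto
      then obtain N where N: "\<And>k. k \<ge> N \<Longrightarrow> B k < B0 + \<epsilon>" by (auto simp: eventually_sequentially)
      have b: "nrm2 M (\<lambda>x. \<phi> (k + N) x * \<phi> (k + N) x) \<le> sqrt (B0 + \<epsilon>)" for k
        by (rule real_le_rsqrt) (use tb[of "k + N"] N[of "k + N"] in auto)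
      have l: "AE x in M. (\<lambda>k. \<phi> (k + N) x * \<phi> (k + N) x) \<longlonglongrightarrow> v x * v x"
        using lim by eventually_elim (rule LIMSEQ_ignore_initial_segment)
      show ?thesis using sqi_fatou[OF ts vm l b] by blast
    qed
    have "(nrm2 M (\<lambda>x. v x * v x))\<^sup>2 \<le> B0"
    proof (rule field_le_epsilon)
      fix \<epsilon> :: real assume e: "\<epsilon> > 0"
      then have "(nrm2 M (\<lambda>x. v x * v x))\<^sup>2 \<le> (sqrt (B0 + \<epsilon>))\<^sup>2" using fat[OF e] by (intro power_mono) auto
      then show "(nrm2 M (\<lambda>x. v x * v x))\<^sup>2 \<le> B0 + \<epsilon>" using B0 e by simp
    qed
    then show ?thesis using fat[of 1] by (simp add: B0_def)
  qed
  then show ?thesis using C(1) by blast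
qed

text \<open>The n-th function is replaced by a test function at H^1 distance below 1/(n+1); along a
  subsequence the errors are eventually negligible in L^2.\<close>

theorem rellich:
  assumes v: "\<And>n. v n \<in> H10 D" and bd: "\<And>n. h1norm D (v n) \<le> K"
  shows "\<exists>r::nat\<Rightarrow>nat. strict_mono r \<and> (\<forall>e>0. \<exists>N. \<forall>m\<ge>N. \<forall>n\<ge>N. nrm2 M (\<lambda>x. v (r m) x - v (r n) x) < e)"
proof -
  note H = H10_H1[OF v]
  have "\<forall>n. \<exists>\<phi>. test_fun D \<phi> \<and> h1norm D (\<lambda>x. \<phi> x - v n x) < 1 / real (Suc n)" using H10_approx[OF v] by simp
  then obtain \<phi> where \<phi>: "\<And>n. test_fun D (\<phi> n)" "\<And>n. h1norm D (\<lambda>x. \<phi> n x - v n x) < 1 / real (Suc n)" by metis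
  have b: "h1norm D (\<phi> n) \<le> K + 1" for n
  proof -
    have "h1norm D (\<lambda>x. (\<phi> n x - v n x) + v n x) \<le> h1norm D (\<lambda>x. \<phi> n x - v n x) + h1norm D (v n)"
      by (intro h1norm_triangle H1_diff H1_test \<phi>(1) H)
    moreover have "h1norm D (\<lambda>x. \<phi> n x - v n x) < 1" by (rule order.strict_trans2[OF \<phi>(2)]) simp
    ultimately show ?thesis using bd[of n] by simp
  qed
  have 1: "nrm2 lborel (\<phi> n) \<le> K + 1" for n
    using nrm2_le_h1norm[of "\<phi> n"] b[of n] by (simp add: test_fun_sqi_on(2)[OF sets_D \<phi>(1)])
  have 2: "gradsq (\<phi> n) \<le> (K + 1)\<^sup>2" for n
  proof -
    have "grd (\<phi> n) \<le> (h1norm D (\<phi> n))\<^sup>2" by (simp add: h1norm_sq)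
    also have "\<dots> \<le> (K + 1)\<^sup>2" by (intro power_mono b h1norm_nonneg)
    finally show ?thesis by (simp add: grd_test[OF \<phi>(1)])
  qed
  from rellich_test[OF openD boundedD \<phi>(1) 1 2] obtain r where r0: "strict_mono (r::nat\<Rightarrow>nat) \<and>
     (\<forall>e>0. \<exists>N. \<forall>i\<ge>N. \<forall>j\<ge>N. nrm2 M (\<lambda>x. \<phi> (r i) x - \<phi> (r j) x) < e)" ..
  note r = r0[THEN conjunct1] r0[THEN conjunct2, rule_format]
  have "\<exists>N. \<forall>m\<ge>N. \<forall>n\<ge>N. nrm2 M (\<lambda>x. v (r m) x - v (r n) x) < e" if e: "e > 0" for e
  proof -
    obtain N1 where N1: "\<And>i j. i \<ge> N1 \<Longrightarrow> j \<ge> N1 \<Longrightarrow> nrm2 M (\<lambda>x. \<phi> (r i) x - \<phi> (r j) x) < e/3" using r(2)[of "e/3"] e by auto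
    obtain N2 where N2: "1 / real (Suc N2) < e/3" using nat_approx_posE[of "e/3"] e by auto
    have close: "nrm2 M (\<lambda>x. \<phi> (r i) x - v (r i) x) < e/3" if "i \<ge> N2" for i
    proof -
      have "r i \<ge> N2" using seq_suble[OF r(1), of i] that by linarith
      then have "1 / real (Suc (r i)) \<le> 1 / real (Suc N2)" by (simp add: frac_le)
      from order.strict_trans1[OF this N2] show ?thesis using nrm2_le_h1norm[of "\<lambda>x. \<phi> (r i) x - v (r i) x"] \<phi>(2)[of "r i"]
        by linarith
    qed
    have "nrm2 M (\<lambda>x. v (r m) x - v (r n) x) < e" if mn: "m \<ge> max N1 N2" "n \<ge> max N1 N2" for m n
    proof -
      note s = H1_sqi[OF H] sqi_test[OF \<phi>(1)]
      have "nrm2 M (\<lambda>x. v (r m) x - v (r n) x) \<le> nrm2 M (\<lambda>x. v (r m) x - \<phi> (r m) x) + nrm2 M (\<lambda>x. \<phi> (r m) x - v (r n) x)"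
        by (rule nrm2_diff_triangle) (rule s)+
      moreover have "nrm2 M (\<lambda>x. \<phi> (r m) x - v (r n) x) \<le> nrm2 M (\<lambda>x. \<phi> (r m) x - \<phi> (r n) x) + nrm2 M (\<lambda>x. \<phi> (r n) x - v (r n) x)"
        by (rule nrm2_diff_triangle) (rule s)+
      ultimately show ?thesis using N1[of m n] close[of m] close[of n] mn nrm2_minus_commute[of M "v (r m)" "\<phi> (r m)"] by simp
    qed
    then show ?thesis by blast
  qed
  then show ?thesis using r(1) by blast
qed

end

section \<open>The modulus of a Sobolev function\<close>

context bounded_domain
begin

lemma nrm2_dominated:
  assumes g: "sqi M g" and f [measurable]: "\<And>k. f k \<in> borel_measurable M"
    and lim: "AE x in M. (\<lambda>k. f k x) \<longlonglongrightarrow> 0" and bd: "\<And>k. AE x in M. cmod (f k x) \<le> cmod (g x)"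
  shows "(\<lambda>k. nrm2 M (f k)) \<longlonglongrightarrow> 0"
proof -
  have "(\<lambda>k. \<integral>x. (cmod (f k x))\<^sup>2 \<partial>M) \<longlonglongrightarrow> (\<integral>x. 0 \<partial>M)"
  proof (rule integral_dominated_convergence[where w = "\<lambda>x. (cmod (g x))\<^sup>2"])
    show "AE x in M. (\<lambda>k. (cmod (f k x))\<^sup>2) \<longlonglongrightarrow> 0"
      using lim
    proof eventually_elim
      case (elim x)
      from tendsto_power[OF tendsto_norm[OF this], of 2] show ?case by simp
    qed
    show "AE x in M. norm ((cmod (f k x))\<^sup>2) \<le> (cmod (g x))\<^sup>2" for k
      using bd[of k] by eventually_elim (simp add: power_mono)
  qed (use sqi_int[OF g] in auto)
  from tendsto_real_sqrt[OF this] show ?thesis by (simp add: nrm2_def)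
qed

lemma H10_seq_AE:
  assumes "v \<in> H10 D"
  shows "\<exists>\<phi>. (\<forall>k::nat. test_fun D (\<phi> k)) \<and> (\<lambda>k. nrm2 M (\<lambda>x. \<phi> k x - v x)) \<longlonglongrightarrow> 0
     \<and> (\<forall>b\<in>Basis. (\<lambda>k. nrm2 M (\<lambda>x. pdv (\<phi> k) b x - wpd D v b x)) \<longlonglongrightarrow> 0)
     \<and> (AE x in M. (\<lambda>k. \<phi> k x) \<longlonglongrightarrow> v x)"
proof -
  obtain \<phi> where \<phi>: "\<And>k::nat. test_fun D (\<phi> k)" "(\<lambda>k. nrm2 M (\<lambda>x. \<phi> k x - v x)) \<longlonglongrightarrow> 0"
     "\<And>b. b\<in>Basis \<Longrightarrow> (\<lambda>k. nrm2 M (\<lambda>x. pdv (\<phi> k) b x - wpd D v b x)) \<longlonglongrightarrow> 0" using H10_seq[OF assms] by blast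
  obtain r where r: "strict_mono (r::nat\<Rightarrow>nat)" "AE x in M. (\<lambda>k. \<phi> (r k) x) \<longlonglongrightarrow> v x"
    using nrm2_tendsto_AE_subseq[OF sqi_test[OF \<phi>(1)] H10_sqi[OF assms] \<phi>(2)] by blast
  have "(\<lambda>k. nrm2 M (\<lambda>x. \<phi> (r k) x - v x)) \<longlonglongrightarrow> 0" using LIMSEQ_subseq_LIMSEQ[OF \<phi>(2) r(1)] by (simp add: o_def)
  moreover have "(\<lambda>k. nrm2 M (\<lambda>x. pdv (\<phi> (r k)) b x - wpd D v b x)) \<longlonglongrightarrow> 0" if "b \<in> Basis" for b
    using LIMSEQ_subseq_LIMSEQ[OF \<phi>(3)[OF that] r(1)] by (simp add: o_def)
  ultimately show ?thesis using \<phi>(1) r(2) by (intro exI[of _ "\<lambda>k. \<phi> (r k)"]) auto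
qed

text \<open>Here \<open>f\<close> is differentiable as a map of the real plane, with real linear
  derivative. For test functions the composition is differentiable with continuous partial
  derivatives and can be integrated by parts classically; the Lipschitz bound \<open>C\<close> and
  dominated convergence give the limit.\<close>

lemma chain_rule:
  fixes f :: "complex \<Rightarrow> complex"
  assumes v: "v \<in> H10 D" and b: "b \<in> Basis"
    and d: "\<And>z. (f has_derivative f' z) (at z)" and c: "\<And>\<zeta>. continuous_on UNIV (\<lambda>z. f' z \<zeta>)"
    and bd: "\<And>z \<zeta>. cmod (f' z \<zeta>) \<le> C * cmod \<zeta>"
  shows "sqi M (\<lambda>x. f (v x))" "weak_partial D (\<lambda>x. f (v x)) b (\<lambda>x. f' (v x) (wpd D v b x))"
proof -
  have C0: "C \<ge> 0" using bd[of 0 1] norm_ge_zero[of "f' 0 1"] by (simp del: norm_ge_zero)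
  have fc: "continuous_on UNIV f" using has_derivative_continuous[OF d] by (simp add: continuous_on_eq_continuous_at)
  \<comment> \<open>Real linearity reduces \<open>f'\<close> to its values at 1 and \<i>, so
    separate continuity in the base point already gives joint continuity and measurability.\<close>
  have dec: "f' z \<zeta> = Re \<zeta> *\<^sub>R f' z 1 + Im \<zeta> *\<^sub>R f' z \<i>" for z \<zeta>
  proof -
    have lin: "linear (f' z)" using has_derivative_linear[OF d] .
    have "\<zeta> = Re \<zeta> *\<^sub>R 1 + Im \<zeta> *\<^sub>R \<i>" by (simp add: complex_eq_iff)
    then have "f' z \<zeta> = f' z (Re \<zeta> *\<^sub>R 1 + Im \<zeta> *\<^sub>R \<i>)" by simp
    then show ?thesis by (simp only: linear_add[OF lin] linear_cmul[OF lin])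
  qed
  have cj: "continuous_on S (\<lambda>y. f' (p y) (q y))" if "continuous_on S p" "continuous_on S q" for S p and q :: "'a \<Rightarrow> complex"
    unfolding dec[of _ "q _"]
    by (intro continuous_intros that continuous_on_compose2[OF c that(1)] continuous_on_Re continuous_on_Im) auto
  have [measurable]: "(\<lambda>z. f' z \<zeta>) \<in> borel_measurable borel" for \<zeta> by (rule borel_measurable_continuous_onI[OF c])
  have [measurable]: "f \<in> borel_measurable borel" by (rule borel_measurable_continuous_onI[OF fc])
  have mj: "(\<lambda>y. f' (p y) (q y)) \<in> borel_measurable M" if [measurable]: "p \<in> borel_measurable M" "q \<in> borel_measurable M" for p q
    unfolding dec[of _ "q _"] by measurable
  have lip: "cmod (f y - f z) \<le> C * cmod (y - z)" for y z
    by (rule differentiable_bound[of UNIV f f' C y z])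
      (use d bd C0 in \<open>auto intro!: onorm_le simp: has_derivative_at_withinI\<close>)
  define g where "g = wpd D v b"
  note H = H10_H1[OF v]
  have vs: "sqi M v" and gs: "sqi M g" using H1_sqi[OF H] H1_wpd_sqi[OF H b] by (auto simp: g_def)
  have vm [measurable]: "v \<in> borel_measurable M" "g \<in> borel_measurable M" using vs gs by (auto simp: sqi_def)
  have fs: "sqi M (\<lambda>x. f (p x))" if p: "sqi M p" for p
  proof -
    have [measurable]: "p \<in> borel_measurable M" using p by (rule sqi_meas)
    have "sqi M (\<lambda>x. f (p x) - f 0)"
      by (rule sqi_mono[of _ _ p C]) (use lip[of _ 0] p in auto)
    from sqi_add[OF this sqi_cmult[OF sqi_one, of "f 0"]] show ?thesis by simp
  qed
  show "sqi M (\<lambda>x. f (v x))" by (rule fs[OF vs])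
  have f's: "sqi M (\<lambda>x. f' (p x) (q x))" if "p \<in> borel_measurable M" "sqi M q" for p q
    by (rule sqi_mono[of _ _ q C]) (use mj[OF that(1) sqi_meas[OF that(2)]] bd that in auto)
  obtain \<phi> where \<phi>: "\<And>k::nat. test_fun D (\<phi> k)" "(\<lambda>k. nrm2 M (\<lambda>x. \<phi> k x - v x)) \<longlonglongrightarrow> 0"
     "(\<lambda>k. nrm2 M (\<lambda>x. pdv (\<phi> k) b x - g x)) \<longlonglongrightarrow> 0" "AE x in M. (\<lambda>k. \<phi> k x) \<longlonglongrightarrow> v x"
    using H10_seq_AE[OF v] b unfolding g_def by blast
  have ps: "sqi M (\<phi> k)" "sqi M (pdv (\<phi> k) b)" for k using sqi_test[OF \<phi>(1)] sqi_test_pdv[OF \<phi>(1) b] by auto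
  have pm [measurable]: "\<phi> k \<in> borel_measurable M" "pdv (\<phi> k) b \<in> borel_measurable M" for k using ps[of k] by (auto simp: sqi_def)
  have lim1: "(\<lambda>k. nrm2 M (\<lambda>x. f (\<phi> k x) - f (v x))) \<longlonglongrightarrow> 0"
  proof (rule tendsto_dist_bound)
    show "\<bar>nrm2 M (\<lambda>x. f (\<phi> k x) - f (v x)) - 0\<bar> \<le> C * nrm2 M (\<lambda>x. \<phi> k x - v x)" for k
    proof -
      have "nrm2 M (\<lambda>x. f (\<phi> k x) - f (v x)) \<le> nrm2 M (\<lambda>x. complex_of_real C * (\<phi> k x - v x))"
        by (rule nrm2_mono[OF sqi_cmult[OF sqi_diff[OF ps(1) vs]]]) (use lip C0 in \<open>auto simp: norm_mult\<close>)
      then show ?thesis using C0 by (simp add: nrm2_cmult)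
    qed
    show "(\<lambda>k. C * nrm2 M (\<lambda>x. \<phi> k x - v x)) \<longlonglongrightarrow> 0" using tendsto_mult[OF tendsto_const[of C] \<phi>(2)] by simp
  qed
  have lim2: "(\<lambda>k. nrm2 M (\<lambda>x. f' (\<phi> k x) (pdv (\<phi> k) b x) - f' (v x) (g x))) \<longlonglongrightarrow> 0"
  proof -
    have s1: "sqi M (\<lambda>x. f' (\<phi> k x) (pdv (\<phi> k) b x) - f' (\<phi> k x) (g x))" for k by (intro sqi_diff f's pm ps gs)
    have s2: "sqi M (\<lambda>x. f' (\<phi> k x) (g x) - f' (v x) (g x))" for k by (intro sqi_diff f's pm vm gs)
    have t1: "nrm2 M (\<lambda>x. f' (\<phi> k x) (pdv (\<phi> k) b x) - f' (\<phi> k x) (g x)) \<le> C * nrm2 M (\<lambda>x. pdv (\<phi> k) b x - g x)" for k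
    proof -
      have "f' z \<zeta> - f' z \<xi> = f' z (\<zeta> - \<xi>)" for z \<zeta> \<xi> using linear_diff[OF has_derivative_linear[OF d]] by simp
      then have "nrm2 M (\<lambda>x. f' (\<phi> k x) (pdv (\<phi> k) b x) - f' (\<phi> k x) (g x)) \<le> nrm2 M (\<lambda>x. complex_of_real C * (pdv (\<phi> k) b x - g x))"
        by (intro nrm2_mono[OF sqi_cmult[OF sqi_diff[OF ps(2) gs]] sqi_meas[OF s1]]) (use bd C0 in \<open>auto simp: norm_mult\<close>)
      then show ?thesis using C0 by (simp add: nrm2_cmult)
    qed
    \<comment> \<open>With the direction \<open>g\<close> fixed only the base point moves:
      continuity gives pointwise convergence, and 2 C |g| dominates.\<close>
    have t2: "(\<lambda>k. nrm2 M (\<lambda>x. f' (\<phi> k x) (g x) - f' (v x) (g x))) \<longlonglongrightarrow> 0"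
    proof (rule nrm2_dominated[OF sqi_cmult[OF gs, of "complex_of_real (2 * C)"]])
      show "AE x in M. (\<lambda>k. f' (\<phi> k x) (g x) - f' (v x) (g x)) \<longlonglongrightarrow> 0"
        using \<phi>(4)
      proof eventually_elim
        case (elim x)
        have "isCont (\<lambda>z. f' z (g x)) (v x)" using c[of "g x"] by (simp add: continuous_on_eq_continuous_at)
        from isCont_tendsto_compose[OF this elim] show ?case by (rule LIM_zero)
      qed
      show "AE x in M. cmod (f' (\<phi> k x) (g x) - f' (v x) (g x)) \<le> cmod (complex_of_real (2 * C) * g x)" for k
      proof (rule AE_I2)
        fix x
        show "cmod (f' (\<phi> k x) (g x) - f' (v x) (g x)) \<le> cmod (complex_of_real (2 * C) * g x)"
          using norm_triangle_ineq4[of "f' (\<phi> k x) (g x)" "f' (v x) (g x)"] bd[of "\<phi> k x" "g x"] bd[of "v x" "g x"] C0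
          by (simp add: norm_mult)
      qed
    qed (rule sqi_meas[OF s2])
    show ?thesis
    proof (rule tendsto_dist_bound)
      show "\<bar>nrm2 M (\<lambda>x. f' (\<phi> k x) (pdv (\<phi> k) b x) - f' (v x) (g x)) - 0\<bar>
        \<le> C * nrm2 M (\<lambda>x. pdv (\<phi> k) b x - g x) + nrm2 M (\<lambda>x. f' (\<phi> k x) (g x) - f' (v x) (g x))" for k
        using nrm2_triangle[OF s1[of k] s2[of k]] t1[of k] by simp
      show "(\<lambda>k. C * nrm2 M (\<lambda>x. pdv (\<phi> k) b x - g x) + nrm2 M (\<lambda>x. f' (\<phi> k x) (g x) - f' (v x) (g x))) \<longlonglongrightarrow> 0"
        using tendsto_add[OF tendsto_mult[OF tendsto_const[of C] \<phi>(3)] t2] by simp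
    qed
  qed
  show "weak_partial D (\<lambda>x. f (v x)) b (\<lambda>x. f' (v x) (wpd D v b x))"
    unfolding weak_partial_iff g_def[symmetric]
  proof (intro conjI allI impI)
    show "sqi M (\<lambda>x. f' (v x) (g x))" by (intro f's vm gs)
    fix \<eta> assume t: "test_fun D \<eta>"
    have c0: "(\<lambda>n. nrm2 M (\<lambda>x. k x - k x)) \<longlonglongrightarrow> 0" for k :: "'a \<Rightarrow> complex" by (simp add: nrm2_def)
    have "(\<lambda>k. \<integral>x. f (\<phi> k x) * pdv \<eta> b x \<partial>M) \<longlonglongrightarrow> (\<integral>x. f (v x) * pdv \<eta> b x \<partial>M)"
      by (rule tendsto_integral_mult[OF fs[OF ps(1)] fs[OF vs] sqi_test_pdv[OF t b] sqi_test_pdv[OF t b] lim1 c0])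
    moreover have "(\<lambda>k. - (\<integral>x. f' (\<phi> k x) (pdv (\<phi> k) b x) * \<eta> x \<partial>M)) \<longlonglongrightarrow> - (\<integral>x. f' (v x) (g x) * \<eta> x \<partial>M)"
      by (rule tendsto_minus, rule tendsto_integral_mult[OF f's[OF pm(1) ps(2)] f's[OF vm(1) gs] sqi_test[OF t] sqi_test[OF t] lim2 c0])
    moreover have "(\<integral>x. f (\<phi> k x) * pdv \<eta> b x \<partial>M) = - (\<integral>x. f' (\<phi> k x) (pdv (\<phi> k) b x) * \<eta> x \<partial>M)" for k
    proof (rule integration_by_parts[OF sets_D b, of "\<lambda>x. f (\<phi> k x)" "\<lambda>x h. f' (\<phi> k x) (pdv (\<phi> k) h x)"])
      show "((\<lambda>x. f (\<phi> k x)) has_derivative (\<lambda>h. f' (\<phi> k x) (pdv (\<phi> k) h x))) (at x)" for x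
        by (rule has_derivative_compose[OF smooth_fun_has_derivative[OF test_fun_smooth[OF \<phi>(1)]] d])
      show "continuous_on UNIV (\<lambda>x. f' (\<phi> k x) (pdv (\<phi> k) b x))"
        by (intro cj test_fun_continuous[OF \<phi>(1)] test_fun_continuous[OF test_fun_pdv[OF \<phi>(1) b]])
    qed (rule t)
    ultimately show "(\<integral>x. f (v x) * pdv \<eta> b x \<partial>M) = - (\<integral>x. f' (v x) (g x) * \<eta> x \<partial>M)" by (simp add: LIMSEQ_unique)
  qed
qed

text \<open>Weak differentiation is a closed operator in L^2; regularised formulas therefore survive
  their limits.\<close>

lemma weak_partial_limit:
  assumes v: "\<And>n. sqi M (v n)" "sqi M w" and g: "sqi M g" and b: "b \<in> Basis"
    and wp: "\<And>n. weak_partial D (v n) b (k n)"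
    and l: "(\<lambda>n. nrm2 M (\<lambda>x. v n x - w x)) \<longlonglongrightarrow> 0" "(\<lambda>n. nrm2 M (\<lambda>x. k n x - g x)) \<longlonglongrightarrow> 0"
  shows "weak_partial D w b g"
  unfolding weak_partial_iff
proof (intro conjI allI impI g)
  fix \<phi> assume t: "test_fun D \<phi>"
  have c0: "(\<lambda>n. nrm2 M (\<lambda>x. f x - f x)) \<longlonglongrightarrow> 0" for f :: "'a \<Rightarrow> complex" by (simp add: nrm2_def)
  have "(\<lambda>n. \<integral>x. v n x * pdv \<phi> b x \<partial>M) \<longlonglongrightarrow> (\<integral>x. w x * pdv \<phi> b x \<partial>M)"
    by (rule tendsto_integral_mult[OF v(1,2) sqi_test_pdv[OF t b] sqi_test_pdv[OF t b] l(1) c0])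
  moreover have "(\<lambda>n. - (\<integral>x. k n x * \<phi> x \<partial>M)) \<longlonglongrightarrow> - (\<integral>x. g x * \<phi> x \<partial>M)"
    by (rule tendsto_minus, rule tendsto_integral_mult[OF weak_partial_sqi[OF wp] g sqi_test[OF t] sqi_test[OF t] l(2) c0])
  moreover have "(\<integral>x. v n x * pdv \<phi> b x \<partial>M) = - (\<integral>x. k n x * \<phi> x \<partial>M)" for n
    using wp[of n] t by (simp add: weak_partial_iff)
  ultimately show "(\<integral>x. w x * pdv \<phi> b x \<partial>M) = - (\<integral>x. g x * \<phi> x \<partial>M)" by (simp add: LIMSEQ_unique)
qed

text \<open>The modulus is not differentiable at 0, so it is replaced by sqrt(|z|^2 + \<epsilon>^2),
  whose derivative is bounded by 1 independently of \<epsilon>. On the zero set the regularised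
  derivative is 0, which matches \<open>sgn 0 = 0\<close>.\<close>

lemma weak_partial_modulus:
  assumes v: "v \<in> H10 D" and b: "b \<in> Basis"
  shows "weak_partial D (\<lambda>x. complex_of_real (cmod (v x))) b (\<lambda>x. complex_of_real (sgn (v x) \<bullet> wpd D v b x))"
proof -
  define g where "g = wpd D v b"
  have vs: "sqi M v" and gs: "sqi M g" using H10_sqi[OF v] H1_wpd_sqi[OF H10_H1[OF v] b] by (auto simp: g_def)
  have [measurable]: "v \<in> borel_measurable M" "g \<in> borel_measurable M" using vs gs by (auto simp: sqi_def)
  define \<epsilon> where "\<epsilon> n = 1 / real (Suc n)" for n
  have e: "\<epsilon> n > 0" for n by (simp add: \<epsilon>_def)
  have e0: "\<epsilon> \<longlonglongrightarrow> 0" unfolding \<epsilon>_def using LIMSEQ_inverse_real_of_nat by (simp add: inverse_eq_divide)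
  define s where "s n z = sqrt (z \<bullet> z + (\<epsilon> n)\<^sup>2)" for n and z :: complex
  have pos: "z \<bullet> z + (\<epsilon> n)\<^sup>2 > 0" for n and z :: complex using e[of n] by (simp add: add_nonneg_pos)
  have sp: "s n z > 0" for n z using pos by (simp add: s_def)
  have s_ge: "cmod z \<le> s n z" for n z unfolding s_def by (rule real_le_rsqrt) (simp add: dot_square_norm)
  have s_le: "s n z \<le> cmod z + \<epsilon> n" for n z
    unfolding s_def using e[of n] by (intro real_le_lsqrt) (auto simp: dot_square_norm power2_sum)
  define f' where "f' n z \<zeta> = complex_of_real ((z \<bullet> \<zeta>) / s n z)" for n z \<zeta>
  have d: "((\<lambda>z. complex_of_real (s n z)) has_derivative f' n z) (at z)" for n z
  proof -
    have "(s n has_derivative (\<lambda>\<zeta>. (z \<bullet> \<zeta>) / s n z)) (at z)"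
      unfolding s_def using pos[of z n]
      by (auto intro!: derivative_eq_intros simp: fun_eq_iff inner_commute field_simps)
    then show ?thesis unfolding f'_def by (rule bounded_linear.has_derivative[OF bounded_linear_of_real])
  qed
  have sc: "continuous_on UNIV (s n)" for n unfolding s_def by (intro continuous_intros)
  have cc: "continuous_on UNIV (\<lambda>z. f' n z \<zeta>)" for n \<zeta>
    unfolding f'_def using sp[of n] by (intro continuous_intros sc) (auto simp: less_imp_neq[symmetric])
  have ib: "\<bar>z \<bullet> \<zeta>\<bar> / s n z \<le> cmod \<zeta>" for n z \<zeta>
  proof -
    have "\<bar>z \<bullet> \<zeta>\<bar> \<le> cmod z * cmod \<zeta>" by (rule Cauchy_Schwarz_ineq2)
    also have "\<dots> \<le> s n z * cmod \<zeta>" by (intro mult_right_mono s_ge) simp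
    finally show ?thesis using sp[of n z] by (simp add: pos_divide_le_eq mult.commute)
  qed
  have bd: "cmod (f' n z \<zeta>) \<le> 1 * cmod \<zeta>" for n z \<zeta>
    using ib[of z \<zeta> n] sp[of n z] by (simp add: f'_def norm_divide)
  note cr = chain_rule[OF v b d cc bd, folded g_def]
  have [measurable]: "sgn \<in> borel_measurable (borel :: complex measure)" unfolding sgn_div_norm[abs_def] by measurable
  have sg: "\<bar>sgn z \<bullet> \<zeta>\<bar> \<le> cmod \<zeta>" for z \<zeta> :: complex
    using Cauchy_Schwarz_ineq2[of "sgn z" \<zeta>] by (auto simp: norm_sgn split: if_splits)
  have gs': "sqi M (\<lambda>x. complex_of_real (sgn (v x) \<bullet> g x))"
    by (rule sqi_mono[of _ _ g 1]) (use gs sg in auto)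
  have vs': "sqi M (\<lambda>x. complex_of_real (cmod (v x)))" by (rule sqi_mono[of _ _ v 1]) (use vs in auto)
  show ?thesis unfolding g_def[symmetric]
  proof (rule weak_partial_limit[OF cr(1) vs' gs' b cr(2)])
    show "(\<lambda>n. nrm2 M (\<lambda>x. complex_of_real (s n (v x)) - complex_of_real (cmod (v x)))) \<longlonglongrightarrow> 0"
    proof (rule nrm2_dominated[OF sqi_one])
      show "AE x in M. (\<lambda>n. complex_of_real (s n (v x)) - complex_of_real (cmod (v x))) \<longlonglongrightarrow> 0"
      proof (rule AE_I2)
        fix x
        have "(\<lambda>n. s n (v x) - cmod (v x)) \<longlonglongrightarrow> 0"
          by (rule tendsto_dist_bound[OF _ e0]) (use s_ge[of "v x"] s_le[of _ "v x"] in \<open>auto simp: abs_le_iff algebra_simps\<close>)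
        from tendsto_of_real[OF this, where 'a=complex] show "(\<lambda>n. complex_of_real (s n (v x)) - complex_of_real (cmod (v x))) \<longlonglongrightarrow> 0" by simp
      qed
      show "AE x in M. cmod (complex_of_real (s n (v x)) - complex_of_real (cmod (v x))) \<le> cmod 1" for n
      proof (rule AE_I2)
        fix x
        have "\<epsilon> n \<le> 1" by (simp add: \<epsilon>_def)
        then have "\<bar>s n (v x) - cmod (v x)\<bar> \<le> 1" using s_ge[of "v x" n] s_le[of n "v x"] by linarith
        then show "cmod (complex_of_real (s n (v x)) - complex_of_real (cmod (v x))) \<le> cmod 1"
          by (simp flip: of_real_diff)
      qed
    qed (use sqi_meas[OF sqi_diff[OF cr(1) vs']] in auto)
    show "(\<lambda>n. nrm2 M (\<lambda>x. f' n (v x) (g x) - complex_of_real (sgn (v x) \<bullet> g x))) \<longlonglongrightarrow> 0"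
    proof (rule nrm2_dominated[OF sqi_cmult[OF gs, of 2]])
      show "AE x in M. (\<lambda>n. f' n (v x) (g x) - complex_of_real (sgn (v x) \<bullet> g x)) \<longlonglongrightarrow> 0"
      proof (rule AE_I2)
        fix x
        show "(\<lambda>n. f' n (v x) (g x) - complex_of_real (sgn (v x) \<bullet> g x)) \<longlonglongrightarrow> 0"
        proof (cases "v x = 0")
          case False
          have "(\<lambda>n. s n (v x)) \<longlonglongrightarrow> sqrt (v x \<bullet> v x + 0\<^sup>2)" unfolding s_def by (intro tendsto_intros e0)
          then have "(\<lambda>n. s n (v x)) \<longlonglongrightarrow> cmod (v x)" by (simp add: norm_eq_sqrt_inner)
          then have "(\<lambda>n. f' n (v x) (g x)) \<longlonglongrightarrow> complex_of_real ((v x \<bullet> g x) / cmod (v x))"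
            unfolding f'_def using False by (intro tendsto_intros) auto
          moreover have "sgn (v x) \<bullet> g x = (v x \<bullet> g x) / cmod (v x)" by (simp add: sgn_div_norm divide_inverse mult.commute)
          ultimately show ?thesis by (simp add: LIM_zero)
        qed (simp add: f'_def)
      qed
      show "AE x in M. cmod (f' n (v x) (g x) - complex_of_real (sgn (v x) \<bullet> g x)) \<le> cmod (2 * g x)" for n
      proof (rule AE_I2)
        fix x
        show "cmod (f' n (v x) (g x) - complex_of_real (sgn (v x) \<bullet> g x)) \<le> cmod (2 * g x)"
          using norm_triangle_ineq4[of "f' n (v x) (g x)" "complex_of_real (sgn (v x) \<bullet> g x)"] bd[of n "v x" "g x"] sg[of "v x" "g x"]
          by (simp add: norm_mult)
      qed
    qed (use sqi_meas[OF sqi_diff[OF weak_partial_sqi[OF cr(2)] gs']] in auto)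
  qed
qed

text \<open>Needed because \<open>sgn\<close> is discontinuous at 0: the derivative of the modulus
  depends continuously on the function only where the limit is nonzero, and on the zero set the
  vanishing gradient takes over.\<close>

lemma gradient_zero_on_zero_set:
  assumes v: "v \<in> H10 D" and b: "b \<in> Basis"
  shows "AE x in M. v x = 0 \<longrightarrow> wpd D v b x = 0"
proof -
  define g where "g = wpd D v b"
  have vs: "sqi M v" and gs: "sqi M g" using H10_sqi[OF v] H1_wpd_sqi[OF H10_H1[OF v] b] by (auto simp: g_def)
  have [measurable]: "v \<in> borel_measurable M" "g \<in> borel_measurable M" using vs gs by (auto simp: sqi_def)
  define m where "m n z = 1 + (real n)\<^sup>2 * (z \<bullet> z)" for n and z :: complex
  have mp: "m n z \<ge> 1" for n z by (simp add: m_def)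
  have m0: "m n z \<noteq> 0" for n z using mp[of n z] by linarith
  text \<open>The truncations \<open>z / (1 + n\<^sup>2 |z|\<^sup>2)\<close> tend to 0 uniformly while their derivative tends to the indicator of \<open>z = 0\<close>.\<close>
  define f where "f n z = (1 / m n z) *\<^sub>R z" for n z
  define f' where "f' n z \<zeta> = (1 / m n z) *\<^sub>R \<zeta> + (- ((real n)\<^sup>2 * (2 * (z \<bullet> \<zeta>))) / (m n z)\<^sup>2) *\<^sub>R z" for n z \<zeta>
  have d: "(f n has_derivative f' n z) (at z)" for n z
  proof -
    have "(m n has_derivative (\<lambda>\<zeta>. (real n)\<^sup>2 * (2 * (z \<bullet> \<zeta>)))) (at z)"
      unfolding m_def by (auto intro!: derivative_eq_intros simp: inner_commute algebra_simps)
    then have "((\<lambda>z. 1 / m n z) has_derivative (\<lambda>\<zeta>. - ((real n)\<^sup>2 * (2 * (z \<bullet> \<zeta>))) / (m n z)\<^sup>2)) (at z)"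
      using m0[of n z] by (auto intro!: derivative_eq_intros simp: power2_eq_square field_simps)
    from has_derivative_scaleR[OF this has_derivative_ident] show ?thesis unfolding f_def f'_def .
  qed
  have mc: "continuous_on UNIV (m n)" for n unfolding m_def by (intro continuous_intros)
  have cc: "continuous_on UNIV (\<lambda>z. f' n z \<zeta>)" for n \<zeta>
    unfolding f'_def using m0 by (intro continuous_intros mc) auto
  have bd: "cmod (f' n z \<zeta>) \<le> 3 * cmod \<zeta>" for n z \<zeta>
  proof -
    have a: "cmod ((1 / m n z) *\<^sub>R \<zeta>) \<le> cmod \<zeta>" using mp[of n z] by (simp add: divide_le_eq mult_left_le_one_le) (simp add: mult_le_cancel_left1)
    have "cmod ((- ((real n)\<^sup>2 * (2 * (z \<bullet> \<zeta>))) / (m n z)\<^sup>2) *\<^sub>R z) = 2 * ((real n)\<^sup>2 * \<bar>z \<bullet> \<zeta>\<bar> * cmod z) / (m n z)\<^sup>2"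
      by (simp add: abs_mult)
    also have "\<dots> \<le> 2 * ((real n)\<^sup>2 * (cmod z * cmod \<zeta>) * cmod z) / (m n z)\<^sup>2"
      by (intro divide_right_mono mult_left_mono mult_right_mono Cauchy_Schwarz_ineq2) auto
    also have "\<dots> = 2 * cmod \<zeta> * (((real n)\<^sup>2 * (z \<bullet> z)) / (m n z)\<^sup>2)" by (simp add: dot_square_norm power2_eq_square)
    also have "\<dots> \<le> 2 * cmod \<zeta> * 1"
    proof (rule mult_left_mono)
      have "(real n)\<^sup>2 * (z \<bullet> z) \<le> m n z * m n z" using mp[of n z] mult_mono[OF mp[of n z] order_refl[of "m n z"]] by (simp add: m_def)
      then show "((real n)\<^sup>2 * (z \<bullet> z)) / (m n z)\<^sup>2 \<le> 1" using mp[of n z] by (simp add: divide_le_eq power2_eq_square zero_less_mult_iff)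
    qed simp
    finally show ?thesis using a norm_triangle_ineq[of "(1 / m n z) *\<^sub>R \<zeta>" "(- ((real n)\<^sup>2 * (2 * (z \<bullet> \<zeta>))) / (m n z)\<^sup>2) *\<^sub>R z"]
      unfolding f'_def by linarith
  qed
  note cr = chain_rule[OF v b d cc bd, folded g_def]
  have mlim: "(\<lambda>n. 1 / m n z) \<longlonglongrightarrow> 0" if "z \<noteq> 0" for z
  proof -
    have zz: "z \<bullet> z > 0" using that by simp
    have "filterlim (\<lambda>n. (real n)\<^sup>2 * (z \<bullet> z)) at_top sequentially"
      by (rule filterlim_at_top_mult_tendsto_pos[OF tendsto_const zz])
        (intro filterlim_pow_at_top filterlim_real_sequentially, simp)
    then have "filterlim (\<lambda>n. m n z) at_top sequentially" unfolding m_def by (rule filterlim_tendsto_add_at_top[OF tendsto_const])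
    then show ?thesis using tendsto_inverse_0_at_top by (simp add: divide_inverse)
  qed
  \<comment> \<open>For fixed nonzero \<open>z\<close> this partial fraction form displays decay
    like \<open>1 / m n z\<close>.\<close>
  have b2: "(real n)\<^sup>2 * (2 * (z \<bullet> \<zeta>)) / (m n z)\<^sup>2 = 2 * (z \<bullet> \<zeta>) / (z \<bullet> z) * ((1 / m n z) - (1 / m n z)\<^sup>2)" if "z \<noteq> 0" for n z \<zeta>
  proof -
    have "1 / m n z - (1 / m n z)\<^sup>2 = (m n z - 1) / (m n z)\<^sup>2" using m0[of n z] by (simp add: field_simps power2_eq_square)
    also have "m n z - 1 = (real n)\<^sup>2 * (z \<bullet> z)" by (simp add: m_def)
    finally show ?thesis using that by simp
  qed
  \<comment> \<open>The limit of the derivatives. It is a weak derivative of the limit 0 of the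
    functions, so uniqueness of weak derivatives forces it to vanish.\<close>
  define k where "k x = (if v x = 0 then g x else 0)" for x
  have km: "k \<in> borel_measurable M" unfolding k_def by measurable
  have ks: "sqi M k" by (rule sqi_mono[OF km gs, of 1]) (auto simp: k_def)
  have "weak_partial D (\<lambda>x. 0) b k"
  proof (rule weak_partial_limit[OF cr(1) sqi_zero ks b cr(2)])
    have fb: "cmod (f n z) \<le> cmod z" for n z
      using mp[of n z] by (simp add: f_def divide_le_eq mult_left_le_one_le) (simp add: mult_le_cancel_left1)
    show "(\<lambda>n. nrm2 M (\<lambda>x. f n (v x) - 0)) \<longlonglongrightarrow> 0"
    proof (rule nrm2_dominated[OF vs])
      show "AE x in M. (\<lambda>n. f n (v x) - 0) \<longlonglongrightarrow> 0"
      proof (rule AE_I2)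
        fix x
        show "(\<lambda>n. f n (v x) - 0) \<longlonglongrightarrow> 0"
          using tendsto_scaleR[OF mlim tendsto_const[of "v x"]] by (cases "v x = 0") (auto simp: f_def)
      qed
    qed (use sqi_meas[OF cr(1)] fb in auto)
    show "(\<lambda>n. nrm2 M (\<lambda>x. f' n (v x) (g x) - k x)) \<longlonglongrightarrow> 0"
    proof (rule nrm2_dominated[OF sqi_cmult[OF gs, of 4]])
      show "AE x in M. (\<lambda>n. f' n (v x) (g x) - k x) \<longlonglongrightarrow> 0"
      proof (rule AE_I2)
        fix x
        show "(\<lambda>n. f' n (v x) (g x) - k x) \<longlonglongrightarrow> 0"
        proof (cases "v x = 0")
          case True
          then show ?thesis by (simp add: f'_def k_def m_def)
        next
          case False
          have "(\<lambda>n. (1 / m n (v x)) *\<^sub>R g x + (- (2 * (v x \<bullet> g x) / (v x \<bullet> v x) * ((1 / m n (v x)) - (1 / m n (v x))\<^sup>2))) *\<^sub>R v x)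
             \<longlonglongrightarrow> 0 *\<^sub>R g x + (- (2 * (v x \<bullet> g x) / (v x \<bullet> v x) * (0 - 0\<^sup>2))) *\<^sub>R v x"
            by (intro tendsto_intros mlim False)
          then show ?thesis using False b2[OF False] by (simp add: f'_def k_def)
        qed
      qed
      show "AE x in M. cmod (f' n (v x) (g x) - k x) \<le> cmod (4 * g x)" for n
      proof (rule AE_I2)
        fix x
        have "cmod (k x) \<le> cmod (g x)" by (simp add: k_def)
        then show "cmod (f' n (v x) (g x) - k x) \<le> cmod (4 * g x)"
          using norm_triangle_ineq4[of "f' n (v x) (g x)" "k x"] bd[of n "v x" "g x"] by (simp add: norm_mult)
      qed
    qed (use sqi_meas[OF sqi_diff[OF weak_partial_sqi[OF cr(2)] ks]] in auto)
  qed
  then have "AE x in M. k x = 0" using weak_partial_unique[of "\<lambda>x. 0" b k "\<lambda>x. 0"] by (simp add: weak_partial_iff sqi_zero)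
  then show ?thesis by eventually_elim (auto simp: k_def g_def)
qed

lemma H1_modulus: "v \<in> H10 D \<Longrightarrow> H1 D (\<lambda>x. complex_of_real (cmod (v x)))"
proof (rule H1I[OF _ weak_partial_modulus])
  assume v: "v \<in> H10 D"
  have [measurable]: "v \<in> borel_measurable M" using sqi_meas[OF H10_sqi[OF v]] .
  show "sqi M (\<lambda>x. complex_of_real (cmod (v x)))" by (rule sqi_mono[OF _ H10_sqi[OF v], of _ 1]) auto
qed

text \<open>The derivative of the modulus splits into a part with the converging gradient,
  controlled since |sgn| is at most 1, and a part with fixed gradient \<open>g\<close>, handled by
  dominated convergence. The latter requires pointwise convergence, hence a subsequence.\<close>

theorem modulus_subseq_conv:
  assumes v: "\<And>n. v n \<in> H10 D" and w: "w \<in> H10 D"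
    and l: "(\<lambda>n. h1norm D (\<lambda>x. v n x - w x)) \<longlonglongrightarrow> 0"
  shows "\<exists>r::nat\<Rightarrow>nat. strict_mono r \<and> (\<lambda>n. h1norm D (\<lambda>x. complex_of_real (cmod (v (r n) x)) - complex_of_real (cmod (w x)))) \<longlonglongrightarrow> 0"
proof -
  note H = H10_H1[OF v] and Hw = H10_H1[OF w]
  have l1: "(\<lambda>n. nrm2 M (\<lambda>x. v n x - w x)) \<longlonglongrightarrow> 0" and
    l2: "\<And>b. b \<in> Basis \<Longrightarrow> (\<lambda>n. nrm2 M (\<lambda>x. wpd D (v n) b x - wpd D w b x)) \<longlonglongrightarrow> 0"
    using l h1_tendsto_iff[OF H Hw] by auto
  obtain r where r: "strict_mono (r::nat\<Rightarrow>nat)" "AE x in M. (\<lambda>n. v (r n) x) \<longlonglongrightarrow> w x"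
    using nrm2_tendsto_AE_subseq[OF H1_sqi[OF H] H1_sqi[OF Hw] l1] by blast
  have [measurable]: "v n \<in> borel_measurable M" "w \<in> borel_measurable M" for n using H1_sqi[OF H] H1_sqi[OF Hw] by (auto simp: sqi_def)
  have [measurable]: "sgn \<in> borel_measurable (borel :: complex measure)" unfolding sgn_div_norm[abs_def] by measurable
  have "(\<lambda>n. h1norm D (\<lambda>x. complex_of_real (cmod (v (r n) x)) - complex_of_real (cmod (w x)))) \<longlonglongrightarrow> 0"
    unfolding h1_tendsto_iff[OF H1_modulus[OF v] H1_modulus[OF w]]
  proof (intro conjI ballI)
    show "(\<lambda>n. nrm2 M (\<lambda>x. complex_of_real (cmod (v (r n) x)) - complex_of_real (cmod (w x)))) \<longlonglongrightarrow> 0"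
    proof (rule tendsto_dist_bound)
      show "\<bar>nrm2 M (\<lambda>x. complex_of_real (cmod (v (r n) x)) - complex_of_real (cmod (w x))) - 0\<bar> \<le> nrm2 M (\<lambda>x. v (r n) x - w x)" for n
      proof -
        have "nrm2 M (\<lambda>x. complex_of_real (cmod (v (r n) x)) - complex_of_real (cmod (w x))) \<le> nrm2 M (\<lambda>x. v (r n) x - w x)"
          by (rule nrm2_mono[OF sqi_diff[OF H1_sqi[OF H] H1_sqi[OF Hw]]])
            (auto simp flip: of_real_diff intro: norm_triangle_ineq3)
        then show ?thesis by simp
      qed
      show "(\<lambda>n. nrm2 M (\<lambda>x. v (r n) x - w x)) \<longlonglongrightarrow> 0" using LIMSEQ_subseq_LIMSEQ[OF l1 r(1)] by (simp add: o_def)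
    qed
    fix b :: 'a assume b: "b \<in> Basis"
    define g where "g = wpd D w b"
    define k where "k n = wpd D (v n) b" for n
    have gs: "sqi M g" and ks: "\<And>n. sqi M (k n)" using H1_wpd_sqi[OF H b] H1_wpd_sqi[OF Hw b] by (auto simp: g_def k_def)
    have [measurable]: "g \<in> borel_measurable M" "k n \<in> borel_measurable M" for n using gs ks by (auto simp: sqi_def)
    have sg: "\<bar>sgn z \<bullet> \<zeta>\<bar> \<le> cmod \<zeta>" for z \<zeta> :: complex
      using Cauchy_Schwarz_ineq2[of "sgn z" \<zeta>] by (auto simp: norm_sgn split: if_splits)
    have s1: "sqi M (\<lambda>x. complex_of_real (sgn (v n x) \<bullet> (k n x - g x)))" for n
      by (rule sqi_mono[OF _ sqi_diff[OF ks[of n] gs], of _ 1]) (use sg in auto)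
    have s2: "sqi M (\<lambda>x. complex_of_real (sgn (v n x) \<bullet> g x) - complex_of_real (sgn (w x) \<bullet> g x))" for n
      by (intro sqi_diff; rule sqi_mono[OF _ gs, of _ 1]) (use sg in auto)
    have t1: "nrm2 M (\<lambda>x. complex_of_real (sgn (v n x) \<bullet> (k n x - g x))) \<le> nrm2 M (\<lambda>x. k n x - g x)" for n
      by (rule nrm2_mono[OF sqi_diff[OF ks gs] sqi_meas[OF s1]]) (use sg in auto)
    \<comment> \<open>Where the limit is nonzero \<open>sgn\<close> is continuous; where it is zero
      the gradient \<open>g\<close> vanishes almost everywhere.\<close>
    have t2: "(\<lambda>n. nrm2 M (\<lambda>x. complex_of_real (sgn (v (r n) x) \<bullet> g x) - complex_of_real (sgn (w x) \<bullet> g x))) \<longlonglongrightarrow> 0"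
    proof (rule nrm2_dominated[OF sqi_cmult[OF gs, of 2] sqi_meas[OF s2]])
      show "AE x in M. (\<lambda>n. complex_of_real (sgn (v (r n) x) \<bullet> g x) - complex_of_real (sgn (w x) \<bullet> g x)) \<longlonglongrightarrow> 0"
        using r(2) gradient_zero_on_zero_set[OF w b]
      proof eventually_elim
        case (elim x)
        show ?case
        proof (cases "w x = 0")
          case True
          then show ?thesis using elim(2) by (simp add: g_def)
        next
          case False
          have "(\<lambda>n. complex_of_real (sgn (v (r n) x) \<bullet> g x)) \<longlonglongrightarrow> complex_of_real (sgn (w x) \<bullet> g x)"
            by (intro tendsto_intros tendsto_sgn elim(1) False)
          then show ?thesis by (rule LIM_zero)
        qed
      qed
      show "AE x in M. cmod (complex_of_real (sgn (v (r n) x) \<bullet> g x) - complex_of_real (sgn (w x) \<bullet> g x)) \<le> cmod (2 * g x)" for n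
      proof (rule AE_I2)
        fix x
        show "cmod (complex_of_real (sgn (v (r n) x) \<bullet> g x) - complex_of_real (sgn (w x) \<bullet> g x)) \<le> cmod (2 * g x)"
          using norm_triangle_ineq4[of "complex_of_real (sgn (v (r n) x) \<bullet> g x)" "complex_of_real (sgn (w x) \<bullet> g x)"]
            sg[of "v (r n) x" "g x"] sg[of "w x" "g x"] by (simp add: norm_mult)
      qed
    qed
    have mm: "(\<lambda>x. wpd D (\<lambda>x. complex_of_real (cmod (u x))) b x) \<in> borel_measurable M" if "u \<in> H10 D" for u
      using sqi_meas[OF H1_wpd_sqi[OF H1_modulus[OF that] b]] .
    have eq: "nrm2 M (\<lambda>x. wpd D (\<lambda>x. complex_of_real (cmod (v n x))) b x - wpd D (\<lambda>x. complex_of_real (cmod (w x))) b x)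
       = nrm2 M (\<lambda>x. complex_of_real (sgn (v n x) \<bullet> k n x) - complex_of_real (sgn (w x) \<bullet> g x))" for n
    proof (rule nrm2_AE_cong)
      show "AE x in M. wpd D (\<lambda>x. complex_of_real (cmod (v n x))) b x - wpd D (\<lambda>x. complex_of_real (cmod (w x))) b x
         = complex_of_real (sgn (v n x) \<bullet> k n x) - complex_of_real (sgn (w x) \<bullet> g x)"
        using wpd_AE[OF weak_partial_modulus[OF v[of n] b]] wpd_AE[OF weak_partial_modulus[OF w b]]
        by eventually_elim (simp add: k_def g_def)
    qed (use mm[OF v[of n]] mm[OF w] in measurable)
    show "(\<lambda>n. nrm2 M (\<lambda>x. wpd D (\<lambda>x. complex_of_real (cmod (v (r n) x))) b x - wpd D (\<lambda>x. complex_of_real (cmod (w x))) b x)) \<longlonglongrightarrow> 0"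
      unfolding eq
    proof (rule tendsto_dist_bound)
      show "\<bar>nrm2 M (\<lambda>x. complex_of_real (sgn (v (r n) x) \<bullet> k (r n) x) - complex_of_real (sgn (w x) \<bullet> g x)) - 0\<bar>
        \<le> nrm2 M (\<lambda>x. k (r n) x - g x) + nrm2 M (\<lambda>x. complex_of_real (sgn (v (r n) x) \<bullet> g x) - complex_of_real (sgn (w x) \<bullet> g x))" for n
        using nrm2_triangle[OF s1[of "r n"] s2[of "r n"]] t1[of "r n"] by (simp add: inner_diff_right)
      have "(\<lambda>n. nrm2 M (\<lambda>x. k (r n) x - g x)) \<longlonglongrightarrow> 0"
        using LIMSEQ_subseq_LIMSEQ[OF l2[OF b] r(1)] by (simp add: o_def k_def g_def)
      from tendsto_add[OF this t2] show "(\<lambda>n. nrm2 M (\<lambda>x. k (r n) x - g x) + nrm2 M (\<lambda>x. complex_of_real (sgn (v (r n) x) \<bullet> g x) - complex_of_real (sgn (w x) \<bullet> g x))) \<longlonglongrightarrow> 0"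
        by simp
    qed
  qed
  then show ?thesis using r(1) by blast
qed

end

section \<open>The Gross--Pitaevskii form\<close>

text \<open>Pointwise operations make the space of all functions a vector space type, as the
  abstract setting demands.\<close>

instantiation "fun" :: (type, real_vector) real_vector
begin

definition scaleR_fun :: "real \<Rightarrow> ('a \<Rightarrow> 'b) \<Rightarrow> 'a \<Rightarrow> 'b" where
  "scaleR_fun r f = (\<lambda>x. r *\<^sub>R f x)"

instance
  by standard (simp_all add: scaleR_fun_def plus_fun_def scaleR_add_right scaleR_add_left)

end

context bounded_domain
begin

section \<open>Bilinearity and phase invariance of the inner products\<close>

lemma l2_add:
  assumes "sqi M f" "sqi M g" "sqi M k"
  shows "l2inner D (\<lambda>x. f x + g x) k = l2inner D f k + l2inner D g k"
  using assms by (simp add: l2inner_eq distrib_right sqi_mult_cnj_integrable)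

lemma l2_scale: "l2inner D (\<lambda>x. complex_of_real c * f x) g = c * l2inner D f g"
  by (simp add: l2inner_eq mult.assoc)

lemma l2_comm: "l2inner D f g = l2inner D g f"
proof -
  have "(\<integral>x. g x * cnj (f x) \<partial>M) = cnj (\<integral>x. f x * cnj (g x) \<partial>M)"
    using Bochner_Integration.integral_cnj[of M "\<lambda>x. f x * cnj (g x)"] by (simp add: mult.commute)
  then show ?thesis by (simp add: l2inner_eq)
qed

lemma l2_i: "l2inner D (\<lambda>x. \<i> * f x) (\<lambda>x. \<i> * g x) = l2inner D f g"
proof -
  have "\<i> * y * cnj (\<i> * z) = y * cnj z" for y z by (simp add: complex_eq_iff)
  then show ?thesis by (simp add: l2inner_eq)
qed

lemma l2_i_skew: "l2inner D (\<lambda>x. \<i> * f x) g = - l2inner D f (\<lambda>x. \<i> * g x)"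
proof -
  have "\<i> * y * cnj z = - (y * cnj (\<i> * z))" for y z by (simp add: complex_eq_iff)
  then have "(\<lambda>x. \<i> * f x * cnj (g x)) = (\<lambda>x. - (f x * cnj (\<i> * g x)))" by blast
  then show ?thesis by (simp only: l2inner_eq integral_minus) simp
qed

lemma l2_cong:
  assumes "AE x in M. f x = f' x" "AE x in M. g x = g' x"
    and [measurable]: "f \<in> borel_measurable M" "f' \<in> borel_measurable M" "g \<in> borel_measurable M" "g' \<in> borel_measurable M"
  shows "l2inner D f g = l2inner D f' g'"
  unfolding l2inner_eq
proof (intro arg_cong[of _ _ Re] integral_cong_AE)
  have [measurable]: "cnj \<in> borel_measurable borel" by (intro borel_measurable_continuous_onI continuous_intros)
  show "(\<lambda>x. f x * cnj (g x)) \<in> borel_measurable M" "(\<lambda>x. f' x * cnj (g' x)) \<in> borel_measurable M" by measurable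
  show "AE x in M. f x * cnj (g x) = f' x * cnj (g' x)" using assms(1,2) by eventually_elim simp
qed

lemma l2_bound: "sqi M f \<Longrightarrow> sqi M g \<Longrightarrow> \<bar>l2inner D f g\<bar> \<le> nrm2 M f * nrm2 M g"
  using norm_integral_mult_le(2)[OF _ sqi_cnj, of M f g] abs_Re_le_cmod[of "\<integral>x. f x * cnj (g x) \<partial>M"]
  by (simp add: l2inner_eq nrm2_cnj)

lemma l2_real: "sqi M f \<Longrightarrow> sqi M g \<Longrightarrow> l2inner D f g = (\<integral>x. Re (f x * cnj (g x)) \<partial>M)"
  unfolding l2inner_eq by (rule integral_Re[symmetric]) (rule sqi_mult_cnj_integrable)

lemma l2_tendsto:
  assumes "\<And>n. sqi M (f n)" "sqi M F" "sqi M g" "(\<lambda>n. nrm2 M (\<lambda>x. f n x - F x)) \<longlonglongrightarrow> 0"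
  shows "(\<lambda>n. l2inner D (f n) g) \<longlonglongrightarrow> l2inner D F g"
  unfolding l2inner_eq
  by (intro tendsto_Re tendsto_integral_mult assms sqi_cnj) (simp add: nrm2_def)

lemma h1_add:
  assumes "H1 D v" "H1 D w" "H1 D k"
  shows "h1inner D (\<lambda>x. v x + w x) k = h1inner D v k + h1inner D w k"
proof -
  have "l2inner D (wpd D (\<lambda>x. v x + w x) b) (wpd D k b) = l2inner D (wpd D v b) (wpd D k b) + l2inner D (wpd D w b) (wpd D k b)"
    if b: "b \<in> Basis" for b
  proof -
    note s = H1_wpd_sqi[OF assms(1) b] H1_wpd_sqi[OF assms(2) b] H1_wpd_sqi[OF assms(3) b] H1_wpd_sqi[OF H1_add[OF assms(1,2)] b]
    have "l2inner D (wpd D (\<lambda>x. v x + w x) b) (wpd D k b) = l2inner D (\<lambda>x. wpd D v b x + wpd D w b x) (wpd D k b)"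
      by (rule l2_cong[OF wpd_add[OF assms(1,2) b]]) (use s sqi_add[OF s(1,2)] in \<open>auto simp: sqi_def\<close>)
    then show ?thesis using l2_add[OF s(1-3)] by simp
  qed
  then show ?thesis
    using l2_add[OF H1_sqi[OF assms(1)] H1_sqi[OF assms(2)] H1_sqi[OF assms(3)]]
    by (simp add: h1inner_def sum.distrib)
qed

lemma wpd_l2_cmult:
  assumes "H1 D v" "b \<in> Basis" "sqi M g"
  shows "l2inner D (wpd D (\<lambda>x. c * v x) b) g = l2inner D (\<lambda>x. c * wpd D v b x) g"
  by (rule l2_cong[OF wpd_cmult[OF assms(1,2)]])
    (use H1_wpd_sqi[OF H1_cmult[OF assms(1)] assms(2), of c] sqi_cmult[OF H1_wpd_sqi[OF assms(1,2)], of c] assms(3) in \<open>auto simp: sqi_def\<close>)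

lemma h1_scale:
  assumes "H1 D v" "H1 D k" shows "h1inner D (\<lambda>x. complex_of_real c * v x) k = c * h1inner D v k"
  using assms by (simp add: h1inner_def l2_scale wpd_l2_cmult H1_wpd_sqi sum_distrib_left distrib_left)

lemma h1_comm: "h1inner D v w = h1inner D w v"
  by (simp add: h1inner_def l2_comm[of v w] l2_comm[of "wpd D v _"])

lemma h1_i_skew:
  assumes "H1 D v" "H1 D w"
  shows "h1inner D (\<lambda>x. \<i> * v x) w = - h1inner D v (\<lambda>x. \<i> * w x)"
proof -
  have "l2inner D (wpd D (\<lambda>x. \<i> * v x) b) (wpd D w b) = - l2inner D (wpd D v b) (wpd D (\<lambda>x. \<i> * w x) b)" if b: "b \<in> Basis" for b
  proof -
    have "l2inner D (wpd D v b) (wpd D (\<lambda>x. \<i> * w x) b) = l2inner D (\<lambda>x. \<i> * wpd D w b x) (wpd D v b)"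
      unfolding l2_comm[of "wpd D v b"] by (rule wpd_l2_cmult[OF assms(2) b H1_wpd_sqi[OF assms(1) b]])
    then show ?thesis
      unfolding wpd_l2_cmult[OF assms(1) b H1_wpd_sqi[OF assms(2) b]] l2_i_skew[of "wpd D v b"]
      by (simp add: l2_comm[of "wpd D v b"])
  qed
  then show ?thesis by (simp add: h1inner_def l2_i_skew sum_negf)
qed

lemma h1_i:
  assumes "H1 D v" "H1 D w"
  shows "h1inner D (\<lambda>x. \<i> * v x) (\<lambda>x. \<i> * w x) = h1inner D v w"
proof -
  have "h1inner D (\<lambda>x. \<i> * v x) (\<lambda>x. \<i> * w x) = - h1inner D v (\<lambda>x. \<i> * (\<i> * w x))"
    by (rule h1_i_skew[OF assms(1) H1_cmult[OF assms(2)]])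
  also have "(\<lambda>x. \<i> * (\<i> * w x)) = (\<lambda>x. complex_of_real (-1) * w x)" by (simp add: mult.assoc[symmetric])
  also have "h1inner D v \<dots> = - h1inner D v w"
    using h1_scale[OF assms(2,1), of "-1"] by (simp add: h1_comm[of v])
  finally show ?thesis by simp
qed

lemma h1_self: "h1inner D v v = (h1norm D v)\<^sup>2"
  by (simp add: h1inner_def h1norm_sq l2inner_self grd_def)

definition quart :: "('a \<Rightarrow> complex) \<Rightarrow> ('a \<Rightarrow> complex) \<Rightarrow> ('a \<Rightarrow> complex) \<Rightarrow> ('a \<Rightarrow> complex) \<Rightarrow> real" where
  "quart p q v w = (\<integral>x. Re (p x * cnj (q x)) * Re (v x * cnj (w x)) \<partial>M)"

text \<open>The L^4 norm, written through the L^2 norm of the square so that the results on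
  \<open>sqi\<close> apply.\<close>

definition nrm4 :: "('a \<Rightarrow> complex) \<Rightarrow> real" where "nrm4 v = sqrt (nrm2 M (\<lambda>x. v x * v x))"

end

locale gross_pitaevskii = bounded_domain D for D :: "'a::euclidean_space set" +
  fixes V :: "'a \<Rightarrow> real" and \<beta> \<Omega> :: real and e1 e2 :: 'a
  assumes dim: "DIM('a) = 2 \<or> DIM('a) = 3"
    and axes: "e1 \<in> Basis" "e2 \<in> Basis" "e1 \<noteq> e2"
    and V_meas: "set_borel_measurable lebesgue D V"
    and V_bdd: "\<exists>B. AE x in lebesgue. x \<in> D \<longrightarrow> \<bar>V x\<bar> \<le> B"
    and beta0: "\<beta> \<ge> 0"
    and trap: "\<exists>K>0. AE x in lebesgue. x \<in> D \<longrightarrow>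
                 V x - (1 + K) / 4 * \<Omega>^2 * ((x \<bullet> e1)^2 + (x \<bullet> e2)^2) \<ge> 0"
begin

lemma AE_D: "(AE x in lebesgue. x \<in> D \<longrightarrow> P x) \<longleftrightarrow> (AE x in M. P x)"
  by (subst AE_restrict_space_iff) auto

lemma V_measurable [measurable]: "V \<in> borel_measurable M"
  using V_meas by (simp add: set_borel_measurable_def borel_measurable_restrict_space_iff)

section \<open>Products of H^1_0 functions and the quartic form\<close>

lemma quart_sqi:
  assumes "v \<in> H10 D" shows "sqi M (\<lambda>x. v x * v x)"
  using ladyzhenskaya[OF dim] assms by blast

lemma prod_sqi:
  assumes "v \<in> H10 D" "w \<in> H10 D"
  shows "sqi M (\<lambda>x. v x * w x)" "nrm2 M (\<lambda>x. v x * w x) \<le> nrm4 v * nrm4 w"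
proof -
  have [measurable]: "v \<in> borel_measurable M" "w \<in> borel_measurable M" using assms H10_sqi by (auto simp: sqi_def)
  note s = quart_sqi[OF assms(1)] quart_sqi[OF assms(2)]
  have i: "integrable M (\<lambda>x. cmod (v x * v x) * cmod (w x * w x))"
    using integrable_norm[OF sqi_mult_integrable[OF s]] by (simp add: norm_mult)
  have eq: "(cmod (v x * w x))\<^sup>2 = cmod (v x * v x) * cmod (w x * w x)" for x by (simp add: norm_mult power2_eq_square)
  show "sqi M (\<lambda>x. v x * w x)" using i by (simp add: sqi_def eq)
  have "(nrm2 M (\<lambda>x. v x * w x))\<^sup>2 \<le> nrm2 M (\<lambda>x. v x * v x) * nrm2 M (\<lambda>x. w x * w x)"
    unfolding nrm2_sq eq by (rule norm_integral_mult_le(1)[OF s])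
  also have "\<dots> = (nrm4 v * nrm4 w)\<^sup>2" by (simp add: nrm4_def power_mult_distrib)
  finally show "nrm2 M (\<lambda>x. v x * w x) \<le> nrm4 v * nrm4 w" by (rule power2_le_imp_le) (simp add: nrm4_def)
qed

lemma prod_cnj_sqi:
  assumes "v \<in> H10 D" "w \<in> H10 D"
  shows "sqi M (\<lambda>x. v x * cnj (w x))" "nrm2 M (\<lambda>x. v x * cnj (w x)) \<le> nrm4 v * nrm4 w"
    "sqi M (\<lambda>x. complex_of_real (Re (v x * cnj (w x))))" "nrm2 M (\<lambda>x. complex_of_real (Re (v x * cnj (w x)))) \<le> nrm4 v * nrm4 w"
proof -
  have m: "(\<lambda>x. v x * cnj (w x)) \<in> borel_measurable M"
    using H10_sqi[OF assms(1)] sqi_cnj[OF H10_sqi[OF assms(2)]] by (auto simp: sqi_def)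
  have m': "(\<lambda>x. complex_of_real (Re (v x * cnj (w x)))) \<in> borel_measurable M" using m by measurable
  have e: "cmod (complex_of_real (Re (v x * cnj (w x)))) \<le> cmod (v x * w x)" for x
    unfolding norm_of_real by (rule order_trans[OF abs_Re_le_cmod]) (simp add: norm_mult)
  show "sqi M (\<lambda>x. v x * cnj (w x))" by (rule sqi_mono[OF m prod_sqi(1)[OF assms], of 1]) (simp add: norm_mult)
  show "nrm2 M (\<lambda>x. v x * cnj (w x)) \<le> nrm4 v * nrm4 w"
    by (rule order_trans[OF nrm2_mono[OF prod_sqi(1)[OF assms] m] prod_sqi(2)[OF assms]]) (simp add: norm_mult)
  show "sqi M (\<lambda>x. complex_of_real (Re (v x * cnj (w x))))"
    by (rule sqi_mono[OF m' prod_sqi(1)[OF assms], of 1]) (use e in simp)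
  show "nrm2 M (\<lambda>x. complex_of_real (Re (v x * cnj (w x)))) \<le> nrm4 v * nrm4 w"
    by (rule order_trans[OF nrm2_mono[OF prod_sqi(1)[OF assms] m'] prod_sqi(2)[OF assms]]) (use e in simp)
qed

lemma quart_integrable:
  assumes "p \<in> H10 D" "q \<in> H10 D" "v \<in> H10 D" "w \<in> H10 D"
  shows "integrable M (\<lambda>x. Re (p x * cnj (q x)) * Re (v x * cnj (w x)))"
  using integrable_Re[OF sqi_mult_integrable[OF prod_cnj_sqi(3)[OF assms(1,2)] prod_cnj_sqi(3)[OF assms(3,4)]]] by simp

lemma quart_bound:
  assumes "p \<in> H10 D" "q \<in> H10 D" "v \<in> H10 D" "w \<in> H10 D"
  shows "\<bar>quart p q v w\<bar> \<le> nrm4 p * nrm4 q * nrm4 v * nrm4 w"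
proof -
  have "quart p q v w = Re (\<integral>x. complex_of_real (Re (p x * cnj (q x))) * complex_of_real (Re (v x * cnj (w x))) \<partial>M)"
    unfolding quart_def
    by (subst integral_Re[symmetric, OF sqi_mult_integrable[OF prod_cnj_sqi(3)[OF assms(1,2)] prod_cnj_sqi(3)[OF assms(3,4)]]]) simp
  also have "\<bar>\<dots>\<bar> \<le> nrm2 M (\<lambda>x. complex_of_real (Re (p x * cnj (q x)))) * nrm2 M (\<lambda>x. complex_of_real (Re (v x * cnj (w x))))"
    by (rule order_trans[OF abs_Re_le_cmod norm_integral_mult_le(2)[OF prod_cnj_sqi(3)[OF assms(1,2)] prod_cnj_sqi(3)[OF assms(3,4)]]])
  also have "\<dots> \<le> (nrm4 p * nrm4 q) * (nrm4 v * nrm4 w)"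
    by (intro mult_mono prod_cnj_sqi(4) assms) (simp_all add: nrm4_def)
  finally show ?thesis by (simp add: mult.assoc)
qed

lemma quart_add:
  assumes "p \<in> H10 D" "p' \<in> H10 D" "q \<in> H10 D" "v \<in> H10 D" "w \<in> H10 D"
  shows "quart (\<lambda>x. p x + p' x) q v w = quart p q v w + quart p' q v w"
  unfolding quart_def
  by (subst Bochner_Integration.integral_add[symmetric, OF quart_integrable[OF assms(1,3,4,5)] quart_integrable[OF assms(2,3,4,5)]])
    (simp add: algebra_simps)

lemma quart_scale: "quart (\<lambda>x. complex_of_real c * p x) q v w = c * quart p q v w"
  unfolding quart_def by (subst integral_mult_right_zero[symmetric]) (simp add: algebra_simps)

lemma quart_comm: "quart p q v w = quart q p v w"
  unfolding quart_def by (simp add: mult.commute)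

lemma quart_swap: "quart p q v w = quart v w p q"
  unfolding quart_def by (simp add: mult.commute)

lemma quart_nonneg: "0 \<le> quart p p v v"
  unfolding quart_def by (intro integral_nonneg_AE AE_I2) auto

lemma quart_i: "quart (\<lambda>x. \<i> * p x) (\<lambda>x. \<i> * q x) v w = quart p q v w"
  unfolding quart_def by (simp add: algebra_simps)

lemma quart_i_skew: "quart (\<lambda>x. \<i> * p x) q v w = - quart p (\<lambda>x. \<i> * q x) v w"
  unfolding quart_def by (subst integral_minus[symmetric]) (simp add: algebra_simps)

section \<open>The linear part of the operator: potential and rotation\<close>

definition aform :: "('a \<Rightarrow> complex) \<Rightarrow> ('a \<Rightarrow> complex) \<Rightarrow> real" where
  "aform v w = (\<Sum>b\<in>Basis. l2inner D (wpd D v b) (wpd D w b))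
     + l2inner D (\<lambda>x. complex_of_real (V x) * v x) w - \<Omega> * l2inner D (L3 D e1 e2 v) w"

lemma Vmult_sqi: assumes "sqi M v" shows "sqi M (\<lambda>x. complex_of_real (V x) * v x)"
proof -
  obtain B where B: "AE x in M. \<bar>V x\<bar> \<le> B" using V_bdd unfolding AE_D by blast
  have [measurable]: "v \<in> borel_measurable M" using assms by (rule sqi_meas)
  show ?thesis
  proof (rule sqi_mono[OF _ assms, of _ B])
    show "AE x in M. cmod (complex_of_real (V x) * v x) \<le> B * cmod (v x)"
      using B by eventually_elim (simp add: norm_mult mult_right_mono)
  qed measurable
qed

lemma coord_bound: "\<exists>B\<ge>0. \<forall>x\<in>D. \<forall>b\<in>Basis. \<bar>x \<bullet> b\<bar> \<le> B"
proof -
  obtain B where B: "\<And>x. x \<in> D \<Longrightarrow> norm x \<le> B" using boundedD by (auto simp: bounded_iff)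
  have "\<bar>x \<bullet> b\<bar> \<le> max B 0" if "x \<in> D" "b \<in> Basis" for x b
    using Basis_le_norm[OF that(2), of x] B[OF that(1)] by linarith
  then show ?thesis by (intro exI[of _ "max B 0"]) auto
qed

definition CB :: real where "CB = (SOME B. B \<ge> 0 \<and> (\<forall>x\<in>D. \<forall>b\<in>Basis. \<bar>x \<bullet> b\<bar> \<le> B))"

lemma CB: "CB \<ge> 0" "\<And>x b. x \<in> D \<Longrightarrow> b \<in> Basis \<Longrightarrow> \<bar>x \<bullet> b\<bar> \<le> CB"
  using someI_ex[OF coord_bound] unfolding CB_def by blast+

text \<open>The angular momentum operator with the two gradient components as arguments, so that it
  applies to weak and to classical partial derivatives alike.\<close>

definition rot :: "('a \<Rightarrow> complex) \<Rightarrow> ('a \<Rightarrow> complex) \<Rightarrow> 'a \<Rightarrow> complex" where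
  "rot g2 g1 x = - \<i> * (complex_of_real (x \<bullet> e1) * g2 x - complex_of_real (x \<bullet> e2) * g1 x)"

lemma L3_rot: "L3 D e1 e2 v = rot (wpd D v e2) (wpd D v e1)"
  by (simp add: L3_def rot_def fun_eq_iff)

lemma coord_measurable [measurable]: "(\<lambda>x. x \<bullet> b) \<in> borel_measurable M"
  by (rule borel_measurable_lebesgue_on) simp

lemma coord_mult_sqi:
  assumes "sqi M g" "b \<in> Basis"
  shows "sqi M (\<lambda>x. complex_of_real (x \<bullet> b) * g x)" "nrm2 M (\<lambda>x. complex_of_real (x \<bullet> b) * g x) \<le> CB * nrm2 M g"
proof -
  have [measurable]: "g \<in> borel_measurable M" using assms(1) by (rule sqi_meas)
  have e: "AE x in M. cmod (complex_of_real (x \<bullet> b) * g x) \<le> CB * cmod (g x)"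
    using CB assms(2) by (intro AE_I2) (auto simp: norm_mult intro!: mult_right_mono)
  show "sqi M (\<lambda>x. complex_of_real (x \<bullet> b) * g x)" by (rule sqi_mono[OF _ assms(1) e]) measurable
  have "nrm2 M (\<lambda>x. complex_of_real (x \<bullet> b) * g x) \<le> nrm2 M (\<lambda>x. complex_of_real CB * g x)"
    by (rule nrm2_mono[OF sqi_cmult[OF assms(1)]]) (use e CB(1) in \<open>auto simp: norm_mult\<close>)
  then show "nrm2 M (\<lambda>x. complex_of_real (x \<bullet> b) * g x) \<le> CB * nrm2 M g" using CB(1) by (simp add: nrm2_cmult)
qed

lemma rot_sqi:
  assumes "sqi M g2" "sqi M g1"
  shows "sqi M (rot g2 g1)" "nrm2 M (rot g2 g1) \<le> CB * (nrm2 M g2 + nrm2 M g1)"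
proof -
  note c = coord_mult_sqi[OF assms(1) axes(1)] coord_mult_sqi[OF assms(2) axes(2)]
  show "sqi M (rot g2 g1)" unfolding rot_def[abs_def] by (intro sqi_cmult sqi_diff c)
  have "nrm2 M (rot g2 g1) = nrm2 M (\<lambda>x. complex_of_real (x \<bullet> e1) * g2 x - complex_of_real (x \<bullet> e2) * g1 x)"
    unfolding rot_def[abs_def] by (subst nrm2_cmult) simp
  also have "\<dots> \<le> nrm2 M (\<lambda>x. complex_of_real (x \<bullet> e1) * g2 x) + nrm2 M (\<lambda>x. complex_of_real (x \<bullet> e2) * g1 x)"
    using nrm2_triangle[OF c(1) sqi_cmult[OF c(3), of "-1"]] nrm2_cmult[of M "-1"] by simp
  finally show "nrm2 M (rot g2 g1) \<le> CB * (nrm2 M g2 + nrm2 M g1)" using c(2,4) by (simp add: distrib_left)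
qed

lemma L3_sqi: "H1 D v \<Longrightarrow> sqi M (L3 D e1 e2 v)"
  unfolding L3_rot by (intro rot_sqi H1_wpd_sqi axes)

lemma L3_add:
  assumes "H1 D v" "H1 D w"
  shows "AE x in M. L3 D e1 e2 (\<lambda>x. v x + w x) x = L3 D e1 e2 v x + L3 D e1 e2 w x"
  using wpd_add[OF assms axes(1)] wpd_add[OF assms axes(2)]
  by eventually_elim (simp add: L3_def algebra_simps)

lemma L3_cmult:
  assumes "H1 D v"
  shows "AE x in M. L3 D e1 e2 (\<lambda>x. c * v x) x = c * L3 D e1 e2 v x"
  using wpd_cmult[OF assms axes(1), of c] wpd_cmult[OF assms axes(2), of c]
  by eventually_elim (simp add: L3_def algebra_simps)

text \<open>Each partial derivative is multiplied by a different coordinate, so integration by parts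
  leaves no zero-order term: x1 d2 - x2 d1 is skew, and the factor -\<i> makes it symmetric.\<close>

lemma L3_test:
  assumes v: "v \<in> H10 D" and t: "test_fun D \<phi>"
  shows "l2inner D (L3 D e1 e2 v) \<phi> = l2inner D (rot (pdv \<phi> e2) (pdv \<phi> e1)) v"
proof -
  note H = H10_H1[OF v]
  have pd: "pdv (\<lambda>x. complex_of_real (x \<bullet> c) * cnj (\<phi> x)) d x = complex_of_real (x \<bullet> c) * cnj (pdv \<phi> d x)"
    if "c \<in> Basis" "d \<in> Basis" "c \<noteq> d" for c d x
  proof -
    have "((\<lambda>x. complex_of_real (x \<bullet> c) * cnj (\<phi> x)) has_derivative
        (\<lambda>h. complex_of_real (x \<bullet> c) * cnj (pdv \<phi> h x) + complex_of_real (h \<bullet> c) * cnj (\<phi> x))) (at x)"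
    proof (rule has_derivative_mult)
      show "((\<lambda>x. complex_of_real (x \<bullet> c)) has_derivative (\<lambda>h. complex_of_real (h \<bullet> c))) (at x)"
        by (intro bounded_linear.has_derivative[OF bounded_linear_of_real]) (auto intro!: derivative_eq_intros)
      show "((\<lambda>x. cnj (\<phi> x)) has_derivative (\<lambda>h. cnj (pdv \<phi> h x))) (at x)"
        by (rule bounded_linear.has_derivative[OF bounded_linear_cnj smooth_fun_has_derivative[OF test_fun_smooth[OF t]]])
    qed
    from fun_cong[OF frechet_derivative_at[OF this], of d] inner_not_same_Basis[OF that(2,1)] that(3)
    show ?thesis by simp
  qed
  have ibp: "(\<integral>x. v x * (complex_of_real (x \<bullet> c) * cnj (pdv \<phi> d x)) \<partial>M)
      = - (\<integral>x. wpd D v d x * (complex_of_real (x \<bullet> c) * cnj (\<phi> x)) \<partial>M)" if cd: "c \<in> Basis" "d \<in> Basis" "c \<noteq> d" for c d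
  proof -
    have "test_fun D (\<lambda>x. complex_of_real (x \<bullet> c) * cnj (\<phi> x))" by (intro test_fun_mult smooth_fun_inner test_fun_cnj t)
    then have "(\<integral>x. v x * pdv (\<lambda>x. complex_of_real (x \<bullet> c) * cnj (\<phi> x)) d x \<partial>M) = - (\<integral>x. wpd D v d x * (complex_of_real (x \<bullet> c) * cnj (\<phi> x)) \<partial>M)"
      using H1_wpd[OF H cd(2)] by (simp add: weak_partial_iff)
    then show ?thesis by (simp add: pd[OF cd])
  qed
  have i1: "integrable M (\<lambda>x. wpd D v d x * (complex_of_real (x \<bullet> c) * cnj (\<phi> x)))" if "c \<in> Basis" "d \<in> Basis" for c d
    by (intro sqi_mult_integrable H1_wpd_sqi H coord_mult_sqi sqi_cnj sqi_test t that)
  have i2: "integrable M (\<lambda>x. v x * (complex_of_real (x \<bullet> c) * cnj (pdv \<phi> d x)))" if "c \<in> Basis" "d \<in> Basis" for c d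
    by (intro sqi_mult_integrable H1_sqi H coord_mult_sqi sqi_cnj sqi_test_pdv t that)
  have "(\<integral>x. L3 D e1 e2 v x * cnj (\<phi> x) \<partial>M) = (\<integral>x. - \<i> * (wpd D v e2 x * (complex_of_real (x \<bullet> e1) * cnj (\<phi> x)))
      + \<i> * (wpd D v e1 x * (complex_of_real (x \<bullet> e2) * cnj (\<phi> x))) \<partial>M)"
    by (simp add: L3_def algebra_simps)
  also have "\<dots> = - \<i> * (\<integral>x. wpd D v e2 x * (complex_of_real (x \<bullet> e1) * cnj (\<phi> x)) \<partial>M)
      + \<i> * (\<integral>x. wpd D v e1 x * (complex_of_real (x \<bullet> e2) * cnj (\<phi> x)) \<partial>M)"
    using i1[OF axes(1,2)] i1[OF axes(2,1)] by (subst Bochner_Integration.integral_add) auto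
  also have "\<dots> = \<i> * (\<integral>x. v x * (complex_of_real (x \<bullet> e1) * cnj (pdv \<phi> e2 x)) \<partial>M)
      + - \<i> * (\<integral>x. v x * (complex_of_real (x \<bullet> e2) * cnj (pdv \<phi> e1 x)) \<partial>M)"
    using ibp[OF axes] ibp[OF axes(2,1) axes(3)[symmetric]] by simp
  also have "\<dots> = (\<integral>x. \<i> * (v x * (complex_of_real (x \<bullet> e1) * cnj (pdv \<phi> e2 x)))
      + - \<i> * (v x * (complex_of_real (x \<bullet> e2) * cnj (pdv \<phi> e1 x))) \<partial>M)"
    using i2[OF axes(1,2)] i2[OF axes(2,1)] by (subst Bochner_Integration.integral_add) auto
  also have "\<dots> = (\<integral>x. v x * cnj (rot (pdv \<phi> e2) (pdv \<phi> e1) x) \<partial>M)"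
    by (simp add: rot_def algebra_simps)
  finally have "l2inner D (L3 D e1 e2 v) \<phi> = l2inner D v (rot (pdv \<phi> e2) (pdv \<phi> e1))" by (simp add: l2inner_eq)
  then show ?thesis by (simp add: l2_comm)
qed

text \<open>Density of test functions in the second argument; both sides are L^2-continuous in the
  function and its gradient because the coordinates are bounded on the domain.\<close>

lemma L3_sym:
  assumes v: "v \<in> H10 D" and w: "w \<in> H10 D"
  shows "l2inner D (L3 D e1 e2 v) w = l2inner D (L3 D e1 e2 w) v"
proof -
  obtain \<phi> where \<phi>: "\<And>k::nat. test_fun D (\<phi> k)" "(\<lambda>k. nrm2 M (\<lambda>x. \<phi> k x - w x)) \<longlonglongrightarrow> 0"
     "\<And>b. b\<in>Basis \<Longrightarrow> (\<lambda>k. nrm2 M (\<lambda>x. pdv (\<phi> k) b x - wpd D w b x)) \<longlonglongrightarrow> 0" using H10_seq[OF w] by blast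
  note sv = L3_sqi[OF H10_H1[OF v]] and sw = L3_sqi[OF H10_H1[OF w]]
  have "(\<lambda>k. l2inner D (\<phi> k) (L3 D e1 e2 v)) \<longlonglongrightarrow> l2inner D w (L3 D e1 e2 v)"
    by (rule l2_tendsto[OF sqi_test[OF \<phi>(1)] H10_sqi[OF w] sv \<phi>(2)])
  then have 1: "(\<lambda>k. l2inner D (L3 D e1 e2 v) (\<phi> k)) \<longlonglongrightarrow> l2inner D (L3 D e1 e2 v) w" by (simp add: l2_comm)
  have s: "sqi M (pdv (\<phi> k) b)" "sqi M (wpd D w b)" if "b \<in> Basis" for k b using sqi_test_pdv[OF \<phi>(1) that] H1_wpd_sqi[OF H10_H1[OF w] that] by auto
  have "(\<lambda>k. l2inner D (rot (pdv (\<phi> k) e2) (pdv (\<phi> k) e1)) v) \<longlonglongrightarrow> l2inner D (L3 D e1 e2 w) v"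
  proof (rule l2_tendsto[OF rot_sqi(1)[OF s(1) s(1)] sw H10_sqi[OF v]])
    show "(\<lambda>k. nrm2 M (\<lambda>x. rot (pdv (\<phi> k) e2) (pdv (\<phi> k) e1) x - L3 D e1 e2 w x)) \<longlonglongrightarrow> 0"
    proof (rule tendsto_dist_bound)
      show "\<bar>nrm2 M (\<lambda>x. rot (pdv (\<phi> k) e2) (pdv (\<phi> k) e1) x - L3 D e1 e2 w x) - 0\<bar> \<le>
          CB * (nrm2 M (\<lambda>x. pdv (\<phi> k) e2 x - wpd D w e2 x) + nrm2 M (\<lambda>x. pdv (\<phi> k) e1 x - wpd D w e1 x))" for k
      proof -
        have "(\<lambda>x. rot (pdv (\<phi> k) e2) (pdv (\<phi> k) e1) x - L3 D e1 e2 w x)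
          = rot (\<lambda>x. pdv (\<phi> k) e2 x - wpd D w e2 x) (\<lambda>x. pdv (\<phi> k) e1 x - wpd D w e1 x)"
          by (simp add: L3_rot rot_def fun_eq_iff algebra_simps)
        then show ?thesis using rot_sqi(2)[OF sqi_diff[OF s[OF axes(2)]] sqi_diff[OF s[OF axes(1)]], of k k] by simp
      qed
      show "(\<lambda>k. CB * (nrm2 M (\<lambda>x. pdv (\<phi> k) e2 x - wpd D w e2 x) + nrm2 M (\<lambda>x. pdv (\<phi> k) e1 x - wpd D w e1 x))) \<longlonglongrightarrow> 0"
        using tendsto_mult[OF tendsto_const[of CB] tendsto_add[OF \<phi>(3)[OF axes(2)] \<phi>(3)[OF axes(1)]]] by simp
    qed
  qed (use axes in auto)
  then have "(\<lambda>k. l2inner D (L3 D e1 e2 v) (\<phi> k)) \<longlonglongrightarrow> l2inner D (L3 D e1 e2 w) v" by (simp add: L3_test[OF v \<phi>(1)])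
  with 1 show ?thesis by (rule LIMSEQ_unique)
qed

lemma aform_comm:
  assumes "v \<in> H10 D" "w \<in> H10 D" shows "aform v w = aform w v"
proof -
  have "l2inner D (\<lambda>x. complex_of_real (V x) * v x) w = l2inner D v (\<lambda>x. complex_of_real (V x) * w x)"
    by (simp add: l2inner_eq mult_ac)
  then show ?thesis
    by (simp add: aform_def L3_sym[OF assms] l2_comm[of v] l2_comm[of "wpd D v _"])
qed

lemma L3_l2_cong:
  assumes "AE x in M. L3 D e1 e2 u x = f x" "H1 D u" "sqi M f" "sqi M w"
  shows "l2inner D (L3 D e1 e2 u) w = l2inner D f w"
  by (rule l2_cong[OF assms(1)]) (use L3_sqi[OF assms(2)] assms(3,4) in \<open>auto simp: sqi_def\<close>)

lemma aform_add:
  assumes "v \<in> H10 D" "v' \<in> H10 D" "w \<in> H10 D"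
  shows "aform (\<lambda>x. v x + v' x) w = aform v w + aform v' w"
proof -
  note H = H10_H1[OF assms(1)] H10_H1[OF assms(2)] H10_H1[OF assms(3)]
  note s = H1_sqi[OF H(1)] H1_sqi[OF H(2)] H1_sqi[OF H(3)]
  have 1: "(\<Sum>b\<in>Basis. l2inner D (wpd D (\<lambda>x. v x + v' x) b) (wpd D w b))
     = (\<Sum>b\<in>Basis. l2inner D (wpd D v b) (wpd D w b)) + (\<Sum>b\<in>Basis. l2inner D (wpd D v' b) (wpd D w b))"
    using h1_add[OF H] l2_add[OF s] by (simp add: h1inner_def)
  have 2: "l2inner D (\<lambda>x. complex_of_real (V x) * (v x + v' x)) w
     = l2inner D (\<lambda>x. complex_of_real (V x) * v x) w + l2inner D (\<lambda>x. complex_of_real (V x) * v' x) w"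
    unfolding distrib_left by (rule l2_add[OF Vmult_sqi[OF s(1)] Vmult_sqi[OF s(2)] s(3)])
  have 3: "l2inner D (L3 D e1 e2 (\<lambda>x. v x + v' x)) w = l2inner D (L3 D e1 e2 v) w + l2inner D (L3 D e1 e2 v') w"
    using L3_l2_cong[OF L3_add[OF H(1,2)] H1_add[OF H(1,2)] sqi_add[OF L3_sqi[OF H(1)] L3_sqi[OF H(2)]] s(3)]
      l2_add[OF L3_sqi[OF H(1)] L3_sqi[OF H(2)] s(3)] by simp
  show ?thesis unfolding aform_def 1 2 3 by (simp add: distrib_left)
qed

lemma aform_scale:
  assumes "v \<in> H10 D" "w \<in> H10 D"
  shows "aform (\<lambda>x. complex_of_real c * v x) w = c * aform v w"
proof -
  note H = H10_H1[OF assms(1)] H10_H1[OF assms(2)]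
  note s = H1_sqi[OF H(1)] H1_sqi[OF H(2)]
  have 1: "(\<Sum>b\<in>Basis. l2inner D (wpd D (\<lambda>x. complex_of_real c * v x) b) (wpd D w b)) = c * (\<Sum>b\<in>Basis. l2inner D (wpd D v b) (wpd D w b))"
    using h1_scale[OF H, of c] by (simp add: h1inner_def l2_scale distrib_left)
  have 2: "l2inner D (\<lambda>x. complex_of_real (V x) * (complex_of_real c * v x)) w = c * l2inner D (\<lambda>x. complex_of_real (V x) * v x) w"
    unfolding mult.left_commute[of "complex_of_real (V _)"] by (rule l2_scale)
  have 3: "l2inner D (L3 D e1 e2 (\<lambda>x. complex_of_real c * v x)) w = c * l2inner D (L3 D e1 e2 v) w"
    using L3_l2_cong[OF L3_cmult[OF H(1)] H1_cmult[OF H(1)] sqi_cmult[OF L3_sqi[OF H(1)]] s(2)] by (simp add: l2_scale)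
  show ?thesis unfolding aform_def 1 2 3 by (simp add: distrib_left right_diff_distrib mult.left_commute[of \<Omega> c])
qed

lemma aform_i_skew:
  assumes "v \<in> H10 D" "w \<in> H10 D"
  shows "aform (\<lambda>x. \<i> * v x) w = - aform v (\<lambda>x. \<i> * w x)"
proof -
  note H = H10_H1[OF assms(1)] H10_H1[OF assms(2)]
  note s = H1_sqi[OF H(1)] H1_sqi[OF H(2)]
  have 1: "(\<Sum>b\<in>Basis. l2inner D (wpd D (\<lambda>x. \<i> * v x) b) (wpd D w b)) = - (\<Sum>b\<in>Basis. l2inner D (wpd D v b) (wpd D (\<lambda>x. \<i> * w x) b))"
    using h1_i_skew[OF H] by (simp add: h1inner_def l2_i_skew)
  have "l2inner D (\<lambda>x. complex_of_real (V x) * (\<i> * v x)) w = l2inner D (\<lambda>x. \<i> * (complex_of_real (V x) * v x)) w"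
    by (simp add: mult.left_commute)
  then have 2: "l2inner D (\<lambda>x. complex_of_real (V x) * (\<i> * v x)) w = - l2inner D (\<lambda>x. complex_of_real (V x) * v x) (\<lambda>x. \<i> * w x)"
    by (simp add: l2_i_skew)
  have 3: "l2inner D (L3 D e1 e2 (\<lambda>x. \<i> * v x)) w = - l2inner D (L3 D e1 e2 v) (\<lambda>x. \<i> * w x)"
    using L3_l2_cong[OF L3_cmult[OF H(1)] H1_cmult[OF H(1)] sqi_cmult[OF L3_sqi[OF H(1)]] s(2)] by (simp add: l2_i_skew)
  show ?thesis by (simp add: aform_def 1 2 3)
qed

lemma aform_i:
  assumes "v \<in> H10 D" "w \<in> H10 D"
  shows "aform (\<lambda>x. \<i> * v x) (\<lambda>x. \<i> * w x) = aform v w"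
proof -
  have "aform (\<lambda>x. \<i> * v x) (\<lambda>x. \<i> * w x) = - aform v (\<lambda>x. \<i> * (\<i> * w x))"
    by (rule aform_i_skew[OF assms(1) H10_cmult[OF assms(2)]])
  also have "(\<lambda>x. \<i> * (\<i> * w x)) = (\<lambda>x. complex_of_real (-1) * w x)" by (simp add: mult.assoc[symmetric])
  also have "aform v \<dots> = - aform v w"
    using aform_scale[OF assms(2,1), of "-1"] aform_comm[OF assms] aform_comm[OF assms(1) H10_cmult[OF assms(2)], of "-1"] by simp
  finally show ?thesis by simp
qed

text \<open>Young's inequality splits the rotation term into a fraction 1/k of the gradient and a
  part that the trapping condition absorbs into the potential. A positive fraction of the gradient
  remains, and the Poincare inequality turns it into the full norm.\<close>

lemma aform_coercive: "\<exists>c>0. \<forall>v\<in>H10 D. c * h1inner D v v \<le> aform v v"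
proof -
  obtain K where K: "K > 0" "AE x in M. V x - (1 + K) / 4 * \<Omega>\<^sup>2 * ((x \<bullet> e1)\<^sup>2 + (x \<bullet> e2)\<^sup>2) \<ge> 0"
    using trap unfolding AE_D by blast
  obtain C where C: "C \<ge> 0" "\<And>v. v \<in> H10 D \<Longrightarrow> (nrm2 M v)\<^sup>2 \<le> C * grd v" using poincare by blast
  define k where "k = 1 + K"
  have k: "k > 1" using K by (simp add: k_def)
  have main: "(1 - 1/k) * grd v \<le> aform v v" if v: "v \<in> H10 D" for v
  proof -
    note H = H10_H1[OF v]
    note s = H1_sqi[OF H] and gs = H1_wpd_sqi[OF H]
    let ?S = "\<lambda>x. \<Sum>b\<in>Basis. (cmod (wpd D v b x))\<^sup>2"
    have iS: "integrable M ?S" by (intro Bochner_Integration.integrable_sum sqi_int gs)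
    have IS: "(\<integral>x. ?S x \<partial>M) = grd v" by (simp add: grd_def nrm2_sq sqi_int gs)
    have iV: "integrable M (\<lambda>x. Re (complex_of_real (V x) * v x * cnj (v x)))"
      by (intro integrable_Re sqi_mult_cnj_integrable Vmult_sqi s)
    have iL: "integrable M (\<lambda>x. Re (L3 D e1 e2 v x * cnj (v x)))"
      by (intro integrable_Re sqi_mult_cnj_integrable L3_sqi H s)
    \<comment> \<open>Pointwise nonnegativity with only the share 1/k of the gradient; k = 1 + K
      exceeds 1, so the share 1 - 1/k is left over.\<close>
    have "0 \<le> (\<integral>x. 1/k * ?S x + Re (complex_of_real (V x) * v x * cnj (v x)) - \<Omega> * Re (L3 D e1 e2 v x * cnj (v x)) \<partial>M)"
    proof (rule integral_nonneg_AE)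
      show "AE x in M. 0 \<le> 1/k * ?S x + Re (complex_of_real (V x) * v x * cnj (v x)) - \<Omega> * Re (L3 D e1 e2 v x * cnj (v x))"
        using K(2)
      proof eventually_elim
        case (elim x)
        define y where "y = cmod (v x)"
        define g1 g2 where "g1 = cmod (wpd D v e1 x)" and "g2 = cmod (wpd D v e2 x)"
        define x1 x2 where "x1 = \<bar>x \<bullet> e1\<bar>" and "x2 = \<bar>x \<bullet> e2\<bar>"
        have S: "g1\<^sup>2 + g2\<^sup>2 \<le> ?S x"
        proof -
          have "(\<Sum>b\<in>{e1,e2}. (cmod (wpd D v b x))\<^sup>2) \<le> ?S x" by (rule sum_mono2) (use axes in auto)
          then show ?thesis using axes by (simp add: g1_def g2_def)
        qed
        have Vy: "Re (complex_of_real (V x) * v x * cnj (v x)) = V x * y\<^sup>2"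
        proof -
          have "complex_of_real (V x * y\<^sup>2) = complex_of_real (V x) * v x * cnj (v x)"
            by (simp only: of_real_mult y_def complex_norm_square mult.assoc)
          then show ?thesis by (metis Re_complex_of_real)
        qed
        \<comment> \<open>The weight in Young's inequality is chosen so that the coefficient k/4 is
          exactly the one of the trapping condition.\<close>
        have ag: "w * X * g * y \<le> g\<^sup>2 / k + k / 4 * w\<^sup>2 * X\<^sup>2 * y\<^sup>2" for w X g :: real
        proof -
          have "0 \<le> (g - k / 2 * (w * X * y))\<^sup>2 / k" using k by simp
          also have "\<dots> = g\<^sup>2 / k + k / 4 * w\<^sup>2 * X\<^sup>2 * y\<^sup>2 - w * X * g * y"
            using k by (simp add: power2_eq_square field_simps)
          finally show ?thesis by simp
        qed
        have "cmod (L3 D e1 e2 v x) \<le> x1 * g2 + x2 * g1"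
          unfolding L3_def norm_mult norm_minus_cancel
          using norm_triangle_ineq4[of "complex_of_real (x \<bullet> e1) * wpd D v e2 x" "complex_of_real (x \<bullet> e2) * wpd D v e1 x"]
          by (simp add: norm_mult x1_def x2_def g1_def g2_def)
        then have "cmod (L3 D e1 e2 v x) * y \<le> (x1 * g2 + x2 * g1) * y" by (intro mult_right_mono) (simp_all add: y_def)
        then have "\<bar>\<Omega>\<bar> * (cmod (L3 D e1 e2 v x) * y) \<le> \<bar>\<Omega>\<bar> * ((x1 * g2 + x2 * g1) * y)" by (rule mult_left_mono) simp
        moreover have "\<Omega> * Re (L3 D e1 e2 v x * cnj (v x)) \<le> \<bar>\<Omega>\<bar> * (cmod (L3 D e1 e2 v x) * y)"
        proof -
          have "\<Omega> * Re (L3 D e1 e2 v x * cnj (v x)) \<le> \<bar>\<Omega>\<bar> * \<bar>Re (L3 D e1 e2 v x * cnj (v x))\<bar>" by (simp add: abs_mult[symmetric])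
          also have "\<dots> \<le> \<bar>\<Omega>\<bar> * (cmod (L3 D e1 e2 v x) * y)"
            using abs_Re_le_cmod[of "L3 D e1 e2 v x * cnj (v x)"] by (intro mult_left_mono) (auto simp: norm_mult y_def)
          finally show ?thesis .
        qed
        ultimately have "\<Omega> * Re (L3 D e1 e2 v x * cnj (v x)) \<le> \<bar>\<Omega>\<bar> * x1 * g2 * y + \<bar>\<Omega>\<bar> * x2 * g1 * y"
          by (simp add: algebra_simps)
        also have "\<dots> \<le> (g2\<^sup>2 / k + k / 4 * \<bar>\<Omega>\<bar>\<^sup>2 * x1\<^sup>2 * y\<^sup>2) + (g1\<^sup>2 / k + k / 4 * \<bar>\<Omega>\<bar>\<^sup>2 * x2\<^sup>2 * y\<^sup>2)"
          by (intro add_mono ag)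
        also have "\<dots> = (g1\<^sup>2 + g2\<^sup>2) / k + (k / 4 * \<Omega>\<^sup>2 * ((x \<bullet> e1)\<^sup>2 + (x \<bullet> e2)\<^sup>2)) * y\<^sup>2"
          by (simp add: x1_def x2_def add_divide_distrib algebra_simps)
        also have "\<dots> \<le> ?S x / k + V x * y\<^sup>2"
          using S elim k by (intro add_mono divide_right_mono mult_right_mono) (auto simp: k_def)
        finally show ?case unfolding Vy by simp
      qed
    qed
    also have "\<dots> = 1/k * grd v + l2inner D (\<lambda>x. complex_of_real (V x) * v x) v - \<Omega> * l2inner D (L3 D e1 e2 v) v"
      using iS iV iL by (simp add: IS l2_real[OF Vmult_sqi[OF s] s] l2_real[OF L3_sqi[OF H] s])
    also have "\<dots> = aform v v - (1 - 1/k) * grd v"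
      by (simp add: aform_def grd_def l2inner_self algebra_simps)
    finally show ?thesis by simp
  qed
  define c where "c = (1 - 1/k) / (C + 1)"
  have c: "c > 0" using k C by (simp add: c_def)
  have "c * h1inner D v v \<le> aform v v" if v: "v \<in> H10 D" for v
  proof -
    have "h1inner D v v \<le> (C + 1) * grd v" unfolding h1_self h1norm_sq using C(2)[OF v] by (simp add: distrib_right)
    then have "c * h1inner D v v \<le> c * ((C + 1) * grd v)" using c by (intro mult_left_mono) auto
    also have "\<dots> = (1 - 1/k) * grd v" using C(1) by (simp add: c_def)
    also note main[OF v]
    finally show ?thesis .
  qed
  then show ?thesis using c by blast
qed

lemma aform_bounded: "\<exists>C. \<forall>v\<in>H10 D. aform v v \<le> C * h1inner D v v"
proof -
  obtain B where B: "AE x in M. \<bar>V x\<bar> \<le> B" using V_bdd unfolding AE_D by blast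
  define B' where "B' = max B 0"
  have B': "AE x in M. \<bar>V x\<bar> \<le> B'" using B by eventually_elim (simp add: B'_def)
  have "aform v v \<le> (1 + B' + \<bar>\<Omega>\<bar> * (2 * CB)) * h1inner D v v" if v: "v \<in> H10 D" for v
  proof -
    note H = H10_H1[OF v]
    note s = H1_sqi[OF H] and gs = H1_wpd_sqi[OF H]
    let ?n = "h1norm D v"
    have n0: "?n \<ge> 0" by (rule h1norm_nonneg)
    have 1: "(\<Sum>b\<in>Basis. l2inner D (wpd D v b) (wpd D v b)) \<le> ?n\<^sup>2"
      by (simp add: l2inner_self grd_def[symmetric] h1norm_sq)
    have 2: "l2inner D (\<lambda>x. complex_of_real (V x) * v x) v \<le> B' * ?n\<^sup>2"
    proof -
      have "nrm2 M (\<lambda>x. complex_of_real (V x) * v x) \<le> nrm2 M (\<lambda>x. complex_of_real B' * v x)"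
      proof (rule nrm2_mono[OF sqi_cmult[OF s] sqi_meas[OF Vmult_sqi[OF s]]])
        show "AE x in M. cmod (complex_of_real (V x) * v x) \<le> cmod (complex_of_real B' * v x)"
          using B' by eventually_elim (simp add: norm_mult mult_right_mono B'_def)
      qed
      then have "nrm2 M (\<lambda>x. complex_of_real (V x) * v x) \<le> B' * nrm2 M v" by (simp add: nrm2_cmult B'_def)
      then have "nrm2 M (\<lambda>x. complex_of_real (V x) * v x) * nrm2 M v \<le> B' * nrm2 M v * nrm2 M v" by (rule mult_right_mono) simp
      also have "\<dots> \<le> B' * ?n * ?n" using nrm2_le_h1norm[of v] n0 by (intro mult_mono) (auto simp: B'_def)
      finally show ?thesis using l2_bound[OF Vmult_sqi[OF s] s] by (simp add: power2_eq_square mult.assoc)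
    qed
    have 3: "- \<Omega> * l2inner D (L3 D e1 e2 v) v \<le> \<bar>\<Omega>\<bar> * (2 * CB) * ?n\<^sup>2"
    proof -
      have "nrm2 M (L3 D e1 e2 v) \<le> CB * (nrm2 M (wpd D v e2) + nrm2 M (wpd D v e1))"
        unfolding L3_rot by (intro rot_sqi gs axes)
      also have "\<dots> \<le> CB * (?n + ?n)" using CB(1) by (intro mult_left_mono add_mono nrm2_wpd_le_h1norm axes) auto
      finally have "nrm2 M (L3 D e1 e2 v) * nrm2 M v \<le> (2 * CB * ?n) * ?n"
        using nrm2_le_h1norm[of v] n0 CB(1) by (intro mult_mono) auto
      then have "\<bar>l2inner D (L3 D e1 e2 v) v\<bar> \<le> 2 * CB * ?n\<^sup>2" using l2_bound[OF L3_sqi[OF H] s] by (simp add: power2_eq_square mult.assoc)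
      then have "\<bar>\<Omega>\<bar> * \<bar>l2inner D (L3 D e1 e2 v) v\<bar> \<le> \<bar>\<Omega>\<bar> * (2 * CB * ?n\<^sup>2)" by (rule mult_left_mono) simp
      then have "\<bar>\<Omega> * l2inner D (L3 D e1 e2 v) v\<bar> \<le> \<bar>\<Omega>\<bar> * (2 * CB) * ?n\<^sup>2" by (simp add: abs_mult mult.assoc)
      then show ?thesis by linarith
    qed
    show ?thesis using 1 2 3 by (simp add: aform_def h1_self algebra_simps)
  qed
  then show ?thesis by blast
qed

section \<open>Instance of the abstract setting\<close>

lemma fun_ops:
  fixes v w :: "'a \<Rightarrow> complex"
  shows "v + w = (\<lambda>x. v x + w x)" "v - w = (\<lambda>x. v x - w x)" "c *\<^sub>R v = (\<lambda>x. complex_of_real c * v x)"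
  by (simp_all add: plus_fun_def fun_diff_def scaleR_fun_def scaleR_conv_of_real)

lemma H10_subspace: "subspace (H10 D)"
  unfolding subspace_def fun_ops using H10_add H10_cmult H10_zero by (simp add: zero_fun_def)

text \<open>A purely algebraic left inverse of the inclusion, possibly discontinuous. Every form and
  norm applies it first, so the analysis takes place among elements of \<open>H10 D\<close>.\<close>

lemma exists_projection: "\<exists>P. linear P \<and> range P \<subseteq> H10 D \<and> (\<forall>v\<in>H10 D. P v = v)"
  using linear_exists_left_inverse_on[OF linear_id H10_subspace inj_on_id] by auto

theorem gp_instance:
  assumes P: "linear P" "range P \<subseteq> H10 D" "\<And>v. v \<in> H10 D \<Longrightarrow> P v = v"
  shows "\<exists>c0 Ca Cs. gp (\<lambda>v w. h1inner D (P v) (P w)) (\<lambda>v w. l2inner D (P v) (P w)) (\<lambda>v w. aform (P v) (P w))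
     (\<lambda>p q v w. quart (P p) (P q) (P v) (P w)) (\<lambda>v x. \<i> * P v x) (\<lambda>v. nrm4 (P v)) \<beta> c0 Ca Cs"
proof -
  have PX: "P v \<in> H10 D" for v using P(2) by auto
  note PH = H10_H1[OF PX] and Ps = H10_sqi[OF PX]
  have Padd: "P (v + w) = (\<lambda>x. P v x + P w x)" for v w using linear_add[OF P(1)] by (simp add: fun_ops)
  have Psc: "P (c *\<^sub>R v) = (\<lambda>x. complex_of_real c * P v x)" for c v using linear_cmul[OF P(1)] by (simp add: fun_ops)
  have Pdiff: "P (v - w) = (\<lambda>x. P v x - P w x)" for v w using linear_diff[OF P(1)] by (simp add: fun_ops)
  have PJ: "P (\<lambda>x. \<i> * P v x) = (\<lambda>x. \<i> * P v x)" for v by (rule P(3)[OF H10_cmult[OF PX]])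
  obtain c0 where c0: "c0 > 0" "\<And>v. v \<in> H10 D \<Longrightarrow> c0 * h1inner D v v \<le> aform v v" using aform_coercive by blast
  obtain Ca where Ca: "\<And>v. v \<in> H10 D \<Longrightarrow> aform v v \<le> Ca * h1inner D v v" using aform_bounded by blast
  obtain Cs where Cs: "Cs \<ge> 0" "\<And>v. v \<in> H10 D \<Longrightarrow> (nrm2 M (\<lambda>x. v x * v x))\<^sup>2 \<le> Cs * nrm2 M v * (sqrt (grd v))^3"
    using ladyzhenskaya[OF dim] by blast
  have hnn: "0 \<le> h1inner D v v" for v by (simp add: h1_self)
  have h: "psd_form (\<lambda>v w. h1inner D (P v) (P w))"
  proof
    show "h1inner D (P (x + y)) (P z) = h1inner D (P x) (P z) + h1inner D (P y) (P z)" for x y z unfolding Padd by (intro h1_add PH)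
    show "h1inner D (P (c *\<^sub>R x)) (P z) = c * h1inner D (P x) (P z)" for c x z unfolding Psc by (intro h1_scale PH)
    show "h1inner D (P x) (P y) = h1inner D (P y) (P x)" for x y by (rule h1_comm)
  qed (rule hnn)
  have b: "psd_form (\<lambda>v w. l2inner D (P v) (P w))"
  proof
    show "l2inner D (P (x + y)) (P z) = l2inner D (P x) (P z) + l2inner D (P y) (P z)" for x y z unfolding Padd by (intro l2_add Ps)
    show "l2inner D (P (c *\<^sub>R x)) (P z) = c * l2inner D (P x) (P z)" for c x z unfolding Psc by (rule l2_scale)
    show "l2inner D (P x) (P y) = l2inner D (P y) (P x)" for x y by (rule l2_comm)
  qed (simp add: l2inner_self)
  have a: "psd_form (\<lambda>v w. aform (P v) (P w))"
  proof
    show "aform (P (x + y)) (P z) = aform (P x) (P z) + aform (P y) (P z)" for x y z by (simp add: Padd aform_add PX)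
    show "aform (P (c *\<^sub>R x)) (P z) = c * aform (P x) (P z)" for c x z by (simp add: Psc aform_scale PX)
    show "aform (P x) (P y) = aform (P y) (P x)" for x y by (rule aform_comm[OF PX PX])
    show "0 \<le> aform (P x) (P x)" for x
      using c0(2)[OF PX[of x]] mult_nonneg_nonneg[OF less_imp_le[OF c0(1)] hnn[of "P x"]] by linarith
  qed
  have hn: "psd_form.nrm (\<lambda>v w. h1inner D (P v) (P w)) v = h1norm D (P v)" for v
    by (simp add: psd_form.nrm_def[OF h] h1norm_def)
  have bn: "psd_form.nrm (\<lambda>v w. l2inner D (P v) (P w)) v = nrm2 M (P v)" for v
    by (simp add: psd_form.nrm_def[OF b] l2inner_self)
  have "gp_axioms (\<lambda>v w. h1inner D (P v) (P w)) (\<lambda>v w. l2inner D (P v) (P w)) (\<lambda>v w. aform (P v) (P w))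
     (\<lambda>p q v w. quart (P p) (P q) (P v) (P w)) (\<lambda>v x. \<i> * P v x) (\<lambda>v. nrm4 (P v)) \<beta> c0 Ca Cs"
  proof (unfold_locales, unfold hn bn PJ Padd Psc Pdiff)
    show "l2inner D (P v) (P v) \<le> h1inner D (P v) (P v)" for v by (simp add: l2inner_self h1_self h1norm_sq grd_nonneg)
    \<comment> \<open>Vanishing in L^2 means vanishing almost everywhere, and then every chosen weak
      derivative vanishes almost everywhere too.\<close>
    show "h1inner D (P v) (P v) = 0" if "l2inner D (P v) (P v) = 0" for v
    proof -
      have "AE x in M. P v x = 0" using that nrm2_eq_0_iff[OF Ps[of v]] by (simp add: l2inner_self)
      then have "nrm2 M (wpd D (P v) b) = 0" if "b \<in> Basis" for b
        using wpd_null[OF _ that] nrm2_eq_0_iff[OF H1_wpd_sqi[OF PH that]] by blast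
      then show ?thesis using that by (simp add: h1_self h1norm_sq l2inner_self grd_def)
    qed
    show "c0 * h1inner D (P v) (P v) \<le> aform (P v) (P v)" "aform (P v) (P v) \<le> Ca * h1inner D (P v) (P v)" for v
      using c0(2)[OF PX] Ca[OF PX] by auto
    show "quart (\<lambda>x. P p x + P p' x) (P q) (P v) (P w) = quart (P p) (P q) (P v) (P w) + quart (P p') (P q) (P v) (P w)" for p p' q v w
      by (intro quart_add PX)
    show "quart (P p) (P q) (P v) (P w) = quart (P q) (P p) (P v) (P w)" for p q v w by (rule quart_comm)
    show "quart (P p) (P q) (P v) (P w) = quart (P v) (P w) (P p) (P q)" for p q v w by (rule quart_swap)
    show "\<bar>quart (P p) (P q) (P v) (P w)\<bar> \<le> nrm4 (P p) * nrm4 (P q) * nrm4 (P v) * nrm4 (P w)" for p q v w by (intro quart_bound PX)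
    show "nrm4 (P v) ^ 4 \<le> Cs * nrm2 M (P v) * h1norm D (P v) ^ 3" for v
    proof -
      have "nrm4 (P v) ^ 4 = (nrm2 M (\<lambda>x. P v x * P v x))\<^sup>2"
        unfolding nrm4_def by (metis nrm2_nonneg mult_2 numeral_Bit0 power_mult real_sqrt_pow2)
      also have "\<dots> \<le> Cs * nrm2 M (P v) * (sqrt (grd (P v)))^3" by (rule Cs(2)[OF PX])
      also have "\<dots> \<le> Cs * nrm2 M (P v) * h1norm D (P v) ^ 3"
        using Cs(1) by (intro mult_left_mono power_mono) (auto simp: h1norm_eq grd_nonneg)
      finally show ?thesis .
    qed
    show "(\<lambda>x. \<i> * (P v x + P w x)) = (\<lambda>x. \<i> * P v x) + (\<lambda>x. \<i> * P w x)" for v w by (simp add: fun_ops distrib_left)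
    show "(\<lambda>x. \<i> * (complex_of_real c * P v x)) = c *\<^sub>R (\<lambda>x. \<i> * P v x)" for c v by (simp add: fun_ops mult.left_commute)
    show "\<exists>l. (\<lambda>n. h1norm D (\<lambda>x. P (x' n) x - P l x)) \<longlonglongrightarrow> 0"
      if C: "\<And>e. e > 0 \<Longrightarrow> \<exists>N. \<forall>m\<ge>N. \<forall>n\<ge>N. h1norm D (\<lambda>x. P (x' m) x - P (x' n) x) < e" for x' :: "nat \<Rightarrow> 'a \<Rightarrow> complex"
    proof -
      obtain w where "w \<in> H10 D" "(\<lambda>n. h1norm D (\<lambda>x. P (x' n) x - w x)) \<longlonglongrightarrow> 0"
        using H10_complete[of "\<lambda>n. P (x' n)", OF PX C] by blast
      then show ?thesis using P(3)[of w] by (intro exI[of _ w]) simp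
    qed
    show "\<exists>r::nat\<Rightarrow>nat. strict_mono r \<and> (\<forall>e>0. \<exists>N. \<forall>m\<ge>N. \<forall>n\<ge>N. nrm2 M (\<lambda>x. P (x' (r m)) x - P (x' (r n)) x) < e)"
      if "\<And>n. h1norm D (P (x' n)) \<le> K" for x' :: "nat \<Rightarrow> 'a \<Rightarrow> complex" and K
      by (rule rellich[of "\<lambda>n. P (x' n)", OF PX that])
  qed (simp_all add: c0 beta0 quart_scale quart_nonneg nrm4_def h1_i h1_i_skew PH l2_i l2_i_skew aform_i aform_i_skew PX quart_i quart_i_skew)
  then show ?thesis using gp.intro[OF h b a] by blast
qed

end

section \<open>The energy-adaptive Riemannian gradient iteration\<close>

context gross_pitaevskii
begin

lemma quart_l2:
  assumes "z \<in> H10 D" "v \<in> H10 D" "w \<in> H10 D"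
  shows "l2inner D (\<lambda>x. complex_of_real ((cmod (z x))\<^sup>2) * v x) w = quart z z v w"
proof -
  have "integrable M (\<lambda>x. (z x * cnj (z x)) * (v x * cnj (w x)))"
    by (intro sqi_mult_integrable prod_cnj_sqi assms)
  then have i: "integrable M (\<lambda>x. complex_of_real ((cmod (z x))\<^sup>2) * v x * cnj (w x))"
    by (simp only: complex_norm_square mult.assoc)
  have "Re (complex_of_real ((cmod (z x))\<^sup>2) * v x * cnj (w x)) = Re (z x * cnj (z x)) * Re (v x * cnj (w x))" for x
  proof -
    have "Re (z x * cnj (z x)) = (cmod (z x))\<^sup>2" by (metis Re_complex_of_real complex_norm_square)
    moreover have "Re (complex_of_real r * y) = r * Re y" for r y by simp
    ultimately show ?thesis by (simp only: mult.assoc)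
  qed
  then show ?thesis using integral_Re[OF i] by (simp add: l2inner_eq quart_def)
qed

lemma Aform_eq:
  assumes "z \<in> H10 D" "v \<in> H10 D" "w \<in> H10 D"
  shows "Aform D V \<beta> \<Omega> e1 e2 z v w = aform v w + \<beta> * quart z z v w"
  unfolding Aform_def aform_def quart_l2[OF assms] by simp

lemma energy_eq:
  assumes "v \<in> H10 D"
  shows "energy D V \<beta> \<Omega> e1 e2 v = 1/2 * aform v v + \<beta>/4 * quart v v v v"
proof -
  have "(\<lambda>x. complex_of_real (V x) * v x * cnj (v x)) = (\<lambda>x. complex_of_real (V x * (cmod (v x))\<^sup>2))"
    by (simp only: of_real_mult complex_norm_square mult.assoc)
  then have 1: "set_lebesgue_integral lebesgue D (\<lambda>x. V x * (cmod (v x))\<^sup>2) = l2inner D (\<lambda>x. complex_of_real (V x) * v x) v"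
    by (simp only: l2inner_eq integral_complex_of_real Re_complex_of_real lebesgue_on_integral(1)[OF sets_D])
  have 2: "Re (set_lebesgue_integral lebesgue D (\<lambda>x. cnj (v x) * L3 D e1 e2 v x)) = l2inner D (L3 D e1 e2 v) v"
    by (simp add: l2inner_eq lebesgue_on_integral(1)[OF sets_D] mult.commute)
  have "cmod (v x) ^ 4 = Re (v x * cnj (v x)) * Re (v x * cnj (v x))" for x
  proof -
    have "Re (v x * cnj (v x)) = (cmod (v x))\<^sup>2" by (metis Re_complex_of_real complex_norm_square)
    then show ?thesis by (simp add: power2_eq_square power4_eq_xxxx mult.assoc)
  qed
  then have 3: "set_lebesgue_integral lebesgue D (\<lambda>x. cmod (v x) ^ 4) = quart v v v v"
    by (simp only: quart_def lebesgue_on_integral(1)[OF sets_D])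
  show ?thesis unfolding energy_def 1 2 3 aform_def by (simp add: algebra_simps)
qed

end

text \<open>A linear projection \<open>P\<close> of the space of all functions onto \<open>H10 D\<close> makes the forms total, as
  the abstract locale requires a whole vector space type.\<close>

locale gp_model = gross_pitaevskii D V \<beta> \<Omega> e1 e2
  for D :: "'a::euclidean_space set" and V \<beta> \<Omega> e1 e2 +
  fixes P :: "('a \<Rightarrow> complex) \<Rightarrow> 'a \<Rightarrow> complex" and c0 Ca Cs :: real
  assumes P_lin: "linear P" and P_range: "range P \<subseteq> H10 D" and P_id: "\<And>v. v \<in> H10 D \<Longrightarrow> P v = v"
    and gp: "gp (\<lambda>v w. h1inner D (P v) (P w)) (\<lambda>v w. l2inner D (P v) (P w)) (\<lambda>v w. aform (P v) (P w))
     (\<lambda>p q v w. quart (P p) (P q) (P v) (P w)) (\<lambda>v x. \<i> * P v x) (\<lambda>v. nrm4 (P v)) \<beta> c0 Ca Cs"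
begin

sublocale G: gp "\<lambda>v w. h1inner D (P v) (P w)" "\<lambda>v w. l2inner D (P v) (P w)" "\<lambda>v w. aform (P v) (P w)"
     "\<lambda>p q v w. quart (P p) (P q) (P v) (P w)" "\<lambda>v x. \<i> * P v x" "\<lambda>v. nrm4 (P v)" \<beta> c0 Ca Cs
  by (rule gp)

section \<open>Dictionary between the concrete method and the abstract setting\<close>

abbreviation En :: "('a \<Rightarrow> complex) \<Rightarrow> real" where "En \<equiv> energy D V \<beta> \<Omega> e1 e2"
abbreviation gm :: "('a \<Rightarrow> complex) \<Rightarrow> real" where "gm \<equiv> gam D V \<beta> \<Omega> e1 e2"
abbreviation Ai :: "('a \<Rightarrow> complex) \<Rightarrow> 'a \<Rightarrow> complex" where "Ai v \<equiv> Ainv D V \<beta> \<Omega> e1 e2 v v"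

lemma PX: "P v \<in> H10 D" using P_range by auto

lemma PP [simp]: "P (P v) = P v" by (rule P_id[OF PX])

lemma Pdiff: "P (v - w) = (\<lambda>x. P v x - P w x)" using linear_diff[OF P_lin] by (simp add: fun_ops)

lemma GN: "G.h.nrm v = h1norm D (P v)" by (simp add: G.h.nrm_def h1norm_def)

lemma GN_diff: "v \<in> H10 D \<Longrightarrow> w \<in> H10 D \<Longrightarrow> G.h.nrm (v - w) = h1norm D (\<lambda>x. v x - w x)"
  by (simp add: GN Pdiff P_id)

lemma Gbn: "G.b.nrm v = nrm2 M (P v)" by (simp add: G.b.nrm_def l2inner_self)

lemma GE: "G.E v = En (P v)" by (simp add: G.E_def energy_eq[OF PX])

lemma GA: "G.A z v w = Aform D V \<beta> \<Omega> e1 e2 (P z) (P v) (P w)"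
  by (simp add: G.A_def Aform_eq[OF PX PX PX])

lemma GA_P: "G.A (P z) v w = G.A z v w" "G.A z (P v) w = G.A z v w" "G.A z v (P w) = G.A z v w"
  by (simp_all add: GA)

lemma conv_iff:
  assumes "\<And>n. u n \<in> H10 D" shows "G.conv u w \<longleftrightarrow> (\<lambda>n. h1norm D (\<lambda>x. u n x - P w x)) \<longlonglongrightarrow> 0"
  by (simp add: G.conv_def GN Pdiff P_id[OF assms])

text \<open>The abstract existence result supplies the witness for the choice in
  \<open>Ainv\<close>, which thereby satisfies the weak equation; \<open>P\<close> brings the
  abstract solution into \<open>H10 D\<close>.\<close>

lemma Ai:
  assumes v: "v \<in> H10 D"
  shows "Ai v \<in> H10 D" "\<And>w. G.A v (Ai v) w = l2inner D (P v) (P w)" "gm v = inverse (l2inner D v (Ai v))"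
proof -
  obtain q where q: "\<And>w. G.A v q w = l2inner D (P v) (P w)" using G.exists_inverse by metis
  have "Aform D V \<beta> \<Omega> e1 e2 v (P q) w = l2inner D v w" if "w \<in> H10 D" for w
    using q[of w] unfolding GA P_id[OF v] P_id[OF that] .
  then have "\<exists>q. q \<in> H10 D \<and> (\<forall>w\<in>H10 D. Aform D V \<beta> \<Omega> e1 e2 v q w = l2inner D v w)"
    using PX by blast
  from someI_ex[OF this] have *: "Ai v \<in> H10 D \<and> (\<forall>w\<in>H10 D. Aform D V \<beta> \<Omega> e1 e2 v (Ai v) w = l2inner D v w)"
    unfolding Ainv_def .
  then show 1: "Ai v \<in> H10 D" by blast
  show "G.A v (Ai v) w = l2inner D (P v) (P w)" for w using * 1 v PX by (simp add: GA P_id)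
  show "gm v = inverse (l2inner D v (Ai v))" by (simp add: gam_def)
qed

lemma erg_step_eq:
  assumes v: "v \<in> H10 D"
  shows "erg_step D V \<beta> \<Omega> e1 e2 \<tau> v = G.ustep \<tau> v (Ai v)" "erg_step D V \<beta> \<Omega> e1 e2 \<tau> v \<in> H10 D"
proof -
  define uh where "uh = (\<lambda>x. complex_of_real (1 - \<tau>) * v x + complex_of_real (\<tau> * gm v) * Ai v x)"
  have uh: "uh \<in> H10 D" unfolding uh_def by (intro H10_add H10_cmult v Ai)
  have e: "erg_step D V \<beta> \<Omega> e1 e2 \<tau> v = (\<lambda>x. complex_of_real (1 / l2norm D uh) * uh x)"
    unfolding erg_step_def Let_def uh_def[symmetric] by (simp add: fun_eq_iff divide_simps)
  have 1: "uh = (1 - \<tau>) *\<^sub>R v + (\<tau> * inverse (l2inner D (P v) (P (Ai v)))) *\<^sub>R Ai v"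
    using Ai(1,3)[OF v] v by (simp add: uh_def fun_ops P_id)
  show "erg_step D V \<beta> \<Omega> e1 e2 \<tau> v = G.ustep \<tau> v (Ai v)"
    unfolding G.ustep_def Let_def 1[symmetric] Gbn P_id[OF uh] e l2norm_eq by (simp only: fun_ops)
  show "erg_step D V \<beta> \<Omega> e1 e2 \<tau> v \<in> H10 D" unfolding e by (intro H10_cmult uh)
qed

section \<open>Second variation along great circles\<close>

lemma curve_deriv_comb:
  assumes w: "w \<in> H10 D" and g: "g \<in> H10 D"
    and d: "(\<alpha> has_real_derivative \<alpha>') (at t)" "(\<sigma> has_real_derivative \<sigma>') (at t)"
  shows "curve_deriv D (\<lambda>t x. complex_of_real (\<alpha> t) * w x + complex_of_real (\<sigma> t) * g x)
     (\<lambda>x. complex_of_real \<alpha>' * w x + complex_of_real \<sigma>' * g x) t"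
  unfolding curve_deriv_def
proof (intro conjI allI impI)
  show "(\<lambda>x. complex_of_real \<alpha>' * w x + complex_of_real \<sigma>' * g x) \<in> H10 D" by (intro H10_add H10_cmult w g)
  fix \<epsilon> :: real assume e: "\<epsilon> > 0"
  define X where "X s = (\<alpha> (t + s) - \<alpha> t) / s - \<alpha>'" for s
  define Y where "Y s = (\<sigma> (t + s) - \<sigma> t) / s - \<sigma>'" for s
  have "(X \<longlongrightarrow> \<alpha>' - \<alpha>') (at 0)" "(Y \<longlongrightarrow> \<sigma>' - \<sigma>') (at 0)"
    unfolding X_def Y_def using d by (intro tendsto_intros; simp add: DERIV_def)+
  then have "((\<lambda>s. \<bar>X s\<bar> * h1norm D w + \<bar>Y s\<bar> * h1norm D g) \<longlongrightarrow> \<bar>\<alpha>' - \<alpha>'\<bar> * h1norm D w + \<bar>\<sigma>' - \<sigma>'\<bar> * h1norm D g) (at 0)"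
    by (intro tendsto_intros)
  then have "\<forall>\<^sub>F s in at 0. \<bar>X s\<bar> * h1norm D w + \<bar>Y s\<bar> * h1norm D g < \<epsilon>" using e by (intro order_tendstoD(2)) auto
  then obtain \<delta> where \<delta>: "\<delta> > 0" "\<And>s. s \<noteq> 0 \<Longrightarrow> \<bar>s\<bar> < \<delta> \<Longrightarrow> \<bar>X s\<bar> * h1norm D w + \<bar>Y s\<bar> * h1norm D g < \<epsilon>"
    by (auto simp: eventually_at dist_real_def)
  have "h1norm D (\<lambda>x. ((complex_of_real (\<alpha> (t + s)) * w x + complex_of_real (\<sigma> (t + s)) * g x)
      - (complex_of_real (\<alpha> t) * w x + complex_of_real (\<sigma> t) * g x)) / complex_of_real s
      - (complex_of_real \<alpha>' * w x + complex_of_real \<sigma>' * g x)) \<le> \<epsilon>" if s: "s \<noteq> 0 \<and> \<bar>s\<bar> < \<delta>" for s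
  proof -
    have eq: "(\<lambda>x. ((complex_of_real (\<alpha> (t + s)) * w x + complex_of_real (\<sigma> (t + s)) * g x)
      - (complex_of_real (\<alpha> t) * w x + complex_of_real (\<sigma> t) * g x)) / complex_of_real s
      - (complex_of_real \<alpha>' * w x + complex_of_real \<sigma>' * g x)) = (\<lambda>x. complex_of_real (X s) * w x + complex_of_real (Y s) * g x)"
      using s by (auto simp: X_def Y_def field_simps)
    have "h1norm D (\<lambda>x. complex_of_real (X s) * w x + complex_of_real (Y s) * g x)
        \<le> h1norm D (\<lambda>x. complex_of_real (X s) * w x) + h1norm D (\<lambda>x. complex_of_real (Y s) * g x)"
      by (intro h1norm_triangle H1_cmult H10_H1 w g)
    also have "\<dots> = \<bar>X s\<bar> * h1norm D w + \<bar>Y s\<bar> * h1norm D g" by (simp add: h1norm_cmult H10_H1 w g)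
    finally show ?thesis unfolding eq using \<delta>(2)[of s] s by simp
  qed
  then show "\<exists>\<delta>>0. \<forall>s. s \<noteq> 0 \<and> \<bar>s\<bar> < \<delta> \<longrightarrow> h1norm D (\<lambda>x. ((complex_of_real (\<alpha> (t + s)) * w x + complex_of_real (\<sigma> (t + s)) * g x)
      - (complex_of_real (\<alpha> t) * w x + complex_of_real (\<sigma> t) * g x)) / complex_of_real s
      - (complex_of_real \<alpha>' * w x + complex_of_real \<sigma>' * g x)) \<le> \<epsilon>" using \<delta>(1) by blast
qed

text \<open>In the plane spanned by \<open>w\<close> and \<open>g\<close> the energy is a polynomial
  in the two coefficients, which reduces its second derivative along a circle to calculus in one
  variable.\<close>

lemma E_comb:
  "G.E (c *\<^sub>R w + s *\<^sub>R g) = 1/2 * aform (P w) (P w) * c^2 + aform (P w) (P g) * (c * s) + 1/2 * aform (P g) (P g) * s^2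
    + \<beta>/4 * quart (P w) (P w) (P w) (P w) * c^4 + \<beta> * quart (P w) (P w) (P w) (P g) * (c^3 * s)
    + \<beta>/4 * (4 * quart (P w) (P g) (P w) (P g) + 2 * quart (P w) (P w) (P g) (P g)) * (c^2 * s^2)
    + \<beta> * quart (P w) (P g) (P g) (P g) * (c * s^3) + \<beta>/4 * quart (P g) (P g) (P g) (P g) * s^4"
proof -
  have q: "quart (P g) (P w) x y = quart (P w) (P g) x y" "quart x y (P g) (P w) = quart x y (P w) (P g)" for x y
    by (simp_all add: quart_comm[of "P g" "P w"] quart_swap[of x y])
  show ?thesis
    unfolding G.E_def
    by (simp only: G.a.bilin G.R_lin q aform_comm[OF PX PX, of g w] quart_swap[of "P w" "P g" "P w" "P w"]
        quart_swap[of "P g" "P g" "P w" "P w"] quart_swap[of "P g" "P g" "P w" "P g"])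
      (simp add: power2_eq_square power3_eq_cube power4_eq_xxxx algebra_simps)
qed

text \<open>Quasi-uniqueness is tested on the great circle through \<open>w\<close> with initial
  velocity \<open>g\<close>. The curvature of the sphere contributes minus k^2 times A(w,w), which
  is the multiplier term of the constrained second variation.\<close>

lemma second_variation:
  assumes w: "w \<in> Sph D" and g: "g \<in> H10 D" and lqu: "loc_quasi_unique D V \<beta> \<Omega> e1 e2 w"
    and orth: "l2inner D w g = 0" "l2inner D (\<lambda>x. \<i> * w x) g = 0" and nz: "h1norm D g \<noteq> 0"
  shows "aform g g + \<beta> * quart w w g g + 2 * \<beta> * quart w g w g > G.A w w w * l2inner D g g"
proof -
  have wX: "w \<in> H10 D" and w1: "l2inner D w w = 1" using w by (auto simp: Sph_def l2norm_def)
  define k where "k = nrm2 M g"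
  have kk: "l2inner D g g = k\<^sup>2" by (simp add: k_def l2inner_self)
  have k: "k > 0"
  proof -
    have "k \<noteq> 0" using G.b_null[of g] nz by (auto simp: P_id[OF g] kk h1_self)
    then show ?thesis using nrm2_nonneg[of M g] unfolding k_def by linarith
  qed
  define Cc where "Cc t = cos (k * t)" for t
  \<comment> \<open>Dividing by \<open>k\<close> makes the initial velocity equal to
    \<open>g\<close> for any length of \<open>g\<close>, while the curve stays on the
    sphere.\<close>
  define Ss where "Ss t = sin (k * t) / k" for t
  have dC: "(Cc has_real_derivative - (k\<^sup>2) * Ss t) (at t)" for t
    unfolding Cc_def Ss_def using k by (auto intro!: derivative_eq_intros simp: power2_eq_square)
  have dS: "(Ss has_real_derivative Cc t) (at t)" for t
    unfolding Cc_def Ss_def using k by (auto intro!: derivative_eq_intros)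
  have cs: "(Cc t)\<^sup>2 + (Ss t)\<^sup>2 * k\<^sup>2 = 1" for t using k by (simp add: Cc_def Ss_def power_divide)
  \<comment> \<open>This four-parameter family is closed under differentiation, sending (p, q, r, s)
    to (q, -p k^2, s, -r k^2); so its range is the set required by
    \<open>smooth_curve\<close>.\<close>
  define comb where "comb p q r s = (\<lambda>t x. complex_of_real (p * Cc t + q * Ss t) * w x + complex_of_real (r * Cc t + s * Ss t) * g x)" for p q r s
  define \<gamma> where "\<gamma> = comb 1 0 0 1"
  have dcomb: "curve_deriv D (comb p q r s) (comb q (- (p * k\<^sup>2)) s (- (r * k\<^sup>2)) t) t" for p q r s t
    unfolding comb_def
    by (rule curve_deriv_comb[OF wX g]) (auto intro!: derivative_eq_intros dC dS simp: algebra_simps)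
  have "smooth_curve D \<gamma>"
    unfolding smooth_curve_def
  proof (intro exI[of _ "range (\<lambda>(p, q, r, s). comb p q r s)"] conjI ballI)
    show "\<gamma> \<in> range (\<lambda>(p, q, r, s). comb p q r s)" unfolding \<gamma>_def by (rule range_eqI[of _ _ "(1, 0, 0, 1)"]) simp
    fix a assume "a \<in> range (\<lambda>(p, q, r, s). comb p q r s)"
    then obtain p q r s where a: "a = comb p q r s" by auto
    show "a t \<in> H10 D" for t unfolding a comb_def by (intro H10_add H10_cmult wX g)
    show "\<exists>a'\<in>range (\<lambda>(p, q, r, s). comb p q r s). \<forall>t\<in>{-1<..<1}. curve_deriv D a (a' t) t"
      unfolding a using dcomb by (intro bexI[of _ "comb q (- (p * k\<^sup>2)) s (- (r * k\<^sup>2))"] ballI)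
        (auto intro!: range_eqI[of _ _ "(q, - (p * k\<^sup>2), s, - (r * k\<^sup>2))"])
  qed
  moreover have \<gamma>_eq: "\<gamma> t = Cc t *\<^sub>R w + Ss t *\<^sub>R g" for t by (simp add: \<gamma>_def comb_def fun_ops)
  have \<gamma>X: "\<gamma> t \<in> H10 D" for t unfolding \<gamma>_def comb_def by (intro H10_add H10_cmult wX g)
  moreover have "\<gamma> t \<in> Sph D" for t
  proof -
    have "l2inner D (P (\<gamma> t)) (P (\<gamma> t)) = (Cc t)\<^sup>2 + (Ss t)\<^sup>2 * k\<^sup>2"
    proof -
      have "l2inner D (P (c *\<^sub>R w + s *\<^sub>R g)) (P (c *\<^sub>R w + s *\<^sub>R g)) =
          c * (c * l2inner D (P w) (P w) + s * l2inner D (P w) (P g)) + s * (c * l2inner D (P g) (P w) + s * l2inner D (P g) (P g))" for c s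
        unfolding G.b.add_left[of "c *\<^sub>R w"] G.b.scale_left G.b.add_right G.b.scale_right by (simp add: algebra_simps)
      then show ?thesis unfolding \<gamma>_eq using w1 kk orth(1) l2_comm[of g w]
        by (simp add: P_id[OF wX] P_id[OF g] power2_eq_square)
    qed
    then show ?thesis using \<gamma>X[of t] cs[of t] by (simp add: Sph_def l2norm_def P_id)
  qed
  moreover have "\<gamma> 0 = w" by (simp add: \<gamma>_def comb_def Cc_def Ss_def)
  moreover have "curve_deriv D \<gamma> g 0"
    using dcomb[of 1 0 0 1 0] by (simp add: \<gamma>_def comb_def Cc_def Ss_def)
  ultimately have pos: "deriv (deriv (\<lambda>t. En (\<gamma> t))) 0 > 0"
    using lqu orth nz unfolding loc_quasi_unique_def by blast
  define A0 A1 A2 where "A0 = 1/2 * aform w w" and "A1 = aform w g" and "A2 = 1/2 * aform g g"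
  define B0 B1 B2 B3 B4 where "B0 = \<beta>/4 * quart w w w w" and "B1 = \<beta> * quart w w w g"
    and "B2 = \<beta>/4 * (4 * quart w g w g + 2 * quart w w g g)" and "B3 = \<beta> * quart w g g g" and "B4 = \<beta>/4 * quart g g g g"
  define f where "f t = A0 * (Cc t)^2 + A1 * (Cc t * Ss t) + A2 * (Ss t)^2 + B0 * (Cc t)^4 + B1 * ((Cc t)^3 * Ss t)
     + B2 * ((Cc t)^2 * (Ss t)^2) + B3 * (Cc t * (Ss t)^3) + B4 * (Ss t)^4" for t
  define f1 where "f1 t = A0 * (2 * Cc t * (- (k\<^sup>2) * Ss t)) + A1 * (- (k\<^sup>2) * Ss t * Ss t + Cc t * Cc t) + A2 * (2 * Ss t * Cc t)
     + B0 * (4 * (Cc t)^3 * (- (k\<^sup>2) * Ss t)) + B1 * (3 * (Cc t)^2 * (- (k\<^sup>2) * Ss t) * Ss t + (Cc t)^3 * Cc t)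
     + B2 * (2 * Cc t * (- (k\<^sup>2) * Ss t) * (Ss t)^2 + (Cc t)^2 * (2 * Ss t * Cc t))
     + B3 * (- (k\<^sup>2) * Ss t * (Ss t)^3 + Cc t * (3 * (Ss t)^2 * Cc t)) + B4 * (4 * (Ss t)^3 * Cc t)" for t
  have "En (\<gamma> t) = f t" for t
    using E_comb[of "Cc t" w "Ss t" g]
    unfolding \<gamma>_eq[symmetric] GE P_id[OF \<gamma>X] P_id[OF wX] P_id[OF g] f_def A0_def A1_def A2_def B0_def B1_def B2_def B3_def B4_def .
  then have Ef: "(\<lambda>t. En (\<gamma> t)) = f" by blast
  have d1: "(f has_real_derivative f1 t) (at t)" for t
    unfolding f_def f1_def
    by (rule derivative_eq_intros dC dS refl)+ (simp add: power2_eq_square power3_eq_cube algebra_simps)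
  have "deriv f = f1" using DERIV_imp_deriv[OF d1] by blast
  \<comment> \<open>Terms with an odd power of \<open>Ss\<close> are odd in \<open>t\<close> and the
    fourth power vanishes to fourth order; so only \<open>A0\<close>, \<open>A2\<close>,
    \<open>B0\<close> and \<open>B2\<close> contribute at 0.\<close>
  moreover have "(f1 has_real_derivative (- 2 * k\<^sup>2 * A0 + 2 * A2 - 4 * k\<^sup>2 * B0 + 2 * B2)) (at 0)"
  proof -
    have z: "Cc 0 = 1" "Ss 0 = 0" by (simp_all add: Cc_def Ss_def)
    show ?thesis unfolding f1_def
      by (rule derivative_eq_intros dC dS refl)+ (simp add: z algebra_simps)
  qed
  ultimately have "deriv (deriv (\<lambda>t. En (\<gamma> t))) 0 = - 2 * k\<^sup>2 * A0 + 2 * A2 - 4 * k\<^sup>2 * B0 + 2 * B2"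
    unfolding Ef using DERIV_imp_deriv by metis
  then have "0 < - 2 * k\<^sup>2 * A0 + 2 * A2 - 4 * k\<^sup>2 * B0 + 2 * B2" using pos by simp
  also have "\<dots> = aform g g + \<beta> * quart w w g g + 2 * \<beta> * quart w g w g - k\<^sup>2 * (aform w w + \<beta> * quart w w w w)"
    by (simp add: A0_def A2_def B0_def B2_def algebra_simps)
  also have "aform w w + \<beta> * quart w w w w = G.A w w w" by (simp add: G.A_def P_id wX)
  finally show ?thesis by (simp add: kk mult.commute)
qed

section \<open>Properties of the iterates\<close>

lemma iterates_H10:
  assumes "u 0 \<in> H10 D" "\<And>n. u (Suc n) = erg_step D V \<beta> \<Omega> e1 e2 (\<tau> n) (u n)"
  shows "u n \<in> H10 D"
  by (induction n) (use assms erg_step_eq(2) in auto)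

text \<open>The derivative of the energy at \<open>w\<close> is \<open>A w w\<close>, with quadratic
  remainder; at an eigenfunction it equals \<kappa> times the L^2 pairing, which is how the
  eigenvalue equation is expressed.\<close>

lemma frechet_at_critical:
  assumes w: "w \<in> H10 D" and c: "\<And>x. G.A w w x = \<kappa> * l2inner D (P w) (P x)"
  shows "H10_frechet D En w (\<lambda>v. \<kappa> * l2inner D w v)"
  unfolding H10_frechet_def
proof (intro conjI ballI allI impI)
  note ws = H10_sqi[OF w]
  show "\<kappa> * l2inner D w (\<lambda>x. v x + v' x) = \<kappa> * l2inner D w v + \<kappa> * l2inner D w v'" if "v \<in> H10 D" "v' \<in> H10 D" for v v'
    using l2_add[OF H10_sqi[OF that(1)] H10_sqi[OF that(2)] ws] by (simp add: l2_comm[of w] distrib_left)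
  show "\<kappa> * l2inner D w (\<lambda>x. complex_of_real c * v x) = c * (\<kappa> * l2inner D w v)" for v c
    using l2_scale[of c v w] by (simp add: l2_comm[of w])
  show "\<exists>C. \<forall>v\<in>H10 D. \<bar>\<kappa> * l2inner D w v\<bar> \<le> C * h1norm D v"
  proof (intro exI[of _ "\<bar>\<kappa>\<bar> * nrm2 M w"] ballI)
    fix v assume v: "v \<in> H10 D"
    have "\<bar>l2inner D w v\<bar> \<le> nrm2 M w * h1norm D v"
      using l2_bound[OF ws H10_sqi[OF v]] mult_left_mono[OF nrm2_le_h1norm[of v] nrm2_nonneg[of M w]] by linarith
    then show "\<bar>\<kappa> * l2inner D w v\<bar> \<le> \<bar>\<kappa>\<bar> * nrm2 M w * h1norm D v"
      using mult_left_mono[of _ _ "\<bar>\<kappa>\<bar>"] by (simp add: abs_mult mult.assoc)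
  qed
  fix \<epsilon> :: real assume e: "\<epsilon> > 0"
  define C where "C = G.CA (G.h.nrm w) + \<beta> * G.K4^4 * (G.h.nrm w + 1)\<^sup>2"
  have C: "C \<ge> 0" using G.CA_nonneg beta0 by (simp add: C_def)
  show "\<exists>\<delta>>0. \<forall>h\<in>H10 D. h1norm D h < \<delta> \<longrightarrow> \<bar>En (\<lambda>x. w x + h x) - En w - \<kappa> * l2inner D w h\<bar> \<le> \<epsilon> * h1norm D h"
  proof (intro exI[of _ "min 1 (\<epsilon> / (C + 1))"] conjI ballI impI)
    fix h assume h: "h \<in> H10 D" and small: "h1norm D h < min 1 (\<epsilon> / (C + 1))"
    have N: "G.h.nrm h = h1norm D h" by (simp add: GN P_id h)
    have "\<bar>G.E (w + h) - G.E w - G.A w w h\<bar> \<le> C * (h1norm D h)\<^sup>2"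
      using G.E_quadratic_remainder[of h w] small unfolding N C_def by simp
    also have "\<dots> = (C * h1norm D h) * h1norm D h" by (simp add: power2_eq_square)
    also have "\<dots> \<le> \<epsilon> * h1norm D h"
    proof (rule mult_right_mono[OF _ h1norm_nonneg])
      have "C * h1norm D h \<le> (C + 1) * (\<epsilon> / (C + 1))" using small C h1norm_nonneg[of h] by (intro mult_mono) auto
      then show "C * h1norm D h \<le> \<epsilon>" using C by simp
    qed
    finally show "\<bar>En (\<lambda>x. w x + h x) - En w - \<kappa> * l2inner D w h\<bar> \<le> \<epsilon> * h1norm D h"
      using c[of h] H10_add[OF w h] by (simp add: GE P_id w h fun_ops)
  qed (use e C in auto)
qed

theorem iteration_properties:
  assumes u0: "u0 \<in> Sph D"
  shows "\<exists>\<tau>0>0. \<exists>\<tau>1>0. \<forall>\<tau>min. 0 < \<tau>min \<and> \<tau>min \<le> \<tau>0 \<longrightarrow>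
     (\<exists>\<tau>max>\<tau>min. \<exists>C>0. \<forall>(\<tau>::nat \<Rightarrow> real) (u::nat \<Rightarrow> 'a \<Rightarrow> complex).
        (\<forall>n. \<tau>min \<le> \<tau> n \<and> \<tau> n \<le> \<tau>max) \<and> u 0 = u0
        \<and> (\<forall>n. u (Suc n) = erg_step D V \<beta> \<Omega> e1 e2 (\<tau> n) (u n)) \<longrightarrow>
          (\<forall>n. En (u n) - En (u (Suc n)) \<ge> C * (h1norm D (\<lambda>x. u (Suc n) x - u n x))^2)
        \<and> ((\<forall>n. \<tau> n \<le> \<tau>1) \<longrightarrow>
             (\<forall>n. En (u n) - En (u (Suc n)) \<ge> 1/2 * (h1norm D (\<lambda>x. u (Suc n) x - u n x))^2))
        \<and> convergent (\<lambda>n. En (u n))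
        \<and> (\<exists>r w. strict_mono r \<and> w \<in> Sph D
              \<and> (\<lambda>j. h1norm D (\<lambda>x. u (r j) x - w x)) \<longlonglongrightarrow> 0
              \<and> H10_frechet D En w (\<lambda>v. gm w * l2inner D w v)
              \<and> (\<lambda>j. gm (u (r j))) \<longlonglongrightarrow> gm w)
        \<and> (\<forall>r w. strict_mono r \<and> w \<in> Sph D
              \<and> (\<lambda>j. h1norm D (\<lambda>x. u (r j) x - w x)) \<longlonglongrightarrow> 0
              \<and> ground_state D V \<beta> \<Omega> e1 e2 w \<and> loc_quasi_unique D V \<beta> \<Omega> e1 e2 w \<longrightarrow>
                (\<lambda>n. l2norm D (\<lambda>x. complex_of_real ((cmod (u n x))^2 - (cmod (w x))^2))) \<longlonglongrightarrow> 0
              \<and> (\<lambda>n. h1norm D (\<lambda>x. complex_of_real (cmod (u n x) - cmod (w x)))) \<longlonglongrightarrow> 0))"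
proof -
  have u0X: "u0 \<in> H10 D" and u01: "l2inner D u0 u0 = 1" using u0 by (auto simp: Sph_def l2norm_def)
  \<comment> \<open>One threshold for the whole iteration, computed from the energy of the initial
    function.\<close>
  obtain T where T: "T > 0" "\<And>u q \<tau>. l2inner D (P u) (P u) = 1 \<Longrightarrow> (\<And>w. G.A u q w = l2inner D (P u) (P w)) \<Longrightarrow>
     G.E u \<le> G.E u0 \<Longrightarrow> 0 < \<tau> \<Longrightarrow> \<tau> \<le> T \<Longrightarrow> l2inner D (P (G.ustep \<tau> u q)) (P (G.ustep \<tau> u q)) = 1 \<and>
     G.E u - G.E (G.ustep \<tau> u q) \<ge> \<tau> / 2 * c0 * (G.h.nrm (G.resid u q))\<^sup>2 + 1/2 * (G.h.nrm (G.ustep \<tau> u q - u))\<^sup>2"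
    using G.uniform_decrease[of "G.E u0"] by blast
  have key: "(\<forall>n. En (u n) - En (u (Suc n)) \<ge> 1/2 * (h1norm D (\<lambda>x. u (Suc n) x - u n x))^2)
        \<and> convergent (\<lambda>n. En (u n))
        \<and> (\<exists>r w. strict_mono r \<and> w \<in> Sph D
              \<and> (\<lambda>j. h1norm D (\<lambda>x. u (r j) x - w x)) \<longlonglongrightarrow> 0
              \<and> H10_frechet D En w (\<lambda>v. gm w * l2inner D w v)
              \<and> (\<lambda>j. gm (u (r j))) \<longlonglongrightarrow> gm w)
        \<and> (\<forall>r w. strict_mono r \<and> w \<in> Sph D
              \<and> (\<lambda>j. h1norm D (\<lambda>x. u (r j) x - w x)) \<longlonglongrightarrow> 0
              \<and> ground_state D V \<beta> \<Omega> e1 e2 w \<and> loc_quasi_unique D V \<beta> \<Omega> e1 e2 w \<longrightarrow>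
                (\<lambda>n. l2norm D (\<lambda>x. complex_of_real ((cmod (u n x))^2 - (cmod (w x))^2))) \<longlonglongrightarrow> 0
              \<and> (\<lambda>n. h1norm D (\<lambda>x. complex_of_real (cmod (u n x) - cmod (w x)))) \<longlonglongrightarrow> 0)"
    if \<tau>min: "0 < \<tau>min" and \<tau>: "\<forall>n. \<tau>min \<le> \<tau> n \<and> \<tau> n \<le> T" and u00: "u 0 = u0"
      and step: "\<forall>n. u (Suc n) = erg_step D V \<beta> \<Omega> e1 e2 (\<tau> n) (u n)"
    for \<tau>min and \<tau> :: "nat \<Rightarrow> real" and u :: "nat \<Rightarrow> 'a \<Rightarrow> complex"
  proof (intro conjI)
    have uX: "u n \<in> H10 D" for n by (rule iterates_H10[of u \<tau>]) (use u00 u0X step in auto)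
    note Pu = P_id[OF uX]
    define q where "q n = Ai (u n)" for n
    have q: "G.A (u n) (q n) x = l2inner D (P (u n)) (P x)" for n x unfolding q_def by (rule Ai(2)[OF uX])
    have qX: "q n \<in> H10 D" for n unfolding q_def by (rule Ai(1)[OF uX])
    have gmu: "gm (u n) = inverse (l2inner D (P (u n)) (P (q n)))" for n
      using Ai(3)[OF uX[of n]] by (simp add: q_def[symmetric] Pu P_id[OF qX])
    have st: "u (Suc n) = G.ustep (\<tau> n) (u n) (q n)" for n using step erg_step_eq(1)[OF uX[of n]] by (simp add: q_def)
    have base: "l2inner D (P (u 0)) (P (u 0)) = 1" "G.E (u 0) \<le> G.E u0" using u00 u01 u0X by (simp_all add: P_id)
    note it = G.iteration_basic[of "G.E u0" T u q \<tau>min \<tau>, OF T(2) base q \<tau>min \<tau>[rule_format] st]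
    have En_u: "G.E (u n) = En (u n)" for n by (simp add: GE Pu)
    have Nd: "G.h.nrm (u (Suc n) - u n) = h1norm D (\<lambda>x. u (Suc n) x - u n x)" for n by (rule GN_diff[OF uX uX])
    show "\<forall>n. 1/2 * (h1norm D (\<lambda>x. u (Suc n) x - u n x))\<^sup>2 \<le> En (u n) - En (u (Suc n))"
      using it(3) by (simp only: En_u Nd) blast
    show "convergent (\<lambda>n. En (u n))" using it(4) by (simp only: En_u)
    show "\<exists>r w. strict_mono r \<and> w \<in> Sph D \<and> (\<lambda>j. h1norm D (\<lambda>x. u (r j) x - w x)) \<longlonglongrightarrow> 0
        \<and> H10_frechet D En w (\<lambda>v. gm w * l2inner D w v) \<and> (\<lambda>j. gm (u (r j))) \<longlonglongrightarrow> gm w"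
    proof -
      obtain r w p where r: "strict_mono (r::nat\<Rightarrow>nat)" and w1: "l2inner D (P w) (P w) = 1" and cw: "G.conv (\<lambda>j. u (r j)) w"
        and p: "\<And>x. G.A w p x = l2inner D (P w) (P x)"
        and gl: "(\<lambda>j. inverse (l2inner D (P (u (r j))) (P (q (r j))))) \<longlonglongrightarrow> inverse (l2inner D (P w) (P p))"
        and wp: "w = inverse (l2inner D (P w) (P p)) *\<^sub>R p"
        using G.conv_of_resid[OF it(1) q it(2) it(5)] by blast
      \<comment> \<open>The abstract limit is an arbitrary function seen only through
        \<open>P\<close>; its projection is the genuine limit in \<open>H10 D\<close>.\<close>
      let ?w = "P w"
      have "?w \<in> Sph D" using w1 PX by (simp add: Sph_def l2norm_def)
      moreover have "(\<lambda>j. h1norm D (\<lambda>x. u (r j) x - ?w x)) \<longlonglongrightarrow> 0" using cw conv_iff[of "\<lambda>j. u (r j)" w, OF uX] by simp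
      \<comment> \<open>\<open>p\<close> and the inverse chosen by \<open>Ainv\<close> solve the
        same equation, so they differ by a null function and give the same multiplier.\<close>
      moreover have gw: "gm ?w = inverse (l2inner D (P w) (P p))"
      proof -
        have "G.A w (Ai ?w) x = l2inner D (P w) (P x)" for x using Ai(2)[OF PX[of w], of x] by (simp add: GA_P)
        from G.inverse_unique[OF p this] have "G.h.nrm (p - Ai ?w) = 0" .
        then have "G.b.nrm (p - Ai ?w) = 0" using G.b_le_N[of "p - Ai ?w"] G.b.nrm_nonneg[of "p - Ai ?w"] by linarith
        from G.b.nrm_null_left[OF this, of w] have "l2inner D (P p) (P w) = l2inner D (P (Ai ?w)) (P w)" by (simp only: G.b.diff_left)
        then show ?thesis using Ai(1,3)[OF PX[of w]] by (simp add: P_id l2_comm[of _ "P w"])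
      qed
      moreover have "H10_frechet D En ?w (\<lambda>v. gm ?w * l2inner D ?w v)"
      proof (rule frechet_at_critical[OF PX])
        fix x
        have "G.A w w x = G.A w (inverse (l2inner D (P w) (P p)) *\<^sub>R p) x" using wp by simp
        also have "\<dots> = gm ?w * l2inner D (P w) (P x)" by (simp add: G.A.scale_left p gw)
        finally show "G.A ?w ?w x = gm ?w * l2inner D (P ?w) (P x)" by (simp add: GA_P)
      qed
      ultimately show ?thesis using r gl by (intro exI[of _ r] exI[of _ ?w]) (simp add: gmu)
    qed
    show "\<forall>r w. strict_mono r \<and> w \<in> Sph D
              \<and> (\<lambda>j. h1norm D (\<lambda>x. u (r j) x - w x)) \<longlonglongrightarrow> 0
              \<and> ground_state D V \<beta> \<Omega> e1 e2 w \<and> loc_quasi_unique D V \<beta> \<Omega> e1 e2 w \<longrightarrow>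
                (\<lambda>n. l2norm D (\<lambda>x. complex_of_real ((cmod (u n x))^2 - (cmod (w x))^2))) \<longlonglongrightarrow> 0
              \<and> (\<lambda>n. h1norm D (\<lambda>x. complex_of_real (cmod (u n x) - cmod (w x)))) \<longlonglongrightarrow> 0"
    proof (intro allI impI)
      fix \<rho> :: "nat \<Rightarrow> nat" and w :: "'a \<Rightarrow> complex"
      assume "strict_mono \<rho> \<and> w \<in> Sph D \<and> (\<lambda>j. h1norm D (\<lambda>x. u (\<rho> j) x - w x)) \<longlonglongrightarrow> 0
                \<and> ground_state D V \<beta> \<Omega> e1 e2 w \<and> loc_quasi_unique D V \<beta> \<Omega> e1 e2 w"
      then have \<rho>: "strict_mono \<rho>" and wS: "w \<in> Sph D" and lw: "(\<lambda>j. h1norm D (\<lambda>x. u (\<rho> j) x - w x)) \<longlonglongrightarrow> 0"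
        and gs: "ground_state D V \<beta> \<Omega> e1 e2 w" and lqu: "loc_quasi_unique D V \<beta> \<Omega> e1 e2 w" by auto
      have wX: "w \<in> H10 D" and w1: "l2inner D (P w) (P w) = 1" using wS P_id[of w] by (auto simp: Sph_def l2norm_def)
      note Pw = P_id[OF wX]
      have cw: "G.conv (\<lambda>j. u (\<rho> j)) w" using lw by (simp add: conv_iff uX Pw)
      have min: "G.E w \<le> G.E v" if "l2inner D (P v) (P v) = 1" for v
      proof -
        have "P v \<in> Sph D" using that PX by (simp add: Sph_def l2norm_def)
        then show ?thesis using gs by (simp add: ground_state_def GE Pw)
      qed
      have pos: "aform (P g) (P g) + \<beta> * quart (P w) (P w) (P g) (P g) + 2 * \<beta> * quart (P w) (P g) (P w) (P g) > G.A w w w * l2inner D (P g) (P g)"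
        if "l2inner D (P w) (P g) = 0" "l2inner D (P (\<lambda>x. \<i> * P w x)) (P g) = 0" "h1inner D (P g) (P g) \<noteq> 0" for g
        unfolding Pw
      proof (rule second_variation[OF wS PX lqu])
        show "l2inner D w (P g) = 0" using that(1) by (simp add: Pw)
        show "l2inner D (\<lambda>x. \<i> * w x) (P g) = 0" using that(2) by (simp add: Pw P_id[OF H10_cmult[OF wX]])
        show "h1norm D (P g) \<noteq> 0" using that(3) by (simp add: h1_self)
      qed
      \<comment> \<open>Limit points are phase rotations of \<open>w\<close>, so their phases may
        differ but their moduli agree pointwise with that of \<open>w\<close>.\<close>
      have orbit: "\<exists>r v. strict_mono (r::nat\<Rightarrow>nat) \<and> v \<in> H10 D \<and> (\<forall>x. cmod (v x) = cmod (w x)) \<and> (\<lambda>j. h1norm D (\<lambda>x. u (s (r j)) x - v x)) \<longlonglongrightarrow> 0"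
        if s: "strict_mono s" for s :: "nat \<Rightarrow> nat"
      proof -
        obtain r c d where r: "strict_mono (r::nat\<Rightarrow>nat)" "c\<^sup>2 + d\<^sup>2 = 1" "G.conv (\<lambda>j. u (s (r j))) (c *\<^sub>R w + d *\<^sub>R (\<lambda>x. \<i> * P w x))"
          using G.orbit_convergence[OF it(1) q it(2) it(5) it(6) it(4) \<rho> cw w1 min pos s] by blast
        define v where "v = c *\<^sub>R w + d *\<^sub>R (\<lambda>x. \<i> * P w x)"
        have vX: "v \<in> H10 D" unfolding v_def Pw fun_ops by (intro H10_add H10_cmult wX)
        have "cmod (v x) = cmod (w x)" for x
        proof -
          have "v x = Complex c d * w x" by (simp add: v_def Pw fun_ops complex_eq_iff)
          moreover have "cmod (Complex c d) = 1" using r(2) by (simp add: cmod_def)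
          ultimately show ?thesis by (simp add: norm_mult)
        qed
        moreover have "(\<lambda>j. h1norm D (\<lambda>x. u (s (r j)) x - v x)) \<longlonglongrightarrow> 0"
          using r(3)[folded v_def] by (simp add: conv_iff uX P_id[OF vX])
        ultimately show ?thesis using r(1) vX by blast
      qed
      show "(\<lambda>n. l2norm D (\<lambda>x. complex_of_real ((cmod (u n x))\<^sup>2 - (cmod (w x))\<^sup>2))) \<longlonglongrightarrow> 0
         \<and> (\<lambda>n. h1norm D (\<lambda>x. complex_of_real (cmod (u n x) - cmod (w x)))) \<longlonglongrightarrow> 0"
      proof (intro conjI; rule tendsto_zero_subseqI)
        fix s :: "nat \<Rightarrow> nat" assume s: "strict_mono s"
        obtain r v where r: "strict_mono (r::nat\<Rightarrow>nat)" and vX: "v \<in> H10 D" and vw: "\<And>x. cmod (v x) = cmod (w x)"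
          and l: "(\<lambda>j. h1norm D (\<lambda>x. u (s (r j)) x - v x)) \<longlonglongrightarrow> 0" using orbit[OF s] by blast
        have "(\<lambda>j. l2norm D (\<lambda>x. complex_of_real ((cmod (u (s (r j)) x))\<^sup>2 - (cmod (w x))\<^sup>2))) \<longlonglongrightarrow> 0"
        proof (rule tendsto_dist_bound)
          let ?u = "\<lambda>j. u (s (r j))"
          show "\<bar>l2norm D (\<lambda>x. complex_of_real ((cmod (?u j x))\<^sup>2 - (cmod (w x))\<^sup>2)) - 0\<bar> \<le>
              (G.K4 * G.h.nrm (?u j - v)) * (G.K4 * G.h.nrm (?u j + v))" for j
          proof -
            \<comment> \<open>This factorisation bounds the L^2 distance of densities by a product
              of L^4 norms, the first of which tends to 0 along the subsequence.\<close>
            have pt: "(cmod a)\<^sup>2 - (cmod b)\<^sup>2 = Re ((a - b) * cnj (a + b))" for a b :: complex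
              unfolding cmod_power2 by (simp add: power2_eq_square algebra_simps)
            have eq: "(\<lambda>x. complex_of_real ((cmod (?u j x))\<^sup>2 - (cmod (w x))\<^sup>2)) = (\<lambda>x. complex_of_real (Re ((?u j x - v x) * cnj (?u j x + v x))))"
              unfolding pt[symmetric] by (simp add: vw)
            have "nrm2 M (\<lambda>x. complex_of_real (Re ((?u j x - v x) * cnj (?u j x + v x)))) \<le> nrm4 (\<lambda>x. ?u j x - v x) * nrm4 (\<lambda>x. ?u j x + v x)"
              by (intro prod_cnj_sqi(4) H10_diff H10_add uX vX)
            also have "\<dots> \<le> (G.K4 * G.h.nrm (?u j - v)) * (G.K4 * G.h.nrm (?u j + v))"
            proof (rule mult_mono)
              show "nrm4 (\<lambda>x. ?u j x - v x) \<le> G.K4 * G.h.nrm (?u j - v)"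
                using G.n4_le[of "?u j - v"] H10_diff[OF uX vX] by (simp add: fun_ops P_id)
              show "nrm4 (\<lambda>x. ?u j x + v x) \<le> G.K4 * G.h.nrm (?u j + v)"
                using G.n4_le[of "?u j + v"] H10_add[OF uX vX] by (simp add: fun_ops P_id)
            qed (simp_all add: nrm4_def less_imp_le[OF G.K4_pos])
            finally show ?thesis unfolding eq by (simp add: l2norm_eq)
          qed
          have cv: "G.conv ?u v" using l by (simp add: conv_iff uX P_id[OF vX])
          have "(\<lambda>j. (G.K4 * G.h.nrm (?u j - v)) * (G.K4 * G.h.nrm (?u j + v))) \<longlonglongrightarrow> (G.K4 * 0) * (G.K4 * G.h.nrm (v + v))"
            by (intro tendsto_intros G.conv_N[OF G.conv_add[OF cv G.conv_const]] cv[unfolded G.conv_def])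
          then show "(\<lambda>j. (G.K4 * G.h.nrm (?u j - v)) * (G.K4 * G.h.nrm (?u j + v))) \<longlonglongrightarrow> 0" by simp
        qed
        then show "\<exists>r. strict_mono (r::nat\<Rightarrow>nat) \<and> (\<lambda>j. l2norm D (\<lambda>x. complex_of_real ((cmod (u (s (r j)) x))\<^sup>2 - (cmod (w x))\<^sup>2))) \<longlonglongrightarrow> 0"
          using r by blast
      next
        fix s :: "nat \<Rightarrow> nat" assume s: "strict_mono s"
        obtain r v where r: "strict_mono (r::nat\<Rightarrow>nat)" and vX: "v \<in> H10 D" and vw: "\<And>x. cmod (v x) = cmod (w x)"
          and l: "(\<lambda>j. h1norm D (\<lambda>x. u (s (r j)) x - v x)) \<longlonglongrightarrow> 0" using orbit[OF s] by blast
        \<comment> \<open>The extra subsequence costs nothing: the subsequence principle asks only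
          for some convergent subsubsequence.\<close>
        from modulus_subseq_conv[of "\<lambda>j. u (s (r j))", OF uX vX l] obtain r2 where r2: "strict_mono (r2::nat\<Rightarrow>nat)"
          "(\<lambda>j. h1norm D (\<lambda>x. complex_of_real (cmod (u (s (r (r2 j))) x)) - complex_of_real (cmod (v x)))) \<longlonglongrightarrow> 0" by blast
        then show "\<exists>r. strict_mono (r::nat\<Rightarrow>nat) \<and> (\<lambda>j. h1norm D (\<lambda>x. complex_of_real (cmod (u (s (r j)) x) - cmod (w x)))) \<longlonglongrightarrow> 0"
          using strict_mono_o[OF r r2(1)] by (intro exI[of _ "r \<circ> r2"]) (simp add: vw)
      qed
    qed
  qed
  show ?thesis
    \<comment> \<open>The lower threshold T/2 leaves room for the upper bound T above any admissible
      lower bound. The constant 1/2 holds for all steps up to T, so T also serves as the threshold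
      in the small-step clause.\<close>
    by (rule exI[of _ "T/2"], rule conjI, use T(1) in simp, rule exI[of _ T], rule conjI, rule T(1), intro allI impI,
        rule exI[of _ T], rule conjI, use T(1) in force, rule exI[of _ "1/2"], rule conjI, simp)
      (use key in blast)
qed

end

text \<open>"Sufficiently small" becomes a threshold fixed before the lower bound on the steps. The
  upper bound and the decrease constant are chosen before step sizes and iterates are quantified,
  hence are uniform in them; the clause on densities ranges over all H^1 subsequence limits.\<close>

theorem theorem3p4:
  fixes D :: "'a::euclidean_space set" and V :: "'a \<Rightarrow> real" and \<beta> \<Omega> :: real
    and e1 e2 :: 'a and u0 :: "'a \<Rightarrow> complex"
  assumes dim: "DIM('a) = 2 \<or> DIM('a) = 3"
    and dom: "open D" "connected D" "bounded D" "convex D" "D \<noteq> {}"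
    and axes: "e1 \<in> Basis" "e2 \<in> Basis" "e1 \<noteq> e2"
    and V_meas: "set_borel_measurable lebesgue D V"
    and V_bdd: "\<exists>M. AE x in lebesgue. x \<in> D \<longrightarrow> \<bar>V x\<bar> \<le> M"
    and V_nonneg: "AE x in lebesgue. x \<in> D \<longrightarrow> V x \<ge> 0"
    and beta: "\<beta> \<ge> 0"
    and trap: "\<exists>K>0. AE x in lebesgue. x \<in> D \<longrightarrow>
                 V x - (1 + K) / 4 * \<Omega>^2 * ((x \<bullet> e1)^2 + (x \<bullet> e2)^2) \<ge> 0"
    and u0: "u0 \<in> Sph D"
  shows "\<exists>\<tau>0>0. \<exists>\<tau>1>0. \<forall>\<tau>min. 0 < \<tau>min \<and> \<tau>min \<le> \<tau>0 \<longrightarrow>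
     (\<exists>\<tau>max>\<tau>min. \<exists>C>0. \<forall>(\<tau>::nat \<Rightarrow> real) (u::nat \<Rightarrow> 'a \<Rightarrow> complex).
        (\<forall>n. \<tau>min \<le> \<tau> n \<and> \<tau> n \<le> \<tau>max) \<and> u 0 = u0
        \<and> (\<forall>n. u (Suc n) = erg_step D V \<beta> \<Omega> e1 e2 (\<tau> n) (u n)) \<longrightarrow>
          \<comment> \<open>(i)\<close>
          (\<forall>n. energy D V \<beta> \<Omega> e1 e2 (u n) - energy D V \<beta> \<Omega> e1 e2 (u (Suc n))
                 \<ge> C * (h1norm D (\<lambda>x. u (Suc n) x - u n x))^2)
        \<and> ((\<forall>n. \<tau> n \<le> \<tau>1) \<longrightarrow>
             (\<forall>n. energy D V \<beta> \<Omega> e1 e2 (u n) - energy D V \<beta> \<Omega> e1 e2 (u (Suc n))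
                 \<ge> 1/2 * (h1norm D (\<lambda>x. u (Suc n) x - u n x))^2))
          \<comment> \<open>(ii)\<close>
        \<and> convergent (\<lambda>n. energy D V \<beta> \<Omega> e1 e2 (u n))
          \<comment> \<open>(iii)\<close>
        \<and> (\<exists>r w. strict_mono r \<and> w \<in> Sph D
              \<and> (\<lambda>j. h1norm D (\<lambda>x. u (r j) x - w x)) \<longlonglongrightarrow> 0
              \<and> H10_frechet D (energy D V \<beta> \<Omega> e1 e2) w
                   (\<lambda>v. gam D V \<beta> \<Omega> e1 e2 w * l2inner D w v)
              \<and> (\<lambda>j. gam D V \<beta> \<Omega> e1 e2 (u (r j))) \<longlonglongrightarrow> gam D V \<beta> \<Omega> e1 e2 w)
          \<comment> \<open>(iv)\<close>
        \<and> (\<forall>r w. strict_mono r \<and> w \<in> Sph D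
              \<and> (\<lambda>j. h1norm D (\<lambda>x. u (r j) x - w x)) \<longlonglongrightarrow> 0
              \<and> ground_state D V \<beta> \<Omega> e1 e2 w \<and> loc_quasi_unique D V \<beta> \<Omega> e1 e2 w \<longrightarrow>
                (\<lambda>n. l2norm D (\<lambda>x. complex_of_real ((cmod (u n x))^2 - (cmod (w x))^2)))
                   \<longlonglongrightarrow> 0
              \<and> (\<lambda>n. h1norm D (\<lambda>x. complex_of_real (cmod (u n x) - cmod (w x))))
                   \<longlonglongrightarrow> 0))"
proof -
  interpret gross_pitaevskii D V \<beta> \<Omega> e1 e2
    by unfold_locales (fact dom dim axes V_meas V_bdd beta trap)+
  obtain P where P: "linear P" "range P \<subseteq> H10 D" "\<And>v. v \<in> H10 D \<Longrightarrow> P v = v" using exists_projection by blast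
  obtain c0 Ca Cs where "gp (\<lambda>v w. h1inner D (P v) (P w)) (\<lambda>v w. l2inner D (P v) (P w)) (\<lambda>v w. aform (P v) (P w))
     (\<lambda>p q v w. quart (P p) (P q) (P v) (P w)) (\<lambda>v x. \<i> * P v x) (\<lambda>v. nrm4 (P v)) \<beta> c0 Ca Cs"
    using gp_instance[OF P] by blast
  then interpret gp_model D V \<beta> \<Omega> e1 e2 P c0 Ca Cs
    by (intro gp_model.intro gp_model_axioms.intro gross_pitaevskii_axioms) (use P in auto)
  show ?thesis by (rule iteration_properties[OF u0])
qed

end
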